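(* Let $H$ satisfy the hypothesis that $H^D_{(a,c)}$ has purely discrete spectrum for one (hence all) $c\in(a,b)$, and let $\Phi(z,x),\Theta(z,x)$ be real entire solutions of $\tau u=zu$ such that $\Phi(z,\cdot)$ is non-trivial and lies in the domain of $H$ near $a$ for each $z\in\mathbb{C}$ and $W(\Theta(z),\Phi(z))=1$. Let $M(z)$ be the corresponding singular Weyl function and $\Psi(z,x)=\Theta(z,x)+M(z)\Phi(z,x)$. Let $\lambda\in\mathbb{R}$ be such that $\Theta(\lambda,\cdot)$ lies in the domain of $H$ near $b$ and $\Theta(\lambda)\notin L^2(I,\mathbb{C}^2)$. Let $\gamma\in(0,\infty]$, let $H_\gamma$ be the operator constructed from $u_+(\lambda,x)=\Theta(\lambda,x)$ by the double commutation method starting from the right endpoint, and set $$\widetilde\Theta_\gamma(\lambda,x)=\frac{\Theta(\lambda,x)}{c_\gamma(\lambda,x)},\qquad c_\gamma(\lambda,x)=-\frac1\gamma-\int_x^b\Theta(\lambda,y)^\top\Theta(\lambda,y)\,dy.$$ Then $H_\gamma$ has a system of real entire solutions $$\Phi_\gamma(z,x)=(z-\lambda)\Big(\Phi(z,x)+\frac{1}{z-\lambda}\widetilde\Theta_\gamma(\lambda,x)W_x(\Theta(\lambda),\Phi(z))\Big),$$ $$\Theta_\gamma(z,x)=\frac{1}{z-\lambda}\Big[\Theta(z,x)+\frac{1}{z-\lambda}\widetilde\Theta_\gamma(\lambda,x)W_x(\Theta(\lambda),\Theta(z))+\Big(\frac1\gamma-W_b(\Theta(\lambda),\dot\Theta(\lambda))\Big)\Phi_\gamma(z,x)\Big],$$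 with $W(\Theta_\gamma(z),\Phi_\gamma(z))=1$, where the dot denotes the derivative with respect to $z$. Moreover, $\Phi_\gamma(\lambda,x)=\widetilde\Theta_\gamma(\lambda,x)$. In particular, $H_\gamma$ again satisfies the hypothesis that its Dirichlet restriction to $(a,c)$ has purely discrete spectrum for one (hence all) $c\in(a,b)$. The Weyl solutions of $H_\gamma$ (that is, the solutions lying in the domain of $H_\gamma$ near $a$, respectively near $b$) are given by $\Phi_\gamma(z,x)$ and $$\Psi_\gamma(z,x)=\frac{1}{z-\lambda}\Big[\Psi(z,x)+\frac{1}{z-\lambda}\widetilde\Theta_\gamma(\lambda,x)W_x(\Theta(\lambda),\Psi(z))\Big]=\Theta_\gamma(z,x)+M_\gamma(z)\Phi_\gamma(z,x),$$ where $$M_\gamma(z)=\frac{M(z)+W_b(\Theta(\lambda),\dot\Theta(\lambda))(z-\lambda)}{(z-\lambda)^2}-\frac{\gamma^{-1}}{z-\lambda}$$ is the singular Weyl function of $H_\gamma$ (with respect to $\Phi_\gamma,\Theta_\gamma$).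
   Context: Let $I=(a,b)\subseteq\mathbb{R}$, $-\infty\le a<b\le\infty$, and consider $L^2(I,\mathbb{C}^2)$ with $\langle f,g\rangle=\int_a^b f(y)^*g(y)\,dy$. Let $\tau=\frac{1}{\mathrm{i}}\sigma_2\frac{d}{dx}+Q(x)$ with $Q=q_{\rm el}\mathbb{1}+q_{\rm am}\sigma_1+(m+q_{\rm sc})\sigma_3$, where $m\in[0,\infty)$, $q_{\rm el},q_{\rm am},q_{\rm sc}\in L^1_{\rm loc}(I)$ are real-valued and $\sigma_1=\begin{pmatrix}0&1\\1&0\end{pmatrix}$, $\sigma_2=\begin{pmatrix}0&-\mathrm{i}\\ \mathrm{i}&0\end{pmatrix}$, $\sigma_3=\begin{pmatrix}1&0\\0&-1\end{pmatrix}$. The Wronskian is $W_x(f,g)=f_1(x)g_2(x)-f_2(x)g_1(x)$; $W_a,W_b$ denote its limits as $x\to a,b$; for two solutions of $\tau u=zu$ with the same $z$ it is independent of $x$ and written $W(f,g)$. $H$ is the self-adjoint operator $Hf=\tau f$ with domain $\{f\in L^2(I,\mathbb{C}^2): f\in AC_{\rm loc}(I,\mathbb{C}^2),\ \tau f\in L^2(I,\mathbb{C}^2),\ W_a(u_-,f)=W_b(u_+,f)=0\}$, where $u_-$ (resp. $u_+$) is a fixed non-trivial real solution of $\tau u=0$ if $\tau$ is limit circle at $a$ (resp. $b$), and zero otherwise. A function lies in the domain of $H$ near an endpoint if it is square integrable near that endpoint and satisfies the boundary condition of $H$ there (if any). $H^D_{(a,c)}$ is the restriction of $H$ to $(a,c)$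 with the boundary condition $f_1(c)=0$ at $c$. A real entire solution is a solution of $\tau u=zu$ that is entire in $z$ for every fixed $x$ and real-valued for real $z$. Under the discreteness hypothesis, real entire pairs $\Phi,\Theta$ with $\Phi(z)$ non-trivial and in the domain of $H$ near $a$ and $W(\Theta(z),\Phi(z))=1$ exist. The singular Weyl function is $M(z)=-\frac{W(\Theta(z),u_+(z))}{W(\Phi(z),u_+(z))}$, where $u_+(z)$ is the (unique up to multiples) non-trivial solution of $\tau u=zu$ lying in the domain of $H$ near $b$; thus $\Psi(z)=\Theta(z)+M(z)\Phi(z)$ lies in the domain of $H$ near $b$ ($z\in\mathbb{C}\setminus\sigma(H)$). The same terminology is used for $H_\gamma$. Double commutation from the right endpoint, from $u_+(\lambda,x)$ (a real solution of $\tau u=\lambda u$ in the domain of $H$ near $b$): put $c_\gamma(\lambda,x)=-\frac1\gamma-\int_x^bu_+(\lambda,y)^\top u_+(\lambda,y)\,dy$, $u_\gamma(\lambda,x)=u_+(\lambda,x)/c_\gamma(\lambda,x)$, $$Q_\gamma(x)=\frac{u_{+,1}(\lambda,x)^2-u_{+,2}(\lambda,x)^2}{c_\gamma(\lambda,x)}\sigma_1-2\frac{u_{+,1}(\lambda,x)u_{+,2}(\lambda,x)}{c_\gamma(\lambda,x)}\sigma_3,$$ $\tau_\gamma=\tau+Q_\gamma$, and let $H_\gamma f=\tau_\gamma f$ on $\{f\in L^2(I,\mathbb{C}^2): f\in AC_{\rm loc}(I,\mathbb{C}^2),\ \tau_\gamma f\in L^2(I,\mathbb{C}^2),\ W_a(u_\gamma(\lambda),f)=W_b(u_\gamma(\lambda),f)=0\}$,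 where the boundary condition at an endpoint is imposed only if $\tau_\gamma$ is limit circle there. Convention: $\infty^{-1}=0$. *)

theory Defs
  imports "HOL-Analysis.Analysis"
begin

text \<open>
  Throughout, the interval is the real set \<open>einterval a b\<close> for \<open>a b :: ereal\<close>, spinors are functions
  \<open>real \<Rightarrow> complex^2\<close> of which only the values on the interval matter, and all integrals are Lebesgue
  integrals, written with the Henstock-Kurzweil \<^const>\<open>integral\<close> (which coincides with the Lebesgue
  integral for absolutely integrable functions).
\<close>


section \<open>The Dirac differential expression\<close>

definition sigma1 :: "complex^2^2" where
  "sigma1 = vector [vector [0, 1], vector [1, 0]]"

definition sigma2 :: "complex^2^2" where
  "sigma2 = vector [vector [0, - \<i>], vector [\<i>, 0]]"

definition sigma3 :: "complex^2^2" where
  "sigma3 = vector [vector [1, 0], vector [0, - 1]]"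

definition dirac_potential ::
  "real \<Rightarrow> (real \<Rightarrow> real) \<Rightarrow> (real \<Rightarrow> real) \<Rightarrow> (real \<Rightarrow> real) \<Rightarrow> real \<Rightarrow> complex^2^2" where
  "dirac_potential m q_el q_am q_sc x =
     mat (of_real (q_el x)) + mat (of_real (q_am x)) ** sigma1 + mat (of_real (m + q_sc x)) ** sigma3"

definition L1_loc :: "real set \<Rightarrow> (real \<Rightarrow> 'a::euclidean_space) \<Rightarrow> bool" where
  "L1_loc S f \<longleftrightarrow> (\<forall>K. compact K \<and> K \<subseteq> S \<longrightarrow> f absolutely_integrable_on K)"

text \<open>
  \<open>f\<close> is locally absolutely continuous on \<open>S\<close> with almost everywhere derivative \<open>f'\<close>: as usual,
  \<open>AC_loc\<close> consists of the functions that are indefinite integrals of locally integrable functions,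
  and the integrand is the almost everywhere defined derivative.
\<close>
definition has_ac_derivative ::
  "real set \<Rightarrow> (real \<Rightarrow> complex^2) \<Rightarrow> (real \<Rightarrow> complex^2) \<Rightarrow> bool" where
  "has_ac_derivative S f f' \<longleftrightarrow>
     L1_loc S f' \<and> (\<forall>x\<in>S. \<forall>y\<in>S. x \<le> y \<longrightarrow> f y - f x = integral {x..y} f')"

text \<open>\<open>f\<close> is in \<open>AC_loc\<close> and \<open>\<tau> f = g\<close> almost everywhere, with \<open>\<tau> = (1/i) \<sigma>\<^sub>2 d/dx + Q\<close>.\<close>
definition dirac_expr ::
  "real set \<Rightarrow> (real \<Rightarrow> complex^2^2) \<Rightarrow> (real \<Rightarrow> complex^2) \<Rightarrow> (real \<Rightarrow> complex^2) \<Rightarrow> bool" where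
  "dirac_expr S Q f g \<longleftrightarrow>
     (\<exists>f'. has_ac_derivative S f f' \<and>
        (AE x in lebesgue_on S. g x = (mat (1 / \<i>) ** sigma2) *v f' x + Q x *v f x))"

definition dirac_solution ::
  "real set \<Rightarrow> (real \<Rightarrow> complex^2^2) \<Rightarrow> complex \<Rightarrow> (real \<Rightarrow> complex^2) \<Rightarrow> bool" where
  "dirac_solution S Q z u \<longleftrightarrow> dirac_expr S Q u (\<lambda>x. z *s u x)"

definition nontrivial_on :: "real set \<Rightarrow> (real \<Rightarrow> complex^2) \<Rightarrow> bool" where
  "nontrivial_on S u \<longleftrightarrow> (\<exists>x\<in>S. u x \<noteq> 0)"

definition real_valued_on :: "real set \<Rightarrow> (real \<Rightarrow> complex^2) \<Rightarrow> bool" where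
  "real_valued_on S u \<longleftrightarrow> (\<forall>x\<in>S. \<forall>i. u x $ i \<in> \<real>)"

definition wronskian :: "(real \<Rightarrow> complex^2) \<Rightarrow> (real \<Rightarrow> complex^2) \<Rightarrow> real \<Rightarrow> complex" where
  "wronskian f g x = f x $ 1 * g x $ 2 - f x $ 2 * g x $ 1"

text \<open>\<open>W(f,g)\<close> for \<open>f\<close>, \<open>g\<close> whose Wronskian does not depend on the point.\<close>
definition wronskian_const ::
  "ereal \<Rightarrow> ereal \<Rightarrow> (real \<Rightarrow> complex^2) \<Rightarrow> (real \<Rightarrow> complex^2) \<Rightarrow> complex" where
  "wronskian_const a b f g = (THE w. \<forall>x\<in>einterval a b. wronskian f g x = w)"

text \<open>The filters \<open>x \<rightarrow> a\<close> and \<open>x \<rightarrow> b\<close> on the reals, for possibly infinite endpoints.\<close>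
definition left_end :: "ereal \<Rightarrow> real filter" where
  "left_end a = filtermap real_of_ereal (at_right a)"

definition right_end :: "ereal \<Rightarrow> real filter" where
  "right_end b = filtermap real_of_ereal (at_left b)"


section \<open>Square integrability and the limit circle case\<close>

definition square_integrable :: "real set \<Rightarrow> (real \<Rightarrow> complex^2) \<Rightarrow> bool" where
  "square_integrable S f \<longleftrightarrow>
     f \<in> borel_measurable (lebesgue_on S) \<and> (\<lambda>x. (norm (f x))\<^sup>2) absolutely_integrable_on S"

definition norm_L2 :: "real set \<Rightarrow> (real \<Rightarrow> complex^2) \<Rightarrow> real" where
  "norm_L2 S f = sqrt (integral S (\<lambda>x. (norm (f x))\<^sup>2))"

definition L2_near_left :: "ereal \<Rightarrow> ereal \<Rightarrow> (real \<Rightarrow> complex^2) \<Rightarrow> bool" where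
  "L2_near_left a b f \<longleftrightarrow> (\<exists>c\<in>einterval a b. square_integrable (einterval a (ereal c)) f)"

definition L2_near_right :: "ereal \<Rightarrow> ereal \<Rightarrow> (real \<Rightarrow> complex^2) \<Rightarrow> bool" where
  "L2_near_right a b f \<longleftrightarrow> (\<exists>c\<in>einterval a b. square_integrable (einterval (ereal c) b) f)"

definition limit_circle_left :: "ereal \<Rightarrow> ereal \<Rightarrow> (real \<Rightarrow> complex^2^2) \<Rightarrow> bool" where
  "limit_circle_left a b Q \<longleftrightarrow>
     (\<forall>z u. dirac_solution (einterval a b) Q z u \<longrightarrow> L2_near_left a b u)"

definition limit_circle_right :: "ereal \<Rightarrow> ereal \<Rightarrow> (real \<Rightarrow> complex^2^2) \<Rightarrow> bool" where
  "limit_circle_right a b Q \<longleftrightarrow>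
     (\<forall>z u. dirac_solution (einterval a b) Q z u \<longrightarrow> L2_near_right a b u)"


section \<open>Boundary conditions and domains\<close>

text \<open>
  A boundary condition at an endpoint is given by a spinor \<open>v\<close> and requires the Wronskian with \<open>v\<close> to
  vanish there; \<open>v = 0\<close> stands for no boundary condition.
\<close>
definition bc_left :: "ereal \<Rightarrow> (real \<Rightarrow> complex^2) \<Rightarrow> (real \<Rightarrow> complex^2) \<Rightarrow> bool" where
  "bc_left a v f \<longleftrightarrow> (wronskian v f \<longlongrightarrow> 0) (left_end a)"

definition bc_right :: "ereal \<Rightarrow> (real \<Rightarrow> complex^2) \<Rightarrow> (real \<Rightarrow> complex^2) \<Rightarrow> bool" where
  "bc_right b v f \<longleftrightarrow> (wronskian v f \<longlongrightarrow> 0) (right_end b)"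

definition bc_spinor ::
  "bool \<Rightarrow> ereal \<Rightarrow> ereal \<Rightarrow> (real \<Rightarrow> complex^2^2) \<Rightarrow> (real \<Rightarrow> complex^2) \<Rightarrow> bool" where
  "bc_spinor limit_circle a b Q v \<longleftrightarrow>
     (if limit_circle
      then dirac_solution (einterval a b) Q 0 v \<and> real_valued_on (einterval a b) v
             \<and> nontrivial_on (einterval a b) v
      else (\<forall>x\<in>einterval a b. v x = 0))"

definition in_dom_near_left ::
  "ereal \<Rightarrow> ereal \<Rightarrow> (real \<Rightarrow> complex^2) \<Rightarrow> (real \<Rightarrow> complex^2) \<Rightarrow> bool" where
  "in_dom_near_left a b v f \<longleftrightarrow> L2_near_left a b f \<and> bc_left a v f"

definition in_dom_near_right ::
  "ereal \<Rightarrow> ereal \<Rightarrow> (real \<Rightarrow> complex^2) \<Rightarrow> (real \<Rightarrow> complex^2) \<Rightarrow> bool" where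
  "in_dom_near_right a b v f \<longleftrightarrow> L2_near_right a b f \<and> bc_right b v f"

definition op_bc :: "ereal \<Rightarrow> ereal \<Rightarrow> (real \<Rightarrow> complex^2) \<Rightarrow> (real \<Rightarrow> complex^2)
    \<Rightarrow> (real \<Rightarrow> complex^2) \<Rightarrow> bool" where
  "op_bc a b v w f \<longleftrightarrow> bc_left a v f \<and> bc_right b w f"

text \<open>
  The boundary conditions of the Dirichlet restriction to \<open>(a,c)\<close>.  Functions in its domain extend
  continuously to \<open>c\<close>, and \<open>f\<^sub>1(c) = 0\<close> refers to this extension.
\<close>
definition dirichlet_bc ::
  "ereal \<Rightarrow> real \<Rightarrow> (real \<Rightarrow> complex^2) \<Rightarrow> (real \<Rightarrow> complex^2) \<Rightarrow> bool" where
  "dirichlet_bc a c v f \<longleftrightarrow> bc_left a v f \<and> ((\<lambda>x. f x $ 1) \<longlongrightarrow> 0) (at_left c)"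

text \<open>In what follows \<open>B\<close> is the boundary condition of the operator, as a predicate on spinors.\<close>

definition dirac_dom ::
  "real set \<Rightarrow> (real \<Rightarrow> complex^2^2) \<Rightarrow> ((real \<Rightarrow> complex^2) \<Rightarrow> bool) \<Rightarrow> (real \<Rightarrow> complex^2) set" where
  "dirac_dom S Q B =
     {f. square_integrable S f \<and> (\<exists>g. dirac_expr S Q f g \<and> square_integrable S g) \<and> B f}"


section \<open>Spectrum\<close>

text \<open>\<open>f\<close> is in the domain and \<open>(H - z) f = g\<close>.\<close>
definition dirac_maps :: "real set \<Rightarrow> (real \<Rightarrow> complex^2^2) \<Rightarrow> ((real \<Rightarrow> complex^2) \<Rightarrow> bool) \<Rightarrow> complex
    \<Rightarrow> (real \<Rightarrow> complex^2) \<Rightarrow> (real \<Rightarrow> complex^2) \<Rightarrow> bool" where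
  "dirac_maps S Q B z f g \<longleftrightarrow> f \<in> dirac_dom S Q B \<and> dirac_expr S Q f (\<lambda>x. z *s f x + g x)"

text \<open>
  \<open>H - z\<close> is onto and has a bounded inverse; the norm bound contains injectivity, since functions in
  the domain are continuous.
\<close>
definition dirac_resolvent_set ::
  "real set \<Rightarrow> (real \<Rightarrow> complex^2^2) \<Rightarrow> ((real \<Rightarrow> complex^2) \<Rightarrow> bool) \<Rightarrow> complex set" where
  "dirac_resolvent_set S Q B =
     {z. (\<forall>g. square_integrable S g \<longrightarrow> (\<exists>f. dirac_maps S Q B z f g)) \<and>
         (\<exists>C. \<forall>f g. dirac_maps S Q B z f g \<longrightarrow> norm_L2 S f \<le> C * norm_L2 S g)}"

definition dirac_spectrum ::
  "real set \<Rightarrow> (real \<Rightarrow> complex^2^2) \<Rightarrow> ((real \<Rightarrow> complex^2) \<Rightarrow> bool) \<Rightarrow> complex set" where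
  "dirac_spectrum S Q B = - dirac_resolvent_set S Q B"

definition dirac_eigenspace :: "real set \<Rightarrow> (real \<Rightarrow> complex^2^2) \<Rightarrow> ((real \<Rightarrow> complex^2) \<Rightarrow> bool)
    \<Rightarrow> complex \<Rightarrow> (real \<Rightarrow> complex^2) set" where
  "dirac_eigenspace S Q B z = {f \<in> dirac_dom S Q B. dirac_solution S Q z f}"

text \<open>The spectrum consists of isolated eigenvalues of finite multiplicity.\<close>
definition purely_discrete_spectrum ::
  "real set \<Rightarrow> (real \<Rightarrow> complex^2^2) \<Rightarrow> ((real \<Rightarrow> complex^2) \<Rightarrow> bool) \<Rightarrow> bool" where
  "purely_discrete_spectrum S Q B \<longleftrightarrow>
     (\<forall>z\<in>dirac_spectrum S Q B.
        \<not> z islimpt dirac_spectrum S Q B \<and>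
        (\<exists>f\<in>dirac_eigenspace S Q B z. nontrivial_on S f) \<and>
        (\<exists>F. finite F \<and>
           (\<forall>f\<in>dirac_eigenspace S Q B z. \<exists>k. \<forall>x\<in>S. f x = (\<Sum>h\<in>F. k h *s h x))))"


section \<open>Weyl solutions and the singular Weyl function\<close>

definition weyl_solution_left :: "ereal \<Rightarrow> ereal \<Rightarrow> (real \<Rightarrow> complex^2^2) \<Rightarrow> (real \<Rightarrow> complex^2)
    \<Rightarrow> complex \<Rightarrow> (real \<Rightarrow> complex^2) \<Rightarrow> bool" where
  "weyl_solution_left a b Q v z u \<longleftrightarrow>
     dirac_solution (einterval a b) Q z u \<and> nontrivial_on (einterval a b) u \<and> in_dom_near_left a b v u"

definition weyl_solution_right :: "ereal \<Rightarrow> ereal \<Rightarrow> (real \<Rightarrow> complex^2^2) \<Rightarrow> (real \<Rightarrow> complex^2)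
    \<Rightarrow> complex \<Rightarrow> (real \<Rightarrow> complex^2) \<Rightarrow> bool" where
  "weyl_solution_right a b Q w z u \<longleftrightarrow>
     dirac_solution (einterval a b) Q z u \<and> nontrivial_on (einterval a b) u \<and> in_dom_near_right a b w u"

definition real_entire_solution ::
  "ereal \<Rightarrow> ereal \<Rightarrow> (real \<Rightarrow> complex^2^2) \<Rightarrow> (complex \<Rightarrow> real \<Rightarrow> complex^2) \<Rightarrow> bool" where
  "real_entire_solution a b Q \<Phi> \<longleftrightarrow>
     (\<forall>z. dirac_solution (einterval a b) Q z (\<Phi> z)) \<and>
     (\<forall>x\<in>einterval a b. \<forall>i. (\<lambda>z. \<Phi> z x $ i) holomorphic_on UNIV) \<and>
     (\<forall>z\<in>\<real>. real_valued_on (einterval a b) (\<Phi> z))"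

text \<open>
  \<open>M(z) = - W(\<Theta>(z),u\<^sub>+(z)) / W(\<Phi>(z),u\<^sub>+(z))\<close>; the quotient does not depend on the choice of \<open>u\<^sub>+(z)\<close>,
  which exists and is unique up to multiples for \<open>z\<close> outside of the spectrum.
\<close>
definition singular_weyl :: "ereal \<Rightarrow> ereal \<Rightarrow> (real \<Rightarrow> complex^2^2) \<Rightarrow> (real \<Rightarrow> complex^2)
    \<Rightarrow> (complex \<Rightarrow> real \<Rightarrow> complex^2) \<Rightarrow> (complex \<Rightarrow> real \<Rightarrow> complex^2) \<Rightarrow> complex \<Rightarrow> complex" where
  "singular_weyl a b Q w \<Phi> \<Theta> z =
     (let u = (SOME u. weyl_solution_right a b Q w z u)
      in - (wronskian_const a b (\<Theta> z) u / wronskian_const a b (\<Phi> z) u))"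

definition z_deriv :: "(complex \<Rightarrow> real \<Rightarrow> complex^2) \<Rightarrow> complex \<Rightarrow> real \<Rightarrow> complex^2" where
  "z_deriv F z x = (\<chi> i. deriv (\<lambda>w. F w x $ i) z)"


section \<open>Double commutation from the right endpoint\<close>

text \<open>\<open>\<gamma>\<close> ranges over \<open>(0,\<infinity>]\<close>; on \<^typ>\<open>ereal\<close> we have \<open>1 / \<infinity> = 0\<close>.\<close>
definition dc_c :: "ereal \<Rightarrow> ereal \<Rightarrow> (real \<Rightarrow> complex^2) \<Rightarrow> real \<Rightarrow> complex" where
  "dc_c b \<gamma> u x =
     - of_real (real_of_ereal (1 / \<gamma>)) - integral (einterval (ereal x) b) (\<lambda>y. (u y $ 1)\<^sup>2 + (u y $ 2)\<^sup>2)"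

definition dc_u :: "ereal \<Rightarrow> ereal \<Rightarrow> (real \<Rightarrow> complex^2) \<Rightarrow> real \<Rightarrow> complex^2" where
  "dc_u b \<gamma> u x = (1 / dc_c b \<gamma> u x) *s u x"

definition dc_Q :: "ereal \<Rightarrow> ereal \<Rightarrow> (real \<Rightarrow> complex^2) \<Rightarrow> real \<Rightarrow> complex^2^2" where
  "dc_Q b \<gamma> u x =
     mat (((u x $ 1)\<^sup>2 - (u x $ 2)\<^sup>2) / dc_c b \<gamma> u x) ** sigma1
     - mat (2 * (u x $ 1 * u x $ 2 / dc_c b \<gamma> u x)) ** sigma3"

end

theory Submission
  imports Defs "HOL-Complex_Analysis.Conformal_Mappings"
begin

text \<open>
  Everything rests on Wronskians: for solutions at \<open>z\<close> and \<open>w\<close> the derivative of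
  \<open>W(u,v)\<close> is \<open>(z - w) (u\<^sub>1 v\<^sub>1 + u\<^sub>2 v\<^sub>2)\<close>. Write \<open>t = \<Theta>(\<lambda>)/c\<close>, \<open>F = W(\<Theta>(\<lambda>),u)/(z - \<lambda>)\<close>
  and \<open>T u = u + F t\<close>. Then \<open>T\<close> maps solutions to solutions of the commuted equation, preserves
  Wronskians at the same \<open>z\<close>, and \<open>|T u|\<^sup>2 = |u|\<^sup>2 + (|F|\<^sup>2/|c|)'\<close>; this energy identity
  carries square integrability and boundary conditions at both ends back and forth, in the limit
  point as well as in the limit circle case. The pole of \<open>\<Theta>\<^sub>\<gamma>\<close> at \<open>\<lambda>\<close> cancels because
  \<open>W\<^sub>x(\<Theta>(\<lambda>), \<Theta>'(\<lambda>)) = W\<^sub>b(\<Theta>(\<lambda>), \<Theta>'(\<lambda>)) - 1/\<gamma> - c(x)\<close>.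

  Discreteness of the Dirichlet restrictions follows from the entire solution \<open>\<Phi>\<^sub>\<gamma>\<close> alone: off the
  isolated zeros of \<open>z \<mapsto> \<Phi>\<^sub>\<gamma>(z,c)\<^sub>1\<close> Green's function is analytic in \<open>z\<close>, and the bound \<open>1/|Im z|\<close> for
  the resolvent at nonreal points extends to real points by averaging over a circle.
\<close>

text \<open>In the energy identity the boundary term \<open>|F|^2/|c|\<close> is nonnegative, and
  the two ends use it differently. Towards \<open>a\<close> it enters with a minus sign: dropping it
  bounds the energy of \<open>T u\<close>, keeping it bounds \<open>|F|^2/|c|\<close>; as
  \<Theta>(\<lambda>) is not square integrable near \<open>a\<close>, \<open>|c|\<close> is
  unbounded there and \<open>W(t, T u)\<close> tends to 0. Towards \<open>b\<close> it enters with a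
  plus sign and must be bounded: if \<open>W(\<Theta>(\<lambda>), u)\<close> vanishes at
  \<open>b\<close>, then \<open>F\<close> is the integral of \<open>\<Theta>(\<lambda>) . u\<close>
  over the tail, and Cauchy-Schwarz gives \<open>|F|^2 \<le> |c|\<close> times the energy of
  \<open>u\<close>. This survives \<gamma> = \<infinity>, where \<open>c\<close> tends to 0 at
  \<open>b\<close>.

  No existence theory for the equation is invoked: the given pair is a basis of solutions at every
  \<open>z\<close>, and so is the commuted pair. The results on solutions are therefore stated for
  an abstract entire pair with Wronskian 1 and applied twice. In the discreteness proof the obstacle
  is that the second solution need not be square integrable near \<open>a\<close>; resolvent bounds
  are first obtained for right-hand sides vanishing near \<open>a\<close>.\<close>

section \<open>Locally absolutely continuous functions\<close>

definition ac_deriv :: "real set \<Rightarrow> (real \<Rightarrow> 'a::euclidean_space) \<Rightarrow> (real \<Rightarrow> 'a) \<Rightarrow> bool" where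
  "ac_deriv S f f' \<longleftrightarrow> L1_loc S f' \<and> (\<forall>x\<in>S. \<forall>y\<in>S. x \<le> y \<longrightarrow> f y - f x = integral {x..y} f')"

text \<open>The given notion is the spinor instance; the general codomain also covers components,
  their products and quotients.\<close>

lemma has_ac_derivative_eq: "has_ac_derivative = ac_deriv"
  by (intro ext) (simp add: has_ac_derivative_def ac_deriv_def)

lemma einterval_in_lebesgue [simp]: "einterval a b \<in> sets lebesgue"
  by (simp add: borel_open)

lemma is_interval_einterval [simp]: "is_interval (einterval a b)"
  unfolding is_interval_1
proof (intro ballI allI impI)
  fix x y z assume h: "x \<in> einterval a b" "y \<in> einterval a b" "x \<le> z \<and> z \<le> y"
  have "a < ereal z" by (rule less_le_trans[of a "ereal x"]) (use h in \<open>simp_all add: einterval_iff\<close>)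
  moreover have "ereal z < b" by (rule le_less_trans[of _ "ereal y" b]) (use h in \<open>simp_all add: einterval_iff\<close>)
  ultimately show "z \<in> einterval a b" by (simp add: einterval_iff)
qed

lemma interval_Icc_subset: "is_interval S \<Longrightarrow> x \<in> S \<Longrightarrow> y \<in> S \<Longrightarrow> {x..y} \<subseteq> S" for S :: "real set"
  by (meson mem_is_interval_1_I atLeastAtMost_iff subsetI)

lemma L1_loc_Icc: "L1_loc S f \<Longrightarrow> {x..y} \<subseteq> S \<Longrightarrow> f absolutely_integrable_on {x..y}"
  unfolding L1_loc_def by auto

lemma L1_loc_subset: "L1_loc S f \<Longrightarrow> T \<subseteq> S \<Longrightarrow> L1_loc T f"
  unfolding L1_loc_def by auto

lemma L1_loc_linear:
  assumes "L1_loc S f" "bounded_linear h"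
  shows "L1_loc S (\<lambda>x. h (f x))"
  using assms absolutely_integrable_linear[OF _ assms(2)] unfolding L1_loc_def o_def by blast

lemma L1_loc_cong:
  assumes "L1_loc S f" "\<And>x. x \<in> S \<Longrightarrow> f x = g x"
  shows "L1_loc S g"
proof -
  have "g absolutely_integrable_on K" if "f absolutely_integrable_on K" "K \<subseteq> S" for K
    by (rule absolutely_integrable_spike[OF that(1) negligible_empty]) (use that(2) assms(2) in auto)
  then show ?thesis using assms(1) unfolding L1_loc_def by blast
qed

lemma L1_loc_add: "L1_loc S f \<Longrightarrow> L1_loc S g \<Longrightarrow> L1_loc S (\<lambda>x. f x + g x)"
  and L1_loc_diff: "L1_loc S f \<Longrightarrow> L1_loc S g \<Longrightarrow> L1_loc S (\<lambda>x. f x - g x)"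
  unfolding L1_loc_def by (auto intro: set_integral_add set_integral_diff)

lemma L1_loc_continuous:
  fixes f :: "real \<Rightarrow> 'a::euclidean_space"
  assumes "continuous_on S f"
  shows "L1_loc S f"
  unfolding L1_loc_def
proof (intro allI impI)
  fix K assume K: "compact K \<and> K \<subseteq> S"
  have "f integrable_on K \<and> f absolutely_integrable_on K"
  proof -
    have m: "K \<in> sets lebesgue" "K \<in> lmeasurable" using K lmeasurable_compact by (auto simp: fmeasurableD)
    have "bounded (f ` K)" using K assms
      by (meson compact_continuous_image compact_imp_bounded continuous_on_subset)
    then obtain B where B: "\<And>x. x \<in> K \<Longrightarrow> norm (f x) \<le> B" unfolding bounded_iff by auto
    have "f absolutely_integrable_on K"
      by (rule measurable_bounded_by_integrable_imp_absolutely_integrable[where g = "\<lambda>_. B"])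
        (use K m B assms in \<open>auto intro: continuous_imp_measurable_on_sets_lebesgue continuous_on_subset
           simp: integrable_on_const\<close>)
    then show ?thesis using absolutely_integrable_on_def by blast
  qed
  then show "f absolutely_integrable_on K" ..
qed

lemma L1_loc_mult_continuous:
  fixes f g :: "real \<Rightarrow> complex"
  assumes "continuous_on S g" "L1_loc S f"
  shows "L1_loc S (\<lambda>x. g x * f x)"
  unfolding L1_loc_def
proof (intro allI impI)
  fix K assume K: "compact K \<and> K \<subseteq> S"
  have b: "bounded (g ` K)" using K assms
    by (meson compact_continuous_image compact_imp_bounded continuous_on_subset)
  have bl: "bilinear ((*) :: complex \<Rightarrow> complex \<Rightarrow> complex)"
    by (simp add: bilinear_conv_bounded_bilinear bounded_bilinear_mult)
  have m: "K \<in> sets lebesgue" using K lmeasurable_compact fmeasurableD by blast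
  have gm: "g \<in> borel_measurable (lebesgue_on K)"
    by (rule continuous_imp_measurable_on_sets_lebesgue) (use K assms m continuous_on_subset in auto)
  show "(\<lambda>x. g x * f x) absolutely_integrable_on K"
    by (rule absolutely_integrable_bounded_measurable_product[OF bl gm m b])
      (use K assms in \<open>auto simp: L1_loc_def\<close>)
qed

lemma ac_deriv_L1: "ac_deriv S f f' \<Longrightarrow> L1_loc S f'"
  by (simp add: ac_deriv_def)

lemma ac_deriv_subset: "ac_deriv S f f' \<Longrightarrow> T \<subseteq> S \<Longrightarrow> ac_deriv T f f'"
  unfolding ac_deriv_def using L1_loc_subset by blast

lemma abs_integrable_imp:
  fixes f :: "'b::euclidean_space \<Rightarrow> 'a::euclidean_space"
  assumes "f absolutely_integrable_on S"
  shows "f integrable_on S" "(\<lambda>x. norm (f x)) integrable_on S"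
  using assms unfolding absolutely_integrable_on_def by simp_all

lemma ac_deriv_abs_integrable:
  assumes "ac_deriv S f f'" "is_interval S" "x \<in> S" "y \<in> S"
  shows "f' absolutely_integrable_on {x..y}"
  by (rule L1_loc_Icc[OF ac_deriv_L1[OF assms(1)] interval_Icc_subset[OF assms(2-4)]])

lemma ac_deriv_continuous:
  assumes ac: "ac_deriv S f f'" and S: "open S" "is_interval S"
  shows "continuous_on S f"
proof (intro continuous_at_imp_continuous_on ballI)
  fix x assume "x \<in> S"
  then obtain d where d: "d > 0" "cball x d \<subseteq> S" using S(1) open_contains_cball by blast
  have sub: "{x - d..x + d} \<subseteq> S" using d(2) by (auto simp: cball_eq_atLeastAtMost)
  have int: "f' integrable_on {x - d..x + d}"
    by (rule abs_integrable_imp(1)[OF L1_loc_Icc[OF ac_deriv_L1[OF ac] sub]])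
  have e: "f (x - d) + integral {x - d..y} f' = f y" if "y \<in> {x - d..x + d}" for y
  proof -
    have "x - d \<in> S" "y \<in> S" "x - d \<le> y" using sub that d(1) by auto
    then have "f y - f (x - d) = integral {x - d..y} f'"
      using ac unfolding ac_deriv_def by blast
    then show ?thesis by (simp add: algebra_simps)
  qed
  have "continuous_on {x - d..x + d} (\<lambda>y. f (x - d) + integral {x - d..y} f')"
    by (intro continuous_intros indefinite_integral_continuous_1 int)
  then have "continuous_on {x - d..x + d} f"
    by (rule continuous_on_eq) (rule e)
  then show "isCont f x"
    by (rule continuous_on_interior) (use d(1) in auto)
qed

lemma ac_deriv_cong:
  assumes "ac_deriv S f f'" "is_interval S" "\<And>x. x \<in> S \<Longrightarrow> f x = g x" "\<And>x. x \<in> S \<Longrightarrow> f' x = g' x"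
  shows "ac_deriv S g g'"
proof -
  have "integral {x..y} f' = integral {x..y} g'" if "x \<in> S" "y \<in> S" for x y
    using interval_Icc_subset[OF assms(2) that] assms(4) by (intro integral_cong) auto
  moreover have "L1_loc S g'" by (rule L1_loc_cong[OF ac_deriv_L1[OF assms(1)] assms(4)])
  moreover have "f y - f x = integral {x..y} f'" if "x \<in> S" "y \<in> S" "x \<le> y" for x y
    using assms(1) that unfolding ac_deriv_def by blast
  ultimately show ?thesis
    using assms(3) unfolding ac_deriv_def by simp
qed

lemma ac_deriv_linear:
  assumes "ac_deriv S f f'" "is_interval S" "bounded_linear h"
  shows "ac_deriv S (\<lambda>x. h (f x)) (\<lambda>x. h (f' x))"
  unfolding ac_deriv_def
proof (intro conjI ballI impI)
  show "L1_loc S (\<lambda>x. h (f' x))" by (rule L1_loc_linear[OF ac_deriv_L1[OF assms(1)] assms(3)])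
  fix x y assume xy: "x \<in> S" "y \<in> S" "x \<le> y"
  have "f' integrable_on {x..y}"
    by (rule abs_integrable_imp(1)[OF ac_deriv_abs_integrable[OF assms(1,2) xy(1,2)]])
  then have "integral {x..y} (h \<circ> f') = h (integral {x..y} f')"
    by (rule integral_linear[OF _ assms(3)])
  moreover have "f y - f x = integral {x..y} f'" using assms xy unfolding ac_deriv_def by blast
  moreover have "h (f y - f x) = h (f y) - h (f x)"
    by (rule linear_diff[OF bounded_linear.linear[OF assms(3)]])
  ultimately show "h (f y) - h (f x) = integral {x..y} (\<lambda>x. h (f' x))"
    by (simp add: o_def)
qed

lemma ac_deriv_add:
  assumes "ac_deriv S f f'" "ac_deriv S g g'" "is_interval S"
  shows "ac_deriv S (\<lambda>x. f x + g x) (\<lambda>x. f' x + g' x)"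
  unfolding ac_deriv_def
proof (intro conjI ballI impI)
  show "L1_loc S (\<lambda>x. f' x + g' x)" by (rule L1_loc_add[OF ac_deriv_L1[OF assms(1)] ac_deriv_L1[OF assms(2)]])
  fix x y assume xy: "x \<in> S" "y \<in> S" "x \<le> y"
  have sub: "{x..y} \<subseteq> S" by (rule interval_Icc_subset[OF assms(3) xy(1,2)])
  have "f' integrable_on {x..y}" "g' integrable_on {x..y}"
    by (rule abs_integrable_imp(1)[OF L1_loc_Icc[OF ac_deriv_L1[OF assms(1)] sub]]
        abs_integrable_imp(1)[OF L1_loc_Icc[OF ac_deriv_L1[OF assms(2)] sub]])+
  then have "integral {x..y} (\<lambda>x. f' x + g' x) = (f y - f x) + (g y - g x)"
    using assms xy unfolding ac_deriv_def by (simp add: integral_add)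
  then show "f y + g y - (f x + g x) = integral {x..y} (\<lambda>x. f' x + g' x)" by simp
qed

lemma ac_deriv_uminus:
  assumes "ac_deriv S f f'" "is_interval S"
  shows "ac_deriv S (\<lambda>x. - f x) (\<lambda>x. - f' x)"
  by (rule ac_deriv_linear[OF assms bounded_linear_minus[OF bounded_linear_ident]])

lemma ac_deriv_diff:
  assumes "ac_deriv S f f'" "ac_deriv S g g'" "is_interval S"
  shows "ac_deriv S (\<lambda>x. f x - g x) (\<lambda>x. f' x - g' x)"
  using ac_deriv_add[OF assms(1) ac_deriv_uminus[OF assms(2,3)] assms(3)] by simp

lemma ac_deriv_cmult:
  fixes f :: "real \<Rightarrow> complex"
  assumes "ac_deriv S f f'" "is_interval S"
  shows "ac_deriv S (\<lambda>x. k * f x) (\<lambda>x. k * f' x)"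
  by (rule ac_deriv_linear[OF assms bounded_linear_mult_right])

lemma ac_deriv_vec2:
  fixes f f' :: "real \<Rightarrow> complex^2"
  assumes S: "is_interval S"
  shows "ac_deriv S f f' \<longleftrightarrow>
    ac_deriv S (\<lambda>x. f x $ 1) (\<lambda>x. f' x $ 1) \<and> ac_deriv S (\<lambda>x. f x $ 2) (\<lambda>x. f' x $ 2)"
proof
  assume "ac_deriv S f f'"
  then show "ac_deriv S (\<lambda>x. f x $ 1) (\<lambda>x. f' x $ 1) \<and> ac_deriv S (\<lambda>x. f x $ 2) (\<lambda>x. f' x $ 2)"
    using ac_deriv_linear[OF _ S bounded_linear_vec_nth] by blast
next
  assume A: "ac_deriv S (\<lambda>x. f x $ 1) (\<lambda>x. f' x $ 1) \<and> ac_deriv S (\<lambda>x. f x $ 2) (\<lambda>x. f' x $ 2)"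
  have bl: "bounded_linear (axis i :: complex \<Rightarrow> complex^2)" for i
    by (intro linear_conv_bounded_linear[THEN iffD1] linearI) (auto simp: axis_def vec_eq_iff)
  have *: "axis 1 (f x $ 1) + axis 2 (f x $ 2) = f x" for f :: "real \<Rightarrow> complex^2" and x
    by (auto simp: vec_eq_iff axis_def forall_2)
  have "ac_deriv S (\<lambda>x. axis 1 (f x $ 1) + axis 2 (f x $ 2) :: complex^2) (\<lambda>x. axis 1 (f' x $ 1) + axis 2 (f' x $ 2))"
    by (rule ac_deriv_add[OF ac_deriv_linear[OF conjunct1[OF A] S bl] ac_deriv_linear[OF conjunct2[OF A] S bl] S])
  then show "ac_deriv S f f'" by (simp only: *)
qed

text \<open>Subdividing into short intervals sums the bounds to \<open>e * \<mu> p q\<close> for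
  every \<open>e\<close>. This takes the place of differentiation almost everywhere in the product
  rule, the quotient rule and the uniqueness of derivatives.\<close>

lemma additive_small_imp_zero:
  fixes D :: "real \<Rightarrow> real \<Rightarrow> 'a::real_normed_vector" and \<mu> :: "real \<Rightarrow> real \<Rightarrow> real"
  assumes add: "\<And>x y z. p \<le> x \<Longrightarrow> x \<le> y \<Longrightarrow> y \<le> z \<Longrightarrow> z \<le> q \<Longrightarrow> D x z = D x y + D y z"
    and add\<mu>: "\<And>x y z. p \<le> x \<Longrightarrow> x \<le> y \<Longrightarrow> y \<le> z \<Longrightarrow> z \<le> q \<Longrightarrow> \<mu> x z = \<mu> x y + \<mu> y z"
    and small: "\<And>e. e > 0 \<Longrightarrow> \<exists>d>0. \<forall>x y. p \<le> x \<longrightarrow> x \<le> y \<longrightarrow> y \<le> q \<longrightarrow> y - x < d \<longrightarrow> norm (D x y) \<le> e * \<mu> x y"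
    and pq: "p \<le> q"
  shows "D p q = 0"
proof -
  have main: "norm (D p q) \<le> e * \<mu> p q" if e: "e > 0" for e
  proof -
    obtain d where d: "d > 0" "\<And>x y. p \<le> x \<Longrightarrow> x \<le> y \<Longrightarrow> y \<le> q \<Longrightarrow> y - x < d \<Longrightarrow> norm (D x y) \<le> e * \<mu> x y"
      using small[OF e] by blast
    \<comment> \<open>Induction over the number of pieces; the length \<open>d/2\<close> keeps each
      piece strictly below \<open>d\<close>.\<close>
    have *: "norm (D x y) \<le> e * \<mu> x y" if "p \<le> x" "x \<le> y" "y \<le> q" "y - x < real (Suc n) * (d/2)" for n x y
      using that
    proof (induction n arbitrary: y)
      case 0 then show ?case using d by auto
    next
      case (Suc n)
      show ?case
      proof (cases "y - x < d/2")
        case True then show ?thesis using d Suc.prems by auto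
      next
        case False
        let ?m = "y - d/2"
        have m: "x \<le> ?m" "?m \<le> y" using False d(1) by auto
        have lt: "?m - x < real (Suc n) * (d/2)" using Suc.prems(4) by (simp add: algebra_simps)
        have "norm (D x y) \<le> norm (D x ?m) + norm (D ?m y)"
          using add[OF Suc.prems(1) m Suc.prems(3)] norm_triangle_ineq by metis
        also have "\<dots> \<le> e * \<mu> x ?m + e * \<mu> ?m y"
          using Suc.IH[OF Suc.prems(1) m(1) _ lt] d(2)[of ?m y] m Suc.prems d(1) by fastforce
        also have "\<dots> = e * \<mu> x y" using add\<mu>[OF Suc.prems(1) m Suc.prems(3)] by (simp add: algebra_simps)
        finally show ?thesis .
      qed
    qed
    obtain n where "(q - p) / (d/2) < real n" using reals_Archimedean2 by blast
    then have "q - p < real (Suc n) * (d/2)" using d(1)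
      by (simp add: field_simps)
    then show ?thesis using *[of p q n] pq by auto
  qed
  have "norm (D p q) \<le> 0 + e" if "e > 0" for e
  proof (cases "\<mu> p q > 0")
    case True
    then show ?thesis using main[of "e / \<mu> p q"] that by simp
  next
    case False
    then show ?thesis using main[of 1] that by simp
  qed
  then have "norm (D p q) \<le> 0" by (rule field_le_epsilon)
  then show ?thesis by simp
qed

lemma integral_norm_le:
  fixes f :: "real \<Rightarrow> 'a::euclidean_space"
  assumes "f absolutely_integrable_on S" "g integrable_on S" "\<And>x. x \<in> S \<Longrightarrow> norm (f x) \<le> g x"
  shows "norm (integral S f) \<le> integral S g"
  by (rule Henstock_Kurzweil_Integration.integral_norm_bound_integral) (use assms abs_integrable_imp in auto)

lemma uniform_cont_Icc:
  fixes f :: "real \<Rightarrow> 'a::metric_space"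
  assumes "continuous_on {p..q} f" "e > 0"
  shows "\<exists>d>0. \<forall>x\<in>{p..q}. \<forall>y\<in>{p..q}. dist x y < d \<longrightarrow> dist (f x) (f y) < e"
  using compact_uniformly_continuous[OF assms(1) compact_Icc] assms(2)
  unfolding uniformly_continuous_on_def by metis

text \<open>On a short interval the increment of the product is exactly
  \<open>g y * (f y - f x) + f x * (g y - g x)\<close>. Compared with the integrand, this leaves
  only the oscillations of \<open>f\<close> and \<open>g\<close> times their variations.\<close>

lemma ac_deriv_mult:
  fixes f g :: "real \<Rightarrow> complex"
  assumes f: "ac_deriv S f f'" and g: "ac_deriv S g g'" and S: "open S" "is_interval S"
  shows "ac_deriv S (\<lambda>x. f x * g x) (\<lambda>x. g x * f' x + f x * g' x)"
  unfolding ac_deriv_def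
proof (intro conjI ballI impI)
  note cf = ac_deriv_continuous[OF f S] and cg = ac_deriv_continuous[OF g S]
  show L: "L1_loc S (\<lambda>x. g x * f' x + f x * g' x)"
    by (intro L1_loc_add L1_loc_mult_continuous cf cg) (rule ac_deriv_L1[OF f] ac_deriv_L1[OF g])+
  fix p q assume pq: "p \<in> S" "q \<in> S" "p \<le> q"
  have sub: "{p..q} \<subseteq> S" using pq S interval_Icc_subset by blast
  let ?h = "\<lambda>x. g x * f' x + f x * g' x"
  define D where "D x y = f y * g y - f x * g x - integral {x..y} ?h" for x y
  define \<mu> where "\<mu> x y = integral {x..y} (\<lambda>s. norm (f' s) + norm (g' s))" for x y
  have sub': "{x..y} \<subseteq> S" if "p \<le> x" "y \<le> q" for x y
    using sub that by (auto simp: subset_eq)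
  have af: "f' absolutely_integrable_on {x..y}" and ag: "g' absolutely_integrable_on {x..y}"
    and ah: "?h absolutely_integrable_on {x..y}" if "p \<le> x" "y \<le> q" for x y
    by (rule L1_loc_Icc[OF _ sub'[OF that]], rule L ac_deriv_L1[OF f] ac_deriv_L1[OF g])+
  have i\<mu>: "(\<lambda>s. norm (f' s) + norm (g' s)) integrable_on {x..y}" if "p \<le> x" "y \<le> q" for x y
    using af[OF that] ag[OF that] by (intro integrable_add abs_integrable_imp)
  have "D p q = 0"
  proof (rule additive_small_imp_zero[where \<mu> = \<mu>])
    fix x y z assume x: "p \<le> x" "x \<le> y" "y \<le> z" "z \<le> q"
    have "integral {x..y} ?h + integral {y..z} ?h = integral {x..z} ?h"
      by (rule Henstock_Kurzweil_Integration.integral_combine) (use x abs_integrable_imp(1)[OF ah] in auto)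
    then show "D x z = D x y + D y z" by (simp add: D_def algebra_simps)
    show "\<mu> x z = \<mu> x y + \<mu> y z" unfolding \<mu>_def
      by (rule Henstock_Kurzweil_Integration.integral_combine[symmetric]) (use x i\<mu> in auto)
  next
    fix e :: real assume e: "e > 0"
    obtain d1 where d1: "d1 > 0" "\<And>x y. x\<in>{p..q} \<Longrightarrow> y\<in>{p..q} \<Longrightarrow> dist x y < d1 \<Longrightarrow> dist (f x) (f y) < e"
      using uniform_cont_Icc[OF continuous_on_subset[OF cf sub] e] by blast
    obtain d2 where d2: "d2 > 0" "\<And>x y. x\<in>{p..q} \<Longrightarrow> y\<in>{p..q} \<Longrightarrow> dist x y < d2 \<Longrightarrow> dist (g x) (g y) < e"
      using uniform_cont_Icc[OF continuous_on_subset[OF cg sub] e] by blast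
    have "norm (D x y) \<le> e * \<mu> x y" if xy: "p \<le> x" "x \<le> y" "y \<le> q" "y - x < min d1 d2" for x y
    proof -
      have S': "x \<in> S" "y \<in> S" using xy sub by auto
      have py: "p \<le> x" "y \<le> q" using xy by auto
      note if' = abs_integrable_imp(1)[OF af[OF py]] and ig' = abs_integrable_imp(1)[OF ag[OF py]]
        and ih' = abs_integrable_imp(1)[OF ah[OF py]]
      have k1: "integral {x..y} (\<lambda>s. g y * f' s) = g y * (f y - f x)"
        using f S' xy if' unfolding ac_deriv_def by simp
      have k2: "integral {x..y} (\<lambda>s. f x * g' s) = f x * (g y - g x)"
        using g S' xy ig' unfolding ac_deriv_def by simp
      have i1: "(\<lambda>s. g y * f' s) integrable_on {x..y}" and i2: "(\<lambda>s. f x * g' s) integrable_on {x..y}"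
        by (rule integrable_on_mult_right[OF if'] integrable_on_mult_right[OF ig'])+
      have "D x y = integral {x..y} (\<lambda>s. (g y * f' s + f x * g' s) - ?h s)"
        unfolding integral_diff[OF integrable_add[OF i1 i2] ih'] integral_add[OF i1 i2] k1 k2 D_def
        by (simp add: algebra_simps)
      moreover have "norm (integral {x..y} (\<lambda>s. (g y * f' s + f x * g' s) - ?h s)) \<le>
          integral {x..y} (\<lambda>s. e * (norm (f' s) + norm (g' s)))"
      proof (rule integral_norm_le)
        show "(\<lambda>s. (g y * f' s + f x * g' s) - ?h s) absolutely_integrable_on {x..y}"
          using ah[OF py] af[OF py] ag[OF py] by auto
        show "(\<lambda>s. e * (norm (f' s) + norm (g' s))) integrable_on {x..y}"
          using i\<mu>[OF py] by (rule integrable_on_mult_right)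
        fix s assume s: "s \<in> {x..y}"
        have "(g y * f' s + f x * g' s) - ?h s = (g y - g s) * f' s + (f x - f s) * g' s"
          by (simp add: algebra_simps)
        also have "norm \<dots> \<le> norm (g y - g s) * norm (f' s) + norm (f x - f s) * norm (g' s)"
          by (metis norm_mult norm_triangle_ineq)
        also have "\<dots> \<le> e * norm (f' s) + e * norm (g' s)"
        proof (intro add_mono mult_right_mono norm_ge_zero)
          show "norm (g y - g s) \<le> e" using d2(2)[of y s] s xy by (auto simp: dist_norm)
          show "norm (f x - f s) \<le> e" using d1(2)[of x s] s xy by (auto simp: dist_norm)
        qed
        finally show "norm ((g y * f' s + f x * g' s) - ?h s) \<le> e * (norm (f' s) + norm (g' s))"
          by (simp add: algebra_simps)
      qed
      ultimately show ?thesis by (simp add: \<mu>_def)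
    qed
    then show "\<exists>d>0. \<forall>x y. p \<le> x \<longrightarrow> x \<le> y \<longrightarrow> y \<le> q \<longrightarrow> y - x < d \<longrightarrow> norm (D x y) \<le> e * \<mu> x y"
      using d1(1) d2(1) by (intro exI[of _ "min d1 d2"]) auto
  qed (use pq in auto)
  then show "f q * g q - f p * g p = integral {p..q} ?h" by (simp add: D_def)
qed

lemma ac_deriv_inverse:
  fixes f :: "real \<Rightarrow> complex"
  assumes f: "ac_deriv S f f'" and S: "open S" "is_interval S" and nz: "\<And>x. x \<in> S \<Longrightarrow> f x \<noteq> 0"
  shows "ac_deriv S (\<lambda>x. 1 / f x) (\<lambda>x. - (1 / (f x)\<^sup>2) * f' x)"
  unfolding ac_deriv_def
proof (intro conjI ballI impI)
  note cf = ac_deriv_continuous[OF f S]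
  have ci: "continuous_on S (\<lambda>x. 1 / f x)" using cf nz by (intro continuous_intros) auto
  show L: "L1_loc S (\<lambda>x. - (1 / (f x)\<^sup>2) * f' x)"
    by (intro L1_loc_mult_continuous continuous_intros cf) (use nz ac_deriv_L1[OF f] in auto)
  fix p q assume pq: "p \<in> S" "q \<in> S" "p \<le> q"
  have sub: "{p..q} \<subseteq> S" using pq S interval_Icc_subset by blast
  let ?h = "\<lambda>x. - (1 / (f x)\<^sup>2) * f' x"
  define D where "D x y = 1 / f y - 1 / f x - integral {x..y} ?h" for x y
  define \<mu> where "\<mu> x y = integral {x..y} (\<lambda>s. norm (f' s))" for x y
  have sub': "{x..y} \<subseteq> S" if "p \<le> x" "y \<le> q" for x y
    using sub that by (auto simp: subset_eq)
  have af: "f' absolutely_integrable_on {x..y}" and ah: "?h absolutely_integrable_on {x..y}" if "p \<le> x" "y \<le> q" for x y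
    by (rule L1_loc_Icc[OF _ sub'[OF that]], rule L ac_deriv_L1[OF f])+
  have "bounded ((\<lambda>x. 1 / f x) ` {p..q})"
    by (intro compact_imp_bounded compact_continuous_image continuous_on_subset[OF ci sub] compact_Icc)
  then obtain B where B: "B > 0" "\<And>x. x \<in> {p..q} \<Longrightarrow> norm (1 / f x) \<le> B"
    unfolding bounded_pos by (auto simp: image_iff)
  have "D p q = 0"
  proof (rule additive_small_imp_zero[where \<mu> = \<mu>])
    fix x y z assume x: "p \<le> x" "x \<le> y" "y \<le> z" "z \<le> q"
    have "integral {x..y} ?h + integral {y..z} ?h = integral {x..z} ?h"
      by (rule Henstock_Kurzweil_Integration.integral_combine) (use x abs_integrable_imp(1)[OF ah] in auto)
    then show "D x z = D x y + D y z" by (simp add: D_def algebra_simps)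
    show "\<mu> x z = \<mu> x y + \<mu> y z" unfolding \<mu>_def
      by (rule Henstock_Kurzweil_Integration.integral_combine[symmetric]) (use x abs_integrable_imp(2)[OF af] in auto)
  next
    fix e :: real assume e: "e > 0"
    \<comment> \<open>Two error terms, each at most \<open>B\<close> times this modulus, add up to
      \<open>e\<close>.\<close>
    obtain d1 where d1: "d1 > 0" "\<And>x y. x\<in>{p..q} \<Longrightarrow> y\<in>{p..q} \<Longrightarrow> dist x y < d1 \<Longrightarrow> dist (1 / f x) (1 / f y) < e / (2 * B)"
      using uniform_cont_Icc[OF continuous_on_subset[OF ci sub], of "e / (2 * B)"] e B(1) by auto
    have "norm (D x y) \<le> e * \<mu> x y" if xy: "p \<le> x" "x \<le> y" "y \<le> q" "y - x < d1" for x y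
    proof -
      have S': "x \<in> S" "y \<in> S" using xy sub by auto
      have py: "p \<le> x" "y \<le> q" using xy by auto
      note if' = abs_integrable_imp(1)[OF af[OF py]] and ih' = abs_integrable_imp(1)[OF ah[OF py]]
      \<comment> \<open>With this constant in place of \<open>- 1 / (f s)^2\<close> the integral is
        exactly the increment of \<open>1 / f\<close>.\<close>
      let ?k = "- (1 / (f x * f y))"
      have k1: "integral {x..y} (\<lambda>s. ?k * f' s) = ?k * (f y - f x)"
        using f S' xy if' unfolding ac_deriv_def by simp
      have "?k * (f y - f x) = 1 / f y - 1 / f x" using nz S' by (simp add: field_simps)
      then have "D x y = integral {x..y} (\<lambda>s. ?k * f' s - ?h s)"
        unfolding integral_diff[OF integrable_on_mult_right[OF if'] ih'] k1 D_def by simp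
      moreover have "norm (integral {x..y} (\<lambda>s. ?k * f' s - ?h s)) \<le> integral {x..y} (\<lambda>s. e * norm (f' s))"
      proof (rule integral_norm_le)
        show "(\<lambda>s. ?k * f' s - ?h s) absolutely_integrable_on {x..y}"
          using ah[OF py] af[OF py] by (intro set_integral_diff set_integrable_mult_right) auto
        show "(\<lambda>s. e * norm (f' s)) integrable_on {x..y}"
          using abs_integrable_imp(2)[OF af[OF py]] by (rule integrable_on_mult_right)
        fix s assume s: "s \<in> {x..y}"
        have "?k * f' s - ?h s = (1 / f s * (1 / f s - 1 / f x) + 1 / f x * (1 / f s - 1 / f y)) * f' s"
          by (simp add: algebra_simps power2_eq_square)
        also have "norm \<dots> \<le> (norm (1 / f s) * norm (1 / f s - 1 / f x) + norm (1 / f x) * norm (1 / f s - 1 / f y)) * norm (f' s)"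
          unfolding norm_mult[symmetric] unfolding norm_mult[of _ "f' s"]
          by (intro mult_right_mono norm_ge_zero norm_triangle_ineq)
        also have "\<dots> \<le> (B * (e / (2 * B)) + B * (e / (2 * B))) * norm (f' s)"
        proof (intro add_mono mult_mono mult_right_mono norm_ge_zero)
          show "norm (1 / f s - 1 / f x) \<le> e / (2 * B)" using d1(2)[of s x] s xy by (auto simp: dist_norm)
          show "norm (1 / f s - 1 / f y) \<le> e / (2 * B)" using d1(2)[of s y] s xy by (auto simp: dist_norm)
        qed (use B s xy e in auto)
        finally show "norm (?k * f' s - ?h s) \<le> e * norm (f' s)"
          using B(1) by simp
      qed
      ultimately show ?thesis by (simp add: \<mu>_def)
    qed
    then show "\<exists>d>0. \<forall>x y. p \<le> x \<longrightarrow> x \<le> y \<longrightarrow> y \<le> q \<longrightarrow> y - x < d \<longrightarrow> norm (D x y) \<le> e * \<mu> x y"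
      using d1(1) by blast
  qed (use pq in auto)
  then show "1 / f q - 1 / f p = integral {p..q} ?h" unfolding D_def by (simp only: right_minus_eq)
qed

lemma ac_deriv_AE:
  fixes f f' h :: "real \<Rightarrow> complex"
  assumes f: "ac_deriv S f f'" and S: "open S" "is_interval S"
    and ae: "AE x in lebesgue_on S. f' x = h x"
  shows "ac_deriv S f h"
proof -
  have "AE x in lebesgue. x \<in> S \<longrightarrow> f' x = h x"
    using ae by (simp add: AE_restrict_space_iff borel_open S(1))
  then obtain N where N: "negligible N" "{x. \<not> (x \<in> S \<longrightarrow> f' x = h x)} \<subseteq> N"
    unfolding eventually_ae_filter negligible_iff_null_sets by auto
  have eq: "h x = f' x" if "x \<in> K - N" "K \<subseteq> S" for x K using that N(2) by auto
  have "L1_loc S h"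
    unfolding L1_loc_def
  proof (intro allI impI)
    fix K assume K: "compact K \<and> K \<subseteq> S"
    have "f' absolutely_integrable_on K" using ac_deriv_L1[OF f] K unfolding L1_loc_def by blast
    then show "h absolutely_integrable_on K"
      by (rule absolutely_integrable_spike[OF _ N(1)]) (use eq K in blast)
  qed
  moreover have "f y - f x = integral {x..y} h" if "x \<in> S" "y \<in> S" "x \<le> y" for x y
  proof -
    have "integral {x..y} f' = integral {x..y} h"
      by (rule integral_spike[OF N(1)]) (use eq interval_Icc_subset[OF S(2) that(1,2)] in blast)
    then show ?thesis using f that unfolding ac_deriv_def by auto
  qed
  ultimately show ?thesis unfolding ac_deriv_def by blast
qed

section \<open>The Dirac expression in components\<close>

lemma dirac_J_apply:
  "((mat (1 / \<i>) ** sigma2) *v w) $ 1 = - (w $ 2)"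
  "((mat (1 / \<i>) ** sigma2) *v w) $ 2 = w $ 1"
  by (simp_all add: matrix_matrix_mult_def matrix_vector_mult_def mat_def sigma2_def sum_2)

text \<open>The matrix \<open>(1/i) sigma2\<close> is the rotation
  \<open>(w1, w2) -> (- w2, w1)\<close>, so the equation determines both components of the
  derivative almost everywhere, and these formulas can serve as the integrands. The existential and
  the almost everywhere clause disappear.\<close>

lemma dirac_expr_iff:
  assumes S: "open S" "is_interval S"
  shows "dirac_expr S Q f g \<longleftrightarrow>
    ac_deriv S (\<lambda>x. f x $ 1) (\<lambda>x. g x $ 2 - (Q x *v f x) $ 2) \<and>
    ac_deriv S (\<lambda>x. f x $ 2) (\<lambda>x. (Q x *v f x) $ 1 - g x $ 1)"
proof
  assume "dirac_expr S Q f g"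
  then obtain f' where f': "ac_deriv S f f'"
    and ae: "AE x in lebesgue_on S. g x = (mat (1 / \<i>) ** sigma2) *v f' x + Q x *v f x"
    unfolding dirac_expr_def has_ac_derivative_eq by blast
  have ae1: "AE x in lebesgue_on S. f' x $ 1 = g x $ 2 - (Q x *v f x) $ 2"
    using ae by eventually_elim (simp only: dirac_J_apply vector_add_component, simp)
  have ae2: "AE x in lebesgue_on S. f' x $ 2 = (Q x *v f x) $ 1 - g x $ 1"
    using ae by eventually_elim (simp only: dirac_J_apply vector_add_component, simp)
  show "ac_deriv S (\<lambda>x. f x $ 1) (\<lambda>x. g x $ 2 - (Q x *v f x) $ 2) \<and>
    ac_deriv S (\<lambda>x. f x $ 2) (\<lambda>x. (Q x *v f x) $ 1 - g x $ 1)"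
    using f' ac_deriv_AE[OF _ S ae1] ac_deriv_AE[OF _ S ae2] unfolding ac_deriv_vec2[OF S(2)] by blast
next
  assume A: "ac_deriv S (\<lambda>x. f x $ 1) (\<lambda>x. g x $ 2 - (Q x *v f x) $ 2) \<and>
    ac_deriv S (\<lambda>x. f x $ 2) (\<lambda>x. (Q x *v f x) $ 1 - g x $ 1)"
  define f' :: "real \<Rightarrow> complex^2" where
    "f' x = vector [g x $ 2 - (Q x *v f x) $ 2, (Q x *v f x) $ 1 - g x $ 1]" for x
  have "ac_deriv S f f'" unfolding ac_deriv_vec2[OF S(2)] f'_def using A by simp
  moreover have "g x = (mat (1 / \<i>) ** sigma2) *v f' x + Q x *v f x" for x
    by (simp only: vec_eq_iff forall_2 vector_add_component dirac_J_apply) (simp add: f'_def)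
  ultimately show "dirac_expr S Q f g"
    unfolding dirac_expr_def has_ac_derivative_eq by blast
qed

subsection \<open>Spinors\<close>

text \<open>Bilinear, without conjugation, because the derivative of the Wronskian is; the hermitian
  product is recovered by conjugating one argument.\<close>

definition dotc :: "complex^2 \<Rightarrow> complex^2 \<Rightarrow> complex" where
  "dotc u v = u $ 1 * v $ 1 + u $ 2 * v $ 2"

lemma norm_vec2: "(norm u)\<^sup>2 = (norm (u $ 1))\<^sup>2 + (norm (u $ 2))\<^sup>2" for u :: "complex^2"
  by (simp add: norm_vec_def L2_set_def sum_2)

lemma norm_dotc_le: "norm (dotc u v) \<le> norm u * norm v"
proof -
  have "norm (dotc u v) \<le> (\<Sum>i\<in>UNIV. \<bar>norm (u $ i)\<bar> * \<bar>norm (v $ i)\<bar>)"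
    by (simp add: dotc_def sum_2 norm_triangle_le norm_mult)
  also have "\<dots> \<le> norm u * norm v" unfolding norm_vec_def by (rule L2_set_mult_ineq)
  finally show ?thesis .
qed

lemma norm_vec2_le: "norm u \<le> norm (u $ 1) + norm (u $ 2)" for u :: "complex^2"
  using L2_set_le_sum[of UNIV "\<lambda>i. norm (u $ i)"] by (simp add: norm_vec_def sum_2)

lemma norm_smult_vec: "norm (k *s u) = norm k * norm u" for u :: "complex^2"
proof -
  have "(norm (k *s u))\<^sup>2 = (norm k * norm u)\<^sup>2"
    by (simp add: norm_vec2 norm_mult power_mult_distrib distrib_left)
  then show ?thesis by (simp add: power2_eq_iff_nonneg)
qed

lemma wronskian_self [simp]: "wronskian f f x = 0"
  by (simp add: wronskian_def mult.commute)

lemma wronskian_swap: "wronskian g f x = - wronskian f g x"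
  by (simp add: wronskian_def)

text \<open>Three vectors in a plane are dependent, with coefficients given by Cramer's
  rule.\<close>

lemma plucker3:
  "wronskian v w x *s u x + wronskian w u x *s v x + wronskian u v x *s w x = 0"
  by (simp add: vec_eq_iff forall_2 wronskian_def algebra_simps)

text \<open>Recovers the Wronskian of \<open>u\<close> and \<open>v\<close> from their Wronskians
  with two independent solutions \<open>p\<close> and \<open>s\<close>.\<close>

lemma plucker4:
  "wronskian p s x * wronskian u v x = wronskian p u x * wronskian s v x - wronskian p v x * wronskian s u x"
  by (simp add: wronskian_def algebra_simps)

subsection \<open>Square integrability\<close>

lemma square_integrable_iff:
  "square_integrable S f \<longleftrightarrow> f \<in> borel_measurable (lebesgue_on S) \<and> (\<lambda>x. (norm (f x))\<^sup>2) integrable_on S"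
  unfolding square_integrable_def
  by (auto intro: nonnegative_absolutely_integrable_1 abs_integrable_imp)

lemma square_integrable_bound:
  assumes "f \<in> borel_measurable (lebesgue_on S)" "S \<in> sets lebesgue" "h integrable_on S"
    "\<And>x. x \<in> S \<Longrightarrow> (norm (f x))\<^sup>2 \<le> h x"
  shows "square_integrable S f"
  unfolding square_integrable_def
proof
  have "(\<lambda>x. (norm (f x))\<^sup>2) \<in> borel_measurable (lebesgue_on S)"
    using assms(1) by measurable
  then show "(\<lambda>x. (norm (f x))\<^sup>2) absolutely_integrable_on S"
    by (rule measurable_bounded_by_integrable_imp_absolutely_integrable) (use assms in auto)
qed fact

lemma square_integrable_integrable: "square_integrable S f \<Longrightarrow> (\<lambda>x. (norm (f x))\<^sup>2) integrable_on S"
  by (simp add: square_integrable_iff)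

lemma square_integrable_measurable: "square_integrable S f \<Longrightarrow> f \<in> borel_measurable (lebesgue_on S)"
  by (simp add: square_integrable_iff)

lemma square_integrable_subset:
  assumes "square_integrable S f" "T \<subseteq> S" "T \<in> sets lebesgue"
  shows "square_integrable T f"
  using assms unfolding square_integrable_def
  by (auto intro: set_integrable_subset measurable_restrict_mono)

lemma square_integrable_cong:
  assumes "square_integrable S f" "\<And>x. x \<in> S \<Longrightarrow> f x = g x"
  shows "square_integrable S g"
proof -
  have "g \<in> borel_measurable (lebesgue_on S)"
    using square_integrable_measurable[OF assms(1)]
    by (rule measurable_cong[THEN iffD1, rotated]) (use assms(2) in \<open>auto simp: space_restrict_space\<close>)
  moreover have "(\<lambda>x. (norm (g x))\<^sup>2) integrable_on S"
    by (rule integrable_eq[OF square_integrable_integrable[OF assms(1)]]) (use assms(2) in auto)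
  ultimately show ?thesis by (simp add: square_integrable_iff)
qed

lemma square_integrable_add:
  assumes "square_integrable S f" "square_integrable S g" "S \<in> sets lebesgue"
  shows "square_integrable S (\<lambda>x. f x + g x)"
proof (rule square_integrable_bound[where h = "\<lambda>x. 2 * (norm (f x))\<^sup>2 + 2 * (norm (g x))\<^sup>2"])
  show "(\<lambda>x. 2 * (norm (f x))\<^sup>2 + 2 * (norm (g x))\<^sup>2) integrable_on S"
    using assms by (intro integrable_add integrable_on_mult_right square_integrable_integrable)
  fix x
  have "(norm (f x + g x))\<^sup>2 \<le> (norm (f x) + norm (g x))\<^sup>2"
    by (intro power_mono norm_triangle_ineq) auto
  also have "\<dots> \<le> 2 * (norm (f x))\<^sup>2 + 2 * (norm (g x))\<^sup>2"
    using sum_squares_bound[of "norm (f x)" "norm (g x)"] by (simp add: power2_sum)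
  finally show "(norm (f x + g x))\<^sup>2 \<le> 2 * (norm (f x))\<^sup>2 + 2 * (norm (g x))\<^sup>2" .
qed (use assms square_integrable_measurable in \<open>auto intro: borel_measurable_add\<close>)

lemma measurable_smult_vec:
  fixes k :: "real \<Rightarrow> complex" and f :: "real \<Rightarrow> complex^2"
  assumes "k \<in> borel_measurable M" "f \<in> borel_measurable M"
  shows "(\<lambda>x. k x *s f x) \<in> borel_measurable M"
  by (rule borel_measurable_continuous_Pair[OF assms])
    (auto simp: vector_scalar_mult_def intro!: continuous_intros)

lemma square_integrable_mult:
  assumes "square_integrable S f" "S \<in> sets lebesgue" "k \<in> borel_measurable (lebesgue_on S)"
    "\<And>x. x \<in> S \<Longrightarrow> norm (k x) \<le> B"
  shows "square_integrable S (\<lambda>x. k x *s f x)"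
proof (rule square_integrable_bound[where h = "\<lambda>x. B\<^sup>2 * (norm (f x))\<^sup>2"])
  fix x assume "x \<in> S"
  then show "(norm (k x *s f x))\<^sup>2 \<le> B\<^sup>2 * (norm (f x))\<^sup>2"
    using assms(4)[of x] by (auto simp: norm_smult_vec power_mult_distrib intro!: mult_right_mono power_mono)
qed (use assms in \<open>auto intro: measurable_smult_vec square_integrable_measurable
  integrable_on_mult_right square_integrable_integrable\<close>)

lemma square_integrable_cmult:
  "square_integrable S f \<Longrightarrow> S \<in> sets lebesgue \<Longrightarrow> square_integrable S (\<lambda>x. k *s f x)"
  by (rule square_integrable_mult[where B = "norm k"]) auto

lemma measurable_vec_comp:
  fixes f :: "real \<Rightarrow> complex^2"
  assumes "f \<in> borel_measurable M"
  shows "(\<lambda>x. f x $ i) \<in> borel_measurable M"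
  by (rule measurable_compose[OF assms borel_measurable_continuous_onI]) (intro continuous_intros)

lemma square_integrable_prod:
  assumes "square_integrable S f" "square_integrable S g" "S \<in> sets lebesgue"
  shows "(\<lambda>x. norm (f x) * norm (g x)) integrable_on S"
    and "(\<lambda>x. dotc (f x) (g x)) absolutely_integrable_on S"
proof -
  note fm = square_integrable_measurable[OF assms(1)] and gm = square_integrable_measurable[OF assms(2)]
  have h: "(\<lambda>x. (norm (f x))\<^sup>2 + (norm (g x))\<^sup>2) integrable_on S"
    using assms by (intro integrable_add square_integrable_integrable)
  have b: "norm (f x) * norm (g x) \<le> (norm (f x))\<^sup>2 + (norm (g x))\<^sup>2" for x
  proof -
    have "norm (f x) * norm (g x) \<le> 2 * norm (f x) * norm (g x)" by simp
    also have "\<dots> \<le> (norm (f x))\<^sup>2 + (norm (g x))\<^sup>2" by (rule sum_squares_bound)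
    finally show ?thesis .
  qed
  have "(\<lambda>x. norm (f x) * norm (g x)) absolutely_integrable_on S"
    by (rule measurable_bounded_by_integrable_imp_absolutely_integrable[OF _ assms(3) h])
      (use b fm gm in \<open>auto intro!: borel_measurable_times borel_measurable_norm\<close>)
  then show "(\<lambda>x. norm (f x) * norm (g x)) integrable_on S" by (rule abs_integrable_imp)
  show "(\<lambda>x. dotc (f x) (g x)) absolutely_integrable_on S"
    by (rule measurable_bounded_by_integrable_imp_absolutely_integrable[OF _ assms(3) h])
      (use fm gm in \<open>auto simp: dotc_def intro!: borel_measurable_times borel_measurable_add measurable_vec_comp\<close>,
       use b norm_dotc_le order_trans in \<open>unfold dotc_def, blast\<close>)
qed

text \<open>The discriminant argument for the integral of \<open>(|f| - t |g|)^2\<close>,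
  nonnegative for every real \<open>t\<close>.\<close>

lemma integral_Cauchy_Schwarz:
  assumes "square_integrable S f" "square_integrable S g" "S \<in> sets lebesgue"
  shows "(integral S (\<lambda>x. norm (f x) * norm (g x)))\<^sup>2 \<le>
     integral S (\<lambda>x. (norm (f x))\<^sup>2) * integral S (\<lambda>x. (norm (g x))\<^sup>2)"
proof -
  let ?A = "integral S (\<lambda>x. (norm (f x))\<^sup>2)" and ?B = "integral S (\<lambda>x. (norm (g x))\<^sup>2)"
    and ?X = "integral S (\<lambda>x. norm (f x) * norm (g x))"
  note i = square_integrable_integrable[OF assms(1)] square_integrable_integrable[OF assms(2)]
    square_integrable_prod(1)[OF assms]
  have q: "0 \<le> ?A - 2 * t * ?X + t\<^sup>2 * ?B" for t
  proof -
    have "0 \<le> integral S (\<lambda>x. (norm (f x))\<^sup>2 - 2 * t * (norm (f x) * norm (g x)) + t\<^sup>2 * (norm (g x))\<^sup>2)"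
    proof (rule Henstock_Kurzweil_Integration.integral_nonneg)
      show "(\<lambda>x. (norm (f x))\<^sup>2 - 2 * t * (norm (f x) * norm (g x)) + t\<^sup>2 * (norm (g x))\<^sup>2) integrable_on S"
        by (intro integrable_add integrable_diff integrable_on_mult_right i)
      show "0 \<le> (norm (f x))\<^sup>2 - 2 * t * (norm (f x) * norm (g x)) + t\<^sup>2 * (norm (g x))\<^sup>2" for x
        using zero_le_power2[of "norm (f x) - t * norm (g x)"]
        by (simp add: power2_diff power_mult_distrib algebra_simps)
    qed
    also have "\<dots> = ?A - 2 * t * ?X + t\<^sup>2 * ?B"
      using i by (simp add: integral_add integral_diff integrable_add integrable_diff integrable_on_mult_right del: mult.assoc)
    finally show ?thesis .
  qed
  have B: "?B \<ge> 0" by (rule Henstock_Kurzweil_Integration.integral_nonneg) (use i in auto)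
  show ?thesis
  proof (cases "?B = 0")
    case True
    have "?X = 0"
    proof (rule ccontr)
      assume "?X \<noteq> 0"
      \<comment> \<open>Without the quadratic term the polynomial is affine in \<open>t\<close>, and
        this \<open>t\<close> would give it the value -1.\<close>
      then show False using q[of "(?A + 1) / (2 * ?X)"] True by (simp add: field_simps)
    qed
    then show ?thesis using True by simp
  next
    case False
    then have "?B > 0" using B by simp
    then show ?thesis using q[of "?X / ?B"] by (simp add: field_simps power2_eq_square)
  qed
qed

lemma square_integrable_Icc:
  assumes "continuous_on {x..y} f"
  shows "square_integrable {x..y} f"
  unfolding square_integrable_iff
  using assms by (auto intro!: continuous_imp_measurable_on_sets_lebesgue integrable_continuous_real continuous_intros)

lemma square_integrable_Un:
  assumes "square_integrable S f" "square_integrable T f" "S \<in> sets lebesgue" "T \<in> sets lebesgue"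
  shows "square_integrable (S \<union> T) f"
proof -
  have "(\<lambda>x. (norm (f x))\<^sup>2) absolutely_integrable_on (S \<union> T)"
    using assms unfolding square_integrable_def by (intro set_integrable_Un) auto
  moreover have "f \<in> borel_measurable (lebesgue_on (S \<union> T))"
  proof -
    have m: "(\<lambda>x. if x \<in> S then f x else 0) \<in> borel_measurable lebesgue"
      "(\<lambda>x. if x \<in> T then f x else 0) \<in> borel_measurable lebesgue"
      using assms(1,2)[THEN square_integrable_measurable] assms(3,4) by (simp_all add: borel_measurable_if)
    have "(\<lambda>x. if x \<in> S then (if x \<in> S then f x else 0) else (if x \<in> T then f x else 0)) \<in> borel_measurable lebesgue"
      by (rule measurable_If_set[OF m]) (use assms(3) in auto)
    also have "(\<lambda>x. if x \<in> S then (if x \<in> S then f x else 0) else (if x \<in> T then f x else 0)) =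
        (\<lambda>x. if x \<in> S \<union> T then f x else 0)" by auto
    finally show ?thesis using assms(3,4) by (simp only: borel_measurable_if sets.Un)
  qed
  ultimately show ?thesis by (simp add: square_integrable_def)
qed

subsection \<open>The two ends of an interval\<close>

text \<open>The flag \<open>s\<close> selects the left end (\<open>True\<close>) or the right end (\<open>False\<close>).\<close>

definition tail :: "bool \<Rightarrow> ereal \<Rightarrow> ereal \<Rightarrow> real \<Rightarrow> real set" where
  "tail s a b x = (if s then einterval a x else einterval x b)"

definition end_filter :: "bool \<Rightarrow> ereal \<Rightarrow> ereal \<Rightarrow> real filter" where
  "end_filter s a b = (if s then left_end a else right_end b)"

definition L2_near :: "bool \<Rightarrow> ereal \<Rightarrow> ereal \<Rightarrow> (real \<Rightarrow> complex^2) \<Rightarrow> bool" where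
  "L2_near s a b f \<longleftrightarrow> (\<exists>c\<in>einterval a b. square_integrable (tail s a b c) f)"

definition limit_circle :: "bool \<Rightarrow> ereal \<Rightarrow> ereal \<Rightarrow> (real \<Rightarrow> complex^2^2) \<Rightarrow> bool" where
  "limit_circle s a b Q \<longleftrightarrow> (\<forall>z u. dirac_solution (einterval a b) Q z u \<longrightarrow> L2_near s a b u)"

definition in_dom_near :: "bool \<Rightarrow> ereal \<Rightarrow> ereal \<Rightarrow> (real \<Rightarrow> complex^2) \<Rightarrow> (real \<Rightarrow> complex^2) \<Rightarrow> bool" where
  "in_dom_near s a b v f \<longleftrightarrow> L2_near s a b f \<and> (wronskian v f \<longlongrightarrow> 0) (end_filter s a b)"

text \<open>The endpoints are unordered, because the moving point lies below or above the base point
  according to the end considered.\<close>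

definition seg :: "real \<Rightarrow> real \<Rightarrow> real set" where
  "seg x y = {min x y..max x y}"

lemma in_dom_near_left_iff: "in_dom_near_left a b v f \<longleftrightarrow> in_dom_near True a b v f"
  by (simp add: in_dom_near_left_def in_dom_near_def L2_near_left_def L2_near_def bc_left_def tail_def end_filter_def)

lemma in_dom_near_right_iff: "in_dom_near_right a b v f \<longleftrightarrow> in_dom_near False a b v f"
  by (simp add: in_dom_near_right_def in_dom_near_def L2_near_right_def L2_near_def bc_right_def tail_def end_filter_def)

lemma limit_circle_left_iff: "limit_circle_left a b Q \<longleftrightarrow> limit_circle True a b Q"
  by (simp add: limit_circle_left_def limit_circle_def L2_near_left_def L2_near_def tail_def)

lemma limit_circle_right_iff: "limit_circle_right a b Q \<longleftrightarrow> limit_circle False a b Q"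
  by (simp add: limit_circle_right_def limit_circle_def L2_near_right_def L2_near_def tail_def)

lemma tail_open [simp]: "open (tail s a b x)"
  and tail_is_interval [simp]: "is_interval (tail s a b x)"
  and tail_in_lebesgue [simp]: "tail s a b x \<in> sets lebesgue"
  by (simp_all add: tail_def)

lemma ereal_less_trans_real: "x < y \<Longrightarrow> ereal y < b \<Longrightarrow> ereal x < b" "x < y \<Longrightarrow> a < ereal x \<Longrightarrow> a < ereal y"
  using less_trans[of "ereal x" "ereal y" b] less_trans[of a "ereal x" "ereal y"] by simp_all

lemma tail_subset: "x \<in> einterval a b \<Longrightarrow> tail s a b x \<subseteq> einterval a b"
  by (auto simp: tail_def einterval_iff split: if_splits intro: ereal_less_trans_real)

lemma tail_mono: "y \<in> tail s a b x \<Longrightarrow> tail s a b y \<subseteq> tail s a b x"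
  by (cases s) (auto simp: tail_def einterval_iff)

lemma tail_linear:
  assumes "x \<in> einterval a b" "y \<in> einterval a b"
  obtains "y = x" | "y \<in> tail s a b x" | "x \<in> tail s a b y"
  using assms by (cases x y rule: linorder_cases; cases s) (auto simp: tail_def einterval_iff)

lemma tail_nonempty: "x \<in> einterval a b \<Longrightarrow> \<exists>y. y \<in> tail s a b x"
  unfolding tail_def using einterval_nonempty[of a "ereal x"] einterval_nonempty[of "ereal x" b]
  by (auto simp: einterval_iff)

lemma tail_not_self [simp]: "x \<notin> tail s a b x"
  by (simp add: tail_def einterval_iff)

lemma seg_subset: "is_interval S \<Longrightarrow> x \<in> S \<Longrightarrow> y \<in> S \<Longrightarrow> seg x y \<subseteq> S"
  unfolding seg_def by (metis interval_Icc_subset max_def min_def)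

lemma seg_mem [simp]: "x \<in> seg x y" "y \<in> seg x y" by (auto simp: seg_def)

lemma seg_lebesgue [simp]: "seg x y \<in> sets lebesgue" by (simp add: seg_def)

text \<open>Tails are open and segments closed, hence the additional point \<open>x\<close>.\<close>

lemma tail_decomp:
  assumes "x \<in> einterval a b" "y \<in> tail s a b x"
  shows "tail s a b x \<union> {x} = tail s a b y \<union> seg x y" "tail s a b y \<inter> seg x y = {}"
proof -
  have *: "tail s a b x \<union> {x} = tail s a b y \<union> seg x y \<and> tail s a b y \<inter> seg x y = {}"
  proof (cases s)
    case True
    then have yx: "a < ereal y" "y < x" using assms by (auto simp: tail_def einterval_iff)
    have "a < ereal z" if "y \<le> z" for z using yx(1) that less_le_trans[of a "ereal y" "ereal z"] by simp
    moreover have "z < x" if "z < y" for z using yx(2) that by simp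
    ultimately show ?thesis using True yx by (auto simp: tail_def einterval_iff seg_def)
  next
    case False
    then have yx: "ereal y < b" "x < y" using assms by (auto simp: tail_def einterval_iff)
    have "ereal z < b" if "z \<le> y" for z using yx(1) that le_less_trans[of "ereal z" "ereal y" b] by simp
    moreover have "x < z" if "y < z" for z using yx(2) that by simp
    ultimately show ?thesis using False yx by (auto simp: tail_def einterval_iff seg_def)
  qed
  then show "tail s a b x \<union> {x} = tail s a b y \<union> seg x y" "tail s a b y \<inter> seg x y = {}" by auto
qed

text \<open>Limits at an end, finite or infinite, become statements about real tails, so that both
  ends are treated by the same arguments.\<close>

lemma eventually_end_filter:
  assumes "a < b"
  shows "eventually P (end_filter s a b) \<longleftrightarrow> (\<exists>t\<in>einterval a b. \<forall>x\<in>tail s a b t. P x)"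
proof (cases s)
  case True
  have "eventually P (end_filter s a b) \<longleftrightarrow> (\<exists>y>a. \<forall>z>a. z < y \<longrightarrow> P (real_of_ereal z))"
    using True by (simp add: end_filter_def left_end_def eventually_filtermap eventually_at_right[OF assms])
  also have "\<dots> \<longleftrightarrow> (\<exists>t\<in>einterval a b. \<forall>x\<in>tail s a b t. P x)"
  proof
    assume "\<exists>y>a. \<forall>z>a. z < y \<longrightarrow> P (real_of_ereal z)"
    then obtain y where y: "y > a" "\<And>z. z > a \<Longrightarrow> z < y \<Longrightarrow> P (real_of_ereal z)" by blast
    obtain t where t: "a < ereal t" "ereal t < min y b" using ereal_dense2[of a "min y b"] y assms by auto
    have "P x" if "x \<in> tail s a b t" for x
      using y(2)[of "ereal x"] that True t less_trans[of "ereal x" "ereal t" y] by (auto simp: tail_def einterval_iff)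
    moreover have "t \<in> einterval a b" using t by (simp add: einterval_iff)
    ultimately show "\<exists>t\<in>einterval a b. \<forall>x\<in>tail s a b t. P x" by blast
  next
    assume "\<exists>t\<in>einterval a b. \<forall>x\<in>tail s a b t. P x"
    then obtain t where t: "t \<in> einterval a b" "\<And>x. x \<in> tail s a b t \<Longrightarrow> P x" by blast
    have "P (real_of_ereal z)" if "z > a" "z < ereal t" for z
      using that t(2)[of "real_of_ereal z"] True by (cases z) (auto simp: tail_def einterval_iff)
    then show "\<exists>y>a. \<forall>z>a. z < y \<longrightarrow> P (real_of_ereal z)" using t(1) by (auto simp: einterval_iff)
  qed
  finally show ?thesis .
next
  case False
  have "eventually P (end_filter s a b) \<longleftrightarrow> (\<exists>y<b. \<forall>z>y. z < b \<longrightarrow> P (real_of_ereal z))"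
    using False by (simp add: end_filter_def right_end_def eventually_filtermap eventually_at_left[OF assms])
  also have "\<dots> \<longleftrightarrow> (\<exists>t\<in>einterval a b. \<forall>x\<in>tail s a b t. P x)"
  proof
    assume "\<exists>y<b. \<forall>z>y. z < b \<longrightarrow> P (real_of_ereal z)"
    then obtain y where y: "y < b" "\<And>z. z > y \<Longrightarrow> z < b \<Longrightarrow> P (real_of_ereal z)" by blast
    obtain t where t: "max y a < ereal t" "ereal t < b" using ereal_dense2[of "max y a" b] y assms by auto
    have "P x" if "x \<in> tail s a b t" for x
      using y(2)[of "ereal x"] that False t less_trans[of y "ereal t" "ereal x"] by (auto simp: tail_def einterval_iff)
    moreover have "t \<in> einterval a b" using t by (simp add: einterval_iff)
    ultimately show "\<exists>t\<in>einterval a b. \<forall>x\<in>tail s a b t. P x" by blast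
  next
    assume "\<exists>t\<in>einterval a b. \<forall>x\<in>tail s a b t. P x"
    then obtain t where t: "t \<in> einterval a b" "\<And>x. x \<in> tail s a b t \<Longrightarrow> P x" by blast
    have "P (real_of_ereal z)" if "z > ereal t" "z < b" for z
      using that t(2)[of "real_of_ereal z"] False by (cases z) (auto simp: tail_def einterval_iff)
    then show "\<exists>y<b. \<forall>z>y. z < b \<longrightarrow> P (real_of_ereal z)" using t(1) by (auto simp: einterval_iff)
  qed
  finally show ?thesis .
qed

lemma eventually_in_tail: "a < b \<Longrightarrow> t \<in> einterval a b \<Longrightarrow> eventually (\<lambda>x. x \<in> tail s a b t) (end_filter s a b)"
  unfolding eventually_end_filter by blast

lemma end_filter_neq_bot: "a < b \<Longrightarrow> end_filter s a b \<noteq> bot"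
  unfolding trivial_limit_def eventually_end_filter using tail_nonempty by blast

text \<open>A sequence running to the end makes dominated convergence and Fatou's lemma applicable
  to tails.\<close>

lemma end_sequence:
  assumes "a < b"
  obtains e :: "nat \<Rightarrow> real" where "\<And>n. e n \<in> einterval a b"
    "\<And>x. x \<in> einterval a b \<Longrightarrow> eventually (\<lambda>n. e n \<in> tail s a b x) sequentially"
proof -
  have "\<exists>u l :: nat \<Rightarrow> real. (\<forall>i. l i < u i \<and> a < ereal (l i) \<and> ereal (u i) < b) \<and>
    (\<lambda>x. ereal (l x)) \<longlonglongrightarrow> a \<and> (\<lambda>x. ereal (u x)) \<longlonglongrightarrow> b"
    by (rule einterval_Icc_approximation[OF assms]) blast
  then obtain u l :: "nat \<Rightarrow> real" where ul: "\<And>i. l i < u i" "\<And>i. a < ereal (l i)" "\<And>i. ereal (u i) < b"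
    "(\<lambda>x. ereal (l x)) \<longlonglongrightarrow> a" "(\<lambda>x. ereal (u x)) \<longlonglongrightarrow> b" by blast
  have mem: "l i \<in> einterval a b" "u i \<in> einterval a b" for i
    using ul(2,3)[of i] ul(1)[of i] less_trans[of a "ereal (l i)" "ereal (u i)"] less_trans[of "ereal (l i)" "ereal (u i)" b]
    by (simp_all add: einterval_iff)
  show ?thesis
  proof (rule that[of "\<lambda>n. if s then l n else u n"])
    fix x assume x: "x \<in> einterval a b"
    show "eventually (\<lambda>n. (if s then l n else u n) \<in> tail s a b x) sequentially"
    proof (cases s)
      case True
      have "eventually (\<lambda>n. ereal (l n) < ereal x) sequentially"
        using order_tendstoD(2)[OF ul(4), of "ereal x"] x by (simp add: einterval_iff)
      then show ?thesis by eventually_elim (use True ul in \<open>auto simp: tail_def einterval_iff\<close>)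
    next
      case False
      have "eventually (\<lambda>n. ereal x < ereal (u n)) sequentially"
        using order_tendstoD(1)[OF ul(5), of "ereal x"] x by (simp add: einterval_iff)
      then show ?thesis by eventually_elim (use False ul in \<open>auto simp: tail_def einterval_iff\<close>)
    qed
  qed (use mem in auto)
qed

lemma integral_tail_split:
  fixes h :: "real \<Rightarrow> 'a::euclidean_space"
  assumes h: "h absolutely_integrable_on (tail s a b c)" and c: "c \<in> einterval a b" and x: "x \<in> tail s a b c"
  shows "integral (tail s a b c) h = integral (tail s a b x) h + integral (seg c x) h"
    and "h absolutely_integrable_on (tail s a b x)" "h absolutely_integrable_on (seg c x)"
proof -
  have h': "h absolutely_integrable_on (tail s a b c \<union> {c})"
    by (rule absolutely_integrable_spike_set[OF h]) (auto intro: negligible_subset[of "{c}"])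
  note d = tail_decomp[OF c x]
  show i1: "h absolutely_integrable_on (tail s a b x)"
    by (rule set_integrable_subset[OF h']) (use d in auto)
  show i2: "h absolutely_integrable_on (seg c x)"
    by (rule set_integrable_subset[OF h']) (use d in auto)
  have "integral (tail s a b c) h = integral (tail s a b c \<union> {c}) h"
    by (rule integral_spike_set) (auto intro: negligible_subset[of "{c}"])
  also have "\<dots> = integral (tail s a b x) h + integral (seg c x) h"
    unfolding d(1) by (rule integral_Un) (use i1 i2 d(2) abs_integrable_imp in auto)
  finally show "integral (tail s a b c) h = integral (tail s a b x) h + integral (seg c x) h" .
qed

text \<open>Dominated convergence along a sequence running to the end yields one tail of small
  integral; the later tails and the segments issuing from \<open>t\<close> are parts of it.\<close>

lemma tail_integral_small:
  fixes h :: "real \<Rightarrow> real"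
  assumes ab: "a < b" and c: "c \<in> einterval a b" and h: "h absolutely_integrable_on (tail s a b c)"
    and pos: "\<And>x. x \<in> tail s a b c \<Longrightarrow> 0 \<le> h x" and e: "e > 0"
  shows "\<exists>t\<in>tail s a b c. \<forall>x\<in>tail s a b t. integral (tail s a b x) h < e \<and> integral (seg t x) h < e"
proof -
  let ?S = "tail s a b c"
  obtain q where q: "\<And>n. q n \<in> einterval a b"
    "\<And>x. x \<in> einterval a b \<Longrightarrow> eventually (\<lambda>n. q n \<in> tail s a b x) sequentially"
    using end_sequence[OF ab, of s] by blast
  have sub: "?S \<subseteq> einterval a b" by (rule tail_subset[OF c])
  have "(\<lambda>n. integral ?S (\<lambda>x. if x \<in> tail s a b (q n) then h x else 0)) \<longlonglongrightarrow> integral ?S (\<lambda>x. 0)"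
  proof (rule dominated_convergence(2)[where h = h])
    show "h integrable_on ?S" using h by (rule abs_integrable_imp)
    show "(\<lambda>x. if x \<in> tail s a b (q n) then h x else 0) integrable_on ?S" for n
    proof -
      have "h absolutely_integrable_on (?S \<inter> tail s a b (q n))"
        by (rule set_integrable_subset[OF h]) auto
      then have "h integrable_on (tail s a b (q n) \<inter> ?S)" by (simp add: abs_integrable_imp Int_commute)
      then show ?thesis by (simp add: integrable_restrict_Int)
    qed
    show "norm (if x \<in> tail s a b (q n) then h x else 0) \<le> h x" if "x \<in> ?S" for n x
      using pos[OF that] by auto
    show "(\<lambda>n. if x \<in> tail s a b (q n) then h x else 0) \<longlonglongrightarrow> 0" if "x \<in> ?S" for x
    proof (rule tendsto_eventually)
      have "eventually (\<lambda>n. q n \<in> tail s a b x) sequentially" using q(2) that sub by blast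
      then show "eventually (\<lambda>n. (if x \<in> tail s a b (q n) then h x else 0) = 0) sequentially"
        by eventually_elim (use tail_mono tail_not_self in fastforce)
    qed
  qed
  then have "eventually (\<lambda>n. integral ?S (\<lambda>x. if x \<in> tail s a b (q n) then h x else 0) < e) sequentially"
    using order_tendstoD(2) e by fastforce
  with q(2)[OF c] have "eventually (\<lambda>n. integral ?S (\<lambda>x. if x \<in> tail s a b (q n) then h x else 0) < e
      \<and> q n \<in> ?S) sequentially" by eventually_elim auto
  then obtain n where n: "integral ?S (\<lambda>x. if x \<in> tail s a b (q n) then h x else 0) < e" "q n \<in> ?S"
    using eventually_happens trivial_limit_sequentially by blast
  have "integral ?S (\<lambda>x. if x \<in> tail s a b (q n) then h x else 0) = integral (tail s a b (q n) \<inter> ?S) h"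
    by (rule integral_restrict_Int)
  moreover have "tail s a b (q n) \<inter> ?S = tail s a b (q n)" using tail_mono[OF n(2)] by blast
  ultimately have lt: "integral (tail s a b (q n)) h < e" using n(1) by simp
  have hq: "h absolutely_integrable_on (tail s a b (q n))" by (rule integral_tail_split[OF h c n(2)])
  have posq: "0 \<le> h x" if "x \<in> tail s a b (q n)" for x using tail_mono[OF n(2)] pos that by blast
  have "integral (tail s a b x) h < e \<and> integral (seg (q n) x) h < e" if x: "x \<in> tail s a b (q n)" for x
  proof -
    note sp = integral_tail_split[OF hq q(1) x]
    have qn0: "seg (q n) x \<subseteq> tail s a b (q n) \<union> {q n}" using tail_decomp(1)[OF q(1) x] by blast
    have "0 \<le> integral (tail s a b x) h"
      by (rule Henstock_Kurzweil_Integration.integral_nonneg)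
        (use abs_integrable_imp sp posq tail_mono[OF x] in auto)
    moreover have "0 \<le> integral (seg (q n) x) h"
      by (rule Henstock_Kurzweil_Integration.integral_nonneg)
        (use abs_integrable_imp sp pos n(2) posq qn0 in auto)
    ultimately show ?thesis using lt sp(1) by linarith
  qed
  then show ?thesis using n(2) by blast
qed

lemma ac_deriv_norm_le:
  fixes f f' :: "real \<Rightarrow> complex"
  assumes "ac_deriv S f f'" "is_interval S" "x \<in> S" "y \<in> S"
  shows "norm (f y - f x) \<le> integral (seg x y) (\<lambda>t. norm (f' t))"
proof -
  have *: "norm (f y - f x) \<le> integral {x..y} (\<lambda>t. norm (f' t))" if "x \<le> y" "x \<in> S" "y \<in> S" for x y
  proof -
    have i: "f' absolutely_integrable_on {x..y}" by (rule ac_deriv_abs_integrable[OF assms(1,2) that(2,3)])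
    have "f y - f x = integral {x..y} f'" using assms(1) that unfolding ac_deriv_def by blast
    then show ?thesis using integral_norm_le[OF i abs_integrable_imp(2)[OF i]] by simp
  qed
  show ?thesis
  proof (cases "x \<le> y")
    case True then show ?thesis using *[OF True assms(3,4)] by (simp add: seg_def)
  next
    case False then show ?thesis using *[of y x] assms(3,4) by (simp add: seg_def norm_minus_commute)
  qed
qed

text \<open>The sign is the orientation: the tail lies below \<open>x\<close> at the left end and
  above \<open>x\<close> at the right end.\<close>

lemma ac_deriv_tail_limit:
  fixes w w' :: "real \<Rightarrow> complex"
  assumes ab: "a < b" and ac: "ac_deriv (einterval a b) w w'" and c: "c \<in> einterval a b"
    and int: "w' absolutely_integrable_on (tail s a b c)"
  obtains L where "(w \<longlongrightarrow> L) (end_filter s a b)"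
    "\<And>x. x \<in> tail s a b c \<union> {c} \<Longrightarrow> w x - L = (if s then 1 else - 1) * integral (tail s a b x) w'"
proof -
  let ?g = "if s then 1 else - 1 :: complex"
  define L where "L = w c - ?g * integral (tail s a b c) w'"
  have sub: "tail s a b c \<subseteq> einterval a b" by (rule tail_subset[OF c])
  have L: "w x - L = ?g * integral (tail s a b x) w'" if x: "x \<in> tail s a b c \<union> {c}" for x
  proof (cases "x = c")
    case True then show ?thesis by (simp add: L_def)
  next
    case False
    then have x': "x \<in> tail s a b c" using x by simp
    have "w c - w x = ?g * integral (seg c x) w'"
    proof (cases s)
      case True
      then have "x \<le> c" using x' by (auto simp: tail_def einterval_iff)
      then show ?thesis using ac True c x' sub unfolding ac_deriv_def by (auto simp: seg_def)
    next
      case False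
      then have "c \<le> x" using x' by (auto simp: tail_def einterval_iff)
      then have "w x - w c = integral (seg c x) w'"
        using ac c x' sub unfolding ac_deriv_def by (auto simp: seg_def)
      then show ?thesis using False by (simp add: algebra_simps minus_equation_iff)
    qed
    moreover have "integral (tail s a b c) w' = integral (tail s a b x) w' + integral (seg c x) w'"
      by (rule integral_tail_split[OF int c x'])
    ultimately show ?thesis unfolding L_def by (auto simp: algebra_simps)
  qed
  have ni: "(\<lambda>x. norm (w' x)) absolutely_integrable_on (tail s a b c)"
    using int by (rule absolutely_integrable_norm[unfolded o_def])
  have "(w \<longlongrightarrow> L) (end_filter s a b)"
  proof (rule tendstoI)
    fix e :: real assume "e > 0"
    then obtain t where t: "t \<in> tail s a b c"
      "\<And>x. x \<in> tail s a b t \<Longrightarrow> integral (tail s a b x) (\<lambda>x. norm (w' x)) < e"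
      using tail_integral_small[OF ab c ni] by fastforce
    have "dist (w x) L < e" if x: "x \<in> tail s a b t" for x
    proof -
      have xc: "x \<in> tail s a b c" using tail_mono[OF t(1)] x by blast
      have iw: "w' absolutely_integrable_on (tail s a b x)" by (rule integral_tail_split[OF int c xc])
      have "norm (w x - L) = norm (integral (tail s a b x) w')" using L xc by (auto simp: norm_mult)
      also have "\<dots> \<le> integral (tail s a b x) (\<lambda>x. norm (w' x))"
        by (rule integral_norm_le[OF iw abs_integrable_imp(2)[OF iw]]) auto
      finally show ?thesis using t(2)[OF x] by (simp add: dist_norm)
    qed
    then show "eventually (\<lambda>x. dist (w x) L < e) (end_filter s a b)"
      unfolding eventually_end_filter[OF ab] using t(1) sub by blast
  qed
  then show ?thesis using that L by blast
qed

lemma ac_deriv_integral_ends: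
  fixes w w' :: "real \<Rightarrow> complex"
  assumes ab: "a < b" and ac: "ac_deriv (einterval a b) w w'"
    and int: "w' absolutely_integrable_on (einterval a b)"
    and A: "(w \<longlongrightarrow> A) (end_filter True a b)" and B: "(w \<longlongrightarrow> B) (end_filter False a b)"
  shows "integral (einterval a b) w' = B - A"
proof -
  obtain c where c: "c \<in> einterval a b" using einterval_nonempty[OF ab] by blast
  have i: "w' absolutely_integrable_on (tail s a b c)" for s
    by (rule set_integrable_subset[OF int]) (use tail_subset[OF c] in auto)
  have "w c - A = integral (tail True a b c) w'"
    using ac_deriv_tail_limit[OF ab ac c i[of True]] tendsto_unique[OF end_filter_neq_bot[OF ab] A] 
    by (metis UnI2 insertI1 mult_1)
  moreover have "B - w c = integral (tail False a b c) w'"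
  proof -
    obtain L where L: "(w \<longlongrightarrow> L) (end_filter False a b)"
       "\<And>x. x \<in> tail False a b c \<union> {c} \<Longrightarrow> w x - L = (if False then 1 else - 1) * integral (tail False a b x) w'"
      using ac_deriv_tail_limit[OF ab ac c i[of False]] by metis
    have "L = B" using tendsto_unique[OF end_filter_neq_bot[OF ab] L(1) B] .
    then show ?thesis using L(2)[of c] by (simp add: algebra_simps)
  qed
  moreover have "integral (einterval a b) w' = integral (tail True a b c) w' + integral (tail False a b c) w'"
  proof -
    have "integral (einterval a b) w' = integral (tail True a b c \<union> tail False a b c) w'"
    proof (rule integral_spike_set)
      have "einterval a b - (tail True a b c \<union> tail False a b c) \<subseteq> {c}"
        by (auto simp: tail_def einterval_iff)
      then show "negligible {x \<in> einterval a b - (tail True a b c \<union> tail False a b c). w' x \<noteq> 0}"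
        by (auto intro: negligible_subset[of "{c}"])
      have "{x \<in> tail True a b c \<union> tail False a b c - einterval a b. w' x \<noteq> 0} = {}"
        using tail_subset[OF c] by blast
      then show "negligible {x \<in> tail True a b c \<union> tail False a b c - einterval a b. w' x \<noteq> 0}" by (simp only: negligible_empty)
    qed
    also have "\<dots> = integral (tail True a b c) w' + integral (tail False a b c) w'"
    proof (rule integral_Un)
      have "tail True a b c \<inter> tail False a b c = {}" by (auto simp: tail_def einterval_iff)
      then show "negligible (tail True a b c \<inter> tail False a b c)" by simp
    qed (use i abs_integrable_imp in auto)
    finally show ?thesis .
  qed
  ultimately show ?thesis by (simp add: algebra_simps)
qed

subsection \<open>Square integrability near an end\<close>

text \<open>For a continuous spinor only the behaviour at the end matters: another base point adds
  at most a compact segment.\<close>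

lemma square_integrable_tail_extend:
  assumes c: "c \<in> einterval a b" and d: "d \<in> einterval a b"
    and sq: "square_integrable (tail s a b c) f" and cont: "continuous_on (einterval a b) f"
  shows "square_integrable (tail s a b d) f"
proof -
  consider "d = c" | "d \<in> tail s a b c" | "c \<in> tail s a b d" by (rule tail_linear[OF c d])
  then show ?thesis
  proof cases
  assume "d = c" then show ?thesis using sq by simp
next
  assume "d \<in> tail s a b c"
  then show ?thesis using square_integrable_subset[OF sq tail_mono] by simp
next
  assume cd: "c \<in> tail s a b d"
  have "square_integrable (tail s a b c \<union> seg d c) f"
  proof (rule square_integrable_Un[OF sq])
    have "seg d c \<subseteq> einterval a b" by (rule seg_subset) (use c d in auto)
    then show "square_integrable (seg d c) f" unfolding seg_def
      by (intro square_integrable_Icc continuous_on_subset[OF cont])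
  qed auto
  then show ?thesis by (rule square_integrable_subset) (use tail_decomp(1)[OF d cd] in auto)
  qed
qed

lemma L2_nearD:
  assumes "L2_near s a b f" "continuous_on (einterval a b) f" "c \<in> einterval a b"
  shows "square_integrable (tail s a b c) f"
proof -
  obtain d where "d \<in> einterval a b" "square_integrable (tail s a b d) f"
    using assms(1) unfolding L2_near_def by blast
  then show ?thesis by (rule square_integrable_tail_extend[OF _ assms(3) _ assms(2)])
qed

lemma L2_near_tail_cong:
  assumes "L2_near s a b f" "t \<in> einterval a b" "\<And>x. x \<in> tail s a b t \<Longrightarrow> f x = g x"
  shows "L2_near s a b g"
proof -
  obtain c where c: "c \<in> einterval a b" "square_integrable (tail s a b c) f"
    using assms(1) unfolding L2_near_def by blast
  have "\<exists>d\<in>einterval a b. tail s a b d \<subseteq> tail s a b c \<and> tail s a b d \<subseteq> tail s a b t"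
  proof -
    consider "t = c" | "t \<in> tail s a b c" | "c \<in> tail s a b t" by (rule tail_linear[OF c(1) assms(2)])
    then show ?thesis
    proof cases
      case 1 then show ?thesis using c(1) by blast
    next
      case 2 show ?thesis using tail_mono[OF 2] assms(2) by blast
    next
      case 3 show ?thesis using tail_mono[OF 3] c(1) by blast
    qed
  qed
  then obtain d where d: "d \<in> einterval a b" "tail s a b d \<subseteq> tail s a b c" "tail s a b d \<subseteq> tail s a b t"
    by blast
  have "square_integrable (tail s a b d) g"
    by (rule square_integrable_cong[OF square_integrable_subset[OF c(2) d(2)]]) (use d(3) assms(3) in auto)
  then show ?thesis using d(1) unfolding L2_near_def by blast
qed

lemma L2_near_cmult: "L2_near s a b f \<Longrightarrow> L2_near s a b (\<lambda>x. k *s f x)"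
  unfolding L2_near_def using square_integrable_cmult[OF _ tail_in_lebesgue] by blast

text \<open>Energy identities only see compact segments; a bound uniform in the segment passes to
  the whole tail by Fatou's lemma.\<close>

lemma square_integrable_tailI:
  assumes ab: "a < b" and c: "c \<in> einterval a b" and cont: "continuous_on (einterval a b) f"
    and bd: "\<And>x. x \<in> tail s a b c \<Longrightarrow> integral (seg c x) (\<lambda>y. (norm (f y))\<^sup>2) \<le> B"
  shows "square_integrable (tail s a b c) f"
proof -
  let ?S = "tail s a b c" and ?h = "\<lambda>y. (norm (f y))\<^sup>2"
  have sub: "?S \<subseteq> einterval a b" by (rule tail_subset[OF c])
  obtain q where q: "\<And>n. q n \<in> einterval a b"
    "\<And>x. x \<in> einterval a b \<Longrightarrow> eventually (\<lambda>n. q n \<in> tail s a b x) sequentially"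
    using end_sequence[OF ab, of s] by blast
  have m: "f \<in> borel_measurable (lebesgue_on ?S)"
    by (intro continuous_imp_measurable_on_sets_lebesgue continuous_on_subset[OF cont sub]) simp
  have hm: "(\<lambda>x. ennreal (?h x)) \<in> borel_measurable (lebesgue_on ?S)" using m by measurable
  \<comment> \<open>Truncations to compact segments: their integrals are eventually at most
    \<open>B\<close>, and at each point they eventually agree with the integrand.\<close>
  define G where "G n x = ennreal (?h x) * indicator (seg c (q n)) x" for n x
  have Gm: "G n \<in> borel_measurable (lebesgue_on ?S)" for n
  proof -
    have [measurable]: "(indicator (seg c (q n)) :: real \<Rightarrow> ennreal) \<in> borel_measurable (lebesgue_on ?S)"
      by (intro measurable_restrict_space1 borel_measurable_indicator) simp
    note hm [measurable]
    have "G n = (\<lambda>x. ennreal (?h x) * indicator (seg c (q n)) x)" by (auto simp: G_def)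
    then show ?thesis by simp
  qed
  have seg_sub: "seg c (q n) \<subseteq> einterval a b" for n by (rule seg_subset) (use c q in auto)
  have G: "(\<integral>\<^sup>+x. G n x \<partial>lebesgue_on ?S) \<le> ennreal B" if n: "q n \<in> ?S" for n
  proof -
    have int: "?h integrable_on (seg c (q n))" unfolding seg_def
      by (intro integrable_continuous_real continuous_intros continuous_on_subset[OF cont])
        (use seg_sub in \<open>auto simp: seg_def\<close>)
    have "?h absolutely_integrable_on (seg c (q n))"
      by (rule nonnegative_absolutely_integrable_1[OF int]) auto
    then have "integrable (lebesgue_on (seg c (q n))) ?h"
      by (simp add: absolutely_integrable_imp_integrable)
    have "(\<integral>\<^sup>+x. G n x \<partial>lebesgue_on ?S) \<le> (\<integral>\<^sup>+x. ennreal (?h x) * indicator (seg c (q n)) x \<partial>lebesgue)"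
      unfolding G_def by (subst nn_integral_restrict_space) (auto intro!: nn_integral_mono simp: indicator_def)
    also have "\<dots> = (\<integral>\<^sup>+x. ennreal (?h x) \<partial>lebesgue_on (seg c (q n)))"
      by (subst nn_integral_restrict_space) auto
    also have "\<dots> = ennreal (integral (seg c (q n)) ?h)"
      using \<open>integrable (lebesgue_on (seg c (q n))) ?h\<close>
      by (subst nn_integral_eq_integral) (auto simp: lebesgue_integral_eq_integral)
    also have "\<dots> \<le> ennreal B" using bd[OF n] by (rule ennreal_leI)
    finally show ?thesis .
  qed
  have "(\<integral>\<^sup>+x. ennreal (?h x) \<partial>lebesgue_on ?S) \<le> (\<integral>\<^sup>+x. liminf (\<lambda>n. G n x) \<partial>lebesgue_on ?S)"
  proof (rule nn_integral_mono)
    fix x assume "x \<in> space (lebesgue_on ?S)"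
    then have x: "x \<in> ?S" by (simp add: space_restrict_space)
    have "eventually (\<lambda>n. q n \<in> tail s a b x) sequentially" using q(2) x sub by blast
    then have "eventually (\<lambda>n. ennreal (?h x) \<le> G n x) sequentially"
    proof eventually_elim
      case (elim n)
      have "x \<in> seg c x" by simp
      moreover have "seg c x \<subseteq> seg c (q n)" using elim x by (auto simp: tail_def seg_def einterval_iff split: if_splits)
      ultimately have "x \<in> seg c (q n)" by blast
      then show ?case by (simp add: G_def)
    qed
    then show "ennreal (?h x) \<le> liminf (\<lambda>n. G n x)" by (rule Liminf_bounded)
  qed
  also have "\<dots> \<le> liminf (\<lambda>n. \<integral>\<^sup>+x. G n x \<partial>lebesgue_on ?S)"
    by (rule nn_integral_liminf[OF Gm])
  also have "\<dots> \<le> ennreal B"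
  proof (rule Liminf_le)
    show "eventually (\<lambda>n. (\<integral>\<^sup>+x. G n x \<partial>lebesgue_on ?S) \<le> ennreal B) sequentially"
      using q(2)[OF c] by eventually_elim (rule G)
  qed simp
  finally have fin: "(\<integral>\<^sup>+x. ennreal (?h x) \<partial>lebesgue_on ?S) < \<infinity>"
    using ennreal_less_top le_less_trans by fastforce
  have "integrable (lebesgue_on ?S) ?h"
    by (rule integrableI_nonneg) (use m fin in auto)
  then have "?h integrable_on ?S" by (simp add: integrable_on_lebesgue_on)
  then show ?thesis using m by (simp add: square_integrable_iff)
qed

subsection \<open>Solutions\<close>

lemma mult_vec2 [simp]:
  "(A *v u) $ 1 = A $ 1 $ 1 * u $ 1 + A $ 1 $ 2 * u $ 2"
  "(A *v u) $ 2 = A $ 2 $ 1 * u $ 1 + A $ 2 $ 2 * u $ 2" for u :: "complex^2"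
  by (simp_all add: matrix_vector_mult_def sum_2)

lemma dirac_expr_subset:
  assumes "dirac_expr S Q f g" "T \<subseteq> S" "open S" "is_interval S" "open T" "is_interval T"
  shows "dirac_expr T Q f g"
  using assms(1) unfolding dirac_expr_iff[OF assms(3,4)] dirac_expr_iff[OF assms(5,6)]
  using ac_deriv_subset[OF _ assms(2)] by blast

lemma dirac_expr_cong:
  assumes f: "dirac_expr S Q f g" and S: "open S" "is_interval S"
    and eq: "\<And>x. x \<in> S \<Longrightarrow> f x = f2 x" "\<And>x. x \<in> S \<Longrightarrow> g x = g2 x"
  shows "dirac_expr S Q f2 g2"
  unfolding dirac_expr_iff[OF S]
proof
  note * = f[unfolded dirac_expr_iff[OF S]]
  show "ac_deriv S (\<lambda>x. f2 x $ 1) (\<lambda>x. g2 x $ 2 - (Q x *v f2 x) $ 2)"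
    by (rule ac_deriv_cong[OF conjunct1[OF *] S(2)]) (auto simp: eq)
  show "ac_deriv S (\<lambda>x. f2 x $ 2) (\<lambda>x. (Q x *v f2 x) $ 1 - g2 x $ 1)"
    by (rule ac_deriv_cong[OF conjunct2[OF *] S(2)]) (auto simp: eq)
qed

lemma dirac_expr_add:
  assumes f: "dirac_expr S Q f g" and h: "dirac_expr S Q h k" and S: "open S" "is_interval S"
  shows "dirac_expr S Q (\<lambda>x. f x + h x) (\<lambda>x. g x + k x)"
  unfolding dirac_expr_iff[OF S]
proof
  note * = f[unfolded dirac_expr_iff[OF S]] h[unfolded dirac_expr_iff[OF S]]
  show "ac_deriv S (\<lambda>x. (f x + h x) $ 1) (\<lambda>x. (g x + k x) $ 2 - (Q x *v (f x + h x)) $ 2)"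
    by (rule ac_deriv_cong[OF ac_deriv_add[OF conjunct1[OF *(1)] conjunct1[OF *(2)] S(2)] S(2)])
      (auto simp: algebra_simps)
  show "ac_deriv S (\<lambda>x. (f x + h x) $ 2) (\<lambda>x. (Q x *v (f x + h x)) $ 1 - (g x + k x) $ 1)"
    by (rule ac_deriv_cong[OF ac_deriv_add[OF conjunct2[OF *(1)] conjunct2[OF *(2)] S(2)] S(2)])
      (auto simp: algebra_simps)
qed

lemma dirac_expr_cmult:
  assumes f: "dirac_expr S Q f g" and S: "open S" "is_interval S"
  shows "dirac_expr S Q (\<lambda>x. c *s f x) (\<lambda>x. c *s g x)"
  unfolding dirac_expr_iff[OF S]
proof
  note * = f[unfolded dirac_expr_iff[OF S]]
  show "ac_deriv S (\<lambda>x. (c *s f x) $ 1) (\<lambda>x. (c *s g x) $ 2 - (Q x *v (c *s f x)) $ 2)"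
    by (rule ac_deriv_cong[OF ac_deriv_cmult[OF conjunct1[OF *] S(2), of c] S(2)]) (auto simp: algebra_simps)
  show "ac_deriv S (\<lambda>x. (c *s f x) $ 2) (\<lambda>x. (Q x *v (c *s f x)) $ 1 - (c *s g x) $ 1)"
    by (rule ac_deriv_cong[OF ac_deriv_cmult[OF conjunct2[OF *] S(2), of c] S(2)]) (auto simp: algebra_simps)
qed

lemma dirac_solution_add:
  assumes "dirac_solution S Q z u" "dirac_solution S Q z v" "open S" "is_interval S"
  shows "dirac_solution S Q z (\<lambda>x. u x + v x)"
  using dirac_expr_add[OF assms[unfolded dirac_solution_def]]
  by (simp add: dirac_solution_def vector_add_ldistrib)

lemma dirac_solution_cmult:
  assumes "dirac_solution S Q z u" "open S" "is_interval S"
  shows "dirac_solution S Q z (\<lambda>x. c *s u x)"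
  using dirac_expr_cmult[OF assms[unfolded dirac_solution_def], of c]
  by (simp add: dirac_solution_def vector_smult_assoc mult.commute)

lemma dirac_solution_cong:
  assumes "dirac_solution S Q z u" "open S" "is_interval S" "\<And>x. x \<in> S \<Longrightarrow> u x = v x"
  shows "dirac_solution S Q z v"
  using assms unfolding dirac_solution_def by (elim dirac_expr_cong) auto

lemma dirac_expr_continuous:
  assumes f: "dirac_expr S Q f g" and S: "open S" "is_interval S"
  shows "continuous_on S f"
proof -
  have "continuous_on S (\<lambda>x. f x $ 1)" "continuous_on S (\<lambda>x. f x $ 2)"
    using f unfolding dirac_expr_iff[OF S] using ac_deriv_continuous[OF _ S] by blast+
  then have "continuous_on S (\<lambda>x. f x $ i)" for i using exhaust_2[of i] by auto
  then have "continuous_on S (\<lambda>x. \<chi> i. f x $ i)" by (intro continuous_on_vec_lambda)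
  then show ?thesis by simp
qed

text \<open>Symmetry of \<open>Q\<close> cancels the potential and leaves only the right-hand sides.
  They are arbitrary, so that inhomogeneous equations and different spectral parameters are covered
  at once.\<close>

lemma wronskian_ac_deriv:
  assumes f: "dirac_expr S Q f h" and k: "dirac_expr S Q k l" and S: "open S" "is_interval S"
    and sym: "\<And>x. x \<in> S \<Longrightarrow> Q x $ 1 $ 2 = Q x $ 2 $ 1"
  shows "ac_deriv S (wronskian f k) (\<lambda>x. dotc (h x) (k x) - dotc (f x) (l x))"
proof -
  note * = f[unfolded dirac_expr_iff[OF S]] k[unfolded dirac_expr_iff[OF S]]
  show ?thesis
    by (rule ac_deriv_cong[OF ac_deriv_diff[OF ac_deriv_mult[OF conjunct1[OF *(1)] conjunct2[OF *(2)] S]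
            ac_deriv_mult[OF conjunct2[OF *(1)] conjunct1[OF *(2)] S] S(2)] S(2)])
      (use sym in \<open>auto simp: wronskian_def dotc_def algebra_simps\<close>)
qed

text \<open>\<open>U\<close> stands for \<Phi> and \<open>V\<close> for \<Theta>. Only what the
  original and the commuted system have in common is assumed, and the entire basis replaces the
  initial value problem.\<close>

locale dirac_system =
  fixes a b :: ereal and Q :: "real \<Rightarrow> complex^2^2" and U V :: "complex \<Rightarrow> real \<Rightarrow> complex^2"
  assumes ab: "a < b"
    and Q_sym: "\<And>x. x \<in> einterval a b \<Longrightarrow> Q x $ 1 $ 2 = Q x $ 2 $ 1"
    and Q_real: "\<And>x i j. x \<in> einterval a b \<Longrightarrow> Q x $ i $ j \<in> \<real>"
    and U: "real_entire_solution a b Q U" and V: "real_entire_solution a b Q V"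
    and WVU: "\<And>z x. x \<in> einterval a b \<Longrightarrow> wronskian (V z) (U z) x = 1"
begin

abbreviation "I \<equiv> einterval a b"
abbreviation "sol \<equiv> dirac_solution (einterval a b) Q"

lemma U_sol: "sol z (U z)" and V_sol: "sol z (V z)"
  using U V by (auto simp: real_entire_solution_def)

lemma sol_continuous: "sol z u \<Longrightarrow> continuous_on I u"
  unfolding dirac_solution_def by (rule dirac_expr_continuous) auto

lemma sol_add: "sol z u \<Longrightarrow> sol z v \<Longrightarrow> sol z (\<lambda>x. u x + v x)"
  by (rule dirac_solution_add) auto

lemma sol_cmult: "sol z u \<Longrightarrow> sol z (\<lambda>x. c *s u x)"
  by (rule dirac_solution_cmult) auto

lemma sol_combination: "sol z (\<lambda>x. A *s V z x + B *s U z x)"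
  by (intro sol_add sol_cmult U_sol V_sol)

lemma sol_wronskian_ac:
  assumes "sol z u" "sol w v"
  shows "ac_deriv I (wronskian u v) (\<lambda>x. (z - w) * dotc (u x) (v x))"
proof -
  have "ac_deriv I (wronskian u v) (\<lambda>x. dotc (z *s u x) (v x) - dotc (u x) (w *s v x))"
    using assms unfolding dirac_solution_def by (rule wronskian_ac_deriv) (auto intro: Q_sym)
  moreover have "dotc (z *s u x) (v x) - dotc (u x) (w *s v x) = (z - w) * dotc (u x) (v x)" for x
    by (simp add: dotc_def algebra_simps)
  ultimately show ?thesis by simp
qed

lemma wronskian_const_subset:
  assumes u: "dirac_solution S Q z u" and v: "dirac_solution S Q z v"
    and S: "open S" "is_interval S" "S \<subseteq> I" and xy: "x \<in> S" "y \<in> S"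
  shows "wronskian u v x = wronskian u v y"
proof -
  have "ac_deriv S (wronskian u v) (\<lambda>x. dotc (z *s u x) (v x) - dotc (u x) (z *s v x))"
    using u v unfolding dirac_solution_def by (rule wronskian_ac_deriv) (use S Q_sym in auto)
  then have "norm (wronskian u v y - wronskian u v x) \<le>
      integral (seg x y) (\<lambda>t. norm (dotc (z *s u t) (v t) - dotc (u t) (z *s v t)))"
    by (rule ac_deriv_norm_le[OF _ S(2) xy])
  also have "\<dots> = 0" by (simp add: dotc_def algebra_simps)
  finally show ?thesis by simp
qed

lemma sol_wronskian_const:
  "sol z u \<Longrightarrow> sol z v \<Longrightarrow> x \<in> I \<Longrightarrow> y \<in> I \<Longrightarrow> wronskian u v x = wronskian u v y"
  by (rule wronskian_const_subset) auto

text \<open>Cramer's rule for the basis \<open>V z x\<close>, \<open>U z x\<close> of determinant 1,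
  at a single point and for an arbitrary \<open>f\<close>.\<close>

lemma expand:
  assumes "x \<in> I"
  shows "f x = wronskian f (U z) x *s V z x + wronskian (V z) f x *s U z x"
  using plucker3[of "V z" "U z" x f] WVU[OF assms, of z]
  by (auto simp: wronskian_swap[of f "V z"] wronskian_swap[of f "U z"] vec_eq_iff wronskian_def algebra_simps)

lemma expand_component:
  "x \<in> I \<Longrightarrow> wronskian f (U z) x * V z x $ i + wronskian (V z) f x * U z x $ i = f x $ i"
  using arg_cong[OF expand[of x f z], of "\<lambda>v. v $ i"] by simp

lemma sol_expand:
  assumes u: "dirac_solution S Q z u" and S: "open S" "is_interval S" "S \<subseteq> I"
  obtains A B where "\<And>x. x \<in> S \<Longrightarrow> u x = A *s V z x + B *s U z x"
proof (cases "S = {}")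
  case True then show ?thesis using that by blast
next
  case False
  then obtain x0 where x0: "x0 \<in> S" by blast
  have sU: "dirac_solution S Q z (U z)" and sV: "dirac_solution S Q z (V z)"
    using U_sol[of z] V_sol[of z] unfolding dirac_solution_def
    by (auto intro: dirac_expr_subset[OF _ S(3) _ _ S(1,2)])
  show ?thesis
  proof (rule that)
    fix x assume x: "x \<in> S"
    show "u x = wronskian u (U z) x0 *s V z x + wronskian (V z) u x0 *s U z x"
      unfolding wronskian_const_subset[OF u sU S x0 x] wronskian_const_subset[OF sV u S x0 x]
      by (rule expand) (use x S in blast)
  qed
qed

lemma sol_expand_I:
  assumes u: "sol z u"
  obtains A B where "\<And>x. x \<in> I \<Longrightarrow> u x = A *s V z x + B *s U z x"
  using sol_expand[OF u] by auto

lemma proportional: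
  assumes u: "sol z u" and v: "sol z v" and W: "\<exists>x\<in>I. wronskian u v x = 0"
    and nt: "nontrivial_on I v"
  shows "\<exists>k. \<forall>x\<in>I. u x = k *s v x"
proof -
  obtain A B where uA: "\<And>x. x \<in> I \<Longrightarrow> u x = A *s V z x + B *s U z x" using sol_expand_I[OF u] by blast
  obtain C D where vC: "\<And>x. x \<in> I \<Longrightarrow> v x = C *s V z x + D *s U z x" using sol_expand_I[OF v] by blast
  obtain x where x: "x \<in> I" "wronskian u v x = 0" using W by blast
  have "wronskian u v x = (A * D - B * C) * wronskian (V z) (U z) x"
    using uA[OF x(1)] vC[OF x(1)] by (simp add: wronskian_def algebra_simps)
  then have AD: "A * D = B * C" using x WVU by simp
  have "C \<noteq> 0 \<or> D \<noteq> 0" using nt vC unfolding nontrivial_on_def by auto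
  then show ?thesis
  proof
    assume "C \<noteq> 0"
    then have "A = (A / C) * C" "B = (A / C) * D" using AD by (auto simp: field_simps)
    then have "u y = (A / C) *s v y" if "y \<in> I" for y
      using uA[OF that] vC[OF that] by (simp add: vector_add_ldistrib vector_smult_assoc)
    then show ?thesis by blast
  next
    assume "D \<noteq> 0"
    then have "B = (B / D) * D" "A = (B / D) * C" using AD by (auto simp: field_simps)
    then have "u y = (B / D) *s v y" if "y \<in> I" for y
      using uA[OF that] vC[OF that] by (simp add: vector_add_ldistrib vector_smult_assoc)
    then show ?thesis by blast
  qed
qed

subsection \<open>Dependence on the spectral parameter\<close>

abbreviation weight :: "complex \<Rightarrow> real \<Rightarrow> real" where
  "weight z x \<equiv> (norm (U z x) + norm (V z x))\<^sup>2"

text \<open>The moduli of the two coefficients of \<open>v\<close> in the basis at \<open>z\<close>;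
  they vary with \<open>x\<close> when \<open>v\<close> solves the equation at another
  parameter.\<close>

definition coefs :: "complex \<Rightarrow> (real \<Rightarrow> complex^2) \<Rightarrow> real \<Rightarrow> real" where
  "coefs z v x = norm (wronskian v (U z) x) + norm (wronskian (V z) v x)"

lemma norm_le_coefs:
  assumes "x \<in> I" shows "norm (v x) \<le> coefs z v x * (norm (U z x) + norm (V z x))"
proof -
  have "norm (v x) \<le> norm (wronskian v (U z) x) * norm (V z x) + norm (wronskian (V z) v x) * norm (U z x)"
    by (subst expand[OF assms, of v z]) (metis norm_smult_vec norm_triangle_ineq)
  also have "\<dots> \<le> coefs z v x * (norm (U z x) + norm (V z x))"
    by (simp add: coefs_def algebra_simps)
  finally show ?thesis .
qed

lemma weight_continuous: "continuous_on I (weight z)"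
  by (intro continuous_intros sol_continuous[OF U_sol] sol_continuous[OF V_sol])

lemma seg_in_I: "x \<in> I \<Longrightarrow> y \<in> I \<Longrightarrow> seg x y \<subseteq> I"
  by (rule seg_subset) auto

lemma continuous_seg_integrable:
  fixes f :: "real \<Rightarrow> real"
  assumes "continuous_on I f" "x \<in> I" "y \<in> I"
  shows "f integrable_on seg x y"
  unfolding seg_def
  by (intro integrable_continuous_real continuous_on_subset[OF assms(1)])
    (use seg_in_I[OF assms(2,3)] in \<open>auto simp: seg_def\<close>)

text \<open>Variation of constants: the coefficients of a solution at \<open>z\<close> with respect to the basis at
  \<open>z0\<close> are nearly constant as long as \<open>|z - z0|\<close> times the integral of the weight is small.\<close>

lemma coefs_nearly_const:
  assumes v: "sol z v" and x0: "x0 \<in> I" and y: "y \<in> I"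
    and small: "norm (z - z0) * integral (seg x0 y) (weight z0) \<le> 1 / 2"
  shows "coefs z0 v y \<le> 2 * coefs z0 v x0"
    and "norm (wronskian v (U z0) y - wronskian v (U z0) x0) + norm (wronskian (V z0) v y - wronskian (V z0) v x0)
       \<le> 2 * coefs z0 v x0 * (norm (z - z0) * integral (seg x0 y) (weight z0))"
proof -
  let ?k = "norm (z - z0)" and ?S = "weight z0" and ?N = "coefs z0 v"
  let ?d = "\<lambda>y. norm (wronskian v (U z0) y - wronskian v (U z0) x0) + norm (wronskian (V z0) v y - wronskian (V z0) v x0)"
  have acA: "ac_deriv I (wronskian v (U z0)) (\<lambda>x. (z - z0) * dotc (v x) (U z0 x))"
    by (rule sol_wronskian_ac[OF v U_sol])
  have acB: "ac_deriv I (wronskian (V z0) v) (\<lambda>x. (z0 - z) * dotc (V z0 x) (v x))"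
    by (rule sol_wronskian_ac[OF V_sol v])
  have cv: "continuous_on I v" by (rule sol_continuous[OF v])
  note cU = sol_continuous[OF U_sol] and cV = sol_continuous[OF V_sol]
  have cN: "continuous_on I ?N" unfolding coefs_def
    by (intro continuous_intros ac_deriv_continuous[OF acA] ac_deriv_continuous[OF acB]) auto
  have sub: "seg x0 y \<subseteq> I" by (rule seg_in_I[OF x0 y])
  \<comment> \<open>Instead of a Gronwall estimate: at the maximum \<open>t\<close> of the
    coefficients the small factor 1/2 absorbs their deviation, so the maximum is at most twice the
    initial value.\<close>
  have "\<exists>t\<in>seg x0 y. \<forall>x\<in>seg x0 y. ?N x \<le> ?N t"
    by (rule continuous_attains_sup[OF _ _ continuous_on_subset[OF cN sub]]) (auto simp: seg_def)
  then obtain t where t: "t \<in> seg x0 y" "\<And>x. x \<in> seg x0 y \<Longrightarrow> ?N x \<le> ?N t" by blast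
  have N0: "0 \<le> ?N x" for x by (simp add: coefs_def)
  have step: "?d y' \<le> ?N t * (?k * integral (seg x0 y') ?S)" if y': "y' \<in> seg x0 y" for y'
  proof -
    have sub': "seg x0 y' \<subseteq> seg x0 y" using y' by (auto simp: seg_def)
    have y'I: "y' \<in> I" using y' sub by blast
    have iA: "(\<lambda>x. norm ((z - z0) * dotc (v x) (U z0 x))) integrable_on seg x0 y'"
      unfolding dotc_def by (rule continuous_seg_integrable[OF _ x0 y'I]) (intro continuous_intros cv cU)
    have iB: "(\<lambda>x. norm ((z0 - z) * dotc (V z0 x) (v x))) integrable_on seg x0 y'"
      unfolding dotc_def by (rule continuous_seg_integrable[OF _ x0 y'I]) (intro continuous_intros cv cV)
    have iS: "?S integrable_on seg x0 y'" by (rule continuous_seg_integrable[OF weight_continuous x0 y'I])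
    have "?d y' \<le> integral (seg x0 y') (\<lambda>x. norm ((z - z0) * dotc (v x) (U z0 x)))
        + integral (seg x0 y') (\<lambda>x. norm ((z0 - z) * dotc (V z0 x) (v x)))"
      by (intro add_mono ac_deriv_norm_le[OF acA _ x0 y'I] ac_deriv_norm_le[OF acB _ x0 y'I]) auto
    also have "\<dots> = integral (seg x0 y') (\<lambda>x. norm ((z - z0) * dotc (v x) (U z0 x)) + norm ((z0 - z) * dotc (V z0 x) (v x)))"
      by (rule integral_add[symmetric, OF iA iB])
    also have "\<dots> \<le> integral (seg x0 y') (\<lambda>x. ?N t * ?k * ?S x)"
    proof (rule Henstock_Kurzweil_Integration.integral_le)
      fix x assume x: "x \<in> seg x0 y'"
      then have xI: "x \<in> I" using sub sub' by blast
      have "norm ((z - z0) * dotc (v x) (U z0 x)) + norm ((z0 - z) * dotc (V z0 x) (v x))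
          \<le> ?k * (norm (v x) * norm (U z0 x)) + ?k * (norm (V z0 x) * norm (v x))"
        unfolding norm_mult norm_minus_commute[of z0 z] by (intro add_mono mult_left_mono norm_dotc_le) auto
      also have "\<dots> = ?k * (norm (v x) * (norm (U z0 x) + norm (V z0 x)))" by (simp add: algebra_simps)
      also have "\<dots> \<le> ?k * ((?N t * (norm (U z0 x) + norm (V z0 x))) * (norm (U z0 x) + norm (V z0 x)))"
      proof (intro mult_left_mono mult_right_mono)
        have "norm (v x) \<le> ?N x * (norm (U z0 x) + norm (V z0 x))" by (rule norm_le_coefs[OF xI])
        also have "\<dots> \<le> ?N t * (norm (U z0 x) + norm (V z0 x))"
          using t(2)[of x] x sub' by (intro mult_right_mono) auto
        finally show "norm (v x) \<le> ?N t * (norm (U z0 x) + norm (V z0 x))" .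
      qed auto
      finally show "norm ((z - z0) * dotc (v x) (U z0 x)) + norm ((z0 - z) * dotc (V z0 x) (v x)) \<le> ?N t * ?k * ?S x"
        by (simp add: power2_eq_square algebra_simps)
    qed (intro integrable_add iA iB integrable_on_mult_right iS)+
    also have "\<dots> = ?N t * (?k * integral (seg x0 y') ?S)" by simp
    finally show ?thesis .
  qed
  have mono: "integral (seg x0 y') ?S \<le> integral (seg x0 y) ?S" if "y' \<in> seg x0 y" for y'
  proof (rule integral_subset_le)
    show "seg x0 y' \<subseteq> seg x0 y" using that by (auto simp: seg_def)
    show "?S integrable_on seg x0 y'" by (rule continuous_seg_integrable[OF weight_continuous x0]) (use that sub in blast)
    show "?S integrable_on seg x0 y" by (rule continuous_seg_integrable[OF weight_continuous x0 y])
  qed auto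
  have tri: "?N y' \<le> ?N x0 + ?d y'" for y'
    using norm_triangle_ineq2[of "wronskian v (U z0) y'" "wronskian v (U z0) x0"]
      norm_triangle_ineq2[of "wronskian (V z0) v y'" "wronskian (V z0) v x0"] unfolding coefs_def by linarith
  have "?d t \<le> ?N t * (?k * integral (seg x0 y) ?S)"
    using step[OF t(1)] mult_left_mono[OF mult_left_mono[OF mono[OF t(1)], of ?k] N0[of t]] by simp
  also have "\<dots> \<le> ?N t * (1/2)" by (rule mult_left_mono[OF small N0])
  finally have Nt: "?N t \<le> 2 * ?N x0" using tri[of t] by simp
  show "?N y \<le> 2 * ?N x0" using t(2)[of y] Nt by simp
  have "0 \<le> integral (seg x0 y) ?S"
    by (rule Henstock_Kurzweil_Integration.integral_nonneg) (auto intro!: continuous_seg_integrable weight_continuous x0 y)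
  then have "?N t * (?k * integral (seg x0 y) ?S) \<le> 2 * ?N x0 * (?k * integral (seg x0 y) ?S)"
    using Nt by (intro mult_right_mono) auto
  then show "?d y \<le> 2 * ?N x0 * (?k * integral (seg x0 y) ?S)" using step[of y] by simp
qed

lemma sol_L2_nearD: "L2_near s a b u \<Longrightarrow> sol z u \<Longrightarrow> c \<in> I \<Longrightarrow> square_integrable (tail s a b c) u"
  by (rule L2_nearD[OF _ sol_continuous])

text \<open>The bound \<open>h\<close> depends on \<open>z\<close> only: continuity in
  \<open>z\<close> at the single point \<open>x0\<close> propagates to all \<open>x\<close> reached
  within a weight integral of at most \<open>C\<close>.\<close>

lemma coef_small:
  assumes F: "\<And>z. z \<noteq> z0 \<Longrightarrow> sol z (F z)" and cont: "isCont (\<lambda>z. F z x0) z0" and x0: "x0 \<in> I" and C: "C \<ge> 0"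
  obtains h where "(h \<longlongrightarrow> 0) (at z0)"
    "\<And>z x. z \<noteq> z0 \<Longrightarrow> x \<in> I \<Longrightarrow> integral (seg x0 x) (weight z0) \<le> C \<Longrightarrow> norm (z - z0) * C \<le> 1/2 \<Longrightarrow>
      norm (wronskian (F z) (U z0) x - wronskian (F z0) (U z0) x0) \<le> h z \<and>
      norm (wronskian (V z0) (F z) x - wronskian (V z0) (F z0) x0) \<le> h z"
proof -
  define p where "p z = wronskian (F z) (U z0) x0" for z
  define q where "q z = wronskian (V z0) (F z) x0" for z
  have c: "((\<lambda>z. F z x0 $ i) \<longlongrightarrow> F z0 x0 $ i) (at z0)" for i
    using cont unfolding isCont_def by (rule tendsto_vec_nth)
  have p: "(p \<longlongrightarrow> p z0) (at z0)" and q: "(q \<longlongrightarrow> q z0) (at z0)"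
    unfolding p_def q_def wronskian_def by (intro tendsto_intros c)+
  define h where "h z = (norm (p z - p z0) + norm (q z - q z0)) + 2 * (norm (p z) + norm (q z)) * (norm (z - z0) * C)" for z
  show ?thesis
  proof (rule that)
    have "((\<lambda>z. (norm (p z - p z0) + norm (q z - q z0)) + 2 * (norm (p z) + norm (q z)) * (norm (z - z0) * C)) \<longlongrightarrow>
        (norm (p z0 - p z0) + norm (q z0 - q z0)) + 2 * (norm (p z0) + norm (q z0)) * (norm (z0 - z0) * C)) (at z0)"
      by (intro tendsto_intros p q)
    then show "(h \<longlongrightarrow> 0) (at z0)" by (simp add: h_def[abs_def])
    fix z x assume z: "z \<noteq> z0" "x \<in> I" "integral (seg x0 x) (weight z0) \<le> C" "norm (z - z0) * C \<le> 1/2"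
    have le: "norm (z - z0) * integral (seg x0 x) (weight z0) \<le> norm (z - z0) * C"
      by (rule mult_left_mono[OF z(3) norm_ge_zero])
    then have "norm (z - z0) * integral (seg x0 x) (weight z0) \<le> 1/2" using z by linarith
    from coefs_nearly_const(2)[OF F[OF z(1)] x0 z(2) this]
    have "norm (wronskian (F z) (U z0) x - p z) + norm (wronskian (V z0) (F z) x - q z)
       \<le> 2 * (norm (p z) + norm (q z)) * (norm (z - z0) * integral (seg x0 x) (weight z0))"
      unfolding p_def q_def coefs_def .
    also have "\<dots> \<le> 2 * (norm (p z) + norm (q z)) * (norm (z - z0) * C)" by (rule mult_left_mono[OF le]) auto
    finally have "norm (wronskian (F z) (U z0) x - p z) + norm (wronskian (V z0) (F z) x - q z)
       \<le> 2 * (norm (p z) + norm (q z)) * (norm (z - z0) * C)" .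
    then show "norm (wronskian (F z) (U z0) x - wronskian (F z0) (U z0) x0) \<le> h z \<and>
      norm (wronskian (V z0) (F z) x - wronskian (V z0) (F z0) x0) \<le> h z"
      using norm_triangle_ineq[of "wronskian (F z) (U z0) x - p z" "p z - p z0"]
        norm_triangle_ineq[of "wronskian (V z0) (F z) x - q z" "q z - q z0"]
      unfolding h_def p_def[of z0, symmetric] q_def[of z0, symmetric]
      by (smt (verit) diff_add_cancel add_diff_eq norm_ge_zero)
  qed
qed

text \<open>Continuity in \<open>z\<close> for fixed \<open>x\<close> becomes joint continuity,
  because the coefficients in the basis at \<open>z0\<close> converge uniformly for \<open>x\<close>
  near \<open>x0\<close>. Integrals over \<open>x\<close> can then be differentiated in
  \<open>z\<close>.\<close>

lemma jointly_continuous: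
  assumes F: "\<And>z. sol z (F z)" and cont: "\<And>z x. x \<in> I \<Longrightarrow> isCont (\<lambda>z. F z x) z"
  shows "continuous_on (UNIV \<times> I) (\<lambda>(z, x). F z x)"
  unfolding continuous_on_def
proof
  fix p :: "complex \<times> real" assume "p \<in> UNIV \<times> I"
  then obtain z0 x0 where p: "p = (z0, x0)" and x0: "x0 \<in> I" by blast
  have "open I" by simp
  then obtain d where d: "d > 0" "cball x0 d \<subseteq> I" using x0 open_contains_cball by blast
  have e: "x0 - d \<in> I" "x0 + d \<in> I" using d by (auto simp: cball_eq_atLeastAtMost subset_eq)
  let ?C = "integral (seg (x0 - d) (x0 + d)) (weight z0)"
  have C: "0 \<le> ?C"
    by (rule Henstock_Kurzweil_Integration.integral_nonneg) (auto intro!: continuous_seg_integrable weight_continuous e)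
  have CC: "integral (seg x0 x) (weight z0) \<le> ?C" if "x \<in> ball x0 d" for x
  proof (rule integral_subset_le)
    show "seg x0 x \<subseteq> seg (x0 - d) (x0 + d)" using that d(1) by (auto simp: seg_def dist_norm)
    have "x \<in> I" using that d(2) ball_subset_cball by blast
    then show "weight z0 integrable_on seg x0 x" "weight z0 integrable_on seg (x0 - d) (x0 + d)"
      by (auto intro!: continuous_seg_integrable weight_continuous e x0)
  qed auto
  obtain h where h: "(h \<longlongrightarrow> 0) (at z0)"
    "\<And>z y. z \<noteq> z0 \<Longrightarrow> y \<in> I \<Longrightarrow> integral (seg x0 y) (weight z0) \<le> ?C \<Longrightarrow> norm (z - z0) * ?C \<le> 1/2 \<Longrightarrow>
    norm (wronskian (F z) (U z0) y - wronskian (F z0) (U z0) x0) \<le> h z \<and>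
    norm (wronskian (V z0) (F z) y - wronskian (V z0) (F z0) x0) \<le> h z"
    by (rule coef_small[OF F cont[OF x0] x0 C]) blast+
  \<comment> \<open>\<open>coef_small\<close> leaves out \<open>z0\<close>, but joint continuity
    also involves the points \<open>(z0, x)\<close>; there the Wronskians are constant in
    \<open>x\<close> and the bound 0 is correct.\<close>
  define h' where "h' z = (if z = z0 then 0 else h z)" for z
  have "((\<lambda>z. h' z) \<longlongrightarrow> 0) (at z0)"
    using h(1) by (rule Lim_transform_eventually) (auto simp: h'_def eventually_at_filter)
  moreover have "h' z0 = 0" by (simp add: h'_def)
  ultimately have "isCont h' z0" by (simp add: isCont_def)
  then have hc: "((\<lambda>q. h' (fst q)) \<longlongrightarrow> 0) (at p within UNIV \<times> I)"
    by (intro isCont_tendsto_compose[of z0 h', THEN tendsto_eq_rhs] tendsto_fst[of "\<lambda>q. q" p, simplified p fst_conv, THEN tendsto_eq_rhs])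
      (auto simp: p h'_def tendsto_ident_at)
  have fst0: "(fst \<longlongrightarrow> z0) (at p within UNIV \<times> I)" and snd0: "(snd \<longlongrightarrow> x0) (at p within UNIV \<times> I)"
    using tendsto_fst[OF tendsto_ident_at, of p "UNIV \<times> I"] tendsto_snd[OF tendsto_ident_at, of p "UNIV \<times> I"]
    by (simp_all add: p)
  have "((\<lambda>q. norm (fst q - z0) * ?C) \<longlongrightarrow> norm (z0 - z0) * ?C) (at p within UNIV \<times> I)"
    by (intro tendsto_intros fst0)
  then have "eventually (\<lambda>q. norm (fst q - z0) * ?C < 1/2) (at p within UNIV \<times> I)"
    by (rule order_tendstoD) simp
  moreover have "eventually (\<lambda>q. snd q \<in> ball x0 d) (at p within UNIV \<times> I)"
    by (rule topological_tendstoD[OF snd0]) (use d in auto)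
  ultimately have ev: "eventually (\<lambda>q. norm (fst q - z0) * ?C \<le> 1/2 \<and> snd q \<in> ball x0 d \<and> snd q \<in> I) (at p within UNIV \<times> I)"
    by eventually_elim (use d(2) ball_subset_cball in auto)
  have bound: "norm (wronskian (F z) (U z0) x - wronskian (F z0) (U z0) x0) \<le> h' z \<and>
    norm (wronskian (V z0) (F z) x - wronskian (V z0) (F z0) x0) \<le> h' z"
    if "norm (z - z0) * ?C \<le> 1/2" "x \<in> ball x0 d" "x \<in> I" for z x
  proof (cases "z = z0")
    case True
    then show ?thesis
      using sol_wronskian_const[OF F U_sol that(3) x0, of z0] sol_wronskian_const[OF V_sol F that(3) x0, of z0]
      by (simp add: h'_def)
  next
    case False then show ?thesis using h(2)[OF False that(3) CC[OF that(2)] that(1)] by (simp add: h'_def)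
  qed
  have m1: "((\<lambda>q. wronskian (F (fst q)) (U z0) (snd q)) \<longlongrightarrow> wronskian (F z0) (U z0) x0) (at p within UNIV \<times> I)"
    by (rule LIM_zero_cancel, rule Lim_null_comparison[OF _ hc])
      (use ev in \<open>eventually_elim, use bound in blast\<close>)
  have m2: "((\<lambda>q. wronskian (V z0) (F (fst q)) (snd q)) \<longlongrightarrow> wronskian (V z0) (F z0) x0) (at p within UNIV \<times> I)"
    by (rule LIM_zero_cancel, rule Lim_null_comparison[OF _ hc])
      (use ev in \<open>eventually_elim, use bound in blast\<close>)
  have "isCont (U z0) x0" "isCont (V z0) x0"
    using sol_continuous[OF U_sol] sol_continuous[OF V_sol] x0 by (auto simp: continuous_on_eq_continuous_at)
  then have cu: "((\<lambda>q. U z0 (snd q)) \<longlongrightarrow> U z0 x0) (at p within UNIV \<times> I)"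
    and cv: "((\<lambda>q. V z0 (snd q)) \<longlongrightarrow> V z0 x0) (at p within UNIV \<times> I)"
    using isCont_tendsto_compose[OF _ snd0] by blast+
  have comp: "((\<lambda>q. F (fst q) (snd q) $ i) \<longlongrightarrow> F z0 x0 $ i) (at p within UNIV \<times> I)" for i
  proof -
    have "((\<lambda>q. wronskian (F (fst q)) (U z0) (snd q) * V z0 (snd q) $ i + wronskian (V z0) (F (fst q)) (snd q) * U z0 (snd q) $ i)
       \<longlongrightarrow> wronskian (F z0) (U z0) x0 * V z0 x0 $ i + wronskian (V z0) (F z0) x0 * U z0 x0 $ i) (at p within UNIV \<times> I)"
      by (intro tendsto_intros m1 m2 tendsto_vec_nth cu cv)
    also have "wronskian (F z0) (U z0) x0 * V z0 x0 $ i + wronskian (V z0) (F z0) x0 * U z0 x0 $ i = F z0 x0 $ i"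
      by (rule expand_component[OF x0])
    finally show ?thesis
      by (rule Lim_transform_eventually)
        (use ev in \<open>eventually_elim, simp add: expand_component\<close>)
  qed
  have "((\<lambda>q. F (fst q) (snd q)) \<longlongrightarrow> F z0 x0) (at p within UNIV \<times> I)"
    by (rule vec_tendstoI) (rule comp)
  then show "((\<lambda>(z, x). F z x) \<longlongrightarrow> (case p of (z, x) \<Rightarrow> F z x)) (at p within UNIV \<times> I)"
    by (simp add: p case_prod_unfold)
qed

end

section \<open>Conjugation, zero extension and changes away from an end\<close>

definition cnjv :: "complex^2 \<Rightarrow> complex^2" where
  "cnjv u = (\<chi> i. cnj (u $ i))"

lemma cnjv_component [simp]: "cnjv u $ i = cnj (u $ i)"
  by (simp add: cnjv_def)

lemma norm_cnjv [simp]: "norm (cnjv u) = norm u"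
  by (simp add: cnjv_def norm_vec_def)

lemma dotc_cnjv: "dotc u (cnjv u) = of_real ((norm u)\<^sup>2)"
  by (simp add: dotc_def norm_vec2 complex_mult_cnj cmod_power2)

lemma continuous_on_cnjv: "continuous_on S f \<Longrightarrow> continuous_on S (\<lambda>x. cnjv (f x))"
  unfolding cnjv_def by (intro continuous_intros)

lemma square_integrable_zero_extend:
  assumes f: "square_integrable T f" and TS: "T \<subseteq> S" "T \<in> sets lebesgue" "S \<in> sets lebesgue"
  shows "square_integrable S (\<lambda>x. if x \<in> T then f x else 0)"
proof -
  have "square_integrable (T \<union> (S - T)) (\<lambda>x. if x \<in> T then f x else 0)"
  proof (rule square_integrable_Un)
    show "square_integrable T (\<lambda>x. if x \<in> T then f x else 0)" by (rule square_integrable_cong[OF f]) auto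
    have "square_integrable (S - T) (\<lambda>x. 0 :: complex^2)" using integrable_0 by (simp add: square_integrable_iff)
    then show "square_integrable (S - T) (\<lambda>x. if x \<in> T then f x else 0)" by (rule square_integrable_cong) auto
  qed (use TS in auto)
  then show ?thesis using TS by (simp add: Un_absorb1)
qed

lemma in_dom_near_tail_cong:
  assumes ab: "a < b" and f: "in_dom_near s a b v f" and t: "t \<in> einterval a b"
    and eq: "\<And>x. x \<in> tail s a b t \<Longrightarrow> f x = g x"
  shows "in_dom_near s a b v g"
proof -
  have "L2_near s a b g" using f unfolding in_dom_near_def by (auto intro: L2_near_tail_cong[OF _ t] eq)
  moreover have "(wronskian v g \<longlongrightarrow> 0) (end_filter s a b)"
  proof (rule Lim_transform_eventually)
    show "(wronskian v f \<longlongrightarrow> 0) (end_filter s a b)" using f by (simp add: in_dom_near_def)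
    show "eventually (\<lambda>x. wronskian v f x = wronskian v g x) (end_filter s a b)"
      using eventually_in_tail[OF ab t] by eventually_elim (simp add: wronskian_def eq)
  qed
  ultimately show ?thesis by (simp add: in_dom_near_def)
qed

lemma seg_integral_combine:
  fixes h :: "real \<Rightarrow> real"
  assumes h: "continuous_on (einterval a b) h" and p: "p \<in> einterval a b" and q: "q \<in> tail s a b p" and r: "r \<in> tail s a b q"
  shows "integral (seg p r) h = integral (seg p q) h + integral (seg q r) h"
proof -
  have qI: "q \<in> einterval a b" using tail_subset[OF p] q by blast
  have rI: "r \<in> einterval a b" using tail_subset[OF qI] r by blast
  have int: "h integrable_on {x..y}" if "x \<in> einterval a b" "y \<in> einterval a b" for x y
    by (intro integrable_continuous_real continuous_on_subset[OF h] interval_Icc_subset that) auto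
  show ?thesis
  proof (cases s)
    case True
    then have o: "q < p" "r < q" using q r by (auto simp: tail_def einterval_iff)
    then show ?thesis using Henstock_Kurzweil_Integration.integral_combine[OF _ _ int[OF rI p], of q] by (simp add: seg_def)
  next
    case False
    then have o: "p < q" "q < r" using q r by (auto simp: tail_def einterval_iff)
    then show ?thesis using Henstock_Kurzweil_Integration.integral_combine[OF _ _ int[OF p rI], of q] by (simp add: seg_def)
  qed
qed

section \<open>Limit point and limit circle ends; solutions from the resolvent\<close>

context dirac_system
begin

text \<open>The derivative \<open>(z - w) u . v\<close> of the Wronskian is integrable near the end
  by Cauchy-Schwarz.\<close>

lemma sol_wronskian_limit:
  assumes u: "sol z u" "L2_near s a b u" and v: "sol w v" "L2_near s a b v"
  obtains L where "(wronskian u v \<longlongrightarrow> L) (end_filter s a b)"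
proof -
  obtain c where c: "c \<in> I" using einterval_nonempty[OF ab] by blast
  note sq = sol_L2_nearD[OF u(2,1) c] sol_L2_nearD[OF v(2,1) c]
  have "(\<lambda>x. (z - w) * dotc (u x) (v x)) absolutely_integrable_on tail s a b c"
    using square_integrable_prod(2)[OF sq] by (intro set_integrable_mult_right) auto
  then show ?thesis
    by (rule ac_deriv_tail_limit[OF ab sol_wronskian_ac[OF u(1) v(1)] c]) (use that in blast)
qed

text \<open>If the limit \<open>L\<close> of \<open>W(u,v)\<close> were nonzero, the Pluecker identity
  \<open>p W(u,v) + u W(v,p) + v W(p,u) = 0\<close> would bound \<open>|p|\<^sup>2\<close> by \<open>|u|\<^sup>2 + |v|\<^sup>2\<close> times the
  energy of \<open>p\<close> accumulated so far, and this forces \<open>p\<close> to have finite energy.\<close>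

lemma limit_point_wronskian:
  assumes p: "sol \<zeta> p" "\<not> L2_near s a b p" and u: "sol z u" "L2_near s a b u" and v: "sol w v" "L2_near s a b v"
  shows "(wronskian u v \<longlongrightarrow> 0) (end_filter s a b)"
proof (rule ccontr)
  assume contr: "\<not> (wronskian u v \<longlongrightarrow> 0) (end_filter s a b)"
  obtain L where L: "(wronskian u v \<longlongrightarrow> L) (end_filter s a b)" by (rule sol_wronskian_limit[OF u v])
  then have L0: "L \<noteq> 0" using contr by auto
  define m where "m = norm L / 2"
  have m: "m > 0" using L0 by (simp add: m_def)
  have "eventually (\<lambda>x. norm (wronskian u v x) > m) (end_filter s a b)"
    by (rule order_tendstoD(1)[OF tendsto_norm[OF L]]) (use L0 in \<open>simp add: m_def\<close>)
  then obtain t0 where t0: "t0 \<in> I" "\<And>x. x \<in> tail s a b t0 \<Longrightarrow> norm (wronskian u v x) > m"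
    unfolding eventually_end_filter[OF ab] by blast
  note cp = sol_continuous[OF p(1)] and cu = sol_continuous[OF u(1)] and cv = sol_continuous[OF v(1)]
  let ?T = "tail s a b t0"
  have subT: "?T \<subseteq> I" by (rule tail_subset[OF t0(1)])
  note squ = sol_L2_nearD[OF u(2,1) t0(1)] and sqv = sol_L2_nearD[OF v(2,1) t0(1)]
  define h where "h x = (norm (u x))\<^sup>2 + (norm (v x))\<^sup>2" for x
  have h0: "0 \<le> h x" for x by (simp add: h_def)
  have ch: "continuous_on I h" unfolding h_def by (intro continuous_intros cu cv)
  have cpp: "continuous_on I (\<lambda>x. (norm (p x))\<^sup>2)" by (intro continuous_intros cp)
  have ih: "h integrable_on ?T" unfolding h_def
    by (intro integrable_add square_integrable_integrable squ sqv)
  have ah: "h absolutely_integrable_on ?T" by (rule nonnegative_absolutely_integrable_1[OF ih]) (simp add: h0)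
  define B where "B = integral ?T h"
  define R where "R y = integral (seg t0 y) (\<lambda>x. (norm (p x))\<^sup>2)" for y
  have hseg: "integral (seg t0 x) h \<le> B" if x: "x \<in> ?T" for x
  proof -
    have "0 \<le> integral (tail s a b x) h"
      by (rule Henstock_Kurzweil_Integration.integral_nonneg)
        (use abs_integrable_imp(1)[OF integral_tail_split(2)[OF ah t0(1) x]] h0 in auto)
    then show ?thesis using integral_tail_split(1)[OF ah t0(1) x] unfolding B_def by linarith
  qed
  have B0: "B \<ge> 0" unfolding B_def by (rule Henstock_Kurzweil_Integration.integral_nonneg[OF ih]) (simp add: h0)
  have Rnn: "0 \<le> R y" if "y \<in> I" for y unfolding R_def
    by (rule Henstock_Kurzweil_Integration.integral_nonneg[OF continuous_seg_integrable[OF cpp t0(1) that]]) simp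
  define K where "K = norm (wronskian v p t0) + norm (wronskian p u t0)"
  define k where "k = norm (w - \<zeta>) + norm (\<zeta> - z)"
  \<comment> \<open>\<open>D\<close> collects the constants of
    \<open>(K + k J)^2 \<le> 2 K^2 + 2 k^2 J^2\<close> with \<open>J^2 \<le> B R\<close>; the
    summand 1 makes it positive.\<close>
  define D where "D = 2 * K\<^sup>2 + 2 * k\<^sup>2 * B + 1"
  have D0: "D > 0" using B0 by (simp add: D_def add_nonneg_pos)
  have sqseg: "square_integrable (seg t0 x) f" if "continuous_on I f" "x \<in> I" for x f
    using seg_in_I[OF t0(1) that(2)] unfolding seg_def
    by (intro square_integrable_Icc continuous_on_subset[OF that(1)])
  \<comment> \<open>Stated for an abstract \<open>W\<close>, since \<open>p\<close> stands on
    different sides in the Wronskians of \<open>v\<close> with \<open>p\<close> and of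
    \<open>p\<close> with \<open>u\<close>; \<open>R y\<close> is the energy of \<open>p\<close>
    between \<open>t0\<close> and \<open>y\<close>.\<close>
  have wbound: "(norm (W x))\<^sup>2 \<le> D * (1 + R y)"
    if y: "y \<in> ?T" and x: "x \<in> seg t0 y" "x \<in> ?T"
      and ac: "ac_deriv I W (\<lambda>x. l * dotc (f x) (g x))"
      and fg: "\<And>x. norm (f x) * norm (g x) = norm (q x) * norm (p x)" and q: "q = u \<or> q = v"
      and l: "norm l \<le> k" and W0: "norm (W t0) \<le> K" for W l f g q x y
  proof -
    have xI: "x \<in> I" and yI: "y \<in> I" using x y subT by auto
    have cq: "continuous_on I q" using q cu cv by blast
    let ?J = "integral (seg t0 x) (\<lambda>t. norm (q t) * norm (p t))"
    have iqp: "(\<lambda>t. norm (q t) * norm (p t)) integrable_on seg t0 x"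
      by (rule continuous_seg_integrable[OF _ t0(1) xI]) (intro continuous_intros cq cp)
    have "norm (W x - W t0) \<le> integral (seg t0 x) (\<lambda>t. norm (l * dotc (f t) (g t)))"
      by (rule ac_deriv_norm_le[OF ac _ t0(1) xI]) simp
    also have "\<dots> \<le> integral (seg t0 x) (\<lambda>t. k * (norm (q t) * norm (p t)))"
    proof (rule Henstock_Kurzweil_Integration.integral_le)
      have "(\<lambda>t. l * dotc (f t) (g t)) absolutely_integrable_on seg t0 x"
        using ac_deriv_L1[OF ac] seg_in_I[OF t0(1) xI] unfolding seg_def by (rule L1_loc_Icc)
      then show "(\<lambda>t. norm (l * dotc (f t) (g t))) integrable_on seg t0 x" by (rule abs_integrable_imp)
      show "(\<lambda>t. k * (norm (q t) * norm (p t))) integrable_on seg t0 x" by (rule integrable_on_mult_right[OF iqp])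
      fix t
      show "norm (l * dotc (f t) (g t)) \<le> k * (norm (q t) * norm (p t))"
        unfolding norm_mult using l norm_dotc_le[of "f t" "g t"] fg[of t] by (intro mult_mono) (auto simp: k_def)
    qed
    also have "\<dots> = k * ?J" by simp
    finally have d: "norm (W x - W t0) \<le> k * ?J" .
    have J: "?J\<^sup>2 \<le> B * R y"
    proof -
      have "?J\<^sup>2 \<le> integral (seg t0 x) (\<lambda>t. (norm (q t))\<^sup>2) * integral (seg t0 x) (\<lambda>t. (norm (p t))\<^sup>2)"
        by (rule integral_Cauchy_Schwarz[OF sqseg[OF cq xI] sqseg[OF cp xI]]) simp
      also have "\<dots> \<le> B * R y"
      proof (rule mult_mono)
        have "integral (seg t0 x) (\<lambda>t. (norm (q t))\<^sup>2) \<le> integral (seg t0 x) h"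
          by (rule Henstock_Kurzweil_Integration.integral_le)
            (use q in \<open>auto intro!: continuous_seg_integrable[OF _ t0(1) xI] ch continuous_intros cu cv simp: h_def\<close>)
        then show "integral (seg t0 x) (\<lambda>t. (norm (q t))\<^sup>2) \<le> B" using hseg[OF x(2)] by linarith
        have "seg t0 x \<subseteq> seg t0 y" using x(1) by (auto simp: seg_def)
        then show "integral (seg t0 x) (\<lambda>t. (norm (p t))\<^sup>2) \<le> R y" unfolding R_def
          by (rule integral_subset_le) (auto intro!: continuous_seg_integrable cpp t0(1) xI yI)
        show "0 \<le> integral (seg t0 x) (\<lambda>t. (norm (p t))\<^sup>2)"
          by (rule Henstock_Kurzweil_Integration.integral_nonneg[OF continuous_seg_integrable[OF cpp t0(1) xI]]) simp
      qed (rule B0)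
      finally show ?thesis .
    qed
    have "norm (W x) \<le> K + k * ?J" using d W0 norm_triangle_ineq2[of "W x" "W t0"] by linarith
    then have "(norm (W x))\<^sup>2 \<le> (K + k * ?J)\<^sup>2" by (intro power_mono) auto
    also have "\<dots> \<le> 2 * K\<^sup>2 + 2 * (k * ?J)\<^sup>2"
      using sum_squares_bound[of K "k * ?J"] by (simp add: power2_sum)
    also have "\<dots> \<le> 2 * K\<^sup>2 + 2 * k\<^sup>2 * (B * R y)"
      using mult_left_mono[OF J, of "2 * k\<^sup>2"] by (simp add: power_mult_distrib)
    also have "\<dots> \<le> D * (1 + R y)"
    proof -
      have "0 \<le> 2 * K\<^sup>2 * R y" "0 \<le> 2 * k\<^sup>2 * B" using Rnn[OF yI] B0 by auto
      then show ?thesis using Rnn[OF yI] unfolding D_def by (simp add: algebra_simps)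
    qed
    finally show ?thesis .
  qed
  have pbound: "m\<^sup>2 * (norm (p x))\<^sup>2 \<le> h x * (2 * D * (1 + R y))" if y: "y \<in> ?T" and x: "x \<in> seg t0 y" "x \<in> ?T" for x y
  proof -
    have w1: "(norm (wronskian v p x))\<^sup>2 \<le> D * (1 + R y)"
      by (rule wbound[OF y x sol_wronskian_ac[OF v(1) p(1)], where q = v]) (auto simp: k_def K_def)
    have w2: "(norm (wronskian p u x))\<^sup>2 \<le> D * (1 + R y)"
      by (rule wbound[OF y x sol_wronskian_ac[OF p(1) u(1)], where q = u]) (auto simp: k_def K_def)
    have "wronskian u v x *s p x = - (wronskian v p x *s u x + wronskian p u x *s v x)"
      using plucker3[of u v x p] by (simp only: eq_neg_iff_add_eq_0 add.assoc[symmetric])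
    then have "norm (wronskian u v x) * norm (p x) \<le> norm (wronskian v p x) * norm (u x) + norm (wronskian p u x) * norm (v x)"
      by (metis norm_minus_cancel norm_smult_vec norm_triangle_ineq)
    moreover have "m * norm (p x) \<le> norm (wronskian u v x) * norm (p x)"
      using t0(2)[OF x(2)] by (intro mult_right_mono) auto
    ultimately have "m * norm (p x) \<le> norm (wronskian v p x) * norm (u x) + norm (wronskian p u x) * norm (v x)" by linarith
    then have "(m * norm (p x))\<^sup>2 \<le> (norm (wronskian v p x) * norm (u x) + norm (wronskian p u x) * norm (v x))\<^sup>2"
      using m by (intro power_mono) auto
    also have "\<dots> \<le> ((norm (wronskian v p x))\<^sup>2 + (norm (wronskian p u x))\<^sup>2) * h x"
    proof -
      have "0 \<le> (norm (wronskian v p x) * norm (v x) - norm (wronskian p u x) * norm (u x))\<^sup>2" by simp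
      then show ?thesis by (simp add: h_def power2_eq_square algebra_simps)
    qed
    also have "\<dots> \<le> (D * (1 + R y) + D * (1 + R y)) * h x" by (intro mult_right_mono add_mono w1 w2 h0)
    finally show ?thesis by (simp add: power_mult_distrib algebra_simps)
  qed
  have "m\<^sup>2 / (4 * D) > 0" using m D0 by simp
  \<comment> \<open>Beyond \<open>t2\<close> the energy of \<open>u\<close> and \<open>v\<close> is
    so small that the new energy of \<open>p\<close> is at most \<open>(1 + R y) / 2\<close>, which
    can be absorbed into \<open>R y\<close>.\<close>
  then obtain t2 where t2: "t2 \<in> ?T" "\<And>x. x \<in> tail s a b t2 \<Longrightarrow> integral (seg t2 x) h < m\<^sup>2 / (4 * D)"
    using tail_integral_small[OF ab t0(1) ah, of "m\<^sup>2 / (4 * D)"] h0 by blast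
  have t2I: "t2 \<in> I" using t2 subT by blast
  have "square_integrable (tail s a b t2) p"
  proof (rule square_integrable_tailI[OF ab t2I cp])
    fix y assume y: "y \<in> tail s a b t2"
    have yT: "y \<in> ?T" using tail_mono[OF t2(1)] y by blast
    have yI: "y \<in> I" using yT subT by blast
    have comb: "R y = R t2 + integral (seg t2 y) (\<lambda>x. (norm (p x))\<^sup>2)"
      unfolding R_def by (rule seg_integral_combine[OF cpp t0(1) t2(1) y])
    have "integral (seg t2 y) (\<lambda>x. m\<^sup>2 * (norm (p x))\<^sup>2) \<le> integral (seg t2 y) (\<lambda>x. h x * (2 * D * (1 + R y)))"
    proof (rule Henstock_Kurzweil_Integration.integral_le)
      fix x assume x: "x \<in> seg t2 y"
      have "x \<in> seg t0 y" "x \<in> ?T"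
        using x y t2(1) yT tail_decomp[OF t2I y] tail_decomp[OF t0(1) t2(1)] seg_subset[of ?T t2 y]
        by (auto simp: seg_def tail_def einterval_iff split: if_splits)
      then show "m\<^sup>2 * (norm (p x))\<^sup>2 \<le> h x * (2 * D * (1 + R y))" by (rule pbound[OF yT])
    qed (intro continuous_seg_integrable[OF _ t2I yI] continuous_intros cp ch)+
    then have "m\<^sup>2 * integral (seg t2 y) (\<lambda>x. (norm (p x))\<^sup>2) \<le> integral (seg t2 y) h * (2 * D * (1 + R y))" by simp
    also have "\<dots> \<le> (m\<^sup>2 / (4 * D)) * (2 * D * (1 + R y))"
      using t2(2)[OF y] D0 Rnn[OF yI] by (intro mult_right_mono) auto
    also have "\<dots> = m\<^sup>2 * ((1 + R y) / 2)" using D0 by (simp add: field_simps)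
    finally have le: "integral (seg t2 y) (\<lambda>x. (norm (p x))\<^sup>2) \<le> (1 + R y) / 2" using m by simp
    then have "R y \<le> 2 * R t2 + 1" using comb by (simp add: field_simps)
    then show "integral (seg t2 y) (\<lambda>x. (norm (p x))\<^sup>2) \<le> R t2 + 1" using comb by linarith
  qed
  then show False using p(2) t2I unfolding L2_near_def by blast
qed

text \<open>A solution \<open>p\<close> independent of \<open>v\<close> exists, and its Wronskians
  converge because all solutions are square integrable. The Pluecker relation writes the Wronskian
  of \<open>u\<close> and \<open>u'\<close> as a combination in which each product has a factor
  tending to 0.\<close>

lemma limit_circle_nondegenerate:
  assumes lc: "limit_circle s a b Q" and v: "sol \<zeta> v" "nontrivial_on I v"
    and u: "sol z u" "(wronskian v u \<longlongrightarrow> 0) (end_filter s a b)"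
    and u': "sol w u'" "(wronskian v u' \<longlongrightarrow> 0) (end_filter s a b)"
  shows "(wronskian u u' \<longlongrightarrow> 0) (end_filter s a b)"
proof -
  have L2: "L2_near s a b f" if "sol z f" for z f using lc that unfolding limit_circle_def by blast
  obtain x0 where x0: "x0 \<in> I" "v x0 \<noteq> 0" using v(2) unfolding nontrivial_on_def by blast
  have "wronskian v (U \<zeta>) x0 \<noteq> 0 \<or> wronskian v (V \<zeta>) x0 \<noteq> 0"
  proof (rule ccontr)
    assume "\<not> ?thesis"
    then have "v x0 = 0" using expand[OF x0(1), of v \<zeta>] wronskian_swap[of "V \<zeta>" v x0] by simp
    then show False using x0 by simp
  qed
  then obtain p where p: "sol \<zeta> p" "wronskian v p x0 \<noteq> 0" using U_sol V_sol by blast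
  obtain L1 where L1: "(wronskian p u' \<longlongrightarrow> L1) (end_filter s a b)"
    by (rule sol_wronskian_limit[OF p(1) L2[OF p(1)] u'(1) L2[OF u'(1)]])
  obtain L2' where L2': "(wronskian p u \<longlongrightarrow> L2') (end_filter s a b)"
    by (rule sol_wronskian_limit[OF p(1) L2[OF p(1)] u(1) L2[OF u(1)]])
  have "((\<lambda>x. (1 / wronskian v p x0) * (wronskian v u x * wronskian p u' x - wronskian v u' x * wronskian p u x))
      \<longlongrightarrow> (1 / wronskian v p x0) * (0 * L1 - 0 * L2')) (end_filter s a b)"
    by (intro tendsto_intros u(2) u'(2) L1 L2')
  then have "((\<lambda>x. (1 / wronskian v p x0) * (wronskian v u x * wronskian p u' x - wronskian v u' x * wronskian p u x))
      \<longlongrightarrow> 0) (end_filter s a b)" by simp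
  then show ?thesis
  proof (rule Lim_transform_eventually)
    show "eventually (\<lambda>x. (1 / wronskian v p x0) * (wronskian v u x * wronskian p u' x - wronskian v u' x * wronskian p u x)
       = wronskian u u' x) (end_filter s a b)"
      using eventually_in_tail[OF ab x0(1), of s]
    proof eventually_elim
      case (elim x)
      then have "x \<in> I" using tail_subset[OF x0(1)] by blast
      then have "wronskian v p x = wronskian v p x0" by (rule sol_wronskian_const[OF v(1) p(1) _ x0(1)])
      then show ?case using plucker4[of v p x u u'] p(2) by (simp add: field_simps)
    qed
  qed
qed

text \<open>Unlike in \<open>bc_spinor\<close>, the boundary spinor may be a solution at any
  parameter: the condition of the commuted operator is given by a solution at
  \<open>lam\<close>.\<close>

definition bc_ok :: "bool \<Rightarrow> (real \<Rightarrow> complex^2) \<Rightarrow> bool" where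
  "bc_ok s v \<longleftrightarrow> (if limit_circle s a b Q then (\<exists>\<zeta>. sol \<zeta> v) \<and> nontrivial_on I v else (\<forall>x\<in>I. v x = 0))"

lemma bc_ok_trivial:
  assumes "bc_ok s v" "\<not> limit_circle s a b Q"
  shows "(wronskian v f \<longlongrightarrow> 0) (end_filter s a b)"
proof (rule tendsto_eventually)
  obtain c where c: "c \<in> I" using einterval_nonempty[OF ab] by blast
  show "eventually (\<lambda>x. wronskian v f x = 0) (end_filter s a b)"
    using eventually_in_tail[OF ab c, of s]
  proof eventually_elim
    case (elim x)
    then have "v x = 0" using assms tail_subset[OF c] by (auto simp: bc_ok_def)
    then show ?case by (simp add: wronskian_def)
  qed
qed

text \<open>In the limit circle case the boundary spinor links the two solutions; otherwise some
  solution is not square integrable near the end, which excludes a nonzero limit.\<close>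

lemma dom_wronskian_limit:
  assumes bc: "bc_ok s v" and u: "sol z u" "in_dom_near s a b v u" and u': "sol w u'" "in_dom_near s a b v u'"
  shows "(wronskian u u' \<longlongrightarrow> 0) (end_filter s a b)"
proof (cases "limit_circle s a b Q")
  case True
  then show ?thesis
    using bc u u' limit_circle_nondegenerate[OF True _ _ u(1) _ u'(1)] unfolding bc_ok_def in_dom_near_def by auto
next
  case False
  then obtain \<zeta> p where "sol \<zeta> p" "\<not> L2_near s a b p" unfolding limit_circle_def by blast
  then show ?thesis using limit_point_wronskian[OF _ _ u(1) _ u'(1)] u u' unfolding in_dom_near_def by blast
qed

lemma dom_wronskian_zero:
  assumes bc: "bc_ok s v" and u: "sol z u" "in_dom_near s a b v u" and u': "sol z u'" "in_dom_near s a b v u'"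
    and x: "x \<in> I"
  shows "wronskian u u' x = 0"
proof -
  have "((\<lambda>_. wronskian u u' x) \<longlongrightarrow> 0) (end_filter s a b)"
  proof (rule Lim_transform_eventually[OF dom_wronskian_limit[OF bc u u']])
    show "eventually (\<lambda>y. wronskian u u' y = wronskian u u' x) (end_filter s a b)"
      using eventually_in_tail[OF ab x, of s]
      by eventually_elim (use sol_wronskian_const[OF u(1) u'(1) _ x] tail_subset[OF x] in blast)
  qed
  then show ?thesis using tendsto_const_iff[OF end_filter_neq_bot[OF ab]] by metis
qed

lemma square_integrable_both_ends:
  assumes "sol z u" "L2_near True a b u" "L2_near False a b u"
  shows "square_integrable I u"
proof -
  obtain c where c: "c \<in> I" using einterval_nonempty[OF ab] by blast
  have "square_integrable {c..c} u" by (rule square_integrable_Icc) simp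
  then have "square_integrable ((tail True a b c \<union> {c..c}) \<union> tail False a b c) u"
    by (intro square_integrable_Un sol_L2_nearD[OF assms(2,1) c] sol_L2_nearD[OF assms(3,1) c] sets.Un) auto
  moreover have "(tail True a b c \<union> {c..c}) \<union> tail False a b c = I"
    using c by (auto simp: tail_def einterval_iff intro: ereal_less_trans_real)
  ultimately show ?thesis by simp
qed

lemma U_nonzero: "x \<in> I \<Longrightarrow> U z x \<noteq> 0" and V_nonzero: "x \<in> I \<Longrightarrow> V z x \<noteq> 0"
  using WVU[of x z] by (auto simp: wronskian_def)

lemma U_nontrivial: "nontrivial_on I (U z)"
  using einterval_nonempty[OF ab] U_nonzero unfolding nontrivial_on_def by blast

lemma sol_energy_pos:
  assumes u: "sol z u" and nz: "\<And>x. x \<in> I \<Longrightarrow> u x \<noteq> 0" and x: "x1 \<in> I" "x2 \<in> I" "x1 < x2"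
  shows "integral {x1..x2} (\<lambda>x. (norm (u x))\<^sup>2) > 0"
proof -
  have sub: "{x1..x2} \<subseteq> I" by (rule interval_Icc_subset[OF _ x(1,2)]) simp
  have c: "continuous_on {x1..x2} (\<lambda>x. (norm (u x))\<^sup>2)"
    by (intro continuous_intros continuous_on_subset[OF sol_continuous[OF u] sub])
  have i: "(\<lambda>x. (norm (u x))\<^sup>2) integrable_on {x1..x2}" by (rule integrable_continuous_real[OF c])
  have nn: "0 \<le> integral {x1..x2} (\<lambda>x. (norm (u x))\<^sup>2)"
    by (rule Henstock_Kurzweil_Integration.integral_nonneg[OF i]) simp
  moreover have "integral {x1..x2} (\<lambda>x. (norm (u x))\<^sup>2) \<noteq> 0"
  proof
    assume "integral {x1..x2} (\<lambda>x. (norm (u x))\<^sup>2) = 0"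
    then have "((\<lambda>x. (norm (u x))\<^sup>2) has_integral 0) (cbox x1 x2)" using i by (simp add: has_integral_integral)
    then have "(norm (u x1))\<^sup>2 = 0"
      using has_integral_0_cbox_imp_0[of x1 x2 "\<lambda>x. (norm (u x))\<^sup>2" x1] c x(3) by auto
    then show False using nz[OF x(1)] by simp
  qed
  ultimately show ?thesis by linarith
qed

lemma U_energy_pos:
  "x1 \<in> I \<Longrightarrow> x2 \<in> I \<Longrightarrow> x1 < x2 \<Longrightarrow> integral {x1..x2} (\<lambda>x. (norm (U z x))\<^sup>2) > 0"
  using sol_energy_pos[OF U_sol U_nonzero] .

lemma exists_two_points:
  obtains x1 x2 where "x1 \<in> I" "x2 \<in> I" "x1 < x2"
proof -
  obtain c where c: "c \<in> I" using einterval_nonempty[OF ab] by blast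
  obtain d where d: "d \<in> tail True a b c" using tail_nonempty[OF c] by blast
  then have "d < c" by (simp add: tail_def einterval_iff)
  then show ?thesis using that[of d c] c d tail_subset[OF c] by blast
qed

text \<open>The pair \<open>U z\<close>, 0 violates the norm bound in the resolvent set, as
  \<open>U z\<close> has positive energy.\<close>

lemma eigenvalue_in_spectrum:
  assumes l: "in_dom_near True a b v (U z)" and r: "in_dom_near False a b w (U z)"
  shows "z \<in> dirac_spectrum I Q (op_bc a b v w)"
proof (rule ccontr)
  assume "z \<notin> dirac_spectrum I Q (op_bc a b v w)"
  then obtain C where C: "\<And>f g. dirac_maps I Q (op_bc a b v w) z f g \<Longrightarrow> norm_L2 I f \<le> C * norm_L2 I g"
    unfolding dirac_spectrum_def dirac_resolvent_set_def by auto
  have sq: "square_integrable I (U z)"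
    by (rule square_integrable_both_ends[OF U_sol]) (use l r in \<open>auto simp: in_dom_near_def\<close>)
  have de: "dirac_expr I Q (U z) (\<lambda>x. z *s U z x)" using U_sol unfolding dirac_solution_def .
  have "dirac_maps I Q (op_bc a b v w) z (U z) (\<lambda>x. 0)"
    unfolding dirac_maps_def dirac_dom_def op_bc_def bc_left_def bc_right_def
    using sq de square_integrable_cmult[OF sq] l r by (auto simp: in_dom_near_def end_filter_def)
  then have "norm_L2 I (U z) \<le> 0" using C[of "U z" "\<lambda>x. 0"] by (simp add: norm_L2_def)
  then have le: "integral I (\<lambda>x. (norm (U z x))\<^sup>2) \<le> 0" by (simp add: norm_L2_def)
  obtain x1 x2 where x: "x1 \<in> I" "x2 \<in> I" "x1 < x2" by (rule exists_two_points)
  have sub: "{x1..x2} \<subseteq> I" by (rule interval_Icc_subset[OF _ x(1,2)]) simp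
  have "integral {x1..x2} (\<lambda>x. (norm (U z x))\<^sup>2) \<le> integral I (\<lambda>x. (norm (U z x))\<^sup>2)"
    by (rule integral_subset_le[OF sub _ square_integrable_integrable[OF sq]])
      (auto intro!: integrable_continuous_real continuous_intros continuous_on_subset[OF sol_continuous[OF U_sol] sub])
  then show False using U_energy_pos[OF x] le by (meson not_le order_trans)
qed

text \<open>Solve \<open>(H - z) f = g\<close> with \<open>g\<close> supported in a compact
  interval. To the left of the support \<open>f\<close> continues to a solution in the domain near
  \<open>a\<close>, so its Wronskian with \<open>U\<close> vanishes; across the support this
  Wronskian changes by minus the energy of \<open>U\<close>. Hence the solution continuing
  \<open>f\<close> from the right of the support is nontrivial.\<close>

lemma resolvent_right_solution:
  assumes bcl: "bc_ok True v" and l: "in_dom_near True a b v (U z)"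
    and z: "z \<notin> dirac_spectrum I Q (op_bc a b v w)"
  obtains u where "sol z u" "nontrivial_on I u" "in_dom_near False a b w u"
proof -
  obtain x1 x2 where x: "x1 \<in> I" "x2 \<in> I" "x1 < x2" by (rule exists_two_points)
  have sub: "{x1..x2} \<subseteq> I" by (rule interval_Icc_subset[OF _ x(1,2)]) simp
  \<comment> \<open>The conjugate makes \<open>U . g\<close> equal to \<open>|U|^2\<close>, so
    nothing can cancel in the integral.\<close>
  define g where "g y = (if y \<in> {x1..x2} then cnjv (U z y) else 0)" for y
  have "square_integrable {x1..x2} (\<lambda>y. cnjv (U z y))"
    by (intro square_integrable_Icc continuous_on_cnjv continuous_on_subset[OF sol_continuous[OF U_sol] sub])
  then have "square_integrable I g" unfolding g_def by (rule square_integrable_zero_extend[OF _ sub]) auto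
  then obtain f where f: "dirac_maps I Q (op_bc a b v w) z f g"
    using z unfolding dirac_spectrum_def dirac_resolvent_set_def by auto
  have fsq: "square_integrable I f" and bl: "bc_left a v f" and br: "bc_right b w f"
    and fe: "dirac_expr I Q f (\<lambda>x. z *s f x + g x)"
    using f unfolding dirac_maps_def dirac_dom_def op_bc_def by auto
  have L2f: "L2_near s a b f" for s
    unfolding L2_near_def using x(1) square_integrable_subset[OF fsq tail_subset[OF x(1)]] by auto
  have fsol: "dirac_solution T Q z f" if "T \<subseteq> I" "open T" "is_interval T" "T \<inter> {x1..x2} = {}" for T
    unfolding dirac_solution_def
    by (rule dirac_expr_cong[OF dirac_expr_subset[OF fe that(1) _ _ that(2,3)] that(2,3)])
      (use that(4) in \<open>auto simp: g_def\<close>)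
  let ?S1 = "tail True a b x1" and ?S2 = "tail False a b x2"
  have S1: "?S1 \<subseteq> I" and S2: "?S2 \<subseteq> I" using tail_subset x by auto
  have "?S1 \<inter> {x1..x2} = {}" "?S2 \<inter> {x1..x2} = {}" by (auto simp: tail_def einterval_iff)
  then have s1: "dirac_solution ?S1 Q z f" and s2: "dirac_solution ?S2 Q z f" using fsol S1 S2 by auto
  obtain A B where fA: "\<And>x. x \<in> ?S1 \<Longrightarrow> f x = A *s V z x + B *s U z x"
    using sol_expand[OF s1 _ _ S1] by auto
  obtain C D where fC: "\<And>x. x \<in> ?S2 \<Longrightarrow> f x = C *s V z x + D *s U z x"
    using sol_expand[OF s2 _ _ S2] by auto
  define u1 where "u1 x = A *s V z x + B *s U z x" for x
  define u2 where "u2 x = C *s V z x + D *s U z x" for x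
  have u1: "sol z u1" and u2: "sol z u2" unfolding u1_def u2_def by (rule sol_combination)+
  have d1: "in_dom_near True a b v u1"
    by (rule in_dom_near_tail_cong[OF ab _ x(1), of True v f])
      (use L2f bl fA in \<open>auto simp: in_dom_near_def bc_left_def end_filter_def u1_def\<close>)
  have d2: "in_dom_near False a b w u2"
    by (rule in_dom_near_tail_cong[OF ab _ x(2), of False w f])
      (use L2f br fC in \<open>auto simp: in_dom_near_def bc_right_def end_filter_def u2_def\<close>)
  obtain p where p: "p \<in> ?S1" using tail_nonempty[OF x(1)] by blast
  obtain q where q: "q \<in> ?S2" using tail_nonempty[OF x(2)] by blast
  have pI: "p \<in> I" and qI: "q \<in> I" using p q S1 S2 by auto
  have pq: "p < x1" "x2 < q" using p q by (auto simp: tail_def einterval_iff)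
  have "wronskian (U z) u1 p = 0" by (rule dom_wronskian_zero[OF bcl U_sol l u1 d1 pI])
  then have Wp: "wronskian (U z) f p = 0" using fA[OF p] by (simp add: wronskian_def u1_def)
  have ac: "ac_deriv I (wronskian (U z) f) (\<lambda>x. dotc (z *s U z x) (f x) - dotc (U z x) (z *s f x + g x))"
    using U_sol[of z] fe unfolding dirac_solution_def by (rule wronskian_ac_deriv) (auto intro: Q_sym)
  have eqg: "dotc (z *s U z x) (f x) - dotc (U z x) (z *s f x + g x) = - (if x \<in> {x1..x2} then of_real ((norm (U z x))\<^sup>2) else 0)" for x
    using dotc_cnjv[of "U z x"] by (auto simp: dotc_def g_def algebra_simps)
  have "wronskian (U z) f q - wronskian (U z) f p = integral {p..q} (\<lambda>x. - (if x \<in> {x1..x2} then complex_of_real ((norm (U z x))\<^sup>2) else 0))"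
    using ac pI qI pq x(3) unfolding ac_deriv_def eqg by auto
  also have "\<dots> = - integral {p..q} (\<lambda>x. (if x \<in> {x1..x2} then complex_of_real ((norm (U z x))\<^sup>2) else 0))" by simp
  also have "integral {p..q} (\<lambda>x. (if x \<in> {x1..x2} then complex_of_real ((norm (U z x))\<^sup>2) else 0)) =
      integral ({x1..x2} \<inter> {p..q}) (\<lambda>x. complex_of_real ((norm (U z x))\<^sup>2))" by (rule integral_restrict_Int)
  also have "{x1..x2} \<inter> {p..q} = {x1..x2}" using pq by auto
  also have "integral {x1..x2} (\<lambda>x. complex_of_real ((norm (U z x))\<^sup>2)) = of_real (integral {x1..x2} (\<lambda>x. (norm (U z x))\<^sup>2))"
    using integral_linear[OF integrable_continuous_real bounded_linear_of_real, of x1 x2 "\<lambda>x. (norm (U z x))\<^sup>2"]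
      continuous_on_subset[OF sol_continuous[OF U_sol[of z]] sub]
    by (simp add: o_def continuous_on_norm continuous_on_power)
  finally have "wronskian (U z) f q = - of_real (integral {x1..x2} (\<lambda>x. (norm (U z x))\<^sup>2))" using Wp by simp
  then have "wronskian (U z) f q \<noteq> 0" using U_energy_pos[OF x, of z] by simp
  then have "u2 q \<noteq> 0" using fC[OF q] by (auto simp: wronskian_def u2_def[symmetric])
  then have "nontrivial_on I u2" using qI unfolding nontrivial_on_def by blast
  then show ?thesis using that u2 d2 by blast
qed

end

section \<open>Averages over roots of unity, parameter integrals and limits in L2\<close>

text \<open>A geometric sum in an \<open>N\<close>-th root of unity, which equals 1 exactly if
  \<open>N\<close> divides \<open>k\<close>.\<close>

lemma sum_cis_power_multiple:
  assumes N: "N > 0"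
  shows "(\<Sum>j<N. cis (2 * pi * real j / real N) ^ k) = (if N dvd k then of_nat N else 0)"
proof -
  define w where "w = cis (2 * pi * real k / real N)"
  have pw: "cis (2 * pi * real j / real N) ^ k = w ^ j" for j
    unfolding w_def Complex.DeMoivre by (simp add: field_simps)
  have wN: "w ^ N = 1"
    unfolding w_def Complex.DeMoivre using N by (simp add: cis_multiple_2pi[of "real k"])
  have w1: "w = 1 \<longleftrightarrow> N dvd k"
  proof
    assume "w = 1"
    then have "cos (2 * pi * real k / real N) = 1" unfolding w_def by (metis cis.sel(1) one_complex.sel(1))
    then obtain n :: int where "2 * pi * real k / real N = of_int n * 2 * pi" using cos_one_2pi_int by blast
    then have "real k = of_int n * real N" using N by (simp add: field_simps)
    then have "int k = n * int N" by (metis of_int_eq_iff of_int_mult of_int_of_nat_eq)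
    then have "int N dvd int k" by simp
    then show "N dvd k" by simp
  next
    assume "N dvd k"
    then obtain q where "k = N * q" by blast
    then show "w = 1" unfolding w_def using N by (simp add: cis_multiple_2pi[of "real q"] mult.assoc[symmetric])
  qed
  show ?thesis
  proof (cases "w = 1")
    case True then show ?thesis using w1 by (simp add: pw)
  next
    case False
    then have "(\<Sum>j<N. w ^ j) = 0" using wN by (simp add: geometric_sum)
    then show ?thesis using w1 False by (simp add: pw)
  qed
qed

text \<open>Averages over the \<open>N\<close>-th roots of unity replace the Cauchy integral: they involve only finite
  sums, so that norm estimates and pointwise limits commute with them.\<close>

lemma circle_average_tendsto:
  assumes f: "f holomorphic_on ball z0 R" and r: "0 < r" "r < R"
  shows "(\<lambda>n. (\<Sum>j<Suc n. f (z0 + of_real r * cis (2 * pi * real j / real (Suc n)))) / of_nat (Suc n)) \<longlonglongrightarrow> f z0"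
proof -
  define c where "c k = (deriv ^^ k) f z0 / fact k" for k
  have ser: "(\<lambda>k. c k * (w - z0) ^ k) sums f w" if "w \<in> ball z0 R" for w
    unfolding c_def by (rule holomorphic_power_series[OF f that])
  define t where "t k = norm (c k) * r ^ k" for k
  obtain r' where r': "r < r'" "r' < R" using r dense by blast
  have "summable (\<lambda>k. c k * (z0 + of_real r' - z0) ^ k)"
    using ser[of "z0 + of_real r'"] r r' sums_summable by (auto simp: dist_norm)
  then have "summable (\<lambda>k. norm (c k * (of_real r) ^ k))"
    by (intro powser_insidea[of c "of_real r'"]) (use r r' in auto)
  then have st: "summable t" unfolding t_def using r by (simp add: norm_mult norm_power)
  define avg where "avg n = (\<Sum>j<Suc n. f (z0 + of_real r * cis (2 * pi * real j / real (Suc n)))) / of_nat (Suc n)" for n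
  \<comment> \<open>Averaging over the \<open>n + 1\<close> points keeps exactly the terms of the
    power series whose index is a multiple of \<open>n + 1\<close>.\<close>
  have av: "(\<lambda>k. c k * of_real r ^ k * (if Suc n dvd k then 1 else 0)) sums avg n" for n
  proof -
    have "(\<lambda>k. \<Sum>j<Suc n. c k * (z0 + of_real r * cis (2 * pi * real j / real (Suc n)) - z0) ^ k) sums
        (\<Sum>j<Suc n. f (z0 + of_real r * cis (2 * pi * real j / real (Suc n))))"
      by (rule sums_sum, rule ser) (use r in \<open>auto simp: dist_norm norm_mult\<close>)
    then have "(\<lambda>k. (\<Sum>j<Suc n. c k * (z0 + of_real r * cis (2 * pi * real j / real (Suc n)) - z0) ^ k) / of_nat (Suc n)) sums avg n"
      unfolding avg_def by (rule sums_divide)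
    moreover have "(\<Sum>j<Suc n. c k * (z0 + of_real r * cis (2 * pi * real j / real (Suc n)) - z0) ^ k) / of_nat (Suc n)
       = c k * of_real r ^ k * (if Suc n dvd k then 1 else 0)" for k
    proof -
      have "(\<Sum>j<Suc n. c k * (z0 + of_real r * cis (2 * pi * real j / real (Suc n)) - z0) ^ k)
         = c k * of_real r ^ k * (\<Sum>j<Suc n. cis (2 * pi * real j / real (Suc n)) ^ k)"
        by (simp only: sum_distrib_left power_mult_distrib add_diff_cancel_left' mult.assoc)
      then show ?thesis unfolding sum_cis_power_multiple[OF zero_less_Suc] by (auto simp del: of_nat_Suc)
    qed
    ultimately show ?thesis by simp
  qed
  \<comment> \<open>Apart from index 0, the surviving indices are at least \<open>n + 1\<close>, so
    the error is bounded by a tail of a convergent series.\<close>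
  have bnd: "norm (avg n - f z0) \<le> (\<Sum>k. t (k + Suc n))" for n
  proof -
    let ?s = "\<lambda>k. c k * of_real r ^ k * (if Suc n dvd k then 1 else 0)"
    have "(\<Sum>k<Suc n. ?s k) = (\<Sum>k<Suc n. if k = 0 then c 0 else 0)"
      by (rule sum.cong) (auto dest: dvd_imp_le)
    also have "\<dots> = f z0" by (simp add: c_def)
    finally have s0: "(\<Sum>k<Suc n. ?s k) = f z0" .
    have "(\<lambda>k. ?s (k + Suc n)) sums (avg n - f z0)" using sums_iff_shift'[of ?s "Suc n" "avg n"] av[of n] s0 by simp
    then have "avg n - f z0 = (\<Sum>k. ?s (k + Suc n))" by (rule sums_unique)
    moreover have "norm (?s (k + Suc n)) \<le> t (k + Suc n)" for k
      using r by (auto simp: t_def norm_mult norm_power)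
    moreover have "summable (\<lambda>k. t (k + Suc n))" using st by (rule summable_ignore_initial_segment)
    ultimately show ?thesis using norm_suminf_le[of "\<lambda>k. ?s (k + Suc n)" "\<lambda>k. t (k + Suc n)"] by simp
  qed
  have "(\<lambda>n. \<Sum>k. t (k + n)) \<longlonglongrightarrow> 0"
  proof (rule LIMSEQ_I)
    fix e :: real assume "e > 0"
    then show "\<exists>n0. \<forall>n\<ge>n0. norm ((\<Sum>k. t (k + n)) - 0) < e"
      using suminf_exist_split[OF _ st] by auto
  qed
  then have "(\<lambda>n. \<Sum>k. t (k + Suc n)) \<longlonglongrightarrow> 0" by (rule LIMSEQ_Suc)
  then have "(\<lambda>n. avg n - f z0) \<longlonglongrightarrow> 0"
    by (rule Lim_null_comparison[OF eventuallyI, OF bnd])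
  then show ?thesis unfolding avg_def by (rule LIM_zero_cancel)
qed

text \<open>Cauchy's estimate makes the integrand Lipschitz in \<open>z\<close> uniformly in
  \<open>y\<close>, so its difference quotients are dominated by a multiple of
  \<open>|g|\<close>.\<close>

lemma holomorphic_param_integral:
  fixes F :: "complex \<Rightarrow> real \<Rightarrow> complex" and g :: "real \<Rightarrow> complex"
  assumes F: "continuous_on (UNIV \<times> {p..q}) (\<lambda>(z, y). F z y)"
    and hol: "\<And>y. y \<in> {p..q} \<Longrightarrow> (\<lambda>z. F z y) holomorphic_on UNIV"
    and g: "g absolutely_integrable_on {p..q}"
  shows "(\<lambda>z. integral {p..q} (\<lambda>y. F z y * g y)) holomorphic_on UNIV"
  unfolding holomorphic_on_def
proof
  fix z :: complex
  have FL: "(\<lambda>y. F w y * g y) absolutely_integrable_on {p..q}" for w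
  proof -
    have "continuous_on {p..q} ((\<lambda>(z, y). F z y) \<circ> Pair w)"
      by (intro continuous_on_compose continuous_on_subset[OF F] continuous_intros) auto
    then have "L1_loc {p..q} (\<lambda>y. F w y * g y)"
      by (intro L1_loc_mult_continuous) (use g in \<open>auto simp: o_def L1_loc_def intro: set_integrable_subset lmeasurable_compact fmeasurableD\<close>)
    then show ?thesis by (rule L1_loc_Icc) simp
  qed
  have "bounded ((\<lambda>(z, y). F z y) ` (cball z 2 \<times> {p..q}))"
    by (intro compact_imp_bounded compact_continuous_image continuous_on_subset[OF F] compact_Times) auto
  then obtain B where B: "\<And>w y. w \<in> cball z 2 \<Longrightarrow> y \<in> {p..q} \<Longrightarrow> norm (F w y) \<le> B"
    unfolding bounded_iff by fastforce
  \<comment> \<open>The bound \<open>B\<close> holds on radius 2, which contains the unit discs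
    around all points of the disc of radius 1.\<close>
  have der: "norm (deriv (\<lambda>w. F w y) x) \<le> B" if y: "y \<in> {p..q}" and x: "x \<in> cball z 1" for x y
  proof -
    have "norm ((deriv ^^ 1) (\<lambda>w. F w y) x) \<le> fact 1 * B / 1 ^ 1"
    proof (rule Cauchy_inequality)
      show "(\<lambda>w. F w y) holomorphic_on ball x 1" using hol[OF y] holomorphic_on_subset by blast
      show "continuous_on (cball x 1) (\<lambda>w. F w y)"
        using hol[OF y] holomorphic_on_imp_continuous_on continuous_on_subset by blast
      fix w assume "norm (x - w) = 1"
      then have "w \<in> cball z 2" using x norm_triangle_ineq[of "z - x" "x - w"] by (simp add: dist_norm)
      then show "norm (F w y) \<le> B" by (rule B[OF _ y])
    qed simp
    then show ?thesis by simp
  qed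
  have lip: "norm (F w y - F z y) \<le> B * norm (w - z)" if y: "y \<in> {p..q}" and w: "w \<in> cball z 1" for w y
    by (rule field_differentiable_bound[of "cball z 1" "\<lambda>w. F w y" "deriv (\<lambda>w. F w y)" B w z])
      (use der y w hol[OF y] in \<open>auto intro: holomorphic_derivI[of _ UNIV]\<close>)
  let ?G = "\<lambda>w. integral {p..q} (\<lambda>y. F w y * g y)"
  let ?D = "integral {p..q} (\<lambda>y. deriv (\<lambda>w. F w y) z * g y)"
  have "((\<lambda>w. (?G w - ?G z) / (w - z)) \<longlongrightarrow> ?D) (at z)"
    unfolding tendsto_at_iff_sequentially
  proof (intro allI impI)
    fix X :: "nat \<Rightarrow> complex" assume X0: "\<forall>i. X i \<in> UNIV - {z}" and Xz: "X \<longlonglongrightarrow> z"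
    have "eventually (\<lambda>i. dist (X i) z < 1) sequentially" using tendstoD[OF Xz, of 1] by simp
    then obtain n0 where n0: "\<And>i. i \<ge> n0 \<Longrightarrow> dist (X i) z < 1" unfolding eventually_sequentially by blast
    \<comment> \<open>Dropping finitely many terms makes the domination valid for every index, as
      dominated convergence requires.\<close>
    define Y where "Y i = X (i + n0)" for i
    have Y: "Y i \<noteq> z" "Y i \<in> cball z 1" for i using X0 n0[of "i + n0"] by (auto simp: Y_def dist_commute)
    have Yz: "Y \<longlonglongrightarrow> z" unfolding Y_def using Xz by (rule LIMSEQ_ignore_initial_segment)
    have "(\<lambda>i. integral {p..q} (\<lambda>y. (F (Y i) y * g y - F z y * g y) * (1 / (Y i - z)))) \<longlonglongrightarrow> ?D"
    proof (rule dominated_convergence(2)[where h = "\<lambda>y. B * norm (g y)"])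
      show "(\<lambda>y. (F (Y i) y * g y - F z y * g y) * (1 / (Y i - z))) integrable_on {p..q}" for i
        by (intro integrable_on_mult_left integrable_diff abs_integrable_imp(1)[OF FL])
      show "(\<lambda>y. B * norm (g y)) integrable_on {p..q}" by (intro integrable_on_mult_right abs_integrable_imp(2)[OF g])
      show "norm ((F (Y i) y * g y - F z y * g y) * (1 / (Y i - z))) \<le> B * norm (g y)" if "y \<in> {p..q}" for i y
      proof -
        have "(F (Y i) y * g y - F z y * g y) * (1 / (Y i - z)) = (F (Y i) y - F z y) / (Y i - z) * g y"
          by (simp add: algebra_simps diff_divide_distrib)
        moreover have "norm ((F (Y i) y - F z y) / (Y i - z)) \<le> B"
          using lip[OF that Y(2)[of i]] Y(1)[of i] by (simp add: norm_divide divide_le_eq)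
        ultimately show ?thesis by (simp only: norm_mult mult_right_mono norm_ge_zero)
      qed
      show "(\<lambda>i. (F (Y i) y * g y - F z y * g y) * (1 / (Y i - z))) \<longlonglongrightarrow> deriv (\<lambda>w. F w y) z * g y" if y: "y \<in> {p..q}" for y
      proof -
        have "((\<lambda>w. F w y) has_field_derivative deriv (\<lambda>w. F w y) z) (at z)"
          using hol[OF y] by (intro holomorphic_derivI[of _ UNIV]) auto
        then have "((\<lambda>w. (F w y - F z y) / (w - z)) \<longlongrightarrow> deriv (\<lambda>w. F w y) z) (at z)"
          by (simp add: has_field_derivative_iff)
        then have "((\<lambda>w. (F w y - F z y) / (w - z)) \<circ> Y) \<longlonglongrightarrow> deriv (\<lambda>w. F w y) z"
          unfolding tendsto_at_iff_sequentially using Y(1) Yz by auto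
        then have "(\<lambda>i. ((\<lambda>w. (F w y - F z y) / (w - z)) \<circ> Y) i * g y) \<longlonglongrightarrow> deriv (\<lambda>w. F w y) z * g y"
          by (intro tendsto_intros)
        then show ?thesis by (simp add: o_def algebra_simps diff_divide_distrib)
      qed
    qed
    moreover have "integral {p..q} (\<lambda>y. (F (Y i) y * g y - F z y * g y) * (1 / (Y i - z))) = (?G (Y i) - ?G z) / (Y i - z)" for i
      by (simp add: integral_diff abs_integrable_imp(1)[OF FL])
    ultimately have "(\<lambda>i. (?G (Y i) - ?G z) / (Y i - z)) \<longlonglongrightarrow> ?D" by (simp only:)
    then have "(\<lambda>i. ((\<lambda>w. (?G w - ?G z) / (w - z)) \<circ> X) (i + n0)) \<longlonglongrightarrow> ?D" by (simp only: Y_def o_def)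
    then show "((\<lambda>w. (?G w - ?G z) / (w - z)) \<circ> X) \<longlonglongrightarrow> ?D" by (rule LIMSEQ_offset)
  qed
  then have "(?G has_field_derivative ?D) (at z)" by (simp add: has_field_derivative_iff)
  then show "?G field_differentiable at z within UNIV" using field_differentiable_def by auto
qed

text \<open>Lower semicontinuity of the L2 norm: bounds proved for approximations pass to pointwise
  limits.\<close>

lemma square_integrable_Fatou:
  assumes J: "J \<in> sets lebesgue" and fn: "\<And>n. square_integrable J (fn n)"
    and bd: "\<And>n. integral J (\<lambda>x. (norm (fn n x))\<^sup>2) \<le> K"
    and lim: "\<And>x. x \<in> J \<Longrightarrow> (\<lambda>n. fn n x) \<longlonglongrightarrow> f x"
  shows "square_integrable J f" "integral J (\<lambda>x. (norm (f x))\<^sup>2) \<le> K"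
proof -
  let ?M = "lebesgue_on J"
  have mf: "f \<in> borel_measurable ?M"
    by (rule borel_measurable_LIMSEQ_metric[of fn]) (use fn lim square_integrable_measurable in \<open>auto simp: space_restrict_space\<close>)
  have K0: "0 \<le> K"
    using Henstock_Kurzweil_Integration.integral_nonneg[OF square_integrable_integrable[OF fn[of 0]]] bd[of 0] by (meson order_trans zero_le_power2)
  have intn: "integrable ?M (\<lambda>x. (norm (fn n x))\<^sup>2)" for n
    using fn[of n] J unfolding square_integrable_def by (simp add: absolutely_integrable_imp_integrable)
  have nn: "(\<integral>\<^sup>+x. ennreal ((norm (fn n x))\<^sup>2) \<partial>?M) \<le> ennreal K" for n
  proof -
    have "(\<integral>\<^sup>+x. ennreal ((norm (fn n x))\<^sup>2) \<partial>?M) = ennreal (integral J (\<lambda>x. (norm (fn n x))\<^sup>2))"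
      using intn[of n] J by (subst nn_integral_eq_integral) (auto simp: lebesgue_integral_eq_integral)
    then show ?thesis using bd[of n] by (simp add: ennreal_leI)
  qed
  have "(\<integral>\<^sup>+x. ennreal ((norm (f x))\<^sup>2) \<partial>?M) \<le> (\<integral>\<^sup>+x. liminf (\<lambda>n. ennreal ((norm (fn n x))\<^sup>2)) \<partial>?M)"
  proof (rule nn_integral_mono)
    fix x assume "x \<in> space ?M"
    then have "x \<in> J" by (simp add: space_restrict_space)
    then have "(\<lambda>n. ennreal ((norm (fn n x))\<^sup>2)) \<longlonglongrightarrow> ennreal ((norm (f x))\<^sup>2)"
      by (intro tendsto_ennrealI tendsto_intros lim)
    then have "liminf (\<lambda>n. ennreal ((norm (fn n x))\<^sup>2)) = ennreal ((norm (f x))\<^sup>2)"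
      by (intro lim_imp_Liminf) auto
    then show "ennreal ((norm (f x))\<^sup>2) \<le> liminf (\<lambda>n. ennreal ((norm (fn n x))\<^sup>2))" by simp
  qed
  also have "\<dots> \<le> liminf (\<lambda>n. \<integral>\<^sup>+x. ennreal ((norm (fn n x))\<^sup>2) \<partial>?M)"
    using square_integrable_measurable[OF fn] by (intro nn_integral_liminf) measurable
  also have "\<dots> \<le> ennreal K"
    by (rule Liminf_le) (use nn in \<open>auto intro: eventuallyI\<close>)
  finally have le: "(\<integral>\<^sup>+x. ennreal ((norm (f x))\<^sup>2) \<partial>?M) \<le> ennreal K" .
  have fin: "(\<integral>\<^sup>+x. ennreal ((norm (f x))\<^sup>2) \<partial>?M) < \<infinity>" using le ennreal_less_top le_less_trans by fastforce
  have int: "integrable ?M (\<lambda>x. (norm (f x))\<^sup>2)"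
    by (rule integrableI_nonneg) (use mf fin in auto)
  then show "square_integrable J f" using mf J integrable_on_lebesgue_on by (auto simp: square_integrable_iff)
  have "ennreal (integral J (\<lambda>x. (norm (f x))\<^sup>2)) = (\<integral>\<^sup>+x. ennreal ((norm (f x))\<^sup>2) \<partial>?M)"
    using int J by (subst nn_integral_eq_integral) (auto simp: lebesgue_integral_eq_integral)
  then show "integral J (\<lambda>x. (norm (f x))\<^sup>2) \<le> K" using le ennreal_le_iff[OF K0] by metis
qed

lemma integral_two_tails:
  fixes h :: "real \<Rightarrow> 'a::euclidean_space"
  assumes c: "c \<in> einterval a b" and int: "h absolutely_integrable_on (einterval a b)"
  shows "integral (einterval a b) h = integral (tail s a b c) h + integral (tail (\<not> s) a b c) h"
proof -
  have i: "h absolutely_integrable_on (tail s a b c)" for s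
    by (rule set_integrable_subset[OF int]) (use tail_subset[OF c] in auto)
  have "einterval a b - (tail s a b c \<union> tail (\<not> s) a b c) \<subseteq> {c}"
    by (auto simp: tail_def einterval_iff)
  moreover have "tail s a b c \<union> tail (\<not> s) a b c \<subseteq> einterval a b" using tail_subset[OF c] by blast
  ultimately have "integral (einterval a b) h = integral (tail s a b c \<union> tail (\<not> s) a b c) h"
    by (intro integral_spike_set) (auto intro: negligible_subset[of "{c}"] negligible_subset[of "{}"])
  also have "\<dots> = integral (tail s a b c) h + integral (tail (\<not> s) a b c) h"
  proof (rule integral_Un)
    have "tail s a b c \<inter> tail (\<not> s) a b c = {}" by (auto simp: tail_def einterval_iff)
    then show "negligible (tail s a b c \<inter> tail (\<not> s) a b c)" by simp
  qed (use i abs_integrable_imp in auto)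
  finally show ?thesis .
qed

lemma tail_integral_ac_deriv:
  fixes h :: "real \<Rightarrow> complex"
  assumes int: "h absolutely_integrable_on (einterval a b)"
  shows "ac_deriv (einterval a b) (\<lambda>x. integral (tail s a b x) h) (\<lambda>x. (if s then 1 else - 1) * h x)"
  unfolding ac_deriv_def
proof (intro conjI ballI impI)
  have L: "L1_loc (einterval a b) h"
    unfolding L1_loc_def using set_integrable_subset[OF int] lmeasurable_compact fmeasurableD by blast
  then show "L1_loc (einterval a b) (\<lambda>x. (if s then 1 else - 1) * h x)"
    by (intro L1_loc_mult_continuous) auto
  fix x y assume xy: "x \<in> einterval a b" "y \<in> einterval a b" "x \<le> y"
  have i: "h absolutely_integrable_on (tail s a b c)" if "c \<in> einterval a b" for c
    by (rule set_integrable_subset[OF int]) (use tail_subset[OF that] in auto)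
  show "integral (tail s a b y) h - integral (tail s a b x) h = integral {x..y} (\<lambda>x. (if s then 1 else - 1) * h x)"
  proof (cases "x = y")
    case True then show ?thesis by simp
  next
    case False
    then have lt: "x < y" using xy by simp
    show ?thesis
    proof (cases s)
      case True
      then have "x \<in> tail s a b y" using lt xy by (auto simp: tail_def einterval_iff)
      then show ?thesis using integral_tail_split(1)[OF i[OF xy(2)] xy(2), of x] True lt by (simp add: seg_def)
    next
      case False
      then have "y \<in> tail s a b x" using lt xy by (auto simp: tail_def einterval_iff)
      then show ?thesis using integral_tail_split(1)[OF i[OF xy(1)] xy(1), of y] False lt by (simp add: seg_def)
    qed
  qed
qed

lemma tail_integral_limits:
  fixes h :: "real \<Rightarrow> complex"
  assumes ab: "a < b" and int: "h absolutely_integrable_on (einterval a b)"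
  shows "((\<lambda>x. integral (tail s a b x) h) \<longlongrightarrow> 0) (end_filter s a b)"
    and "((\<lambda>x. integral (tail s a b x) h) \<longlongrightarrow> integral (einterval a b) h) (end_filter (\<not> s) a b)"
proof -
  show *: "((\<lambda>x. integral (tail s a b x) h) \<longlongrightarrow> 0) (end_filter s a b)" for s
  proof -
    obtain c where c: "c \<in> einterval a b" using einterval_nonempty[OF ab] by blast
    let ?g = "if s then 1 else - 1 :: complex"
    have i: "h absolutely_integrable_on (tail s a b c)"
      by (rule set_integrable_subset[OF int]) (use tail_subset[OF c] in auto)
    then have i': "(\<lambda>x. ?g * h x) absolutely_integrable_on (tail s a b c)" by (intro set_integrable_mult_right) auto
    obtain L where L: "((\<lambda>x. integral (tail s a b x) h) \<longlongrightarrow> L) (end_filter s a b)"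
      "\<And>x. x \<in> tail s a b c \<union> {c} \<Longrightarrow> integral (tail s a b x) h - L = ?g * integral (tail s a b x) (\<lambda>x. ?g * h x)"
      using ac_deriv_tail_limit[OF ab tail_integral_ac_deriv[OF int, of s] c i'] by metis
    have "L = 0" using L(2)[of c] by (auto split: if_splits)
    then show ?thesis using L(1) by simp
  qed
  obtain c where c: "c \<in> einterval a b" using einterval_nonempty[OF ab] by blast
  have "((\<lambda>x. integral (einterval a b) h - integral (tail (\<not> s) a b x) h) \<longlongrightarrow> integral (einterval a b) h - 0) (end_filter (\<not> s) a b)"
    by (intro tendsto_intros *)
  then have "((\<lambda>x. integral (einterval a b) h - integral (tail (\<not> s) a b x) h) \<longlongrightarrow> integral (einterval a b) h) (end_filter (\<not> s) a b)" by simp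
  then show "((\<lambda>x. integral (tail s a b x) h) \<longlongrightarrow> integral (einterval a b) h) (end_filter (\<not> s) a b)"
  proof (rule Lim_transform_eventually)
    show "eventually (\<lambda>x. integral (einterval a b) h - integral (tail (\<not> s) a b x) h = integral (tail s a b x) h) (end_filter (\<not> s) a b)"
      using eventually_in_tail[OF ab c, of "\<not> s"]
    proof eventually_elim
      case (elim x)
      then have "x \<in> einterval a b" using tail_subset[OF c] by blast
      then show ?case using integral_two_tails[OF _ int, of x s] by simp
    qed
  qed
qed

lemma end_filter_real_right:
  assumes "a < ereal c"
  shows "end_filter False a (ereal c) = at_left c"
proof (rule filter_eqI)
  fix P :: "real \<Rightarrow> bool"
  have "eventually P (at_left c) \<longleftrightarrow> (\<exists>t<c. \<forall>y>t. y < c \<longrightarrow> P y)" by (rule eventually_at_left[of "c - 1"]) simp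
  also have "\<dots> \<longleftrightarrow> (\<exists>t\<in>einterval a (ereal c). \<forall>x\<in>tail False a (ereal c) t. P x)"
  proof
    assume "\<exists>t<c. \<forall>y>t. y < c \<longrightarrow> P y"
    then obtain t where t: "t < c" "\<And>y. y > t \<Longrightarrow> y < c \<Longrightarrow> P y" by blast
    obtain d where d: "max a (ereal t) < ereal d" "ereal d < ereal c" using ereal_dense2[of "max a (ereal t)" "ereal c"] t assms by auto
    then show "\<exists>t\<in>einterval a (ereal c). \<forall>x\<in>tail False a (ereal c) t. P x"
      using t(2) by (intro bexI[of _ d]) (auto simp: tail_def einterval_iff)
  next
    assume "\<exists>t\<in>einterval a (ereal c). \<forall>x\<in>tail False a (ereal c) t. P x"
    then obtain t where "t \<in> einterval a (ereal c)" "\<And>x. x \<in> tail False a (ereal c) t \<Longrightarrow> P x" by blast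
    then show "\<exists>t<c. \<forall>y>t. y < c \<longrightarrow> P y" by (intro exI[of _ t]) (auto simp: tail_def einterval_iff)
  qed
  finally show "eventually P (end_filter False a (ereal c)) = eventually P (at_left c)"
    using eventually_end_filter[OF assms] by blast
qed

subsection \<open>Discreteness of the Dirichlet restrictions\<close>

lemma dotc_commute: "dotc u v = dotc v u" by (simp add: dotc_def mult.commute)

text \<open>A real boundary spinor makes the boundary condition invariant under conjugation.\<close>

lemma wronskian_tendsto_left:
  assumes "(wronskian v f \<longlongrightarrow> 0) F" "eventually (\<lambda>x. \<forall>i. v x $ i \<in> \<real>) F"
  shows "(wronskian v (\<lambda>x. cnjv (f x)) \<longlongrightarrow> 0) F"
proof (rule Lim_transform_eventually)
  show "((\<lambda>x. cnj (wronskian v f x)) \<longlongrightarrow> 0) F" using tendsto_cnj[OF assms(1)] by simp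
  show "eventually (\<lambda>x. cnj (wronskian v f x) = wronskian v (\<lambda>x. cnjv (f x)) x) F"
    using assms(2) by eventually_elim (simp add: wronskian_def Reals_cnj_iff)
qed

lemma dirac_expr_cnjv:
  assumes f: "dirac_expr S Q f g" and S: "open S" "is_interval S"
    and real: "\<And>x i j. x \<in> S \<Longrightarrow> Q x $ i $ j \<in> \<real>"
  shows "dirac_expr S Q (\<lambda>x. cnjv (f x)) (\<lambda>x. cnjv (g x))"
  unfolding dirac_expr_iff[OF S]
proof
  note * = f[unfolded dirac_expr_iff[OF S]]
  have r: "cnj (Q x $ i $ j) = Q x $ i $ j" if "x \<in> S" for x i j
    using real[OF that] by (simp add: Reals_cnj_iff)
  show "ac_deriv S (\<lambda>x. cnjv (f x) $ 1) (\<lambda>x. cnjv (g x) $ 2 - (Q x *v cnjv (f x)) $ 2)"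
    by (rule ac_deriv_cong[OF ac_deriv_linear[OF conjunct1[OF *] S(2) bounded_linear_cnj] S(2)]) (auto simp: r)
  show "ac_deriv S (\<lambda>x. cnjv (f x) $ 2) (\<lambda>x. (Q x *v cnjv (f x)) $ 1 - cnjv (g x) $ 1)"
    by (rule ac_deriv_cong[OF ac_deriv_linear[OF conjunct2[OF *] S(2) bounded_linear_cnj] S(2)]) (auto simp: r)
qed

lemma square_integrable_cnjv:
  assumes "square_integrable S f" shows "square_integrable S (\<lambda>x. cnjv (f x))"
proof -
  have "continuous_on UNIV cnjv" by (rule continuous_on_cnjv[of UNIV "\<lambda>x. x", simplified])
  then have "(\<lambda>x. cnjv (f x)) \<in> borel_measurable (lebesgue_on S)"
    using measurable_compose[OF square_integrable_measurable[OF assms] borel_measurable_continuous_onI] by blast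
  then show ?thesis using assms by (simp add: square_integrable_iff)
qed

lemma isCont_of_hol: "(\<And>i. (\<lambda>z. F z $ i) holomorphic_on UNIV) \<Longrightarrow> isCont F z" for F :: "complex \<Rightarrow> complex^2"
  unfolding isCont_def
  by (rule vec_tendstoI) (metis holomorphic_on_imp_continuous_on continuous_on_eq_continuous_at isCont_def open_UNIV UNIV_I)

text \<open>On a bounded interval a constant vector is square integrable, and pairing with it
  extracts a component.\<close>

lemma square_integrable_component:
  assumes g: "square_integrable {p<..<q} g"
  shows "(\<lambda>y. g y $ i) absolutely_integrable_on {p..q}"
proof -
  have "square_integrable {p..q} (\<lambda>_. axis i 1 :: complex^2)" by (rule square_integrable_Icc) simp
  then have "square_integrable {p<..<q} (\<lambda>_. axis i 1 :: complex^2)" by (rule square_integrable_subset) auto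
  from square_integrable_prod(2)[OF g this]
  have "(\<lambda>y. dotc (g y) (axis i 1)) absolutely_integrable_on {p<..<q}" by simp
  moreover have "dotc u (axis i 1) = u $ i" for u using exhaust_2[of i] by (auto simp: dotc_def axis_def)
  ultimately have *: "(\<lambda>y. g y $ i) absolutely_integrable_on {p<..<q}" by simp
  show ?thesis
    by (rule absolutely_integrable_spike_set[OF *]) (auto intro: negligible_subset[of "{p, q}"])
qed

context dirac_system
begin

lemma U_hol: "x \<in> I \<Longrightarrow> (\<lambda>z. U z x $ i) holomorphic_on UNIV"
  and V_hol: "x \<in> I \<Longrightarrow> (\<lambda>z. V z x $ i) holomorphic_on UNIV"
  using U V by (auto simp: real_entire_solution_def)

lemma dotc_integral_hol:
  assumes F: "\<And>z. sol z (F z)" and hol: "\<And>x i. x \<in> I \<Longrightarrow> (\<lambda>z. F z x $ i) holomorphic_on UNIV"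
    and pq: "p \<in> I" "q \<in> I" and g: "square_integrable {p<..<q} g"
  shows "(\<lambda>z. integral {p..q} (\<lambda>y. dotc (F z y) (g y))) holomorphic_on UNIV"
proof -
  have sub: "{p..q} \<subseteq> I" by (rule interval_Icc_subset[OF _ pq]) simp
  have J: "continuous_on (UNIV \<times> I) (\<lambda>(z, x). F z x)"
    by (rule jointly_continuous[OF F]) (intro isCont_of_hol hol)
  have cont: "continuous_on (UNIV \<times> {p..q}) (\<lambda>(z, y). F z y $ i)" for i
  proof -
    have "continuous_on (UNIV \<times> {p..q}) (\<lambda>u. (case u of (z, x) \<Rightarrow> F z x) $ i)"
      by (intro continuous_intros continuous_on_subset[OF J]) (use sub in auto)
    then show ?thesis by (simp add: case_prod_unfold)
  qed
  note gi = square_integrable_component[OF g]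
  have hi: "(\<lambda>z. integral {p..q} (\<lambda>y. F z y $ i * g y $ i)) holomorphic_on UNIV" for i
    by (rule holomorphic_param_integral[OF cont _ gi]) (use hol sub in blast)
  have ii: "(\<lambda>y. F z y $ i * g y $ i) integrable_on {p..q}" for z i
  proof -
    have "continuous_on {p..q} (\<lambda>y. F z y $ i)"
      by (intro continuous_intros continuous_on_subset[OF sol_continuous[OF F] sub])
    then have "L1_loc {p..q} (\<lambda>y. F z y $ i * g y $ i)"
      by (intro L1_loc_mult_continuous) (use gi in \<open>auto simp: L1_loc_def intro: set_integrable_subset lmeasurable_compact fmeasurableD\<close>)
    then show ?thesis by (intro abs_integrable_imp(1) L1_loc_Icc) auto
  qed
  have "integral {p..q} (\<lambda>y. dotc (F z y) (g y)) =
    integral {p..q} (\<lambda>y. F z y $ 1 * g y $ 1) + integral {p..q} (\<lambda>y. F z y $ 2 * g y $ 2)" for z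
    unfolding dotc_def by (rule integral_add[OF ii ii])
  then show ?thesis using hi by (simp add: holomorphic_on_add)
qed

end

text \<open>The decisive assumption is \<open>U_dom\<close>: for every \<open>z\<close> the entire
  solution \<open>U z\<close> satisfies the conditions at \<open>a\<close>. No condition at
  \<open>b\<close> enters.\<close>

locale dirac_left = dirac_system +
  fixes v :: "real \<Rightarrow> complex^2" and c :: real
  assumes bc: "bc_ok True v"
    and v_real: "\<And>x i. x \<in> I \<Longrightarrow> v x $ i \<in> \<real>"
    and U_dom: "\<And>z. in_dom_near True a b v (U z)"
    and c: "c \<in> I"
begin

definition "J = einterval a (ereal c)"
text \<open>The solution with value \<open>(0, 1)\<close> at \<open>c\<close>, hence satisfying the
  Dirichlet condition there.\<close>

definition "\<xi> z x = (V z c $ 1) *s U z x + (- (U z c $ 1)) *s V z x"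
text \<open>The characteristic function: it is the Wronskian of \<open>U z\<close> and
  \<open>\<xi> z\<close>, the denominator of Green's function, and \<open>U z\<close> is a Dirichlet
  eigenfunction where it vanishes.\<close>

definition "\<Delta> z = U z c $ 1"
definition E :: "(real \<Rightarrow> complex^2) \<Rightarrow> real" where "E f = integral J (\<lambda>x. (norm (f x))\<^sup>2)"

lemma ac: "a < ereal c" using c by (simp add: einterval_iff)
lemma J_tail: "J = tail True a b c" by (simp add: J_def tail_def)
lemma J_sub: "J \<subseteq> I" unfolding J_tail by (rule tail_subset[OF c])
lemma J_simps [simp]: "open J" "is_interval J" "J \<in> sets lebesgue" by (simp_all add: J_def)
lemma end_left: "end_filter True a (ereal c) = end_filter True a b" by (simp add: end_filter_def)
lemma end_right: "end_filter False a (ereal c) = at_left c" by (rule end_filter_real_right[OF ac])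

lemma \<xi>_sol: "sol z (\<xi> z)" 
  unfolding \<xi>_def[abs_def] by (intro sol_add sol_cmult U_sol V_sol)

lemma \<xi>_c: "\<xi> z c $ 1 = 0" by (simp add: \<xi>_def)

lemma W_U_\<xi>: "x \<in> I \<Longrightarrow> wronskian (U z) (\<xi> z) x = \<Delta> z"
  using WVU[of x z] by (simp add: wronskian_def \<xi>_def \<Delta>_def algebra_simps)

lemma \<xi>_hol: "x \<in> I \<Longrightarrow> (\<lambda>z. \<xi> z x $ i) holomorphic_on UNIV"
  unfolding \<xi>_def by (simp, intro holomorphic_intros U_hol V_hol c)

lemma \<Delta>_hol: "\<Delta> holomorphic_on UNIV"
  unfolding \<Delta>_def[abs_def] by (rule U_hol[OF c])

lemma sol_J: "sol z u \<Longrightarrow> dirac_solution J Q z u"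
  unfolding dirac_solution_def by (rule dirac_expr_subset[OF _ J_sub]) auto

lemma U_J: "square_integrable J (U z)"
  unfolding J_tail using sol_L2_nearD[OF _ U_sol c] U_dom unfolding in_dom_near_def by blast

lemma sol_Icc: "sol z u \<Longrightarrow> x \<in> J \<Longrightarrow> square_integrable {x..c} u"
  by (intro square_integrable_Icc continuous_on_subset[OF sol_continuous] interval_Icc_subset)
    (use J_sub c in auto)

lemma E_nonneg: "square_integrable J f \<Longrightarrow> 0 \<le> E f"
  unfolding E_def by (rule Henstock_Kurzweil_Integration.integral_nonneg[OF square_integrable_integrable]) auto

text \<open>The imaginary part of the quadratic form \<open>\<langle>f, (\<tau> - z) f\<rangle>\<close>.\<close>

lemma energy_bound:
  assumes f: "dirac_expr J Q f (\<lambda>x. z *s f x + g x)" and fs: "square_integrable J f" and gs: "square_integrable J g"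
    and l: "(wronskian (\<lambda>x. cnjv (f x)) f \<longlongrightarrow> 0) (end_filter True a b)"
    and r: "(wronskian (\<lambda>x. cnjv (f x)) f \<longlongrightarrow> 0) (at_left c)"
  shows "(Im z)\<^sup>2 * E f \<le> E g"
proof -
  let ?w' = "\<lambda>x. dotc (cnjv (z *s f x + g x)) (f x) - dotc (cnjv (f x)) (z *s f x + g x)"
  have ac': "ac_deriv J (wronskian (\<lambda>x. cnjv (f x)) f) ?w'"
    by (rule wronskian_ac_deriv[OF dirac_expr_cnjv[OF f] f]) (use Q_real Q_sym J_sub in auto)
  let ?h = "\<lambda>x. dotc (cnjv (g x)) (f x) - dotc (cnjv (f x)) (g x)"
  have eq: "?w' x = (cnj z - z) * of_real ((norm (f x))\<^sup>2) + ?h x" for x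
    unfolding dotc_cnjv[symmetric] by (simp add: dotc_def algebra_simps)
  have i1: "(\<lambda>x. complex_of_real ((norm (f x))\<^sup>2)) absolutely_integrable_on J"
    using fs absolutely_integrable_linear[OF _ bounded_linear_of_real] unfolding square_integrable_def o_def by blast
  note i2 = square_integrable_prod(2)[OF square_integrable_cnjv[OF gs] fs J_simps(3)]
    square_integrable_prod(2)[OF square_integrable_cnjv[OF fs] gs J_simps(3)]
  have ih: "?h absolutely_integrable_on J" by (rule set_integral_diff(1)[OF i2])
  have i1': "(\<lambda>x. (cnj z - z) * of_real ((norm (f x))\<^sup>2)) absolutely_integrable_on J"
    using i1 by (intro set_integrable_mult_right) auto
  have "integral J (\<lambda>x. (cnj z - z) * of_real ((norm (f x))\<^sup>2) + ?h x) = 0 - 0"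
    unfolding J_def
  proof (rule ac_deriv_integral_ends[OF ac, where w = "wronskian (\<lambda>x. cnjv (f x)) f"])
    show "ac_deriv (einterval a (ereal c)) (wronskian (\<lambda>x. cnjv (f x)) f) (\<lambda>x. (cnj z - z) * of_real ((norm (f x))\<^sup>2) + ?h x)"
      using ac' unfolding eq J_def .
    show "(\<lambda>x. (cnj z - z) * of_real ((norm (f x))\<^sup>2) + ?h x) absolutely_integrable_on einterval a (ereal c)"
      using set_integral_add(1)[OF i1' ih] unfolding J_def .
  qed (use l r in \<open>simp_all add: end_left end_right\<close>)
  also have "integral J (\<lambda>x. (cnj z - z) * of_real ((norm (f x))\<^sup>2) + ?h x) =
      (cnj z - z) * integral J (\<lambda>x. complex_of_real ((norm (f x))\<^sup>2)) + integral J ?h"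
    by (subst integral_add[OF abs_integrable_imp(1)[OF i1'] abs_integrable_imp(1)[OF ih]]) simp
  also have "integral J (\<lambda>x. complex_of_real ((norm (f x))\<^sup>2)) = of_real (E f)"
    using integral_linear[OF square_integrable_integrable[OF fs] bounded_linear_of_real] unfolding o_def E_def .
  \<comment> \<open>The boundary terms vanish, and the left-hand side is \<open>2 i Im z\<close>
    times the energy of \<open>f\<close>; Cauchy-Schwarz on the right gives the bound.\<close>
  finally have e: "(z - cnj z) * of_real (E f) = integral J ?h" by (simp add: algebra_simps eq_neg_iff_add_eq_0)
  have E0: "0 \<le> E f" by (rule E_nonneg[OF fs])
  let ?X = "integral J (\<lambda>x. norm (f x) * norm (g x))"
  have ifg: "(\<lambda>x. norm (f x) * norm (g x)) integrable_on J" by (rule square_integrable_prod(1)[OF fs gs J_simps(3)])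
  have "norm (integral J ?h) \<le> integral J (\<lambda>x. 2 * (norm (f x) * norm (g x)))"
  proof (rule integral_norm_le[OF ih integrable_on_mult_right[OF ifg]])
    fix x
    have "norm (?h x) \<le> norm (cnjv (g x)) * norm (f x) + norm (cnjv (f x)) * norm (g x)"
      by (intro order_trans[OF norm_triangle_ineq4] add_mono norm_dotc_le)
    then show "norm (?h x) \<le> 2 * (norm (f x) * norm (g x))" by (simp add: mult.commute)
  qed
  then have "norm (z - cnj z) * E f \<le> 2 * ?X" unfolding e[symmetric] norm_mult using E0 by simp
  then have "\<bar>Im z\<bar> * E f \<le> ?X" by (simp add: complex_diff_cnj norm_mult)
  then have "(\<bar>Im z\<bar> * E f)\<^sup>2 \<le> ?X\<^sup>2" using E0 by (intro power_mono) auto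
  also have "\<dots> \<le> E f * E g" unfolding E_def by (rule integral_Cauchy_Schwarz[OF fs gs J_simps(3)])
  finally have *: "(Im z)\<^sup>2 * (E f * E f) \<le> E f * E g" by (simp add: power_mult_distrib power2_eq_square mult_ac)
  show ?thesis
  proof (cases "E f = 0")
    case True then show ?thesis using E_nonneg[OF gs] by simp
  next
    case False
    then have "E f > 0" using E0 by simp
    then show ?thesis using * by (simp add: mult.left_commute)
  qed
qed

text \<open>The conjugate of \<open>U z\<close> solves the equation at \<open>cnj z\<close> and
  satisfies the same real boundary condition, so the Wronskian of two solutions in the domain is at
  hand.\<close>

lemma U_left_form: "(wronskian (\<lambda>x. cnjv (U z x)) (U z) \<longlongrightarrow> 0) (end_filter True a b)"
proof (rule dom_wronskian_limit[OF bc _ _ U_sol U_dom])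
  have "dirac_expr I Q (\<lambda>x. cnjv (U z x)) (\<lambda>x. cnjv (z *s U z x))"
    using U_sol[of z] unfolding dirac_solution_def by (rule dirac_expr_cnjv) (auto intro: Q_real)
  moreover have "cnjv (z *s u) = cnj z *s cnjv u" for u by (simp add: vec_eq_iff)
  ultimately show "sol (cnj z) (\<lambda>x. cnjv (U z x))" unfolding dirac_solution_def by simp
  have "L2_near True a b (\<lambda>x. cnjv (U z x))"
    using U_dom[of z] square_integrable_cnjv unfolding in_dom_near_def L2_near_def by blast
  moreover have "(wronskian v (\<lambda>x. cnjv (U z x)) \<longlongrightarrow> 0) (end_filter True a b)"
  proof (rule wronskian_tendsto_left)
    show "(wronskian v (U z) \<longlongrightarrow> 0) (end_filter True a b)" using U_dom by (simp add: in_dom_near_def)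
    show "eventually (\<lambda>x. \<forall>i. v x $ i \<in> \<real>) (end_filter True a b)"
      using eventually_in_tail[OF ab c, of True] by eventually_elim (use tail_subset[OF c] v_real in blast)
  qed
  ultimately show "in_dom_near True a b v (\<lambda>x. cnjv (U z x))" by (simp add: in_dom_near_def)
qed

lemma continuous_at_left_c: 
  assumes "sol z u" shows "((\<lambda>x. u x $ i) \<longlongrightarrow> u c $ i) (at_left c)"
proof -
  have "isCont u c" using sol_continuous[OF assms] c by (simp add: continuous_on_eq_continuous_at)
  then have "(u \<longlongrightarrow> u c) (at_left c)" unfolding isCont_def by (rule tendsto_mono[rotated]) (simp add: at_le)
  then show ?thesis by (rule tendsto_vec_nth)
qed

lemma wronskian_right_zero:
  assumes "((\<lambda>x. f x $ 1) \<longlongrightarrow> 0) (at_left c)" "((\<lambda>x. f x $ 2) \<longlongrightarrow> l) (at_left c)"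
  shows "(wronskian (\<lambda>x. cnjv (f x)) f \<longlongrightarrow> 0) (at_left c)"
proof -
  have "((\<lambda>x. cnj (f x $ 1) * f x $ 2 - cnj (f x $ 2) * f x $ 1) \<longlongrightarrow> cnj 0 * l - cnj l * 0) (at_left c)"
    by (intro tendsto_intros assms)
  then show ?thesis by (simp add: wronskian_def[abs_def])
qed

text \<open>If \<open>\<Delta> z\<close> vanished, \<open>U z\<close> would be an eigenfunction of a
  symmetric operator at a nonreal point; the energy bound with right-hand side 0 excludes
  this.\<close>

lemma \<Delta>_nonreal:
  assumes "Im z \<noteq> 0" shows "\<Delta> z \<noteq> 0"
proof
  assume D: "\<Delta> z = 0"
  have "(Im z)\<^sup>2 * E (U z) \<le> E (\<lambda>x. 0)"
  proof (rule energy_bound[where f = "U z" and g = "\<lambda>x. 0"])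
    show "dirac_expr J Q (U z) (\<lambda>x. z *s U z x + 0)" using sol_J[OF U_sol] by (simp add: dirac_solution_def)
    show "square_integrable J (\<lambda>x. 0 :: complex^2)" using integrable_0 by (simp add: square_integrable_iff)
    show "(wronskian (\<lambda>x. cnjv (U z x)) (U z) \<longlongrightarrow> 0) (at_left c)"
      by (rule wronskian_right_zero[OF _ continuous_at_left_c[OF U_sol]])
        (use continuous_at_left_c[OF U_sol, of z 1] D in \<open>simp add: \<Delta>_def\<close>)
  qed (rule U_J U_left_form)+
  then have "E (U z) \<le> 0" using assms by (simp add: E_def mult_le_0_iff)
  moreover obtain x1 where x1: "x1 \<in> J" using einterval_nonempty[OF ac] by (auto simp: J_def)
  obtain x0 where x0: "x0 \<in> tail True a (ereal c) x1" using tail_nonempty x1 unfolding J_def by blast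
  have x0J: "x0 \<in> J" using x0 tail_subset x1 unfolding J_def by blast
  have lt: "x0 < x1" using x0 by (simp add: tail_def einterval_iff)
  have "integral {x0..x1} (\<lambda>x. (norm (U z x))\<^sup>2) \<le> E (U z)"
    unfolding E_def
    by (rule integral_subset_le[OF interval_Icc_subset[OF J_simps(2) x0J x1] _ square_integrable_integrable[OF U_J]])
      (use J_sub x0J x1 interval_Icc_subset[OF J_simps(2) x0J x1] in \<open>auto intro!: integrable_continuous_real continuous_intros continuous_on_subset[OF sol_continuous[OF U_sol]]\<close>)
  moreover have "integral {x0..x1} (\<lambda>x. (norm (U z x))\<^sup>2) > 0" by (rule U_energy_pos) (use J_sub x0J x1 lt in auto)
  ultimately show False by linarith
qed

definition "GA z g x = integral (tail True a (ereal c) x) (\<lambda>y. dotc (g y) (U z y))"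
definition "GB z g x = integral (tail False a (ereal c) x) (\<lambda>y. dotc (\<xi> z y) (g y))"
text \<open>Green's operator: the kernel is \<open>- \<xi>(x) U(y) / \<Delta>\<close> for
  \<open>y < x\<close> and \<open>- U(x) \<xi>(y) / \<Delta>\<close> for \<open>y > x\<close>. Near
  \<open>a\<close> only \<open>U\<close> is integrated, which is square integrable there.\<close>

definition "green z g x = (- (1 / \<Delta> z) * GA z g x) *s \<xi> z x + (- (1 / \<Delta> z) * GB z g x) *s U z x"

lemma tail_J: "x \<in> J \<Longrightarrow> tail s a (ereal c) x \<subseteq> J" unfolding J_def by (rule tail_subset)

lemma gU: "square_integrable J g \<Longrightarrow> (\<lambda>y. dotc (g y) (U z y)) absolutely_integrable_on einterval a (ereal c)"
  using square_integrable_prod(2)[OF _ U_J J_simps(3)] unfolding J_def by blast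

text \<open>A solution need not be square integrable near \<open>a\<close>, so \<open>\<xi>\<close> is only paired with truncations of \<open>g\<close>.\<close>

lemma \<xi>g:
  assumes g: "square_integrable J g" and x: "x \<in> J"
  shows "(\<lambda>y. dotc (\<xi> z y) (g y)) absolutely_integrable_on tail False a (ereal c) x"
proof (rule square_integrable_prod(2))
  show "square_integrable (tail False a (ereal c) x) (\<xi> z)"
    by (rule square_integrable_subset[OF sol_Icc[OF \<xi>_sol x]]) (auto simp: tail_def einterval_iff)
  show "square_integrable (tail False a (ereal c) x) g"
    by (rule square_integrable_subset[OF g tail_J[OF x]]) simp
qed simp

lemma GA_ac: "square_integrable J g \<Longrightarrow> ac_deriv J (GA z g) (\<lambda>x. dotc (g x) (U z x))"
  using tail_integral_ac_deriv[OF gU, of g True z] unfolding GA_def[abs_def] J_def by simp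

lemma GA_left: "square_integrable J g \<Longrightarrow> (GA z g \<longlongrightarrow> 0) (end_filter True a b)"
  and GA_right: "square_integrable J g \<Longrightarrow> \<exists>l. (GA z g \<longlongrightarrow> l) (at_left c)"
  using tail_integral_limits[OF ac gU, of g True z] end_left end_right unfolding GA_def[abs_def] by auto

lemma GB_ac:
  assumes g: "square_integrable J g"
  shows "ac_deriv J (GB z g) (\<lambda>x. - dotc (\<xi> z x) (g x))"
  unfolding ac_deriv_def
proof (intro conjI ballI impI)
  have "L1_loc J (\<lambda>x. dotc (\<xi> z x) (g x))"
    unfolding L1_loc_def
  proof (intro allI impI)
    fix K assume K: "compact K \<and> K \<subseteq> J"
    have Km: "K \<in> sets lebesgue" using K lmeasurable_compact fmeasurableD by blast
    show "(\<lambda>x. dotc (\<xi> z x) (g x)) absolutely_integrable_on K"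
    proof (rule square_integrable_prod(2)[OF _ square_integrable_subset[OF g _ Km] Km])
      have cK: "continuous_on K (\<xi> z)" using K J_sub by (intro continuous_on_subset[OF sol_continuous[OF \<xi>_sol]]) blast
      have "(\<lambda>x. (norm (\<xi> z x))\<^sup>2) absolutely_integrable_on K"
        using L1_loc_continuous[OF continuous_on_power[OF continuous_on_norm[OF cK]], of 2] K unfolding L1_loc_def by auto
      then show "square_integrable K (\<xi> z)"
        unfolding square_integrable_def using continuous_imp_measurable_on_sets_lebesgue[OF cK Km] by blast
    qed (use K in auto)
  qed
  then show "L1_loc J (\<lambda>x. - dotc (\<xi> z x) (g x))" using L1_loc_linear bounded_linear_minus[OF bounded_linear_ident] by blast
  fix x y assume xy: "x \<in> J" "y \<in> J" "x \<le> y"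
  show "GB z g y - GB z g x = integral {x..y} (\<lambda>x. - dotc (\<xi> z x) (g x))"
  proof (cases "x = y")
    case True then show ?thesis by simp
  next
    case False
    then have "y \<in> tail False a (ereal c) x" using xy by (auto simp: tail_def einterval_iff J_def)
    then show ?thesis using integral_tail_split(1)[OF \<xi>g[OF g xy(1)], of y z] xy False
      unfolding GB_def J_def by (simp add: seg_def)
  qed
qed

lemma GB_right:
  assumes g: "square_integrable J g" shows "(GB z g \<longlongrightarrow> 0) (at_left c)"
proof -
  obtain x where x: "x \<in> J" using einterval_nonempty[OF ac] by (auto simp: J_def)
  have xc: "ereal x < ereal c" using x by (simp add: J_def einterval_iff)
  have "((\<lambda>y. integral (tail False (ereal x) (ereal c) y) (\<lambda>y. dotc (\<xi> z y) (g y))) \<longlongrightarrow> 0) (end_filter False (ereal x) (ereal c))"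
    by (rule tail_integral_limits(1)[OF xc]) (use \<xi>g[OF g x, of z] in \<open>simp add: tail_def\<close>)
  then show ?thesis by (simp add: end_filter_real_right[OF xc] GB_def[abs_def] tail_def)
qed

lemma green_expr:
  assumes g: "square_integrable J g" and D: "\<Delta> z \<noteq> 0"
  shows "dirac_expr J Q (green z g) (\<lambda>x. z *s green z g x + g x)"
  unfolding dirac_expr_iff[OF J_simps(1,2)]
proof
  let ?k = "- (1 / \<Delta> z)"
  note S = J_simps(1,2)
  note \<xi>J = sol_J[OF \<xi>_sol[of z], unfolded dirac_solution_def dirac_expr_iff[OF S]]
  note UJ = sol_J[OF U_sol[of z], unfolded dirac_solution_def dirac_expr_iff[OF S]]
  note kA = ac_deriv_cmult[OF GA_ac[OF g, of z] S(2), of ?k] and kB = ac_deriv_cmult[OF GB_ac[OF g, of z] S(2), of ?k]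
  have W: "U z x $ 1 * \<xi> z x $ 2 - U z x $ 2 * \<xi> z x $ 1 = \<Delta> z" if "x \<in> J" for x
    using W_U_\<xi>[of x z] that J_sub by (auto simp: wronskian_def)
  \<comment> \<open>These are the terms in which \<open>GA\<close> and \<open>GB\<close> are
    differentiated; the Wronskian of \<open>U\<close> and \<open>\<xi>\<close> turns them into the
    inhomogeneity.\<close>
  have e1: "- (1 / \<Delta> z) * ((g1 * u1 + g2 * u2) * x1 - u1 * (x1 * g1 + x2 * g2)) = g2"
    and e2: "- (1 / \<Delta> z) * ((g1 * u1 + g2 * u2) * x2 - u2 * (x1 * g1 + x2 * g2)) = - g1"
    if "u1 * x2 - u2 * x1 = \<Delta> z" for u1 u2 x1 x2 g1 g2
  proof -
    have "(g1 * u1 + g2 * u2) * x1 - u1 * (x1 * g1 + x2 * g2) = - (u1 * x2 - u2 * x1) * g2" by (simp add: algebra_simps)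
    then show "- (1 / \<Delta> z) * ((g1 * u1 + g2 * u2) * x1 - u1 * (x1 * g1 + x2 * g2)) = g2" using that D by simp
    have "(g1 * u1 + g2 * u2) * x2 - u2 * (x1 * g1 + x2 * g2) = (u1 * x2 - u2 * x1) * g1" by (simp add: algebra_simps)
    then show "- (1 / \<Delta> z) * ((g1 * u1 + g2 * u2) * x2 - u2 * (x1 * g1 + x2 * g2)) = - g1" using that D by simp
  qed
  show "ac_deriv J (\<lambda>x. green z g x $ 1) (\<lambda>x. (z *s green z g x + g x) $ 2 - (Q x *v green z g x) $ 2)"
  proof (rule ac_deriv_cong[OF ac_deriv_add[OF ac_deriv_mult[OF kA conjunct1[OF \<xi>J] S] ac_deriv_mult[OF kB conjunct1[OF UJ] S] S(2)] S(2)])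
    fix x assume x: "x \<in> J"
    show "\<xi> z x $ 1 * (?k * dotc (g x) (U z x)) + ?k * GA z g x * ((z *s \<xi> z x) $ 2 - (Q x *v \<xi> z x) $ 2) +
       (U z x $ 1 * (?k * - dotc (\<xi> z x) (g x)) + ?k * GB z g x * ((z *s U z x) $ 2 - (Q x *v U z x) $ 2)) =
       (z *s green z g x + g x) $ 2 - (Q x *v green z g x) $ 2"
      using e1[OF W[OF x], of "g x $ 1" "g x $ 2"] by (simp add: green_def dotc_def algebra_simps)
  qed (simp add: green_def)
  show "ac_deriv J (\<lambda>x. green z g x $ 2) (\<lambda>x. (Q x *v green z g x) $ 1 - (z *s green z g x + g x) $ 1)"
  proof (rule ac_deriv_cong[OF ac_deriv_add[OF ac_deriv_mult[OF kA conjunct2[OF \<xi>J] S] ac_deriv_mult[OF kB conjunct2[OF UJ] S] S(2)] S(2)])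
    fix x assume x: "x \<in> J"
    show "\<xi> z x $ 2 * (?k * dotc (g x) (U z x)) + ?k * GA z g x * ((Q x *v \<xi> z x) $ 1 - (z *s \<xi> z x) $ 1) +
       (U z x $ 2 * (?k * - dotc (\<xi> z x) (g x)) + ?k * GB z g x * ((Q x *v U z x) $ 1 - (z *s U z x) $ 1)) =
       (Q x *v green z g x) $ 1 - (z *s green z g x + g x) $ 1"
      using e2[OF W[OF x], of "g x $ 1" "g x $ 2"] by (simp add: green_def dotc_def algebra_simps)
  qed (simp add: green_def)
qed

lemma green_right:
  assumes g: "square_integrable J g"
  shows "((\<lambda>x. green z g x $ 1) \<longlongrightarrow> 0) (at_left c)" and "\<exists>l. ((\<lambda>x. green z g x $ 2) \<longlongrightarrow> l) (at_left c)"
proof -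
  let ?k = "- (1 / \<Delta> z)"
  obtain l where l: "(GA z g \<longlongrightarrow> l) (at_left c)" using GA_right[OF g] by blast
  have *: "((\<lambda>x. green z g x $ i) \<longlongrightarrow> ?k * l * \<xi> z c $ i + ?k * 0 * U z c $ i) (at_left c)" for i
    unfolding green_def vector_add_component vector_smult_component
    by (intro tendsto_intros l GB_right[OF g] continuous_at_left_c[OF \<xi>_sol] continuous_at_left_c[OF U_sol])
  show "((\<lambda>x. green z g x $ 1) \<longlongrightarrow> 0) (at_left c)" using *[of 1] by (simp add: \<xi>_c)
  show "\<exists>l. ((\<lambda>x. green z g x $ 2) \<longlongrightarrow> l) (at_left c)" using * by blast
qed

text \<open>In the limit circle case \<open>\<xi>\<close> is square integrable near \<open>a\<close>
  too: \<open>GA\<close> tends to 0 against a convergent Wronskian, and \<open>GB\<close> converges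
  against one that tends to 0. Otherwise the condition is empty.\<close>

lemma green_left:
  assumes g: "square_integrable J g"
  shows "(wronskian v (green z g) \<longlongrightarrow> 0) (end_filter True a b)"
proof (cases "limit_circle True a b Q")
  case False then show ?thesis by (rule bc_ok_trivial[OF bc])
next
  case True
  have L2: "L2_near True a b f" if "sol z f" for z f using True that unfolding limit_circle_def by blast
  obtain \<zeta> where v: "sol \<zeta> v" using bc True by (auto simp: bc_ok_def)
  obtain L where L: "(wronskian v (\<xi> z) \<longlongrightarrow> L) (end_filter True a b)"
    by (rule sol_wronskian_limit[OF v L2[OF v] \<xi>_sol L2[OF \<xi>_sol]])
  have vU: "(wronskian v (U z) \<longlongrightarrow> 0) (end_filter True a b)" using U_dom by (simp add: in_dom_near_def)
  have "square_integrable J (\<xi> z)" unfolding J_tail by (rule sol_L2_nearD[OF L2[OF \<xi>_sol] \<xi>_sol c])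
  then have "(\<lambda>y. dotc (\<xi> z y) (g y)) absolutely_integrable_on einterval a (ereal c)"
    using square_integrable_prod(2)[OF _ g J_simps(3)] unfolding J_def by blast
  from tail_integral_limits(2)[OF ac this, of False]
  obtain M where M: "(GB z g \<longlongrightarrow> M) (end_filter True a b)" by (auto simp: GB_def[abs_def] end_left)
  let ?k = "- (1 / \<Delta> z)"
  have "((\<lambda>x. ?k * GA z g x * wronskian v (\<xi> z) x + ?k * GB z g x * wronskian v (U z) x) \<longlongrightarrow> ?k * 0 * L + ?k * M * 0) (end_filter True a b)"
    by (intro tendsto_intros GA_left[OF g] L M vU)
  moreover have "?k * GA z g x * wronskian v (\<xi> z) x + ?k * GB z g x * wronskian v (U z) x = wronskian v (green z g) x" for x
    by (simp add: green_def wronskian_def algebra_simps)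
  ultimately show ?thesis by simp
qed

end

section \<open>Uniqueness of derivatives almost everywhere\<close>

lemma tail_integral_norm_le:
  fixes h :: "real \<Rightarrow> complex"
  assumes "h absolutely_integrable_on (einterval a b)" "x \<in> einterval a b"
  shows "norm (integral (tail s a b x) h) \<le> integral (einterval a b) (\<lambda>y. norm (h y))"
proof -
  have i: "h absolutely_integrable_on (tail s a b x)"
    by (rule set_integrable_subset[OF assms(1)]) (use tail_subset[OF assms(2)] in auto)
  have "norm (integral (tail s a b x) h) \<le> integral (tail s a b x) (\<lambda>y. norm (h y))"
    by (rule integral_norm_le[OF i abs_integrable_imp(2)[OF i]]) simp
  also have "\<dots> \<le> integral (einterval a b) (\<lambda>y. norm (h y))"
    by (rule integral_subset_le) (use tail_subset[OF assms(2)] abs_integrable_imp(2)[OF i] abs_integrable_imp(2)[OF assms(1)] in auto)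
  finally show ?thesis .
qed

text \<open>Vanishing interval integrals imply that \<open>h\<close> is orthogonal to continuous
  functions. Approximating the phase \<open>cnj h / |h|\<close> by these shows that the integral of
  \<open>|h|\<close> is zero.\<close>

lemma zero_integrals_imp_AE_zero:
  fixes h :: "real \<Rightarrow> complex"
  assumes h: "h absolutely_integrable_on {p..q}"
    and zero: "\<And>x y. p \<le> x \<Longrightarrow> x \<le> y \<Longrightarrow> y \<le> q \<Longrightarrow> integral {x..y} h = 0"
  shows "AE x in lebesgue_on {p..q}. h x = 0"
proof (cases "p \<le> q")
  case False
  then show ?thesis by (simp add: AE_restrict_space_iff)
next
  case True
  let ?M = "lebesgue_on {p..q}"
  have hs: "h absolutely_integrable_on {x..y}" if "p \<le> x" "y \<le> q" for x y
    by (rule set_integrable_subset[OF h]) (use that in auto)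
  have L: "(\<lambda>x. \<phi> x * h x) absolutely_integrable_on {x..y}" if "continuous_on {p..q} \<phi>" "p \<le> x" "y \<le> q" for \<phi> x y
  proof -
    have "continuous_on {x..y} \<phi>" by (rule continuous_on_subset[OF that(1)]) (use that in auto)
    moreover have "L1_loc {x..y} h"
      unfolding L1_loc_def using set_integrable_subset[OF hs[OF that(2,3)]] lmeasurable_compact fmeasurableD by blast
    ultimately show ?thesis using L1_loc_mult_continuous L1_loc_Icc by blast
  qed
  have cont: "integral {p..q} (\<lambda>x. \<phi> x * h x) = 0" if \<phi>: "continuous_on {p..q} \<phi>" for \<phi>
  proof (rule additive_small_imp_zero[where D = "\<lambda>x y. integral {x..y} (\<lambda>x. \<phi> x * h x)" and \<mu> = "\<lambda>x y. integral {x..y} (\<lambda>x. norm (h x))"])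
    fix x y z assume x: "p \<le> x" "x \<le> y" "y \<le> z" "z \<le> q"
    show "integral {x..z} (\<lambda>x. \<phi> x * h x) = integral {x..y} (\<lambda>x. \<phi> x * h x) + integral {y..z} (\<lambda>x. \<phi> x * h x)"
      by (rule Henstock_Kurzweil_Integration.integral_combine[symmetric]) (use x abs_integrable_imp(1)[OF L[OF \<phi>]] in auto)
    show "integral {x..z} (\<lambda>x. norm (h x)) = integral {x..y} (\<lambda>x. norm (h x)) + integral {y..z} (\<lambda>x. norm (h x))"
      by (rule Henstock_Kurzweil_Integration.integral_combine[symmetric]) (use x abs_integrable_imp(2)[OF hs] in auto)
  next
    fix e :: real assume e: "e > 0"
    obtain d where d: "d > 0" "\<And>x y. x \<in> {p..q} \<Longrightarrow> y \<in> {p..q} \<Longrightarrow> dist x y < d \<Longrightarrow> dist (\<phi> x) (\<phi> y) < e"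
      using uniform_cont_Icc[OF \<phi> e] by blast
    have "norm (integral {x..y} (\<lambda>x. \<phi> x * h x)) \<le> e * integral {x..y} (\<lambda>x. norm (h x))"
      if x: "p \<le> x" "x \<le> y" "y \<le> q" "y - x < d" for x y
    proof -
      have a: "(\<lambda>s. \<phi> s * h s - \<phi> x * h s) absolutely_integrable_on {x..y}"
        using L[OF \<phi> x(1,3)] hs[OF x(1,3)] by (intro set_integral_diff set_integrable_mult_right) auto
      have "integral {x..y} (\<lambda>s. \<phi> s * h s - \<phi> x * h s) = integral {x..y} (\<lambda>s. \<phi> s * h s) - \<phi> x * integral {x..y} h"
        by (subst integral_diff[OF abs_integrable_imp(1)[OF L[OF \<phi> x(1,3)]] integrable_on_mult_right[OF abs_integrable_imp(1)[OF hs[OF x(1,3)]]]]) simp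
      then have "integral {x..y} (\<lambda>s. \<phi> s * h s) = integral {x..y} (\<lambda>s. \<phi> s * h s - \<phi> x * h s)"
        using zero[OF x(1-3)] by simp
      also have "norm \<dots> \<le> integral {x..y} (\<lambda>s. e * norm (h s))"
      proof (rule integral_norm_le[OF a integrable_on_mult_right[OF abs_integrable_imp(2)[OF hs[OF x(1,3)]]]])
        fix s assume s: "s \<in> {x..y}"
        have "\<phi> s * h s - \<phi> x * h s = (\<phi> s - \<phi> x) * h s" by (simp add: algebra_simps)
        then have "norm (\<phi> s * h s - \<phi> x * h s) = norm (\<phi> s - \<phi> x) * norm (h s)" by (simp add: norm_mult)
        also have "\<dots> \<le> e * norm (h s)"
          using d(2)[of s x] s x by (intro mult_right_mono) (auto simp: dist_norm)
        finally show "norm (\<phi> s * h s - \<phi> x * h s) \<le> e * norm (h s)" .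
      qed
      finally show ?thesis by simp
    qed
    then show "\<exists>d>0. \<forall>x y. p \<le> x \<longrightarrow> x \<le> y \<longrightarrow> y \<le> q \<longrightarrow> y - x < d \<longrightarrow>
        norm (integral {x..y} (\<lambda>x. \<phi> x * h x)) \<le> e * integral {x..y} (\<lambda>x. norm (h x))" using d(1) by blast
  qed (rule True)
  have hm: "h \<in> borel_measurable ?M"
    using absolutely_integrable_imp_integrable[OF h] by (intro borel_measurable_integrable) simp
  have "(\<lambda>x. cnj (h x) / of_real (norm (h x))) \<in> borel_measurable ?M"
    using hm borel_measurable_continuous_onI[OF continuous_on_cnj[OF continuous_on_id]]
    by (intro borel_measurable_divide borel_measurable_of_real borel_measurable_norm measurable_compose[OF hm]) auto
  then have "(\<lambda>x. cnj (h x) / of_real (norm (h x))) measurable_on {p..q}"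
    by (subst measurable_on_iff_borel_measurable) auto
  then obtain N f where N: "negligible N" and fc: "\<And>n. continuous_on UNIV (f n)"
    and fl: "\<And>x. x \<notin> N \<Longrightarrow> (\<lambda>n. f n x) \<longlonglongrightarrow> (if x \<in> {p..q} then cnj (h x) / of_real (norm (h x)) else 0)"
    unfolding measurable_on_def by blast
  \<comment> \<open>Radial truncation to the unit disc: it makes \<open>|h|\<close> a dominating
    function and leaves the limit unchanged, as that has modulus at most 1.\<close>
  define \<phi> where "\<phi> n x = f n x / of_real (max 1 (norm (f n x)))" for n x
  have \<phi>c: "continuous_on {p..q} (\<phi> n)" for n unfolding \<phi>_def
    by (intro continuous_intros continuous_on_subset[OF fc]) auto
  have \<phi>1: "norm (\<phi> n x) \<le> 1" for n x unfolding \<phi>_def by (simp add: norm_divide divide_le_eq)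
  have \<phi>l: "(\<lambda>n. \<phi> n x * h x) \<longlonglongrightarrow> of_real (norm (h x))" if x: "x \<in> {p..q} - N" for x
  proof -
    let ?u = "cnj (h x) / of_real (norm (h x))"
    have "(\<lambda>n. \<phi> n x * h x) \<longlonglongrightarrow> ?u / of_real (max 1 (norm ?u)) * h x"
      unfolding \<phi>_def using fl[of x] x by (intro tendsto_intros) auto
    moreover have "max 1 (norm ?u) = 1" by (rule max_absorb1) (simp add: norm_divide)
    moreover have "?u * h x = of_real (norm (h x))"
      by (cases "h x = 0") (simp_all add: complex_norm_square[symmetric] power2_eq_square mult.commute)
    ultimately show ?thesis by (simp only: of_real_1 div_by_1)
  qed
  have lm: "(\<lambda>n. integral {p..q} (\<lambda>x. if x \<in> N then 0 else \<phi> n x * h x)) \<longlonglongrightarrow> integral {p..q} (\<lambda>x. if x \<in> N then 0 else complex_of_real (norm (h x)))"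
  proof (rule dominated_convergence(2)[where h = "\<lambda>x. norm (h x)"])
    show "(\<lambda>x. if x \<in> N then 0 else \<phi> n x * h x) integrable_on {p..q}" for n
      by (rule integrable_spike[OF abs_integrable_imp(1)[OF L[OF \<phi>c order_refl order_refl]] N]) auto
    show "(\<lambda>x. norm (h x)) integrable_on {p..q}" by (rule abs_integrable_imp(2)[OF h])
    show "norm (if x \<in> N then 0 else \<phi> n x * h x) \<le> norm (h x)" for n x
      using mult_right_mono[OF \<phi>1[of n x] norm_ge_zero[of "h x"]] by (simp add: norm_mult)
    show "(\<lambda>n. if x \<in> N then 0 else \<phi> n x * h x) \<longlonglongrightarrow> (if x \<in> N then 0 else complex_of_real (norm (h x)))" if "x \<in> {p..q}" for x
      using \<phi>l[of x] that by auto
  qed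
  have z: "integral {p..q} (\<lambda>x. if x \<in> N then 0 else \<phi> n x * h x) = 0" for n
  proof -
    have "integral {p..q} (\<lambda>x. \<phi> n x * h x) = integral {p..q} (\<lambda>x. if x \<in> N then 0 else \<phi> n x * h x)"
      by (rule integral_spike[OF N]) auto
    then show ?thesis using cont[OF \<phi>c] by simp
  qed
  have "integral {p..q} (\<lambda>x. complex_of_real (norm (h x))) = integral {p..q} (\<lambda>x. if x \<in> N then 0 else complex_of_real (norm (h x)))"
    by (rule integral_spike[OF N]) auto
  also have "\<dots> = 0" using lm unfolding z by (simp add: LIMSEQ_const_iff)
  finally have "integral {p..q} (\<lambda>x. complex_of_real (norm (h x))) = 0" .
  then have "integral {p..q} (\<lambda>x. norm (h x)) = 0"
    using integral_linear[OF abs_integrable_imp(2)[OF h] bounded_linear_of_real[where 'a = complex]] by (simp add: o_def)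
  moreover have i: "integrable ?M (\<lambda>x. norm (h x))"
    using absolutely_integrable_imp_integrable[OF h] by simp
  ultimately have "integral\<^sup>L ?M (\<lambda>x. norm (h x)) = 0" by (simp add: lebesgue_integral_eq_integral)
  then have "AE x in ?M. norm (h x) = 0" using integral_nonneg_eq_0_iff_AE[OF i] by simp
  then show ?thesis by simp
qed

text \<open>The interval is a countable union of compact intervals, and a countable union of
  negligible exceptional sets is negligible.\<close>

lemma ac_deriv_unique:
  fixes f :: "real \<Rightarrow> complex"
  assumes f: "ac_deriv (einterval a b) f f1" "ac_deriv (einterval a b) f f2" and ab: "a < b"
  obtains N where "negligible N" "\<And>x. x \<in> einterval a b - N \<Longrightarrow> f1 x = f2 x"
proof -
  have "\<exists>u l :: nat \<Rightarrow> real. einterval a b = (\<Union>i. {l i..u i})"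
    by (rule einterval_Icc_approximation[OF ab]) blast
  then obtain u l :: "nat \<Rightarrow> real" where ul: "einterval a b = (\<Union>i. {l i..u i})" by blast
  have "\<exists>N. negligible N \<and> (\<forall>x\<in>{l i..u i} - N. f1 x = f2 x)" for i
  proof -
    have sub: "{l i..u i} \<subseteq> einterval a b" unfolding ul by blast
    have a: "(\<lambda>x. f1 x - f2 x) absolutely_integrable_on {l i..u i}"
      by (intro set_integral_diff(1) L1_loc_Icc[OF ac_deriv_L1[OF f(1)] sub] L1_loc_Icc[OF ac_deriv_L1[OF f(2)] sub])
    have "AE x in lebesgue_on {l i..u i}. f1 x - f2 x = 0"
    proof (rule zero_integrals_imp_AE_zero[OF a])
      fix x y assume xy: "l i \<le> x" "x \<le> y" "y \<le> u i"
      then have m: "x \<in> einterval a b" "y \<in> einterval a b" using sub by auto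
      have "integral {x..y} f1 = integral {x..y} f2"
        using f m xy(2) unfolding ac_deriv_def by metis
      moreover have "f1 integrable_on {x..y}" "f2 integrable_on {x..y}"
        by (rule abs_integrable_imp(1)[OF ac_deriv_abs_integrable[OF f(1) is_interval_einterval m]]
            abs_integrable_imp(1)[OF ac_deriv_abs_integrable[OF f(2) is_interval_einterval m]])+
      ultimately show "integral {x..y} (\<lambda>x. f1 x - f2 x) = 0" by (simp add: integral_diff)
    qed
    then have "AE x in lebesgue. x \<in> {l i..u i} \<longrightarrow> f1 x = f2 x" by (simp add: AE_restrict_space_iff)
    then obtain N where "negligible N" "{x. \<not> (x \<in> {l i..u i} \<longrightarrow> f1 x = f2 x)} \<subseteq> N"
      unfolding eventually_ae_filter negligible_iff_null_sets by auto
    then show ?thesis by (intro exI[of _ N]) blast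
  qed
  then obtain N where N: "\<And>i. negligible (N i)" "\<And>i x. x \<in> {l i..u i} - N i \<Longrightarrow> f1 x = f2 x" by metis
  show ?thesis
  proof (rule that)
    show "negligible (\<Union>(range N))" using N(1) by (intro negligible_countable_Union) auto
    show "f1 x = f2 x" if "x \<in> einterval a b - \<Union>(range N)" for x using that N(2) unfolding ul by blast
  qed
qed

lemma norm_sum_power2_le:
  fixes v :: "nat \<Rightarrow> 'a::real_normed_vector"
  shows "(norm (\<Sum>j<n. v j))\<^sup>2 \<le> real n * (\<Sum>j<n. (norm (v j))\<^sup>2)"
proof -
  have "(norm (\<Sum>j<n. v j))\<^sup>2 \<le> (\<Sum>j<n. norm (v j))\<^sup>2" by (intro power_mono norm_sum) auto
  also have "\<dots> \<le> (\<Sum>j<n. (norm (v j))\<^sup>2) * real (card {..<n})" by (rule sum_squared_le_sum_of_squares)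
  finally show ?thesis by (simp add: mult.commute)
qed

section \<open>Bounds for Green's operator and the Dirichlet spectrum\<close>

context dirac_left
begin

text \<open>For such \<open>g\<close> Green's operator gives a multiple of \<open>U z\<close> near
  \<open>a\<close>, whatever \<open>z\<close> is. Square integrability and the boundary form are
  then available although \<open>\<xi>\<close> may fail to be square integrable.\<close>

definition "vanishes_near_a g x1 \<longleftrightarrow> x1 \<in> J \<and> (\<forall>x\<in>tail True a (ereal c) x1. g x = 0)"

lemma GA_zero:
  assumes t: "vanishes_near_a g x1" and x: "x \<in> tail True a (ereal c) x1 \<union> {x1}"
  shows "GA z g x = 0"
proof -
  have "tail True a (ereal c) x \<subseteq> tail True a (ereal c) x1" using x tail_mono[of x True a "ereal c" x1] by auto
  then have "GA z g x = integral (tail True a (ereal c) x) (\<lambda>y. 0)"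
    unfolding GA_def by (intro integral_cong) (use t in \<open>auto simp: vanishes_near_a_def dotc_def\<close>)
  then show ?thesis by simp
qed

lemma \<xi>g_abs:
  assumes g: "square_integrable J g" and t: "vanishes_near_a g x1"
  shows "(\<lambda>y. dotc (\<xi> z y) (g y)) absolutely_integrable_on einterval a (ereal c)"
proof -
  have x1: "x1 \<in> J" using t by (simp add: vanishes_near_a_def)
  have d: "einterval a (ereal c) - tail False a (ereal c) x1 \<subseteq> tail True a (ereal c) x1 \<union> {x1}"
    by (auto simp: tail_def einterval_iff)
  show ?thesis
  proof (rule absolutely_integrable_spike_set[OF \<xi>g[OF g x1, of z]])
    show "negligible {y \<in> tail False a (ereal c) x1 - einterval a (ereal c). dotc (\<xi> z y) (g y) \<noteq> 0}"
      by (rule negligible_subset[OF negligible_empty]) (use tail_J[OF x1, of False] in \<open>auto simp: J_def\<close>)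
    show "negligible {y \<in> einterval a (ereal c) - tail False a (ereal c) x1. dotc (\<xi> z y) (g y) \<noteq> 0}"
      by (rule negligible_subset[of "{x1}"]) (use d t in \<open>auto simp: vanishes_near_a_def dotc_def\<close>)
  qed
qed

lemma GB_const:
  assumes g: "square_integrable J g" and t: "vanishes_near_a g x1" and x: "x \<in> tail True a (ereal c) x1"
  shows "GB z g x = GB z g x1"
proof -
  have x1: "x1 \<in> J" using t by (simp add: vanishes_near_a_def)
  have xJ: "x \<in> J" using x tail_J[OF x1] by blast
  have lt: "x < x1" using x by (simp add: tail_def einterval_iff)
  have "GB z g x1 - GB z g x = integral {x..x1} (\<lambda>x. - dotc (\<xi> z x) (g x))"
    using GB_ac[OF g, of z] xJ x1 lt unfolding ac_deriv_def by auto
  also have "\<dots> = integral {x..x1} (\<lambda>x. 0)"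
  proof (rule integral_spike[of "{x1}"])
    fix y assume "y \<in> {x..x1} - {x1}"
    then have "y \<in> tail True a (ereal c) x1"
      using x ereal_less_trans_real(2)[of x y a] by (auto simp: tail_def einterval_iff order_le_less)
    then show "0 = - dotc (\<xi> z y) (g y)" using t by (simp add: vanishes_near_a_def dotc_def)
  qed simp
  finally show ?thesis by simp
qed

lemma green_square_integrable:
  assumes g: "square_integrable J g" and t: "vanishes_near_a g x1"
  shows "square_integrable J (green z g)"
proof -
  have x1: "x1 \<in> J" using t by (simp add: vanishes_near_a_def)
  let ?k = "- (1 / \<Delta> z)" and ?T = "tail False a (ereal c) x1"
  have mA: "GA z g \<in> borel_measurable (lebesgue_on J)" and mB: "GB z g \<in> borel_measurable (lebesgue_on J)"
    using ac_deriv_continuous[OF GA_ac[OF g, of z] J_simps(1,2)] ac_deriv_continuous[OF GB_ac[OF g, of z] J_simps(1,2)]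
    by (auto intro: continuous_imp_measurable_on_sets_lebesgue)
  have bA: "norm (GA z g x) \<le> integral J (\<lambda>y. norm (dotc (g y) (U z y)))" if "x \<in> J" for x
    using tail_integral_norm_le[OF gU[OF g]] that unfolding GA_def J_def by blast
  have bB: "norm (GB z g x) \<le> integral J (\<lambda>y. norm (dotc (\<xi> z y) (g y)))" if "x \<in> J" for x
    using tail_integral_norm_le[OF \<xi>g_abs[OF g t]] that unfolding GB_def J_def by blast
  have sB: "square_integrable J (\<lambda>x. GB z g x *s U z x)"
    by (rule square_integrable_mult[OF U_J _ mB bB]) auto
  have TJ: "?T \<subseteq> J" by (rule tail_J[OF x1])
  have "square_integrable ?T (\<lambda>x. GA z g x *s \<xi> z x)"
  proof (rule square_integrable_mult)
    show "square_integrable ?T (\<xi> z)"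
      by (rule square_integrable_subset[OF sol_Icc[OF \<xi>_sol x1]]) (auto simp: tail_def einterval_iff)
    show "GA z g \<in> borel_measurable (lebesgue_on ?T)" using mA TJ by (rule measurable_restrict_mono)
    show "norm (GA z g x) \<le> integral J (\<lambda>y. norm (dotc (g y) (U z y)))" if "x \<in> ?T" for x using bA that TJ by blast
  qed simp
  then have "square_integrable J (\<lambda>x. if x \<in> ?T then GA z g x *s \<xi> z x else 0)"
    by (rule square_integrable_zero_extend[OF _ TJ]) auto
  then have sA: "square_integrable J (\<lambda>x. GA z g x *s \<xi> z x)"
  proof (rule square_integrable_cong)
    fix x assume x: "x \<in> J"
    have "x \<in> tail True a (ereal c) x1 \<union> {x1}" if "x \<notin> ?T" using that x by (auto simp: J_def tail_def einterval_iff)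
    then show "(if x \<in> ?T then GA z g x *s \<xi> z x else 0) = GA z g x *s \<xi> z x" using GA_zero[OF t, of x z] by auto
  qed
  have "square_integrable J (\<lambda>x. ?k *s (GA z g x *s \<xi> z x) + ?k *s (GB z g x *s U z x))"
    by (intro square_integrable_add square_integrable_cmult sA sB) auto
  then show ?thesis by (simp add: green_def[abs_def] vector_smult_assoc)
qed

lemma green_energy_bound:
  assumes g: "square_integrable J g" and t: "vanishes_near_a g x1" and D: "\<Delta> z \<noteq> 0"
  shows "(Im z)\<^sup>2 * E (green z g) \<le> E g"
proof (rule energy_bound[OF green_expr[OF g D] green_square_integrable[OF g t] g])
  have x1: "x1 \<in> J" using t by (simp add: vanishes_near_a_def)
  \<comment> \<open>The factor by which \<open>green z g\<close> is a multiple of \<open>U z\<close>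
    near \<open>a\<close>: there \<open>GA\<close> is zero and \<open>GB\<close> is
    constant.\<close>
  define \<kappa> where "\<kappa> = - (1 / \<Delta> z) * GB z g x1"
  have "((\<lambda>x. (cnj \<kappa> * \<kappa>) * wronskian (\<lambda>x. cnjv (U z x)) (U z) x) \<longlongrightarrow> (cnj \<kappa> * \<kappa>) * 0) (end_filter True a b)"
    by (intro tendsto_intros U_left_form)
  then have "((\<lambda>x. (cnj \<kappa> * \<kappa>) * wronskian (\<lambda>x. cnjv (U z x)) (U z) x) \<longlongrightarrow> 0) (end_filter True a b)" by simp
  then show "(wronskian (\<lambda>x. cnjv (green z g x)) (green z g) \<longlongrightarrow> 0) (end_filter True a b)"
  proof (rule Lim_transform_eventually)
    have "eventually (\<lambda>x. x \<in> tail True a (ereal c) x1) (end_filter True a (ereal c))"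
      by (rule eventually_in_tail[OF ac]) (use x1 in \<open>simp add: J_def\<close>)
    then show "eventually (\<lambda>x. (cnj \<kappa> * \<kappa>) * wronskian (\<lambda>x. cnjv (U z x)) (U z) x =
       wronskian (\<lambda>x. cnjv (green z g x)) (green z g) x) (end_filter True a b)"
      unfolding end_left
    proof eventually_elim
      case (elim x)
      have "green z g x = \<kappa> *s U z x"
        unfolding green_def \<kappa>_def using GA_zero[OF t, of x z] GB_const[OF g t elim] elim by simp
      then show ?case by (simp add: wronskian_def algebra_simps)
    qed
  qed
  show "(wronskian (\<lambda>x. cnjv (green z g x)) (green z g) \<longlongrightarrow> 0) (at_left c)"
    using wronskian_right_zero green_right[OF g] by blast
qed

text \<open>The vanishing of \<open>g\<close> near \<open>a\<close> reduces \<open>GA\<close> to an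
  integral over a compact interval, and \<open>GB\<close> always is one; both are then entire in
  \<open>z\<close>, so \<open>\<Delta>\<close> is the only denominator.\<close>

lemma green_hol:
  assumes g: "square_integrable J g" and t: "vanishes_near_a g x1" and x: "x \<in> J"
    and D: "\<And>z. z \<in> S \<Longrightarrow> \<Delta> z \<noteq> 0"
  shows "(\<lambda>z. green z g x $ i) holomorphic_on S"
proof -
  have x1: "x1 \<in> J" using t by (simp add: vanishes_near_a_def)
  have xI: "x \<in> I" and x1I: "x1 \<in> I" using x x1 J_sub by auto
  have hA: "(\<lambda>z. GA z g x) holomorphic_on UNIV"
  proof (cases "x1 < x")
    case False
    then have "x \<in> tail True a (ereal c) x1 \<union> {x1}" using x by (auto simp: J_def tail_def einterval_iff)
    then have "GA z g x = 0" for z by (rule GA_zero[OF t])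
    then show ?thesis by simp
  next
    case True
    then have xx: "x1 \<in> tail True a (ereal c) x" using x1 by (simp add: J_def tail_def einterval_iff)
    have xc: "x \<in> einterval a (ereal c)" using x by (simp add: J_def)
    have i: "(\<lambda>y. dotc (g y) (U z y)) absolutely_integrable_on tail True a (ereal c) x" for z
      by (rule set_integrable_subset[OF gU[OF g]]) (use tail_subset[OF xc] in auto)
    have "GA z g x = integral {x1..x} (\<lambda>y. dotc (U z y) (g y))" for z
      using integral_tail_split(1)[OF i[of z] xc xx] GA_zero[OF t, of x1 z] True
      by (simp add: GA_def seg_def dotc_commute)
    moreover have "(\<lambda>z. integral {x1..x} (\<lambda>y. dotc (U z y) (g y))) holomorphic_on UNIV"
    proof (rule dotc_integral_hol[OF U_sol U_hol x1I xI])
      have "{x1<..<x} \<subseteq> J" using interval_Icc_subset[OF J_simps(2) x1 x] by auto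
      then show "square_integrable {x1<..<x} g" by (rule square_integrable_subset[OF g]) auto
    qed
    ultimately show ?thesis by simp
  qed
  have hB: "(\<lambda>z. GB z g x) holomorphic_on UNIV"
  proof -
    have "GB z g x = integral {x..c} (\<lambda>y. dotc (\<xi> z y) (g y))" for z
      unfolding GB_def by (simp add: tail_def integral_open_interval_real)
    moreover have "(\<lambda>z. integral {x..c} (\<lambda>y. dotc (\<xi> z y) (g y))) holomorphic_on UNIV"
    proof (rule dotc_integral_hol[OF \<xi>_sol \<xi>_hol xI c])
      have "{x<..<c} \<subseteq> J" using tail_J[OF x, of False] by (simp add: tail_def)
      then show "square_integrable {x<..<c} g" by (rule square_integrable_subset[OF g]) auto
    qed
    ultimately show ?thesis by simp
  qed
  note sub = holomorphic_on_subset[OF _ subset_UNIV, of _ S]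
  show ?thesis unfolding green_def vector_add_component vector_smult_component
    by (intro holomorphic_intros sub[OF hA] sub[OF hB] sub[OF \<xi>_hol[OF xI]] sub[OF U_hol[OF xI]] sub[OF \<Delta>_hol] D)
qed

text \<open>At a real point the bound \<open>1/|Im z|\<close> of the nonreal points is continued inwards: the factor
  \<open>(z - z0)\<^sup>2 - r\<^sup>2\<close> has modulus \<open>2 r |Im z|\<close> on the circle \<open>|z - z0| = r\<close>.\<close>

lemma green_real_bound:
  assumes g: "square_integrable J g" and t: "vanishes_near_a g x1" and z0: "Im z0 = 0"
    and r: "0 < r" "r < R" and D: "\<And>z. z \<in> ball z0 R \<Longrightarrow> \<Delta> z \<noteq> 0"
  shows "E (green z0 g) \<le> (2 / r)\<^sup>2 * E g"
proof -
  define \<zeta> where "\<zeta> n j = z0 + of_real r * cis (2 * pi * real j / real (Suc n))" for n j :: nat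
  \<comment> \<open>Normalised to \<open>k z0 = 1\<close>. On the circle its modulus is
    \<open>2 |Im z| / r\<close>, which cancels the \<open>1/|Im z|\<close> of the resolvent and
    leaves \<open>2/r\<close>, also where the circle meets the real line.\<close>
  define k where "k z = - (((z - z0)\<^sup>2 - (of_real r)\<^sup>2) / (of_real r)\<^sup>2)" for z
  define fn where "fn n x = (1 / of_nat (Suc n)) *s (\<Sum>j<Suc n. k (\<zeta> n j) *s green (\<zeta> n j) g x)" for n x
  have \<zeta>R: "\<zeta> n j \<in> ball z0 R" for n j using r by (simp add: \<zeta>_def dist_norm norm_mult)
  have sqj: "square_integrable J (green (\<zeta> n j) g)" for n j by (rule green_square_integrable[OF g t])
  have lim: "(\<lambda>n. fn n x) \<longlonglongrightarrow> green z0 g x" if x: "x \<in> J" for x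
  proof (rule vec_tendstoI)
    fix i
    have "(\<lambda>z. k z * green z g x $ i) holomorphic_on ball z0 R"
      unfolding k_def by (intro holomorphic_intros green_hol[OF g t x] D) (use r in auto)
    from circle_average_tendsto[OF this r]
    have "(\<lambda>n. (\<Sum>j<Suc n. k (\<zeta> n j) * green (\<zeta> n j) g x $ i) / of_nat (Suc n)) \<longlonglongrightarrow> k z0 * green z0 g x $ i"
      unfolding \<zeta>_def .
    moreover have "k z0 = 1" using r by (simp add: k_def)
    ultimately show "(\<lambda>n. fn n x $ i) \<longlonglongrightarrow> green z0 g x $ i"
      by (simp add: fn_def del: sum.lessThan_Suc of_nat_Suc)
  qed
  have kE: "(norm (k (\<zeta> n j)))\<^sup>2 * E (green (\<zeta> n j) g) \<le> (2 / r)\<^sup>2 * E g" for n j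
  proof -
    define \<theta> where "\<theta> = 2 * pi * real j / real (Suc n)"
    have "(cis \<theta>)\<^sup>2 - 1 = 2 * \<i> * of_real (sin \<theta>) * cis \<theta>"
      using sin_cos_squared_add[of \<theta>] by (simp add: complex_eq_iff power2_eq_square)
    moreover have "k (\<zeta> n j) = - ((cis \<theta>)\<^sup>2 - 1)"
      unfolding k_def \<zeta>_def \<theta>_def[symmetric] using r by (simp add: power_mult_distrib diff_divide_distrib)
    ultimately have "norm (k (\<zeta> n j)) = 2 * \<bar>sin \<theta>\<bar>" by (simp only: norm_minus_cancel) (simp add: norm_mult)
    moreover have "Im (\<zeta> n j) = r * sin \<theta>" using z0 by (simp add: \<zeta>_def \<theta>_def)
    moreover have "(Im (\<zeta> n j))\<^sup>2 * E (green (\<zeta> n j) g) \<le> E g"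
      by (rule green_energy_bound[OF g t D[OF \<zeta>R]])
    ultimately show ?thesis using r by (simp add: power_mult_distrib power_divide field_simps)
  qed
  let ?h = "\<lambda>n x. (1 / real (Suc n)) * (\<Sum>j<Suc n. (norm (k (\<zeta> n j)))\<^sup>2 * (norm (green (\<zeta> n j) g x))\<^sup>2)"
  have ihs: "(\<lambda>x. (norm (k (\<zeta> n j)))\<^sup>2 * (norm (green (\<zeta> n j) g x))\<^sup>2) integrable_on J" for n j
    by (intro integrable_on_mult_right square_integrable_integrable[OF sqj])
  have ih: "?h n integrable_on J" for n
    by (intro integrable_on_mult_right integrable_sum ihs) auto
  have le: "(norm (fn n x))\<^sup>2 \<le> ?h n x" for n x
  proof -
    have "(norm (fn n x))\<^sup>2 = (1 / real (Suc n))\<^sup>2 * (norm (\<Sum>j<Suc n. k (\<zeta> n j) *s green (\<zeta> n j) g x))\<^sup>2"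
      unfolding fn_def norm_smult_vec power_mult_distrib by (simp add: norm_divide power_divide del: of_nat_Suc)
    also have "\<dots> \<le> (1 / real (Suc n))\<^sup>2 * (real (Suc n) * (\<Sum>j<Suc n. (norm (k (\<zeta> n j) *s green (\<zeta> n j) g x))\<^sup>2))"
      by (intro mult_left_mono norm_sum_power2_le) simp
    also have "\<dots> = ?h n x"
      unfolding norm_smult_vec power_mult_distrib by (simp add: power2_eq_square[of "1 / real (Suc n)"] power2_eq_square[of "real (Suc n)"] del: of_nat_Suc sum.lessThan_Suc)
    finally show ?thesis .
  qed
  have sq: "square_integrable J (fn n)" for n
  proof (rule square_integrable_bound[OF _ J_simps(3) ih le])
    show "fn n \<in> borel_measurable (lebesgue_on J)" unfolding fn_def[abs_def]
      by (intro measurable_smult_vec borel_measurable_sum square_integrable_measurable[OF sqj]) auto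
  qed
  have "integral J (\<lambda>x. (norm (fn n x))\<^sup>2) \<le> (2 / r)\<^sup>2 * E g" for n
  proof -
    have "integral J (\<lambda>x. (norm (fn n x))\<^sup>2) \<le> integral J (?h n)"
      by (rule Henstock_Kurzweil_Integration.integral_le[OF square_integrable_integrable[OF sq] ih le])
    also have "\<dots> = (1 / real (Suc n)) * (\<Sum>j<Suc n. (norm (k (\<zeta> n j)))\<^sup>2 * E (green (\<zeta> n j) g))"
      unfolding E_def by (subst integral_mult_right, subst integral_sum) (use ihs in auto)
    also have "\<dots> \<le> (1 / real (Suc n)) * (\<Sum>j<Suc n. (2 / r)\<^sup>2 * E g)"
      by (intro mult_left_mono sum_mono kE) auto
    also have "\<dots> = (2 / r)\<^sup>2 * E g" by (simp del: sum.lessThan_Suc of_nat_Suc)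
    finally show ?thesis .
  qed
  then show ?thesis unfolding E_def using square_integrable_Fatou(2)[OF J_simps(3) sq _ lim] unfolding E_def by blast
qed

lemma green_truncated_bound:
  assumes D: "\<Delta> z \<noteq> 0"
  obtains K where "K \<ge> 0" "\<And>g x1. square_integrable J g \<Longrightarrow> vanishes_near_a g x1 \<Longrightarrow> E (green z g) \<le> K * E g"
proof (cases "Im z = 0")
  case False
  have "E (green z g) \<le> (1 / (Im z)\<^sup>2) * E g" if "square_integrable J g" "vanishes_near_a g x1" for g x1
    using green_energy_bound[OF that D] False by (simp add: field_simps)
  then show ?thesis using that[of "1 / (Im z)\<^sup>2"] by simp
next
  case True
  have "isCont \<Delta> z" using \<Delta>_hol holomorphic_on_imp_continuous_on continuous_on_eq_continuous_at by blast
  then obtain R where R: "R > 0" "\<And>w. dist z w < R \<Longrightarrow> \<Delta> w \<noteq> 0"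
    using continuous_at_avoid[of z \<Delta> 0] D by auto
  have "E (green z g) \<le> (2 / (R / 2))\<^sup>2 * E g" if "square_integrable J g" "vanishes_near_a g x1" for g x1
    by (rule green_real_bound[OF that True, of "R / 2" R]) (use R in auto)
  then show ?thesis by (rule that[OF zero_le_power2])
qed

text \<open>Cut \<open>g\<close> off on tails shrinking to \<open>a\<close>. The bound for truncated
  functions has a constant independent of the cut, the images converge pointwise, and Fatou's lemma
  keeps both square integrability and the bound.\<close>

lemma green_bound:
  assumes D: "\<Delta> z \<noteq> 0"
  obtains K where "K \<ge> 0" "\<And>g. square_integrable J g \<Longrightarrow> square_integrable J (green z g) \<and> E (green z g) \<le> K * E g"
proof -
  obtain K where K: "K \<ge> 0" "\<And>g x1. square_integrable J g \<Longrightarrow> vanishes_near_a g x1 \<Longrightarrow> E (green z g) \<le> K * E g"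
    by (rule green_truncated_bound[OF D]) blast
  obtain q where q: "\<And>n. q n \<in> einterval a (ereal c)"
    "\<And>x. x \<in> einterval a (ereal c) \<Longrightarrow> eventually (\<lambda>n. q n \<in> tail True a (ereal c) x) sequentially"
    using end_sequence[OF ac, of True] by blast
  have "square_integrable J (green z g) \<and> E (green z g) \<le> K * E g" if g: "square_integrable J g" for g
  proof -
    let ?T = "\<lambda>n. J - tail True a (ereal c) (q n)"
    define gn where "gn n x = (if x \<in> ?T n then g x else 0)" for n x
    have gsq: "square_integrable J (gn n)" for n unfolding gn_def
      by (rule square_integrable_zero_extend[OF square_integrable_subset[OF g]]) auto
    have van: "vanishes_near_a (gn n) (q n)" for n using q(1) by (simp add: vanishes_near_a_def gn_def J_def)
    have Egn: "E (gn n) \<le> E g" for n unfolding E_def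
      by (rule Henstock_Kurzweil_Integration.integral_le[OF square_integrable_integrable[OF gsq] square_integrable_integrable[OF g]])
        (simp add: gn_def)
    have bd: "E (green z (gn n)) \<le> K * E g" for n
      using K(2)[OF gsq[of n] van[of n]] mult_left_mono[OF Egn[of n] K(1)] by linarith
    have lim: "(\<lambda>n. green z (gn n) x) \<longlonglongrightarrow> green z g x" if x: "x \<in> J" for x
    proof -
      have xc: "x \<in> einterval a (ereal c)" using x by (simp add: J_def)
      have fl: "filterlim q (end_filter True a (ereal c)) sequentially"
        unfolding filterlim_iff eventually_end_filter[OF ac]
      proof (intro allI impI)
        fix P assume "\<exists>t\<in>einterval a (ereal c). \<forall>x\<in>tail True a (ereal c) t. P x"
        then obtain t where t: "t \<in> einterval a (ereal c)" "\<And>x. x \<in> tail True a (ereal c) t \<Longrightarrow> P x" by blast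
        show "eventually (\<lambda>n. P (q n)) sequentially"
          using q(2)[OF t(1)] by eventually_elim (rule t(2))
      qed
      have "(GA z g \<longlongrightarrow> 0) (end_filter True a (ereal c))" using GA_left[OF g] unfolding end_left .
      then have "(\<lambda>n. GA z g (q n)) \<longlonglongrightarrow> 0" using fl by (rule filterlim_compose)
      then have "(\<lambda>n. GA z g x - GA z g (q n)) \<longlonglongrightarrow> GA z g x - 0" by (intro tendsto_intros)
      then have "(\<lambda>n. GA z g x - GA z g (q n)) \<longlonglongrightarrow> GA z g x" by simp
      \<comment> \<open>Truncation removes exactly the part of the integral beyond
        \<open>q n\<close>; the other factor \<open>GB\<close> does not see the cut once
        \<open>q n\<close> has passed \<open>x\<close>.\<close>
      moreover have "eventually (\<lambda>n. GA z g x - GA z g (q n) = GA z (gn n) x) sequentially"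
        using q(2)[OF xc]
      proof eventually_elim
        case (elim n)
        have i: "(\<lambda>y. dotc (h y) (U z y)) absolutely_integrable_on tail True a (ereal c) x" if "square_integrable J h" for h
          by (rule set_integrable_subset[OF gU[OF that]]) (use tail_subset[OF xc] in auto)
        have "integral (seg x (q n)) (\<lambda>y. dotc (g y) (U z y)) = integral (seg x (q n)) (\<lambda>y. dotc (gn n y) (U z y))"
        proof (rule integral_cong)
          fix y assume y: "y \<in> seg x (q n)"
          have "seg x (q n) \<subseteq> J" by (rule seg_subset) (use x q(1)[of n] in \<open>auto simp: J_def\<close>)
          moreover have "y \<notin> tail True a (ereal c) (q n)" using y elim by (auto simp: tail_def einterval_iff seg_def)
          ultimately show "dotc (g y) (U z y) = dotc (gn n y) (U z y)" using y by (auto simp: gn_def)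
        qed
        moreover have "GA z (gn n) (q n) = 0" by (rule GA_zero[OF van]) simp
        ultimately show ?case
          using integral_tail_split(1)[OF i[OF g] xc elim] integral_tail_split(1)[OF i[OF gsq[of n]] xc elim]
          by (simp add: GA_def)
      qed
      ultimately have lA: "(\<lambda>n. GA z (gn n) x) \<longlonglongrightarrow> GA z g x" by (rule Lim_transform_eventually)
      have lB: "(\<lambda>n. GB z (gn n) x) \<longlonglongrightarrow> GB z g x"
      proof (rule tendsto_eventually)
        show "eventually (\<lambda>n. GB z (gn n) x = GB z g x) sequentially"
          using q(2)[OF xc]
        proof eventually_elim
          case (elim n)
          show ?case unfolding GB_def
          proof (rule integral_cong)
            fix y assume y: "y \<in> tail False a (ereal c) x"
            have "y \<in> J" using y tail_J[OF x] by blast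
            moreover have "y \<notin> tail True a (ereal c) (q n)" using y elim by (auto simp: tail_def einterval_iff)
            ultimately show "dotc (\<xi> z y) (gn n y) = dotc (\<xi> z y) (g y)" by (simp add: gn_def)
          qed
        qed
      qed
      show ?thesis
        by (rule vec_tendstoI) (unfold green_def vector_add_component vector_smult_component, intro tendsto_intros lA lB)
    qed
    have sqn: "square_integrable J (green z (gn n))" for n by (rule green_square_integrable[OF gsq van])
    show ?thesis
      using square_integrable_Fatou[OF J_simps(3) sqn bd[unfolded E_def] lim] unfolding E_def by blast
  qed
  then show ?thesis using that K(1) by blast
qed

text \<open>A solution on \<open>J\<close> continues to the whole interval through the basis; being
  in the domain near \<open>a\<close>, it has Wronskian 0 with \<open>U\<close>, which removes the
  \<open>V\<close> coefficient.\<close>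

lemma dirichlet_solution_multiple:
  assumes d: "dirac_solution J Q z d" "square_integrable J d" "(wronskian v d \<longlongrightarrow> 0) (end_filter True a b)"
  obtains k where "\<And>x. x \<in> J \<Longrightarrow> d x = k *s U z x"
proof -
  obtain C K where d_eq: "\<And>x. x \<in> J \<Longrightarrow> d x = C *s V z x + K *s U z x"
    by (rule sol_expand[OF d(1) J_simps(1,2) J_sub]) blast
  define d' where "d' x = C *s V z x + K *s U z x" for x
  have s: "sol z d'" unfolding d'_def by (rule sol_combination)
  have "L2_near True a b d" unfolding L2_near_def using d(2) c J_tail by auto
  then have "in_dom_near True a b v d'"
    using in_dom_near_tail_cong[OF ab _ c, of True v d d'] d(3) d_eq unfolding J_tail by (simp add: in_dom_near_def d'_def)
  then have "wronskian d' (U z) c = 0" by (rule dom_wronskian_zero[OF bc s _ U_sol U_dom c])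
  moreover have "wronskian d' (U z) c = C * wronskian (V z) (U z) c"
    by (simp add: d'_def wronskian_def algebra_simps)
  ultimately have "C = 0" using WVU[OF c, of z] by simp
  then show ?thesis using that d_eq by auto
qed

text \<open>In a pair \<open>f\<close>, \<open>g\<close> with \<open>(H - z) f = g\<close> the function \<open>g\<close> is determined only
  almost everywhere, and its square integrability has to be inferred from \<open>f\<close> being in the domain.\<close>

lemma dirac_maps_rhs:
  assumes m: "dirac_maps J Q P z f g"
  obtains g' where "square_integrable J g'" "norm_L2 J g = norm_L2 J g'" "dirac_expr J Q f (\<lambda>x. z *s f x + g' x)"
proof -
  have f: "square_integrable J f" "dirac_expr J Q f (\<lambda>x. z *s f x + g x)"
    using m unfolding dirac_maps_def dirac_dom_def by auto
  obtain h where h: "dirac_expr J Q f h" "square_integrable J h"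
    using m unfolding dirac_maps_def dirac_dom_def by blast
  note e1 = f(2)[unfolded dirac_expr_iff[OF J_simps(1,2)]] and e2 = h(1)[unfolded dirac_expr_iff[OF J_simps(1,2)]]
  obtain N1 where N1: "negligible N1" "\<And>x. x \<in> J - N1 \<Longrightarrow> (z *s f x + g x) $ 2 - (Q x *v f x) $ 2 = h x $ 2 - (Q x *v f x) $ 2"
    using ac_deriv_unique[OF conjunct1[OF e1, unfolded J_def] conjunct1[OF e2, unfolded J_def] ac] unfolding J_def by blast
  obtain N2 where N2: "negligible N2" "\<And>x. x \<in> J - N2 \<Longrightarrow> (Q x *v f x) $ 1 - (z *s f x + g x) $ 1 = (Q x *v f x) $ 1 - h x $ 1"
    using ac_deriv_unique[OF conjunct2[OF e1, unfolded J_def] conjunct2[OF e2, unfolded J_def] ac] unfolding J_def by blast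
  have g: "g x = h x + (- z) *s f x" if "x \<in> J - (N1 \<union> N2)" for x
    using N1(2)[of x] N2(2)[of x] that by (auto simp: vec_eq_iff forall_2 algebra_simps)
  have "integral J (\<lambda>x. (norm (g x))\<^sup>2) = integral J (\<lambda>x. (norm (h x + (- z) *s f x))\<^sup>2)"
    by (rule integral_spike[OF negligible_Un[OF N1(1) N2(1)]]) (use g in auto)
  then have "norm_L2 J g = norm_L2 J (\<lambda>x. h x + (- z) *s f x)" by (simp add: norm_L2_def)
  moreover have "square_integrable J (\<lambda>x. h x + (- z) *s f x)"
    by (intro square_integrable_add square_integrable_cmult h f) auto
  moreover have "dirac_expr J Q f (\<lambda>x. z *s f x + (h x + (- z) *s f x))"
    by (rule dirac_expr_cong[OF h(1) J_simps(1,2)]) (auto simp: vec_eq_iff)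
  ultimately show ?thesis using that by blast
qed

text \<open>Green's operator gives surjectivity. For the norm bound, any preimage differs from
  Green's by a multiple of \<open>U z\<close> satisfying the Dirichlet condition at
  \<open>c\<close>, and this multiple is zero as \<open>\<Delta> z\<close> is not.\<close>

lemma dirichlet_resolvent:
  assumes D: "\<Delta> z \<noteq> 0"
  shows "z \<notin> dirac_spectrum J Q (dirichlet_bc a c v)"
proof -
  obtain K where K: "K \<ge> 0" "\<And>g. square_integrable J g \<Longrightarrow> square_integrable J (green z g) \<and> E (green z g) \<le> K * E g"
    by (rule green_bound[OF D]) blast
  have ef: "left_end a = end_filter True a b" by (simp add: end_filter_def)
  have onto: "dirac_maps J Q (dirichlet_bc a c v) z (green z g) g" if g: "square_integrable J g" for g
    unfolding dirac_maps_def dirac_dom_def dirichlet_bc_def bc_left_def ef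
    using K(2)[OF g] green_expr[OF g D] green_left[OF g] green_right(1)[OF g]
      square_integrable_add[OF square_integrable_cmult[of J "green z g" z] g] by auto
  have "norm_L2 J f \<le> sqrt K * norm_L2 J g" if m: "dirac_maps J Q (dirichlet_bc a c v) z f g" for f g
  proof -
    have f: "square_integrable J f" "(wronskian v f \<longlongrightarrow> 0) (end_filter True a b)" "((\<lambda>x. f x $ 1) \<longlongrightarrow> 0) (at_left c)"
      using m unfolding dirac_maps_def dirac_dom_def dirichlet_bc_def bc_left_def ef by auto
    obtain g' where g': "square_integrable J g'" "norm_L2 J g = norm_L2 J g'" "dirac_expr J Q f (\<lambda>x. z *s f x + g' x)"
      by (rule dirac_maps_rhs[OF m])
    define d where "d x = f x + (- 1) *s green z g' x" for x
    have "dirac_expr J Q d (\<lambda>x. (z *s f x + g' x) + (- 1) *s (z *s green z g' x + g' x))"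
      unfolding d_def by (intro dirac_expr_add dirac_expr_cmult g' green_expr D J_simps)
    then have ds: "dirac_solution J Q z d"
      unfolding dirac_solution_def
      by (rule dirac_expr_cong[OF _ J_simps(1,2)]) (auto simp: vec_eq_iff d_def algebra_simps)
    have dsq: "square_integrable J d"
      unfolding d_def using K(2)[OF g'(1)] by (intro square_integrable_add square_integrable_cmult f) auto
    have "((\<lambda>x. wronskian v f x - wronskian v (green z g') x) \<longlongrightarrow> 0 - 0) (end_filter True a b)"
      by (intro tendsto_intros f(2) green_left[OF g'(1)])
    moreover have "wronskian v f x - wronskian v (green z g') x = wronskian v d x" for x
      by (simp add: wronskian_def d_def algebra_simps)
    ultimately have dW: "(wronskian v d \<longlongrightarrow> 0) (end_filter True a b)" by simp
    obtain k where k: "\<And>x. x \<in> J \<Longrightarrow> d x = k *s U z x" by (rule dirichlet_solution_multiple[OF ds dsq dW]) blast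
    have "((\<lambda>x. f x $ 1 - green z g' x $ 1) \<longlongrightarrow> 0 - 0) (at_left c)"
      by (intro tendsto_intros f(3) green_right(1)[OF g'(1)])
    moreover have "eventually (\<lambda>x. f x $ 1 - green z g' x $ 1 = k * U z x $ 1) (at_left c)"
    proof -
      obtain x where x: "x \<in> J" using einterval_nonempty[OF ac] by (auto simp: J_def)
      have "eventually (\<lambda>y. y \<in> tail False a (ereal c) x) (at_left c)"
        using eventually_in_tail[OF ac, of x False] x unfolding end_right J_def by simp
      then show ?thesis
      proof eventually_elim
        case (elim y)
        then have "y \<in> J" using tail_J[OF x] by blast
        from arg_cong[OF k[OF this], of "\<lambda>u. u $ 1"] show ?case by (simp add: d_def)
      qed
    qed
    ultimately have "((\<lambda>x. k * U z x $ 1) \<longlongrightarrow> 0) (at_left c)" using Lim_transform_eventually by fastforce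
    moreover have "((\<lambda>x. k * U z x $ 1) \<longlongrightarrow> k * U z c $ 1) (at_left c)"
      by (intro tendsto_intros continuous_at_left_c[OF U_sol])
    ultimately have "k * U z c $ 1 = 0" using tendsto_unique[OF trivial_limit_at_left_real] by blast
    then have "k = 0" using D by (simp add: \<Delta>_def)
    then have "f x = green z g' x" if "x \<in> J" for x using k[OF that] by (simp add: d_def vec_eq_iff)
    then have "integral J (\<lambda>x. (norm (f x))\<^sup>2) = E (green z g')" unfolding E_def by (intro integral_cong) auto
    also have "\<dots> \<le> K * E g'" using K(2)[OF g'(1)] by blast
    finally show ?thesis unfolding g'(2) unfolding norm_L2_def E_def[symmetric] real_sqrt_mult[symmetric] by (rule real_sqrt_le_mono)
  qed
  then show ?thesis using onto unfolding dirac_spectrum_def dirac_resolvent_set_def by blast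
qed

text \<open>The spectrum is contained in the zero set of an entire function that does not vanish at
  \<open>\<i>\<close>, so it has no limit point; each eigenspace is spanned by
  \<open>U z\<close>.\<close>

lemma dirichlet_purely_discrete: "purely_discrete_spectrum (einterval a (ereal c)) Q (dirichlet_bc a c v)"
  unfolding J_def[symmetric] purely_discrete_spectrum_def
proof (intro ballI conjI)
  let ?\<sigma> = "dirac_spectrum J Q (dirichlet_bc a c v)"
  fix z assume z: "z \<in> ?\<sigma>"
  have D0: "\<Delta> w = 0" if "w \<in> ?\<sigma>" for w using dirichlet_resolvent that by blast
  have ef: "left_end a = end_filter True a b" by (simp add: end_filter_def)
  show "\<not> z islimpt ?\<sigma>"
  proof
    assume "z islimpt ?\<sigma>"
    then have "\<Delta> \<i> = 0"
      using analytic_continuation[OF \<Delta>_hol open_UNIV connected_UNIV subset_UNIV UNIV_I, of z ?\<sigma> \<i>] D0 by blast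
    then show False using \<Delta>_nonreal[of \<i>] by simp
  qed
  have "((\<lambda>x. U z x $ 1) \<longlongrightarrow> 0) (at_left c)"
    using continuous_at_left_c[OF U_sol, of z 1] D0[OF z] by (simp add: \<Delta>_def)
  then have "dirichlet_bc a c v (U z)"
    using U_dom[of z] by (simp add: dirichlet_bc_def bc_left_def ef in_dom_near_def)
  moreover have "dirac_expr J Q (U z) (\<lambda>x. z *s U z x)" using sol_J[OF U_sol] by (simp add: dirac_solution_def)
  ultimately have "U z \<in> dirac_eigenspace J Q (dirichlet_bc a c v) z"
    unfolding dirac_eigenspace_def dirac_dom_def
    using U_J square_integrable_cmult[OF U_J] sol_J[OF U_sol] by auto
  moreover have "nontrivial_on J (U z)"
    using einterval_nonempty[OF ac] U_nonzero J_sub unfolding nontrivial_on_def J_def by blast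
  ultimately show "\<exists>f\<in>dirac_eigenspace J Q (dirichlet_bc a c v) z. nontrivial_on J f" by blast
  show "\<exists>F. finite F \<and> (\<forall>f\<in>dirac_eigenspace J Q (dirichlet_bc a c v) z. \<exists>k. \<forall>x\<in>J. f x = (\<Sum>h\<in>F. k h *s h x))"
  proof (intro exI[of _ "{U z}"] conjI ballI)
    fix f assume "f \<in> dirac_eigenspace J Q (dirichlet_bc a c v) z"
    then have d: "dirac_solution J Q z f" "square_integrable J f" "(wronskian v f \<longlongrightarrow> 0) (end_filter True a b)"
      by (auto simp: dirac_eigenspace_def dirac_dom_def dirichlet_bc_def bc_left_def ef)
    obtain k where "\<And>x. x \<in> J \<Longrightarrow> f x = k *s U z x" by (rule dirichlet_solution_multiple[OF d]) blast
    then show "\<exists>k. \<forall>x\<in>J. f x = (\<Sum>h\<in>{U z}. k h *s h x)" by (intro exI[of _ "\<lambda>_. k"]) simp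
  qed simp
qed

end

subsection \<open>Double commutation\<close>

text \<open>Here \<open>a\<close> is the spinor \<Theta>(\<lambda>) and \<open>r = 1/c\<close>. In
  each identity the two sides differ by a multiple of
  \<open>F * (z - l) - (a1 * u2 - a2 * u1)\<close>; this is where the choice of \<open>F\<close> as
  a Wronskian quotient enters.\<close>

lemma dc_algebra:
  fixes F z l r a1 a2 u1 u2 q11 q12 q22 :: "'a::comm_ring_1"
  assumes F: "F * (z - l) = a1 * u2 - a2 * u1"
  shows "(z * u2 - (q12 * u1 + q22 * u2)) + ((r * a1) * - (a1 * u1 + a2 * u2) +
      F * (a1 * (- (r\<^sup>2) * (a1 * a1 + a2 * a2)) + r * (l * a2 - (q12 * a1 + q22 * a2)))) =
    z * (u2 + F * (r * a2)) - ((q12 + (a1\<^sup>2 - a2\<^sup>2) * r) * (u1 + F * (r * a1)) + (q22 + 2 * (a1 * a2 * r)) * (u2 + F * (r * a2)))"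
    and "((q11 * u1 + q12 * u2) - z * u1) + ((r * a2) * - (a1 * u1 + a2 * u2) +
      F * (a2 * (- (r\<^sup>2) * (a1 * a1 + a2 * a2)) + r * ((q11 * a1 + q12 * a2) - l * a1))) =
    ((q11 - 2 * (a1 * a2 * r)) * (u1 + F * (r * a1)) + (q12 + (a1\<^sup>2 - a2\<^sup>2) * r) * (u2 + F * (r * a2))) - z * (u1 + F * (r * a1))"
proof -
  have F0: "F * (z - l) - (a1 * u2 - a2 * u1) = 0" using F by simp
  let ?L1 = "(z * u2 - (q12 * u1 + q22 * u2)) + ((r * a1) * - (a1 * u1 + a2 * u2) +
      F * (a1 * (- (r\<^sup>2) * (a1 * a1 + a2 * a2)) + r * (l * a2 - (q12 * a1 + q22 * a2))))"
  let ?R1 = "z * (u2 + F * (r * a2)) - ((q12 + (a1\<^sup>2 - a2\<^sup>2) * r) * (u1 + F * (r * a1)) + (q22 + 2 * (a1 * a2 * r)) * (u2 + F * (r * a2)))"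
  have "?R1 - ?L1 = r * a2 * (F * (z - l) - (a1 * u2 - a2 * u1))" by (simp add: algebra_simps power2_eq_square)
  then show "?L1 = ?R1" unfolding F0 by simp
  let ?L2 = "((q11 * u1 + q12 * u2) - z * u1) + ((r * a2) * - (a1 * u1 + a2 * u2) +
      F * (a2 * (- (r\<^sup>2) * (a1 * a1 + a2 * a2)) + r * ((q11 * a1 + q12 * a2) - l * a1)))"
  let ?R2 = "((q11 - 2 * (a1 * a2 * r)) * (u1 + F * (r * a1)) + (q12 + (a1\<^sup>2 - a2\<^sup>2) * r) * (u2 + F * (r * a2))) - z * (u1 + F * (r * a1))"
  have "?R2 - ?L2 = - (r * a1) * (F * (z - l) - (a1 * u2 - a2 * u1))" by (simp add: algebra_simps power2_eq_square)
  then show "?L2 = ?R2" unfolding F0 by simp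
qed

text \<open>The derivative is a limit of real difference quotients along a real sequence, and the
  real line is closed.\<close>

lemma deriv_real:
  assumes f: "f holomorphic_on UNIV" and real: "\<And>z. z \<in> \<real> \<Longrightarrow> f z \<in> \<real>" and x: "x \<in> \<real>"
  shows "deriv f x \<in> \<real>"
proof -
  have "(f has_field_derivative deriv f x) (at x)" by (rule holomorphic_derivI[OF f]) auto
  then have d: "((\<lambda>w. (f w - f x) / (w - x)) \<longlongrightarrow> deriv f x) (at x)" by (simp add: has_field_derivative_iff)
  define X where "X n = x + of_real (1 / real (Suc n))" for n
  have X: "X \<longlonglongrightarrow> x"
  proof -
    have "(\<lambda>n. x + complex_of_real (1 / real (Suc n))) \<longlonglongrightarrow> x + of_real 0"
      by (intro tendsto_intros LIMSEQ_Suc lim_1_over_n)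
    then show ?thesis by (simp add: X_def[abs_def])
  qed
  have "X n \<noteq> x" for n by (simp add: X_def del: of_nat_Suc)
  then have "((\<lambda>w. (f w - f x) / (w - x)) \<circ> X) \<longlonglongrightarrow> deriv f x"
    using d X unfolding tendsto_at_iff_sequentially by auto
  then show ?thesis
  proof (rule closed_sequentially[OF closed_complex_Reals, rotated])
    show "((\<lambda>w. (f w - f x) / (w - x)) \<circ> X) n \<in> \<real>" for n
      using real x by (auto simp: X_def simp del: of_nat_Suc)
  qed
qed

lemma in_dom_near_cmult:
  assumes "in_dom_near s a b v f"
  shows "in_dom_near s a b v (\<lambda>x. k *s f x)"
proof -
  have "wronskian v (\<lambda>x. k *s f x) = (\<lambda>x. k * wronskian v f x)"
    by (auto simp: wronskian_def algebra_simps)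
  then show ?thesis
    using assms tendsto_mult_left[of "wronskian v f" 0 "end_filter s a b" k] L2_near_cmult by (simp add: in_dom_near_def)
qed

lemma in_dom_near_cong:
  assumes "a < b" "in_dom_near s a b v f" "\<And>x. x \<in> einterval a b \<Longrightarrow> f x = g x"
  shows "in_dom_near s a b v g"
proof -
  obtain c where c: "c \<in> einterval a b" using einterval_nonempty[OF assms(1)] by blast
  show ?thesis by (rule in_dom_near_tail_cong[OF assms(1,2) c]) (use assms(3) tail_subset[OF c] in blast)
qed

text \<open>No boundary spinor of \<open>H\<close> is fixed. At \<open>a\<close> square
  integrability of \<Phi> suffices, since the Wronskian of \<open>t\<close> with its transform tends
  to 0 there anyway; the spinor at \<open>b\<close> appears later as \<open>w\<close>.\<close>

locale double_commutation = dirac_system a b Q \<Phi> \<Theta> for a b :: ereal and Q \<Phi> \<Theta> +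
  fixes lam :: complex and \<gamma> :: ereal
  assumes Q_loc: "\<And>i j. L1_loc I (\<lambda>x. Q x $ i $ j)"
    and lam: "lam \<in> \<real>"
    and th_right: "L2_near False a b (\<Theta> lam)"
    and th_left: "\<not> L2_near True a b (\<Theta> lam)"
    and Phi_left: "\<And>z. L2_near True a b (\<Phi> z)"
    and \<gamma>: "0 < \<gamma>"
begin

abbreviation "th \<equiv> \<Theta> lam"
abbreviation "cc \<equiv> dc_c b \<gamma> th"
abbreviation "t \<equiv> dc_u b \<gamma> th"
definition "Qg x = Q x + dc_Q b \<gamma> th x"
definition "g0 = real_of_ereal (1 / \<gamma>)"
text \<open>The negative of \<open>c\<close> as a real-valued function, for use in inequalities; it
  is positive and decreasing.\<close>

definition "Cr x = g0 + integral (tail False a b x) (\<lambda>y. (norm (th y))\<^sup>2)"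
text \<open>An antiderivative of \<open>- th . u\<close>. Written as a Wronskian it makes sense even
  if the integral of \<open>th . u\<close> up to \<open>b\<close> does not exist.\<close>

definition "F z u x = wronskian th u x / (z - lam)"
definition "T z u x = u x + F z u x *s t x"

lemma norm2_integrable:
  fixes f :: "real \<Rightarrow> complex^2"
  assumes f: "continuous_on I f" and x: "x \<in> I" "y \<in> I"
  shows "(\<lambda>s. (norm (f s))\<^sup>2) integrable_on {x..y}"
  using continuous_on_subset[OF f interval_Icc_subset[OF is_interval_einterval x]]
  by (intro integrable_continuous_real continuous_on_power continuous_on_norm)

lemma g0_nonneg: "0 \<le> g0" using \<gamma> unfolding g0_def by (cases \<gamma>) (auto simp: one_ereal_def)

lemma th_sol: "sol lam th" by (rule V_sol)
lemma th_nonzero: "x \<in> I \<Longrightarrow> th x \<noteq> 0" by (rule V_nonzero)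
lemma th_nontrivial: "nontrivial_on I th"
  using einterval_nonempty[OF ab] th_nonzero unfolding nontrivial_on_def by blast
lemma th_cont: "continuous_on I th" by (rule sol_continuous[OF th_sol])
lemma th2_cont: "continuous_on I (\<lambda>x. (norm (th x))\<^sup>2)" by (intro continuous_intros th_cont)

lemma th_real: "x \<in> I \<Longrightarrow> th x $ i \<in> \<real>"
  using V lam unfolding real_entire_solution_def real_valued_on_def by blast

lemma th_cnj: "x \<in> I \<Longrightarrow> cnj (th x $ i) = th x $ i"
  using th_real by (simp add: Reals_cnj_iff)

lemma th_cnjv: "x \<in> I \<Longrightarrow> cnjv (th x) = th x"
  by (simp add: vec_eq_iff th_cnj)

lemma th_dotc: "x \<in> I \<Longrightarrow> dotc (th x) (th x) = of_real ((norm (th x))\<^sup>2)"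
  using dotc_cnjv[of "th x"] by (simp add: th_cnjv)

lemma th_sq: "x \<in> I \<Longrightarrow> square_integrable (tail False a b x) th"
  by (rule sol_L2_nearD[OF th_right th_sol])

lemma th2_abs: "x \<in> I \<Longrightarrow> (\<lambda>y. (norm (th y))\<^sup>2) absolutely_integrable_on tail False a b x"
  using th_sq unfolding square_integrable_def by blast

lemma cc_eq:
  assumes x: "x \<in> I" shows "cc x = - of_real (Cr x)"
proof -
  have "integral (einterval (ereal x) b) (\<lambda>y. (th y $ 1)\<^sup>2 + (th y $ 2)\<^sup>2) =
      integral (tail False a b x) (\<lambda>y. complex_of_real ((norm (th y))\<^sup>2))"
    unfolding tail_def
  proof (simp, rule integral_cong)
    fix y assume "y \<in> einterval (ereal x) b"
    then have "y \<in> I" using tail_subset[OF x, of False] by (auto simp: tail_def)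
    then show "(th y $ 1)\<^sup>2 + (th y $ 2)\<^sup>2 = (complex_of_real (norm (th y)))\<^sup>2"
      using th_dotc[of y] by (simp add: dotc_def power2_eq_square)
  qed
  also have "\<dots> = of_real (integral (tail False a b x) (\<lambda>y. (norm (th y))\<^sup>2))"
    using integral_linear[OF square_integrable_integrable[OF th_sq[OF x]] bounded_linear_of_real] unfolding o_def .
  finally show ?thesis by (simp add: dc_c_def Cr_def g0_def)
qed

lemma Cr_diff:
  assumes x: "x \<in> I" "y \<in> I" "x \<le> y"
  shows "Cr y - Cr x = integral {x..y} (\<lambda>s. - ((norm (th s))\<^sup>2))"
proof (cases "x = y")
  case False
  then have "y \<in> tail False a b x" using x by (auto simp: tail_def einterval_iff)
  then show ?thesis using integral_tail_split(1)[OF th2_abs[OF x(1)] x(1), of y] x False by (simp add: Cr_def seg_def)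
qed simp

lemma Cr_mono: assumes "x \<in> I" "y \<in> I" "x \<le> y" shows "Cr y \<le> Cr x"
proof -
  have "0 \<le> integral {x..y} (\<lambda>s. (norm (th s))\<^sup>2)"
    using continuous_seg_integrable[OF th2_cont assms(1,2)] assms(3)
    by (intro Henstock_Kurzweil_Integration.integral_nonneg) (simp_all add: seg_def)
  then show ?thesis using Cr_diff[OF assms] by simp
qed

text \<open>Strict positivity comes from the energy of the nowhere vanishing \<open>th\<close>
  beyond \<open>x\<close>, and so includes \<gamma> = \<infinity>, where \<open>g0\<close> is
  zero.\<close>

lemma Cr_pos:
  assumes x: "x \<in> I" shows "Cr x > 0"
proof -
  obtain y where y: "y \<in> tail False a b x" using tail_nonempty[OF x] by blast
  then have xy: "x < y" "y \<in> I" using tail_subset[OF x, of False] by (auto simp: tail_def einterval_iff)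
  have "0 < integral {x..y} (\<lambda>s. (norm (th s))\<^sup>2)" by (rule sol_energy_pos[OF th_sol th_nonzero x xy(2,1)])
  moreover have "0 \<le> Cr y" unfolding Cr_def
    using g0_nonneg Henstock_Kurzweil_Integration.integral_nonneg[OF square_integrable_integrable[OF th_sq[OF xy(2)]]] by simp
  ultimately show ?thesis using Cr_diff[OF x xy(2)] xy(1) by simp
qed

lemma cc_nonzero: "x \<in> I \<Longrightarrow> cc x \<noteq> 0"
  using Cr_pos[of x] by (simp add: cc_eq)

lemma cc_ac: "ac_deriv I cc (\<lambda>x. dotc (th x) (th x))"
proof -
  have "ac_deriv I Cr (\<lambda>s. - ((norm (th s))\<^sup>2))"
    unfolding ac_deriv_def
  proof (intro conjI ballI impI)
    show "L1_loc I (\<lambda>s. - ((norm (th s))\<^sup>2))" by (intro L1_loc_continuous continuous_intros th_cont)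
  qed (rule Cr_diff)
  then have "ac_deriv I (\<lambda>x. - complex_of_real (Cr x)) (\<lambda>x. - complex_of_real (- ((norm (th x))\<^sup>2)))"
    by (intro ac_deriv_uminus ac_deriv_linear[OF _ _ bounded_linear_of_real]) auto
  then show ?thesis by (rule ac_deriv_cong) (auto simp: cc_eq th_dotc)
qed

lemma r_ac: "ac_deriv I (\<lambda>x. 1 / cc x) (\<lambda>x. - ((1 / cc x)\<^sup>2) * dotc (th x) (th x))"
  using ac_deriv_inverse[OF cc_ac] cc_nonzero by (simp add: power_one_over)

lemma th_ac:
  "ac_deriv I (\<lambda>x. th x $ 1) (\<lambda>x. lam * th x $ 2 - (Q x *v th x) $ 2)"
  "ac_deriv I (\<lambda>x. th x $ 2) (\<lambda>x. (Q x *v th x) $ 1 - lam * th x $ 1)"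
  using th_sol unfolding dirac_solution_def by (simp_all add: dirac_expr_iff)

lemma t_component: "t x $ i = (1 / cc x) * th x $ i"
  by (simp add: dc_u_def)

lemma t_ac:
  "ac_deriv I (\<lambda>x. t x $ 1) (\<lambda>x. th x $ 1 * (- ((1 / cc x)\<^sup>2) * dotc (th x) (th x)) + (1 / cc x) * (lam * th x $ 2 - (Q x *v th x) $ 2))"
  "ac_deriv I (\<lambda>x. t x $ 2) (\<lambda>x. th x $ 2 * (- ((1 / cc x)\<^sup>2) * dotc (th x) (th x)) + (1 / cc x) * ((Q x *v th x) $ 1 - lam * th x $ 1))"
  unfolding t_component by (rule ac_deriv_mult[OF r_ac th_ac(1)] ac_deriv_mult[OF r_ac th_ac(2)]; simp)+

lemma Qg_components:
  "Qg x $ 1 $ 1 = Q x $ 1 $ 1 - 2 * (th x $ 1 * th x $ 2 * (1 / cc x))"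
  "Qg x $ 1 $ 2 = Q x $ 1 $ 2 + ((th x $ 1)\<^sup>2 - (th x $ 2)\<^sup>2) * (1 / cc x)"
  "Qg x $ 2 $ 1 = Q x $ 2 $ 1 + ((th x $ 1)\<^sup>2 - (th x $ 2)\<^sup>2) * (1 / cc x)"
  "Qg x $ 2 $ 2 = Q x $ 2 $ 2 + 2 * (th x $ 1 * th x $ 2 * (1 / cc x))"
  by (simp_all add: Qg_def dc_Q_def sigma1_def sigma3_def matrix_matrix_mult_def mat_def sum_2)

lemma Qg_sym: "x \<in> I \<Longrightarrow> Qg x $ 1 $ 2 = Qg x $ 2 $ 1"
  by (simp add: Qg_components Q_sym)

lemma cc_real: "x \<in> I \<Longrightarrow> cc x \<in> \<real>"
  by (simp add: cc_eq)

lemma t_real: "x \<in> I \<Longrightarrow> t x $ i \<in> \<real>"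
  using cc_real th_real by (simp add: t_component)

lemma Qg_real: "x \<in> I \<Longrightarrow> Qg x $ i $ j \<in> \<real>"
  using exhaust_2[of i] exhaust_2[of j] Q_real[of x] th_real[of x] cc_real[of x] by (auto simp: Qg_components)

lemma t_sol: "dirac_solution I Qg lam t"
  unfolding dirac_solution_def dirac_expr_iff[OF open_einterval is_interval_einterval]
proof
  show "ac_deriv I (\<lambda>x. t x $ 1) (\<lambda>x. (lam *s t x) $ 2 - (Qg x *v t x) $ 2)"
    by (rule ac_deriv_cong[OF t_ac(1)])
      (auto simp: t_component Qg_components dotc_def power2_eq_square algebra_simps Q_sym)
  show "ac_deriv I (\<lambda>x. t x $ 2) (\<lambda>x. (Qg x *v t x) $ 1 - (lam *s t x) $ 1)"
    by (rule ac_deriv_cong[OF t_ac(2)])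
      (auto simp: t_component Qg_components dotc_def power2_eq_square algebra_simps Q_sym)
qed

lemma F_ac:
  assumes u: "sol z u" and z: "z \<noteq> lam"
  shows "ac_deriv I (F z u) (\<lambda>x. - dotc (th x) (u x))"
proof -
  have "ac_deriv I (\<lambda>x. (1 / (z - lam)) * wronskian th u x) (\<lambda>x. (1 / (z - lam)) * ((lam - z) * dotc (th x) (u x)))"
    by (rule ac_deriv_cmult[OF sol_wronskian_ac[OF th_sol u]]) simp
  then show ?thesis by (rule ac_deriv_cong) (use z in \<open>auto simp: F_def field_simps\<close>)
qed

lemma T_sol:
  assumes u: "sol z u" and z: "z \<noteq> lam"
  shows "dirac_solution I Qg z (T z u)"
  unfolding dirac_solution_def dirac_expr_iff[OF open_einterval is_interval_einterval]
proof
  note o = open_einterval is_interval_einterval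
  note ua = u[unfolded dirac_solution_def dirac_expr_iff[OF o]]
  have FW: "F z u x * (z - lam) = th x $ 1 * u x $ 2 - th x $ 2 * u x $ 1" for x
    using z by (simp add: F_def wronskian_def)
  show "ac_deriv I (\<lambda>x. T z u x $ 1) (\<lambda>x. (z *s T z u x) $ 2 - (Qg x *v T z u x) $ 2)"
  proof (rule ac_deriv_cong[OF ac_deriv_add[OF conjunct1[OF ua] ac_deriv_mult[OF F_ac[OF u z] t_ac(1) o] o(2)] o(2)])
    fix x assume "x \<in> I"
    then show "(z *s u x) $ 2 - (Q x *v u x) $ 2 + (t x $ 1 * - dotc (th x) (u x) + F z u x *
        (th x $ 1 * (- ((1 / cc x)\<^sup>2) * dotc (th x) (th x)) + (1 / cc x) * (lam * th x $ 2 - (Q x *v th x) $ 2)))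
       = (z *s T z u x) $ 2 - (Qg x *v T z u x) $ 2"
      using dc_algebra(1)[OF FW[of x], of "Q x $ 1 $ 2" "Q x $ 2 $ 2" "1 / cc x"]
      by (simp only: T_def t_component Qg_components dotc_def mult_vec2 vector_add_component vector_smult_component Q_sym)
  qed (simp add: T_def)
  show "ac_deriv I (\<lambda>x. T z u x $ 2) (\<lambda>x. (Qg x *v T z u x) $ 1 - (z *s T z u x) $ 1)"
  proof (rule ac_deriv_cong[OF ac_deriv_add[OF conjunct2[OF ua] ac_deriv_mult[OF F_ac[OF u z] t_ac(2) o] o(2)] o(2)])
    fix x assume "x \<in> I"
    then show "(Q x *v u x) $ 1 - (z *s u x) $ 1 + (t x $ 2 * - dotc (th x) (u x) + F z u x *
        (th x $ 2 * (- ((1 / cc x)\<^sup>2) * dotc (th x) (th x)) + (1 / cc x) * ((Q x *v th x) $ 1 - lam * th x $ 1)))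
       = (Qg x *v T z u x) $ 1 - (z *s T z u x) $ 1"
      using dc_algebra(2)[OF FW[of x], of "Q x $ 1 $ 1" "Q x $ 1 $ 2" "1 / cc x"]
      by (simp only: T_def t_component Qg_components dotc_def mult_vec2 vector_add_component vector_smult_component Q_sym)
  qed (simp add: T_def)
qed

text \<open>The correction is \<open>F z u\<close> times the Wronskian of \<open>th\<close> with
  \<open>v\<close>, minus the same with \<open>u\<close> and \<open>v\<close> exchanged; it cancels
  because \<open>F z\<close> is proportional to that Wronskian.\<close>

lemma wronskian_T: "wronskian (T z u) (T z v) x = wronskian u v x"
  and wronskian_t_T: "wronskian t (T z u) x = (1 / cc x) * wronskian th u x"
proof -
  define r where "r = 1 / cc x"
  have t: "t x $ i = r * th x $ i" for i by (simp add: t_component r_def)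
  have "wronskian (T z u) (T z v) x = wronskian u v x + r * (F z u x * wronskian th v x - F z v x * wronskian th u x)"
    by (simp add: T_def wronskian_def t algebra_simps)
  moreover have "F z u x * wronskian th v x = F z v x * wronskian th u x" by (simp add: F_def)
  ultimately show "wronskian (T z u) (T z v) x = wronskian u v x" by simp
  show "wronskian t (T z u) x = (1 / cc x) * wronskian th u x"
    unfolding r_def[symmetric] by (simp add: T_def wronskian_def t algebra_simps)
qed

lemma T_energy:
  assumes u: "sol z u" and z: "z \<noteq> lam" and x: "x \<in> I" "y \<in> I" "x \<le> y"
  shows "integral {x..y} (\<lambda>s. (norm (T z u s))\<^sup>2) =
    integral {x..y} (\<lambda>s. (norm (u s))\<^sup>2) + ((norm (F z u y))\<^sup>2 / Cr y - (norm (F z u x))\<^sup>2 / Cr x)"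
proof -
  note o = open_einterval is_interval_einterval
  \<comment> \<open>The derivative of \<open>- |F|^2 / c\<close>, computed from
    \<open>F' = - th . u\<close> and \<open>c' = th . th\<close>. Pointwise
    \<open>|T u|^2 = |u|^2 + P'\<close>, since \<open>th\<close> and \<open>c\<close> are
    real.\<close>
  define P' where "P' s = (1 / cc s) * (cnj (F z u s) * dotc (th s) (u s) + F z u s * cnj (dotc (th s) (u s)))
     + (F z u s * cnj (F z u s)) * ((1 / cc s)\<^sup>2 * dotc (th s) (th s))" for s
  have Fa: "ac_deriv I (F z u) (\<lambda>x. - dotc (th x) (u x))" by (rule F_ac[OF u z])
  have Fc: "ac_deriv I (\<lambda>x. cnj (F z u x)) (\<lambda>x. cnj (- dotc (th x) (u x)))"
    by (rule ac_deriv_linear[OF Fa o(2) bounded_linear_cnj])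
  have "ac_deriv I (\<lambda>x. (F z u x * cnj (F z u x)) * - (1 / cc x)) P'"
    by (rule ac_deriv_cong[OF ac_deriv_mult[OF ac_deriv_mult[OF Fa Fc o] ac_deriv_uminus[OF r_ac o(2)] o] o(2)])
      (auto simp: P'_def algebra_simps)
  then have P'int: "(F z u y * cnj (F z u y)) * - (1 / cc y) - (F z u x * cnj (F z u x)) * - (1 / cc x) = integral {x..y} P'"
    and P'abs: "P' integrable_on {x..y}"
    using x abs_integrable_imp(1)[OF L1_loc_Icc[OF _ interval_Icc_subset[OF o(2) x(1,2)]]] unfolding ac_deriv_def by blast+
  have cT: "continuous_on I (T z u)"
    using T_sol[OF u z] dirac_expr_continuous[OF _ o] unfolding dirac_solution_def by blast
  note iu = norm2_integrable[OF sol_continuous[OF u] x(1,2)] and iT = norm2_integrable[OF cT x(1,2)]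
  have pt: "complex_of_real ((norm (T z u s))\<^sup>2) = of_real ((norm (u s))\<^sup>2) + P' s" if s: "s \<in> I" for s
  proof -
    have cr: "cnj (cc s) = cc s" using cc_real[OF s] by (simp add: Reals_cnj_iff)
    show ?thesis unfolding dotc_cnjv[symmetric] P'_def T_def
      by (simp add: dotc_def t_component th_cnj[OF s] cr power2_eq_square add_divide_distrib algebra_simps)
  qed
  have cI: "complex_of_real (integral {x..y} f) = integral {x..y} (\<lambda>s. complex_of_real (f s))" if "f integrable_on {x..y}" for f
    using integral_linear[OF that bounded_linear_of_real[where 'a = complex]] by (simp add: o_def)
  have "complex_of_real (integral {x..y} (\<lambda>s. (norm (T z u s))\<^sup>2)) = integral {x..y} (\<lambda>s. complex_of_real ((norm (u s))\<^sup>2) + P' s)"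
    unfolding cI[OF iT] by (rule integral_cong) (use pt interval_Icc_subset[OF o(2) x(1,2)] in blast)
  also have "\<dots> = integral {x..y} (\<lambda>s. complex_of_real ((norm (u s))\<^sup>2)) + integral {x..y} P'"
    using integrable_linear[OF iu bounded_linear_of_real[where 'a = complex]] P'abs by (intro integral_add) (simp_all add: o_def)
  also have "\<dots> = of_real (integral {x..y} (\<lambda>s. (norm (u s))\<^sup>2)) + of_real ((norm (F z u y))\<^sup>2 / Cr y - (norm (F z u x))\<^sup>2 / Cr x)"
    unfolding cI[OF iu] P'int[symmetric] using x
    by (simp add: cc_eq complex_mult_cnj cmod_power2)
  finally show ?thesis unfolding of_real_add[symmetric] of_real_eq_iff .
qed

text \<open>Since \<open>c' = |th|^2\<close>, the derivative of \<open>- 1/c\<close> is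
  \<open>|th|^2 / c^2\<close>, that is \<open>|t|^2\<close>.\<close>

lemma t_energy:
  assumes x: "x \<in> I" "y \<in> I" "x \<le> y"
  shows "integral {x..y} (\<lambda>s. (norm (t s))\<^sup>2) = 1 / Cr y - 1 / Cr x"
proof -
  note o = open_einterval is_interval_einterval
  have r: "1 / cc y - 1 / cc x = integral {x..y} (\<lambda>x. - ((1 / cc x)\<^sup>2) * dotc (th x) (th x))"
    using r_ac x unfolding ac_deriv_def by blast
  have "integral {x..y} (\<lambda>x. - ((1 / cc x)\<^sup>2) * dotc (th x) (th x)) = integral {x..y} (\<lambda>s. - complex_of_real ((norm (t s))\<^sup>2))"
  proof (rule integral_cong)
    fix s assume "s \<in> {x..y}"
    then have s: "s \<in> I" using interval_Icc_subset[OF o(2) x(1,2)] by blast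
    have cr: "cnj (cc s) = cc s" using cc_real[OF s] by (simp add: Reals_cnj_iff)
    show "- ((1 / cc s)\<^sup>2) * dotc (th s) (th s) = - complex_of_real ((norm (t s))\<^sup>2)"
      unfolding dotc_cnjv[symmetric]
      by (simp add: dotc_def t_component th_cnj[OF s] cr power2_eq_square add_divide_distrib)
  qed
  also have "\<dots> = - complex_of_real (integral {x..y} (\<lambda>s. (norm (t s))\<^sup>2))"
  proof -
    have "continuous_on I t" using t_sol dirac_expr_continuous[OF _ o] unfolding dirac_solution_def by blast
    then have "(\<lambda>s. (norm (t s))\<^sup>2) integrable_on {x..y}" by (rule norm2_integrable[OF _ x(1,2)])
    from integral_linear[OF this bounded_linear_of_real[where 'a = complex]] show ?thesis by (simp add: o_def)
  qed
  finally have e: "integral {x..y} (\<lambda>x. - ((1 / cc x)\<^sup>2) * dotc (th x) (th x)) =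
    - complex_of_real (integral {x..y} (\<lambda>s. (norm (t s))\<^sup>2))" .
  have "complex_of_real (integral {x..y} (\<lambda>s. (norm (t s))\<^sup>2)) = - (1 / cc y - 1 / cc x)"
    unfolding r e by simp
  also have "\<dots> = of_real (1 / Cr y - 1 / Cr x)" using x by (simp add: cc_eq)
  finally show ?thesis unfolding of_real_eq_iff .
qed

lemma t_continuous: "continuous_on I t"
  using t_sol dirac_expr_continuous[OF _ open_einterval is_interval_einterval] unfolding dirac_solution_def by blast

lemma T_continuous: "sol z u \<Longrightarrow> z \<noteq> lam \<Longrightarrow> continuous_on I (T z u)"
  using T_sol dirac_expr_continuous[OF _ open_einterval is_interval_einterval] unfolding dirac_solution_def by blast

subsubsection \<open>Behaviour near the left end\<close>

lemma tail_True: "x \<in> I \<Longrightarrow> y \<in> tail True a b x \<Longrightarrow> y \<in> I \<and> y \<le> x"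
  using tail_subset[of x a b True] by (auto simp: tail_def einterval_iff)

lemma tail_False: "x \<in> I \<Longrightarrow> y \<in> tail False a b x \<Longrightarrow> y \<in> I \<and> x \<le> y"
  using tail_subset[of x a b False] by (auto simp: tail_def einterval_iff)

lemma seg_energy_le_tail:
  assumes u: "square_integrable (tail s a b c) u" and c: "c \<in> I" and y: "y \<in> tail s a b c"
  shows "integral (seg c y) (\<lambda>x. (norm (u x))\<^sup>2) \<le> integral (tail s a b c) (\<lambda>x. (norm (u x))\<^sup>2)"
proof -
  have abs: "(\<lambda>x. (norm (u x))\<^sup>2) absolutely_integrable_on tail s a b c" using u unfolding square_integrable_def by blast
  note sp = integral_tail_split[OF abs c y]
  have "0 \<le> integral (tail s a b y) (\<lambda>x. (norm (u x))\<^sup>2)"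
    by (rule Henstock_Kurzweil_Integration.integral_nonneg[OF abs_integrable_imp(1)[OF sp(2)]]) simp
  then show ?thesis using sp(1) by linarith
qed

lemma t_left: "L2_near True a b t"
proof -
  obtain c where c: "c \<in> I" using einterval_nonempty[OF ab] by blast
  have "square_integrable (tail True a b c) t"
  proof (rule square_integrable_tailI[OF ab c t_continuous])
    fix x assume "x \<in> tail True a b c"
    then have x: "x \<in> I" "x \<le> c" using tail_True[OF c] by auto
    show "integral (seg c x) (\<lambda>y. (norm (t y))\<^sup>2) \<le> 1 / Cr c"
      using t_energy[OF x(1) c x(2)] Cr_pos[OF x(1)] x(2) by (simp add: seg_def)
  qed
  then show ?thesis using c unfolding L2_near_def by blast
qed

lemma T_left:
  assumes u: "sol z u" "L2_near True a b u" and z: "z \<noteq> lam"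
  shows "L2_near True a b (T z u)"
proof -
  obtain c where c: "c \<in> I" using einterval_nonempty[OF ab] by blast
  note sq = sol_L2_nearD[OF u(2,1) c]
  have "square_integrable (tail True a b c) (T z u)"
  proof (rule square_integrable_tailI[OF ab c T_continuous[OF u(1) z]])
    fix x assume xt: "x \<in> tail True a b c"
    then have x: "x \<in> I" "x \<le> c" using tail_True[OF c] by auto
    have "0 \<le> (norm (F z u x))\<^sup>2 / Cr x" using Cr_pos[OF x(1)] by simp
    then show "integral (seg c x) (\<lambda>y. (norm (T z u y))\<^sup>2) \<le>
        integral (tail True a b c) (\<lambda>y. (norm (u y))\<^sup>2) + (norm (F z u c))\<^sup>2 / Cr c"
      using T_energy[OF u(1) z x(1) c x(2)] seg_energy_le_tail[OF sq c xt] x(2) by (simp add: seg_def)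
  qed
  then show ?thesis using c unfolding L2_near_def by blast
qed

lemma Cr_left: "filterlim Cr at_top (end_filter True a b)"
  unfolding filterlim_at_top
proof
  fix K :: real
  obtain c where c: "c \<in> I" using einterval_nonempty[OF ab] by blast
  have "\<exists>x\<in>tail True a b c. Cr x > K"
  proof (rule ccontr)
    assume "\<not> ?thesis"
    then have K: "\<And>x. x \<in> tail True a b c \<Longrightarrow> Cr x \<le> K" by force
    have "square_integrable (tail True a b c) th"
    proof (rule square_integrable_tailI[OF ab c th_cont])
      fix x assume xt: "x \<in> tail True a b c"
      then have x: "x \<in> I" "x \<le> c" using tail_True[OF c] by auto
      show "integral (seg c x) (\<lambda>y. (norm (th y))\<^sup>2) \<le> K"
        using Cr_diff[OF x(1) c x(2)] K[OF xt] Cr_pos[OF c] x(2) by (simp add: seg_def)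
    qed
    then show False using th_left c unfolding L2_near_def by blast
  qed
  then obtain x where x: "x \<in> tail True a b c" "Cr x > K" by blast
  have xI: "x \<in> I" using tail_True[OF c x(1)] by blast
  show "eventually (\<lambda>y. K \<le> Cr y) (end_filter True a b)"
    using eventually_in_tail[OF ab xI, of True]
  proof eventually_elim
    case (elim y)
    then have "y \<in> I" "y \<le> x" using tail_True[OF xI] by auto
    then show ?case using Cr_mono[of y x] xI x(2) by auto
  qed
qed

text \<open>The Wronskian has modulus \<open>|z - lam| |F| / Cr\<close>. The energy identity bounds
  \<open>|F|^2 / Cr\<close> by some \<open>B\<close>, so \<open>|F| / Cr\<close> is at most the
  square root of \<open>B / Cr\<close>, and \<open>Cr\<close> tends to infinity at
  \<open>a\<close>.\<close>

lemma wronskian_t_left: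
  assumes u: "sol z u" "L2_near True a b u" and z: "z \<noteq> lam"
  shows "(wronskian t (T z u) \<longlongrightarrow> 0) (end_filter True a b)"
proof -
  obtain c where c: "c \<in> I" using einterval_nonempty[OF ab] by blast
  define B where "B = integral (tail True a b c) (\<lambda>y. (norm (u y))\<^sup>2) + (norm (F z u c))\<^sup>2 / Cr c"
  have "((\<lambda>x. B / Cr x) \<longlongrightarrow> 0) (end_filter True a b)"
    by (rule tendsto_divide_0[OF tendsto_const filterlim_at_top_imp_at_infinity[OF Cr_left]])
  then have "((\<lambda>x. norm (z - lam) * sqrt (B / Cr x)) \<longlongrightarrow> norm (z - lam) * sqrt 0) (end_filter True a b)"
    by (intro tendsto_intros)
  then have lim: "((\<lambda>x. norm (z - lam) * sqrt (B / Cr x)) \<longlongrightarrow> 0) (end_filter True a b)" by simp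
  show ?thesis
  proof (rule Lim_null_comparison[OF _ lim])
    show "eventually (\<lambda>x. norm (wronskian t (T z u) x) \<le> norm (z - lam) * sqrt (B / Cr x)) (end_filter True a b)"
      using eventually_in_tail[OF ab c, of True]
    proof eventually_elim
      case (elim x)
      then have x: "x \<in> I" "x \<le> c" using tail_True[OF c] by auto
      have C: "Cr x > 0" by (rule Cr_pos[OF x(1)])
      have "0 \<le> integral {x..c} (\<lambda>s. (norm (T z u s))\<^sup>2)"
        by (rule Henstock_Kurzweil_Integration.integral_nonneg[OF norm2_integrable[OF T_continuous[OF u(1) z] x(1) c]]) simp
      then have "(norm (F z u x))\<^sup>2 / Cr x \<le> B"
        using T_energy[OF u(1) z x(1) c x(2)] seg_energy_le_tail[OF sol_L2_nearD[OF u(2,1) c] c elim] x(2)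
        by (simp add: seg_def B_def)
      then have "(norm (F z u x) / Cr x)\<^sup>2 \<le> B / Cr x"
        using C by (simp add: power_divide power2_eq_square divide_right_mono field_simps)
      then have le: "norm (F z u x) / Cr x \<le> sqrt (B / Cr x)" by (rule real_le_rsqrt)
      have "wronskian t (T z u) x = (1 / cc x) * ((z - lam) * F z u x)" using z by (simp add: wronskian_t_T F_def)
      then have "norm (wronskian t (T z u) x) = norm (z - lam) * (norm (F z u x) / Cr x)"
        using C x by (simp add: cc_eq norm_mult norm_divide)
      then show ?case using mult_left_mono[OF le norm_ge_zero[of "z - lam"]] by simp
    qed
  qed
qed

end

section \<open>Limits of solutions and the solution selected by the singular Weyl function\<close>

lemma L1_locI_Icc:
  fixes f :: "real \<Rightarrow> 'a::euclidean_space"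
  assumes "\<And>x y. x \<in> S \<Longrightarrow> y \<in> S \<Longrightarrow> f absolutely_integrable_on {x..y}"
  shows "L1_loc S f"
  unfolding L1_loc_def
proof (intro allI impI)
  fix K assume K: "compact K \<and> K \<subseteq> S"
  show "f absolutely_integrable_on K"
  proof (cases "K = {}")
    case True then show ?thesis by simp
  next
    case False
    obtain p where p: "p \<in> K" "\<And>x. x \<in> K \<Longrightarrow> p \<le> x" using compact_attains_inf[of K] K False by blast
    obtain q where q: "q \<in> K" "\<And>x. x \<in> K \<Longrightarrow> x \<le> q" using compact_attains_sup[of K] K False by blast
    have "f absolutely_integrable_on {p..q}" using assms p(1) q(1) K by blast
    then show ?thesis
      by (rule set_integrable_subset) (use p q K lmeasurable_compact fmeasurableD in auto)
  qed
qed

lemma ac_deriv_limit: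
  fixes f h :: "real \<Rightarrow> complex"
  assumes S: "is_interval S" and ac: "\<And>n. ac_deriv S (fn n) (hn n)"
    and f: "\<And>x. x \<in> S \<Longrightarrow> (\<lambda>n. fn n x) \<longlonglongrightarrow> f x" and h: "\<And>x. x \<in> S \<Longrightarrow> (\<lambda>n. hn n x) \<longlonglongrightarrow> h x"
    and dom: "\<And>x y. x \<in> S \<Longrightarrow> y \<in> S \<Longrightarrow> \<exists>B. B integrable_on {x..y} \<and> (\<forall>n. \<forall>s\<in>{x..y}. norm (hn n s) \<le> B s)"
  shows "ac_deriv S f h"
  unfolding ac_deriv_def
proof (intro conjI ballI impI)
  have main: "h absolutely_integrable_on {x..y} \<and> (\<lambda>n. integral {x..y} (hn n)) \<longlonglongrightarrow> integral {x..y} h"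
    if x: "x \<in> S" "y \<in> S" for x y
  proof -
    have sub: "{x..y} \<subseteq> S" by (rule interval_Icc_subset[OF S x])
    obtain B where B: "B integrable_on {x..y}" "\<And>n s. s \<in> {x..y} \<Longrightarrow> norm (hn n s) \<le> B s"
      using dom[OF x] by blast
    have i: "hn n absolutely_integrable_on {x..y}" for n by (rule ac_deriv_abs_integrable[OF ac S x])
    have l: "(\<lambda>n. hn n s) \<longlonglongrightarrow> h s" if "s \<in> {x..y}" for s using h sub that by blast
    have hB: "norm (h s) \<le> B s" if s: "s \<in> {x..y}" for s
      by (rule LIMSEQ_le_const2[OF tendsto_norm[OF l[OF s]]]) (use B(2)[OF s] in blast)
    have "h absolutely_integrable_on {x..y}"
      by (rule dominated_convergence_absolutely_integrable[OF i B(1) hB l])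
    moreover have "(\<lambda>n. integral {x..y} (hn n)) \<longlonglongrightarrow> integral {x..y} h"
      by (rule dominated_convergence(2)[OF abs_integrable_imp(1)[OF i] B l])
    ultimately show ?thesis by blast
  qed
  show "L1_loc S h" by (rule L1_locI_Icc) (use main in blast)
  fix x y assume x: "x \<in> S" "y \<in> S" "x \<le> y"
  have "fn n y - fn n x = integral {x..y} (hn n)" for n using ac[of n] x unfolding ac_deriv_def by blast
  moreover have "(\<lambda>n. fn n y - fn n x) \<longlonglongrightarrow> f y - f x" by (intro tendsto_intros f x)
  ultimately have "(\<lambda>n. integral {x..y} (hn n)) \<longlonglongrightarrow> f y - f x" by simp
  then show "f y - f x = integral {x..y} h" using main[OF x(1,2)] LIMSEQ_unique by blast
qed

text \<open>Passes to the limit in the integrated equation by dominated convergence. It serves to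
  obtain the equation at \<open>lam\<close> for a solution defined there by removing a
  singularity.\<close>

lemma dirac_solution_limit:
  assumes S: "open S" "is_interval S" and Q: "\<And>i j. L1_loc S (\<lambda>x. Q x $ i $ j)"
    and fn: "\<And>n. dirac_solution S Q (zn n) (fn n)" and zn: "zn \<longlonglongrightarrow> z"
    and f: "\<And>x. x \<in> S \<Longrightarrow> (\<lambda>n. fn n x) \<longlonglongrightarrow> f x"
    and bd: "\<And>x y. x \<in> S \<Longrightarrow> y \<in> S \<Longrightarrow> \<exists>M. \<forall>n. \<forall>s\<in>{x..y}. norm (fn n s) \<le> M"
  shows "dirac_solution S Q z f"
proof -
  have fi: "(\<lambda>n. fn n x $ i) \<longlonglongrightarrow> f x $ i" if "x \<in> S" for x i by (rule tendsto_vec_nth[OF f[OF that]])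
  have "Bseq zn" using zn convergent_imp_Bseq convergentI by blast
  then obtain Z where Z: "\<And>n. norm (zn n) \<le> Z" unfolding Bseq_def by blast
  have dom: "\<exists>B. B integrable_on {x..y} \<and> (\<forall>n. \<forall>s\<in>{x..y}. norm (zn n * fn n s $ k - (Q s $ i $ 1 * fn n s $ 1 + Q s $ i $ 2 * fn n s $ 2)) \<le> B s)"
    if x: "x \<in> S" "y \<in> S" for x y k i
  proof -
    obtain M where M: "\<And>n s. s \<in> {x..y} \<Longrightarrow> norm (fn n s) \<le> M" using bd[OF x] by blast
    have Mi: "norm (fn n s $ j) \<le> M" if "s \<in> {x..y}" for n s j
      using M[OF that] Finite_Cartesian_Product.norm_nth_le[of "fn n s" j] order_trans by blast
    let ?B = "\<lambda>s. Z * M + (norm (Q s $ i $ 1) * M + norm (Q s $ i $ 2) * M)"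
    have "?B integrable_on {x..y}"
      by (intro integrable_add integrable_on_mult_left abs_integrable_imp(2) L1_loc_Icc[OF Q] interval_Icc_subset S x) auto
    moreover have "norm (zn n * fn n s $ k - (Q s $ i $ 1 * fn n s $ 1 + Q s $ i $ 2 * fn n s $ 2)) \<le> ?B s" if s: "s \<in> {x..y}" for n s
    proof -
      have "norm (zn n * fn n s $ k - (Q s $ i $ 1 * fn n s $ 1 + Q s $ i $ 2 * fn n s $ 2)) \<le>
        norm (zn n) * norm (fn n s $ k) + (norm (Q s $ i $ 1) * norm (fn n s $ 1) + norm (Q s $ i $ 2) * norm (fn n s $ 2))"
        by (intro order_trans[OF norm_triangle_ineq4] add_mono order_trans[OF norm_triangle_ineq]) (simp_all add: norm_mult)
      also have "\<dots> \<le> ?B s"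
        using Z[of n] Mi[OF s, of n] order_trans[OF norm_ge_zero Z[of n]]
        by (intro add_mono mult_mono mult_left_mono) auto
      finally show ?thesis .
    qed
    ultimately show ?thesis by blast
  qed
  note e = fn[unfolded dirac_solution_def dirac_expr_iff[OF S]]
  have "ac_deriv S (\<lambda>x. f x $ 1) (\<lambda>x. z * f x $ 2 - (Q x $ 2 $ 1 * f x $ 1 + Q x $ 2 $ 2 * f x $ 2))"
  proof (rule ac_deriv_limit[OF S(2)])
    show "ac_deriv S (\<lambda>x. fn n x $ 1) (\<lambda>x. zn n * fn n x $ 2 - (Q x $ 2 $ 1 * fn n x $ 1 + Q x $ 2 $ 2 * fn n x $ 2))" for n
      using conjunct1[OF e[of n]] by simp
    show "(\<lambda>n. zn n * fn n x $ 2 - (Q x $ 2 $ 1 * fn n x $ 1 + Q x $ 2 $ 2 * fn n x $ 2)) \<longlonglongrightarrow>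
        z * f x $ 2 - (Q x $ 2 $ 1 * f x $ 1 + Q x $ 2 $ 2 * f x $ 2)" if "x \<in> S" for x
      by (intro tendsto_intros zn fi that)
  qed (use fi dom in auto)
  moreover have "ac_deriv S (\<lambda>x. f x $ 2) (\<lambda>x. (Q x $ 1 $ 1 * f x $ 1 + Q x $ 1 $ 2 * f x $ 2) - z * f x $ 1)"
  proof (rule ac_deriv_limit[OF S(2)])
    show "ac_deriv S (\<lambda>x. fn n x $ 2) (\<lambda>x. (Q x $ 1 $ 1 * fn n x $ 1 + Q x $ 1 $ 2 * fn n x $ 2) - zn n * fn n x $ 1)" for n
      using conjunct2[OF e[of n]] by simp
    show "(\<lambda>n. (Q x $ 1 $ 1 * fn n x $ 1 + Q x $ 1 $ 2 * fn n x $ 2) - zn n * fn n x $ 1) \<longlonglongrightarrow>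
        (Q x $ 1 $ 1 * f x $ 1 + Q x $ 1 $ 2 * f x $ 2) - z * f x $ 1" if "x \<in> S" for x
      by (intro tendsto_intros zn fi that)
    show "\<exists>B. B integrable_on {x..y} \<and> (\<forall>n. \<forall>s\<in>{x..y}. norm ((Q s $ 1 $ 1 * fn n s $ 1 + Q s $ 1 $ 2 * fn n s $ 2) - zn n * fn n s $ 1) \<le> B s)"
      if "x \<in> S" "y \<in> S" for x y
      unfolding norm_minus_commute[of "_ + _" "_ * _"] using dom[OF that, of 1 1] .
  qed (use fi in auto)
  ultimately show ?thesis unfolding dirac_solution_def dirac_expr_iff[OF S] by simp
qed

context dirac_system
begin

lemma wronskian_const_eq:
  assumes "sol z u" "sol z v" "x \<in> I"
  shows "wronskian_const a b u v = wronskian u v x"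
  unfolding wronskian_const_def
proof (rule the_equality)
  show "\<forall>y\<in>I. wronskian u v y = wronskian u v x"
    by (intro ballI sol_wronskian_const[OF assms(1,2) _ assms(3)])
  show "w = wronskian u v x" if "\<forall>y\<in>I. wronskian u v y = w" for w using that assms(3) by simp
qed

text \<open>Expanding the selected solution in the basis and dividing by its \<open>V\<close>
  coefficient shows that \<open>V + M U\<close> is a nonzero multiple of it; that coefficient is
  nonzero by \<open>ne\<close>.\<close>

lemma singular_weyl_solution:
  assumes ex: "weyl_solution_right a b Q w z u0"
    and ne: "\<And>u. weyl_solution_right a b Q w z u \<Longrightarrow> \<exists>x\<in>I. wronskian (U z) u x \<noteq> 0"
  obtains u k where "weyl_solution_right a b Q w z u" "k \<noteq> 0"
    "\<And>x. x \<in> I \<Longrightarrow> V z x + singular_weyl a b Q w U V z *s U z x = k *s u x"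
proof -
  define u where "u = (SOME u. weyl_solution_right a b Q w z u)"
  have u: "weyl_solution_right a b Q w z u" unfolding u_def by (rule someI[of "weyl_solution_right a b Q w z" u0, OF ex])
  then have us: "sol z u" by (simp add: weyl_solution_right_def)
  obtain x0 where x0: "x0 \<in> I" "wronskian (U z) u x0 \<noteq> 0" using ne[OF u] by blast
  let ?W = "wronskian (U z) u x0" and ?X = "wronskian (V z) u x0"
  have M: "singular_weyl a b Q w U V z = - (?X / ?W)"
    unfolding singular_weyl_def Let_def u_def[symmetric]
    by (simp add: wronskian_const_eq[OF U_sol us x0(1)] wronskian_const_eq[OF V_sol us x0(1)])
  show ?thesis
  proof (rule that[OF u])
    show "- (1 / ?W) \<noteq> 0" using x0 by simp
    fix x assume x: "x \<in> I"
    have "u x = - ?W *s V z x + ?X *s U z x"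
      using expand[OF x, of u z] sol_wronskian_const[OF U_sol us x x0(1)] sol_wronskian_const[OF V_sol us x x0(1)]
        wronskian_swap[of u "U z" x] by simp
    then show "V z x + singular_weyl a b Q w U V z *s U z x = - (1 / ?W) *s u x"
      unfolding M \<open>u x = _\<close> using x0(2) by (simp add: vec_eq_iff right_diff_distrib distrib_left)
  qed
qed

end

context double_commutation
begin

subsubsection \<open>Behaviour near the right end\<close>

text \<open>With the Wronskian vanishing at \<open>b\<close>, \<open>F\<close> is a tail integral
  and Cauchy-Schwarz controls the boundary term of the energy identity.\<close>

lemma T_right:
  assumes u: "sol z u" "L2_near False a b u" and z: "z \<noteq> lam"
    and W: "(wronskian th u \<longlongrightarrow> 0) (end_filter False a b)"
  shows "L2_near False a b (T z u)"
proof -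
  obtain c where c: "c \<in> I" using einterval_nonempty[OF ab] by blast
  note squ = sol_L2_nearD[OF u(2,1)]
  let ?B = "integral (tail False a b c) (\<lambda>y. (norm (u y))\<^sup>2)"
  have F0: "(F z u \<longlongrightarrow> 0) (end_filter False a b)"
    using tendsto_divide[OF W tendsto_const[of "z - lam"]] z by (simp add: F_def[abs_def])
  have da: "(\<lambda>x. dotc (th x) (u x)) absolutely_integrable_on tail False a b y" if "y \<in> I" for y
    using square_integrable_prod(2)[OF th_sq[OF that] squ[OF that]] by simp
  have "(\<lambda>x. - dotc (th x) (u x)) absolutely_integrable_on tail False a b c"
    using absolutely_integrable_linear[OF da[OF c] bounded_linear_minus[OF bounded_linear_ident]] by (simp add: o_def)
  then obtain L where L: "(F z u \<longlongrightarrow> L) (end_filter False a b)"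
    "\<And>x. x \<in> tail False a b c \<union> {c} \<Longrightarrow> F z u x - L = (if False then 1 else - 1) * integral (tail False a b x) (\<lambda>x. - dotc (th x) (u x))"
    by (rule ac_deriv_tail_limit[OF ab F_ac[OF u(1) z] c]) blast
  have "L = 0" by (rule tendsto_unique[OF end_filter_neq_bot[OF ab] L(1) F0])
  then have F: "F z u y = integral (tail False a b y) (\<lambda>x. dotc (th x) (u x))" if "y \<in> tail False a b c" for y
    using L(2)[of y] that by simp
  \<comment> \<open>The quotient stays bounded even if \<open>Cr\<close> tends to 0, because
    \<open>Cr\<close> dominates the energy of \<open>th\<close> in the same tail.\<close>
  have P: "(norm (F z u y))\<^sup>2 / Cr y \<le> ?B" if y: "y \<in> tail False a b c" for y
  proof -
    have yI: "y \<in> I" using tail_False[OF c y] by blast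
    note sq = th_sq[OF yI] squ[OF yI]
    have "norm (F z u y) \<le> integral (tail False a b y) (\<lambda>x. norm (th x) * norm (u x))"
      unfolding F[OF y] by (rule integral_norm_le[OF da[OF yI] square_integrable_prod(1)[OF sq]]) (simp_all add: norm_dotc_le)
    then have "(norm (F z u y))\<^sup>2 \<le> (integral (tail False a b y) (\<lambda>x. norm (th x) * norm (u x)))\<^sup>2"
      by (intro power_mono) auto
    also have "\<dots> \<le> integral (tail False a b y) (\<lambda>x. (norm (th x))\<^sup>2) * integral (tail False a b y) (\<lambda>x. (norm (u x))\<^sup>2)"
      by (rule integral_Cauchy_Schwarz[OF sq]) simp
    also have "\<dots> \<le> Cr y * ?B"
    proof (rule mult_mono)
      show "integral (tail False a b y) (\<lambda>x. (norm (th x))\<^sup>2) \<le> Cr y" using g0_nonneg by (simp add: Cr_def)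
      show "integral (tail False a b y) (\<lambda>x. (norm (u x))\<^sup>2) \<le> ?B"
        by (rule integral_subset_le[OF tail_mono[OF y] square_integrable_integrable[OF sq(2)] square_integrable_integrable[OF squ[OF c]]]) simp
      show "0 \<le> integral (tail False a b y) (\<lambda>x. (norm (u x))\<^sup>2)"
        by (rule Henstock_Kurzweil_Integration.integral_nonneg[OF square_integrable_integrable[OF sq(2)]]) simp
    qed (use Cr_pos[OF yI] in simp)
    finally show ?thesis using Cr_pos[OF yI] by (simp add: divide_le_eq mult.commute)
  qed
  have "square_integrable (tail False a b c) (T z u)"
  proof (rule square_integrable_tailI[OF ab c T_continuous[OF u(1) z]])
    fix y assume yt: "y \<in> tail False a b c"
    then have y: "y \<in> I" "c \<le> y" using tail_False[OF c] by auto
    have "0 \<le> (norm (F z u c))\<^sup>2 / Cr c" using Cr_pos[OF c] by simp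
    then show "integral (seg c y) (\<lambda>y. (norm (T z u y))\<^sup>2) \<le> ?B + ?B"
      using T_energy[OF u(1) z c y] seg_energy_le_tail[OF squ[OF c] c yt] P[OF yt] y(2) by (simp add: seg_def)
  qed
  then show ?thesis using c unfolding L2_near_def by blast
qed

text \<open>The energy identity read from \<open>T z u\<close> to \<open>u\<close>: the energy of
  \<open>u\<close> and the boundary term at the moving point are nonnegative and their sum is
  bounded.\<close>

lemma T_right_back:
  assumes u: "sol z u" and z: "z \<noteq> lam" and Tu: "L2_near False a b (T z u)" and c: "c \<in> I"
  shows "L2_near False a b u" and "\<exists>B. \<forall>y\<in>tail False a b c. (norm (F z u y))\<^sup>2 / Cr y \<le> B"
proof -
  note sq = L2_nearD[OF Tu T_continuous[OF u z] c]
  define B where "B = integral (tail False a b c) (\<lambda>y. (norm (T z u y))\<^sup>2) + (norm (F z u c))\<^sup>2 / Cr c"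
  have bd: "integral (seg c y) (\<lambda>y. (norm (u y))\<^sup>2) + (norm (F z u y))\<^sup>2 / Cr y \<le> B" if yt: "y \<in> tail False a b c" for y
  proof -
    have y: "y \<in> I" "c \<le> y" using tail_False[OF c yt] by auto
    show ?thesis using T_energy[OF u z c y] seg_energy_le_tail[OF sq c yt] y(2) by (simp add: seg_def B_def)
  qed
  have "square_integrable (tail False a b c) u"
  proof (rule square_integrable_tailI[OF ab c sol_continuous[OF u]])
    fix y assume yt: "y \<in> tail False a b c"
    then have "0 \<le> (norm (F z u y))\<^sup>2 / Cr y" using tail_False[OF c] Cr_pos[of y] by simp
    then show "integral (seg c y) (\<lambda>y. (norm (u y))\<^sup>2) \<le> B" using bd[OF yt] by linarith
  qed
  then show "L2_near False a b u" using c unfolding L2_near_def by blast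
  have "(norm (F z u y))\<^sup>2 / Cr y \<le> B" if yt: "y \<in> tail False a b c" for y
  proof -
    have y: "y \<in> I" "c \<le> y" using tail_False[OF c yt] by auto
    have "0 \<le> integral (seg c y) (\<lambda>y. (norm (u y))\<^sup>2)"
      using norm2_integrable[OF sol_continuous[OF u] c y(1)] y(2)
      by (intro Henstock_Kurzweil_Integration.integral_nonneg) (simp_all add: seg_def)
    then show ?thesis using bd[OF yt] by linarith
  qed
  then show "\<exists>B. \<forall>y\<in>tail False a b c. (norm (F z u y))\<^sup>2 / Cr y \<le> B" by blast
qed

text \<open>If \<open>t\<close> is square integrable near \<open>b\<close>, then
  \<open>t_energy\<close> bounds \<open>1 / Cr\<close>, the factor between the two
  Wronskians.\<close>

lemma wronskian_t_right:
  assumes W: "(wronskian th u \<longlongrightarrow> 0) (end_filter False a b)" and t: "L2_near False a b t"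
  shows "(wronskian t (T z u) \<longlongrightarrow> 0) (end_filter False a b)"
proof -
  obtain c where c: "c \<in> I" using einterval_nonempty[OF ab] by blast
  define B where "B = integral (tail False a b c) (\<lambda>y. (norm (t y))\<^sup>2) + 1 / Cr c"
  have "((\<lambda>x. B * norm (wronskian th u x)) \<longlongrightarrow> B * norm (0::complex)) (end_filter False a b)"
    by (intro tendsto_intros W)
  then have lim: "((\<lambda>x. B * norm (wronskian th u x)) \<longlongrightarrow> 0) (end_filter False a b)" by simp
  show ?thesis
  proof (rule Lim_null_comparison[OF _ lim])
    show "eventually (\<lambda>x. norm (wronskian t (T z u) x) \<le> B * norm (wronskian th u x)) (end_filter False a b)"
      using eventually_in_tail[OF ab c, of False]
    proof eventually_elim
      case (elim x)
      then have x: "x \<in> I" "c \<le> x" using tail_False[OF c] by auto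
      have "1 / Cr x \<le> B"
        using t_energy[OF c x] seg_energy_le_tail[OF L2_nearD[OF t t_continuous c] c elim] x(2) by (simp add: seg_def B_def)
      moreover have "norm (wronskian t (T z u) x) = (1 / Cr x) * norm (wronskian th u x)"
        using Cr_pos[OF x(1)] by (simp add: wronskian_t_T norm_mult norm_divide cc_eq[OF x(1)])
      ultimately show ?case using mult_right_mono[of "1 / Cr x" B "norm (wronskian th u x)"] by simp
    qed
  qed
qed

text \<open>If \<open>t\<close> is square integrable near \<open>b\<close>, the assumed limit is
  multiplied by the bounded \<open>Cr\<close>. If it is not, \<open>t_energy\<close> forces
  \<open>Cr\<close> to tend to 0, and the bound on \<open>|F|^2 / Cr\<close> from
  \<open>T_right_back\<close> makes \<open>F\<close> tend to 0.\<close>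

lemma wronskian_th_right:
  assumes u: "sol z u" and z: "z \<noteq> lam" and Tu: "L2_near False a b (T z u)"
    and W: "L2_near False a b t \<Longrightarrow> (wronskian t (T z u) \<longlongrightarrow> 0) (end_filter False a b)"
  shows "(wronskian th u \<longlongrightarrow> 0) (end_filter False a b)"
proof -
  obtain c where c: "c \<in> I" using einterval_nonempty[OF ab] by blast
  show ?thesis
  proof (cases "L2_near False a b t")
    case True
    have "((\<lambda>x. Cr c * norm (wronskian t (T z u) x)) \<longlongrightarrow> Cr c * norm (0::complex)) (end_filter False a b)"
      by (intro tendsto_intros W True)
    then have lim: "((\<lambda>x. Cr c * norm (wronskian t (T z u) x)) \<longlongrightarrow> 0) (end_filter False a b)" by simp
    show ?thesis
    proof (rule Lim_null_comparison[OF _ lim])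
      show "eventually (\<lambda>x. norm (wronskian th u x) \<le> Cr c * norm (wronskian t (T z u) x)) (end_filter False a b)"
        using eventually_in_tail[OF ab c, of False]
      proof eventually_elim
        case (elim x)
        then have x: "x \<in> I" "c \<le> x" using tail_False[OF c] by auto
        have "norm (wronskian th u x) = Cr x * norm (wronskian t (T z u) x)"
          using Cr_pos[OF x(1)] by (simp add: wronskian_t_T norm_mult norm_divide cc_eq[OF x(1)])
        then show ?case using Cr_mono[OF c x] by (simp add: mult_right_mono)
      qed
    qed
  next
    case False
    have C0: "(Cr \<longlongrightarrow> 0) (end_filter False a b)"
    proof (rule tendstoI)
      fix e :: real assume e: "e > 0"
      have "\<exists>x\<in>tail False a b c. Cr x < e"
      proof (rule ccontr)
        assume "\<not> ?thesis"
        then have K: "\<And>x. x \<in> tail False a b c \<Longrightarrow> e \<le> Cr x" by force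
        have "square_integrable (tail False a b c) t"
        proof (rule square_integrable_tailI[OF ab c t_continuous])
          fix x assume xt: "x \<in> tail False a b c"
          then have x: "x \<in> I" "c \<le> x" using tail_False[OF c] by auto
          have "1 / Cr x \<le> 1 / e" using K[OF xt] e by (intro divide_left_mono) auto
          moreover have "0 < 1 / Cr c" using Cr_pos[OF c] by simp
          moreover have "integral (seg c x) (\<lambda>y. (norm (t y))\<^sup>2) = 1 / Cr x - 1 / Cr c"
            using t_energy[OF c x] x(2) by (simp add: seg_def)
          ultimately show "integral (seg c x) (\<lambda>y. (norm (t y))\<^sup>2) \<le> 1 / e" by linarith
        qed
        then show False using False c unfolding L2_near_def by blast
      qed
      then obtain x where x: "x \<in> tail False a b c" "Cr x < e" by blast
      have xI: "x \<in> I" using tail_False[OF c x(1)] by blast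
      show "eventually (\<lambda>y. dist (Cr y) 0 < e) (end_filter False a b)"
        using eventually_in_tail[OF ab xI, of False]
      proof eventually_elim
        case (elim y)
        then have "y \<in> I" "x \<le> y" using tail_False[OF xI] by auto
        then show ?case using Cr_mono[OF xI, of y] Cr_pos[of y] x(2) by simp
      qed
    qed
    obtain B where B: "\<And>y. y \<in> tail False a b c \<Longrightarrow> (norm (F z u y))\<^sup>2 / Cr y \<le> B"
      using T_right_back(2)[OF u z Tu c] by blast
    have "((\<lambda>x. norm (z - lam) * sqrt (B * Cr x)) \<longlongrightarrow> norm (z - lam) * sqrt (B * 0)) (end_filter False a b)"
      by (intro tendsto_intros C0)
    then have lim: "((\<lambda>x. norm (z - lam) * sqrt (B * Cr x)) \<longlongrightarrow> 0) (end_filter False a b)" by simp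
    show ?thesis
    proof (rule Lim_null_comparison[OF _ lim])
      show "eventually (\<lambda>x. norm (wronskian th u x) \<le> norm (z - lam) * sqrt (B * Cr x)) (end_filter False a b)"
        using eventually_in_tail[OF ab c, of False]
      proof eventually_elim
        case (elim x)
        then have x: "x \<in> I" using tail_False[OF c] by auto
        have "(norm (F z u x))\<^sup>2 \<le> B * Cr x" using B[OF elim] Cr_pos[OF x] by (simp add: divide_le_eq)
        then have "norm (F z u x) \<le> sqrt (B * Cr x)" by (rule real_le_rsqrt)
        moreover have "norm (wronskian th u x) = norm (z - lam) * norm (F z u x)"
          using z by (simp add: F_def norm_divide)
        ultimately show ?case by (simp add: mult_left_mono)
      qed
    qed
  qed
qed

subsubsection \<open>The real entire solutions of the commuted operator\<close>

text \<open>Multiplied out, so that no division by \<open>z - lam\<close> remains; at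
  \<open>lam\<close> the Wronskian 1 of the pair leaves \<open>t\<close>.\<close>

definition "Phg z x = (z - lam) *s \<Phi> z x + wronskian th (\<Phi> z) x *s t x"
definition "wd x = deriv (\<lambda>z. wronskian th (\<Theta> z) x) lam"
definition "Wb = Lim (right_end b) (wronskian th (z_deriv \<Theta> lam))"
text \<open>The subtracted Wronskian of \<open>th\<close> with itself is zero. It is kept so that
  \<open>qq\<close>, like \<open>Thg\<close> below, is literally a divided difference with removable
  singularity at \<open>lam\<close>.\<close>

definition "qq z x = (if z = lam then wd x else (wronskian th (\<Theta> z) x - wronskian th (\<Theta> lam) x) / (z - lam))"
definition "N z x = \<Theta> z x + qq z x *s t x + (of_real g0 - Wb) *s Phg z x"
definition "Thg z x = (\<chi> i. if z = lam then deriv (\<lambda>z. N z x $ i) lam else (N z x $ i - N lam x $ i) / (z - lam))"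

lemma wronskian_hol:
  "x \<in> I \<Longrightarrow> (\<lambda>z. wronskian th (\<Theta> z) x) holomorphic_on UNIV"
  "x \<in> I \<Longrightarrow> (\<lambda>z. wronskian th (\<Phi> z) x) holomorphic_on UNIV"
  unfolding wronskian_def by (intro holomorphic_intros U_hol V_hol; simp)+

lemma wd_eq:
  assumes x: "x \<in> I" shows "wronskian th (z_deriv \<Theta> lam) x = wd x"
proof -
  have d: "((\<lambda>z. \<Theta> z x $ i) has_field_derivative deriv (\<lambda>z. \<Theta> z x $ i) lam) (at lam)" for i
    using V_hol[OF x] by (intro holomorphic_derivI[of _ UNIV]) auto
  have "((\<lambda>z. th x $ 1 * \<Theta> z x $ 2 - th x $ 2 * \<Theta> z x $ 1) has_field_derivative
     th x $ 1 * deriv (\<lambda>z. \<Theta> z x $ 2) lam - th x $ 2 * deriv (\<lambda>z. \<Theta> z x $ 1) lam) (at lam)"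
    by (intro DERIV_diff DERIV_cmult d)
  then have "deriv (\<lambda>z. th x $ 1 * \<Theta> z x $ 2 - th x $ 2 * \<Theta> z x $ 1) lam =
     th x $ 1 * deriv (\<lambda>z. \<Theta> z x $ 2) lam - th x $ 2 * deriv (\<lambda>z. \<Theta> z x $ 1) lam" by (rule DERIV_imp_deriv)
  then show ?thesis by (simp add: wd_def wronskian_def z_deriv_def)
qed

text \<open>Differentiating the Wronskian identity in \<open>z\<close> shows \<open>W(\<Theta>(\<lambda>), \<Theta>'(\<lambda>)) + c = W\<^sub>b - 1/\<gamma>\<close>, which is
  what makes the numerator \<open>N\<close> of \<open>Thg\<close> vanish at \<open>\<lambda>\<close>.\<close>

lemma wd_const:
  assumes x: "x \<in> I" "y \<in> I" "x \<le> y"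
  shows "wd y + cc y = wd x + cc x"
proof -
  let ?G = "\<lambda>z. integral {x..y} (\<lambda>s. dotc (\<Theta> z s) (th s))"
  have sq: "square_integrable {x<..<y} th"
    by (rule square_integrable_subset[OF square_integrable_Icc[OF continuous_on_subset[OF th_cont interval_Icc_subset[OF _ x(1,2)]]]]) auto
  have G: "?G holomorphic_on UNIV" by (rule dotc_integral_hol[OF V_sol _ x(1,2) sq]) (rule V_hol)
  have eq: "wronskian th (\<Theta> z) y - wronskian th (\<Theta> z) x = (lam - z) * ?G z" for z
  proof -
    have "wronskian th (\<Theta> z) y - wronskian th (\<Theta> z) x = integral {x..y} (\<lambda>s. (lam - z) * dotc (th s) (\<Theta> z s))"
      using sol_wronskian_ac[OF th_sol V_sol, of z] x unfolding ac_deriv_def by blast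
    then show ?thesis by (simp add: dotc_commute)
  qed
  have w: "((\<lambda>z. wronskian th (\<Theta> z) s) has_field_derivative wd s) (at lam)" if "s \<in> I" for s
    unfolding wd_def using wronskian_hol(1)[OF that] by (intro holomorphic_derivI[of _ UNIV]) auto
  have "((\<lambda>z. wronskian th (\<Theta> z) y - wronskian th (\<Theta> z) x) has_field_derivative wd y - wd x) (at lam)"
    by (intro DERIV_diff w x)
  then have 1: "((\<lambda>z. (lam - z) * ?G z) has_field_derivative wd y - wd x) (at lam)" unfolding eq .
  have "(?G has_field_derivative deriv ?G lam) (at lam)" using G by (intro holomorphic_derivI[of _ UNIV]) auto
  \<comment> \<open>The factor \<open>lam - z\<close> vanishes at \<open>lam\<close>, so the
    derivative of \<open>?G\<close> drops out.\<close>
  then have "((\<lambda>z. (lam - z) * ?G z) has_field_derivative (0 - 1) * ?G lam + deriv ?G lam * (lam - lam)) (at lam)"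
    by (intro DERIV_mult DERIV_diff DERIV_const DERIV_ident)
  then have "wd y - wd x = - ?G lam" using DERIV_unique[OF 1] by simp
  moreover have "cc y - cc x = ?G lam" using cc_ac x unfolding ac_deriv_def by blast
  ultimately show ?thesis by (simp add: algebra_simps)
qed

text \<open>The constant \<open>wd + cc\<close> is evaluated at \<open>b\<close>, where
  \<open>cc\<close> tends to \<open>- 1/\<gamma>\<close>. This also shows that the limit behind
  \<open>Wb\<close> exists.\<close>

lemma wd_Wb:
  assumes x: "x \<in> I" shows "wd x = Wb - of_real g0 - cc x"
proof -
  define \<kappa> where "\<kappa> = wd x + cc x"
  have k: "wd y = \<kappa> - cc y" if "y \<in> I" for y
    using wd_const[OF x that] wd_const[OF that x] unfolding \<kappa>_def by (cases "x \<le> y") (simp_all add: algebra_simps)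
  have "(cc \<longlongrightarrow> - of_real g0) (end_filter False a b)"
  proof -
    have abs: "(\<lambda>y. (norm (th y))\<^sup>2) absolutely_integrable_on tail False a b x" by (rule th2_abs[OF x])
    have "((\<lambda>y. integral (tail False a b y) (\<lambda>y. (norm (th y))\<^sup>2)) \<longlongrightarrow> 0) (end_filter False a b)"
    proof (rule tendstoI)
      fix e :: real assume "e > 0"
      then obtain s where s: "s \<in> tail False a b x" "\<And>y. y \<in> tail False a b s \<Longrightarrow> integral (tail False a b y) (\<lambda>y. (norm (th y))\<^sup>2) < e"
        using tail_integral_small[OF ab x abs] by fastforce
      have sI: "s \<in> I" using tail_False[OF x s(1)] by blast
      show "eventually (\<lambda>y. dist (integral (tail False a b y) (\<lambda>y. (norm (th y))\<^sup>2)) 0 < e) (end_filter False a b)"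
        using eventually_in_tail[OF ab sI, of False]
      proof eventually_elim
        case (elim y)
        have "y \<in> I" using tail_False[OF sI elim] by blast
        then have "0 \<le> integral (tail False a b y) (\<lambda>y. (norm (th y))\<^sup>2)"
          by (intro Henstock_Kurzweil_Integration.integral_nonneg[OF square_integrable_integrable[OF th_sq]]) auto
        then show ?case using s(2)[OF elim] by simp
      qed
    qed
    then have "((\<lambda>y. - complex_of_real (g0 + integral (tail False a b y) (\<lambda>y. (norm (th y))\<^sup>2))) \<longlongrightarrow> - of_real (g0 + 0)) (end_filter False a b)"
      by (intro tendsto_intros)
    then have "((\<lambda>y. - complex_of_real (Cr y)) \<longlongrightarrow> - of_real g0) (end_filter False a b)" by (simp add: Cr_def)
    then show ?thesis
    proof (rule Lim_transform_eventually)
      show "eventually (\<lambda>y. - complex_of_real (Cr y) = cc y) (end_filter False a b)"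
        using eventually_in_tail[OF ab x, of False] by eventually_elim (use cc_eq tail_False[OF x] in simp)
    qed
  qed
  then have "((\<lambda>y. \<kappa> - cc y) \<longlongrightarrow> \<kappa> - - of_real g0) (end_filter False a b)" by (intro tendsto_intros)
  then have "(wronskian th (z_deriv \<Theta> lam) \<longlongrightarrow> \<kappa> + of_real g0) (end_filter False a b)"
  proof (rule Lim_transform_eventually[THEN tendsto_eq_rhs])
    show "eventually (\<lambda>y. \<kappa> - cc y = wronskian th (z_deriv \<Theta> lam) y) (end_filter False a b)"
      using eventually_in_tail[OF ab x, of False] by eventually_elim (use k wd_eq tail_False[OF x] in simp)
  qed simp
  then have "Lim (end_filter False a b) (wronskian th (z_deriv \<Theta> lam)) = \<kappa> + of_real g0"
    by (rule tendsto_Lim[OF end_filter_neq_bot[OF ab]])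
  then have "Wb = \<kappa> + of_real g0" by (simp add: Wb_def end_filter_def)
  then show ?thesis using k[OF x] by simp
qed

lemma Phg_lam: "x \<in> I \<Longrightarrow> Phg lam x = t x"
  by (simp add: Phg_def WVU)

lemma Phg_T: "z \<noteq> lam \<Longrightarrow> Phg z x = (z - lam) *s T z (\<Phi> z) x"
  by (simp add: Phg_def T_def F_def vector_add_ldistrib vector_smult_assoc)

text \<open>By \<open>wd_Wb\<close> the coefficient of \<open>t\<close> is \<open>- cc\<close>, and
  \<open>cc\<close> times \<open>t\<close> is \<open>th\<close>.\<close>

lemma N_lam: assumes x: "x \<in> I" shows "N lam x = 0"
proof -
  have "cc x * (1 / cc x) = 1" using cc_nonzero[OF x] by simp
  then have "cc x *s t x = th x" by (simp add: dc_u_def vector_smult_assoc)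
  moreover have "N lam x = th x + (wd x + (of_real g0 - Wb)) *s t x"
    by (simp add: N_def qq_def Phg_lam[OF x] vector_sadd_rdistrib)
  ultimately show ?thesis by (simp add: wd_Wb[OF x] vec_eq_iff)
qed

lemma Thg_T:
  assumes z: "z \<noteq> lam" and x: "x \<in> I"
  shows "Thg z x = (1 / (z - lam)) *s (T z (\<Theta> z) x + (of_real g0 - Wb) *s Phg z x)"
  using z by (simp add: Thg_def N_lam[OF x] vec_eq_iff)
    (simp add: N_def qq_def T_def F_def add_divide_distrib diff_divide_distrib algebra_simps)

lemma Phg_hol: "x \<in> I \<Longrightarrow> (\<lambda>z. Phg z x $ i) holomorphic_on UNIV"
  unfolding Phg_def vector_add_component vector_smult_component
  by (intro holomorphic_intros U_hol wronskian_hol)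

lemma qq_hol: "x \<in> I \<Longrightarrow> (\<lambda>z. qq z x) holomorphic_on UNIV"
  unfolding qq_def wd_def by (rule pole_lemma_open[OF wronskian_hol(1)]) auto

lemma N_hol: "x \<in> I \<Longrightarrow> (\<lambda>z. N z x $ i) holomorphic_on UNIV"
  unfolding N_def vector_add_component vector_smult_component
  by (intro holomorphic_intros V_hol Phg_hol qq_hol)

lemma Thg_hol: "x \<in> I \<Longrightarrow> (\<lambda>z. Thg z x $ i) holomorphic_on UNIV"
  unfolding Thg_def using pole_lemma_open[OF N_hol[of x i] open_UNIV, of lam] by simp

lemma WTP:
  assumes x: "x \<in> I" shows "wronskian (Thg z) (Phg z) x = 1"
proof -
  have ne: "wronskian (Thg z) (Phg z) x = 1" if z: "z \<noteq> lam" for z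
  proof -
    define d where "d = 1 / (z - lam)"
    define e where "e = of_real g0 - Wb"
    have Th: "Thg z x $ i = d * (T z (\<Theta> z) x $ i + e * Phg z x $ i)" for i
      by (simp only: Thg_T[OF z x] d_def e_def vector_add_component vector_smult_component)
    have Ph: "Phg z x $ i = (z - lam) * T z (\<Phi> z) x $ i" for i
      by (simp only: Phg_T[OF z] vector_smult_component)
    have "wronskian (Thg z) (Phg z) x = d * wronskian (T z (\<Theta> z)) (Phg z) x"
      by (simp add: wronskian_def Th algebra_simps)
    also have "wronskian (T z (\<Theta> z)) (Phg z) x = (z - lam) * wronskian (T z (\<Theta> z)) (T z (\<Phi> z)) x"
      by (simp add: wronskian_def Ph algebra_simps)
    finally have "wronskian (Thg z) (Phg z) x = wronskian (T z (\<Theta> z)) (T z (\<Phi> z)) x"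
      using z by (simp add: d_def)
    then show ?thesis using WVU[OF x] by (simp add: wronskian_T)
  qed
  show ?thesis
  proof (cases "z = lam")
    case True
    \<comment> \<open>At \<open>lam\<close> the value follows by continuity from the punctured
      plane.\<close>
    have "(\<lambda>z. wronskian (Thg z) (Phg z) x) holomorphic_on UNIV"
      unfolding wronskian_def by (intro holomorphic_intros Thg_hol Phg_hol x)
    then have "isCont (\<lambda>z. wronskian (Thg z) (Phg z) x) lam"
      using holomorphic_on_imp_continuous_on continuous_on_eq_continuous_at open_UNIV by blast
    then have l: "((\<lambda>z. wronskian (Thg z) (Phg z) x) \<longlongrightarrow> wronskian (Thg lam) (Phg lam) x) (at lam)" by (simp add: isCont_def)
    have "((\<lambda>z. wronskian (Thg z) (Phg z) x) \<longlongrightarrow> 1) (at lam)"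
      by (rule tendsto_eventually) (use ne in \<open>auto simp: eventually_at_filter\<close>)
    then show ?thesis using tendsto_unique[OF _ l] True by simp
  qed (rule ne)
qed

lemma wd_real: assumes x: "x \<in> I" shows "wd x \<in> \<real>"
  unfolding wd_def
proof (rule deriv_real[OF wronskian_hol(1)[OF x] _ lam])
  fix z :: complex assume "z \<in> \<real>"
  then have "\<Theta> z x $ i \<in> \<real>" for i using V x unfolding real_entire_solution_def real_valued_on_def by blast
  then show "wronskian th (\<Theta> z) x \<in> \<real>" using th_real[OF x] by (simp add: wronskian_def)
qed

lemma Wb_real: "Wb \<in> \<real>"
proof -
  obtain x where x: "x \<in> I" using einterval_nonempty[OF ab] by blast
  have "Wb = wd x + of_real g0 + cc x" using wd_Wb[OF x] by simp
  then show ?thesis using wd_real[OF x] cc_real[OF x] by simp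
qed

lemma Phg_real: assumes z: "z \<in> \<real>" and x: "x \<in> I" shows "Phg z x $ i \<in> \<real>"
proof -
  have "\<Phi> z x $ i \<in> \<real>" for i using U z x unfolding real_entire_solution_def real_valued_on_def by blast
  then show ?thesis using th_real[OF x] t_real[OF x] z lam by (simp add: Phg_def wronskian_def)
qed

lemma N_real: assumes z: "z \<in> \<real>" and x: "x \<in> I" shows "N z x $ i \<in> \<real>"
proof -
  have "\<Theta> z x $ i \<in> \<real>" for i using V z x unfolding real_entire_solution_def real_valued_on_def by blast
  then show ?thesis using th_real[OF x] t_real[OF x] z lam wd_real[OF x] Wb_real Phg_real[OF z x]
    by (simp add: N_def qq_def wronskian_def)
qed

lemma Thg_real: assumes z: "z \<in> \<real>" and x: "x \<in> I" shows "Thg z x $ i \<in> \<real>"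
  using N_real[OF z x] N_real[OF lam x] z lam deriv_real[OF N_hol[OF x] N_real[OF _ x] lam] by (simp add: Thg_def)

lemma Phg_sol: "dirac_solution I Qg z (Phg z)"
proof (cases "z = lam")
  case True
  then show ?thesis using dirac_solution_cong[OF t_sol] Phg_lam by simp
next
  case False
  have eq: "Phg z = (\<lambda>x. (z - lam) *s T z (\<Phi> z) x)" using Phg_T[OF False] by auto
  show ?thesis unfolding eq by (rule dirac_solution_cmult[OF T_sol[OF U_sol False]]) auto
qed

lemma Thg_sol_away:
  assumes z: "z \<noteq> lam" shows "dirac_solution I Qg z (Thg z)"
proof -
  have "dirac_solution I Qg z (\<lambda>x. (1 / (z - lam)) *s (T z (\<Theta> z) x + (of_real g0 - Wb) *s Phg z x))"
    by (intro dirac_solution_cmult dirac_solution_add T_sol V_sol Phg_sol z) auto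
  then show ?thesis by (rule dirac_solution_cong) (simp_all add: Thg_T[OF z])
qed

lemma cc_cont: "continuous_on I cc" by (rule ac_deriv_continuous[OF cc_ac]) auto

lemma Qg_loc: "L1_loc I (\<lambda>x. Qg x $ i $ j)"
proof -
  have c: "continuous_on I (\<lambda>x. th x $ k)" for k by (intro continuous_intros th_cont)
  have r: "continuous_on I (\<lambda>x. 1 / cc x)" using cc_nonzero by (intro continuous_intros cc_cont) auto
  have 1: "L1_loc I (\<lambda>x. 2 * (th x $ 1 * th x $ 2 * (1 / cc x)))"
    by (intro L1_loc_continuous continuous_on_mult continuous_on_const c r)
  have 2: "L1_loc I (\<lambda>x. ((th x $ 1)\<^sup>2 - (th x $ 2)\<^sup>2) * (1 / cc x))"
    by (intro L1_loc_continuous continuous_on_mult continuous_on_diff continuous_on_power c r)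
  show ?thesis
    using exhaust_2[of i] exhaust_2[of j] L1_loc_diff[OF Q_loc 1] L1_loc_add[OF Q_loc 1] L1_loc_add[OF Q_loc 2]
    by (auto simp: Qg_components)
qed

text \<open>On the unit circle around \<open>lam\<close> the quotients are harmless and joint
  continuity gives a bound uniform in \<open>s\<close>; the maximum principle carries it to the
  disc, including \<open>lam\<close>.\<close>

lemma Thg_bounded:
  assumes x: "x \<in> I" "y \<in> I"
  obtains M where "\<And>z s. z \<in> cball lam 1 \<Longrightarrow> s \<in> {x..y} \<Longrightarrow> norm (Thg z s) \<le> M"
proof -
  have sub: "{x..y} \<subseteq> I" by (rule interval_Icc_subset[OF _ x]) simp
  let ?K = "sphere lam 1 \<times> {x..y}"
  have cV: "continuous_on ?K (\<lambda>p. \<Theta> (fst p) (snd p) $ i)" and cU: "continuous_on ?K (\<lambda>p. \<Phi> (fst p) (snd p) $ i)" for i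
  proof -
    have "continuous_on ?K (\<lambda>(z, x). \<Theta> z x)" "continuous_on ?K (\<lambda>(z, x). \<Phi> z x)"
      by (rule continuous_on_subset[OF jointly_continuous[OF V_sol isCont_of_hol[OF V_hol]]]
          continuous_on_subset[OF jointly_continuous[OF U_sol isCont_of_hol[OF U_hol]]]; use sub in force)+
    then show "continuous_on ?K (\<lambda>p. \<Theta> (fst p) (snd p) $ i)" "continuous_on ?K (\<lambda>p. \<Phi> (fst p) (snd p) $ i)"
      by (auto simp: case_prod_unfold intro!: continuous_intros)
  qed
  have snd_comp: "continuous_on ?K (\<lambda>p. h (snd p))" if "continuous_on I h" for h :: "real \<Rightarrow> complex"
    by (rule continuous_on_compose2[OF that continuous_on_snd[OF continuous_on_id]]) (use sub in auto)
  have ct: "continuous_on ?K (\<lambda>p. t (snd p) $ i)" and cth: "continuous_on ?K (\<lambda>p. th (snd p) $ i)" for i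
    by (rule snd_comp, intro continuous_intros t_continuous th_cont)+
  define G where "G i p = (1 / (fst p - lam)) * ((\<Theta> (fst p) (snd p) $ i +
     ((th (snd p) $ 1 * \<Theta> (fst p) (snd p) $ 2 - th (snd p) $ 2 * \<Theta> (fst p) (snd p) $ 1) / (fst p - lam)) * t (snd p) $ i) +
     (of_real g0 - Wb) * ((fst p - lam) * \<Phi> (fst p) (snd p) $ i +
       (th (snd p) $ 1 * \<Phi> (fst p) (snd p) $ 2 - th (snd p) $ 2 * \<Phi> (fst p) (snd p) $ 1) * t (snd p) $ i))" for i p
  have "continuous_on ?K (G i)" for i
    unfolding G_def
    by (intro cV cU ct cth continuous_on_add continuous_on_mult continuous_on_diff continuous_on_divide
        continuous_on_const continuous_on_fst continuous_on_id) auto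
  then have "bounded (G i ` ?K)" for i
    by (intro compact_imp_bounded compact_continuous_image compact_Times) auto
  then have "\<exists>M. \<forall>p\<in>?K. norm (G i p) \<le> M" for i unfolding bounded_iff by auto
  then obtain M where M: "\<And>i p. p \<in> ?K \<Longrightarrow> norm (G i p) \<le> M i" by metis
  have comp: "norm (Thg z s $ i) \<le> M i" if z: "z \<in> cball lam 1" and s: "s \<in> {x..y}" for z s i
  proof (rule maximum_modulus_frontier[of "\<lambda>z. Thg z s $ i" "cball lam 1"])
    have hol: "(\<lambda>z. Thg z s $ i) holomorphic_on UNIV" using Thg_hol s sub by blast
    show "(\<lambda>z. Thg z s $ i) holomorphic_on interior (cball lam 1)" using hol holomorphic_on_subset by blast
    show "continuous_on (closure (cball lam 1)) (\<lambda>z. Thg z s $ i)"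
      using hol holomorphic_on_imp_continuous_on continuous_on_subset by blast
    fix w assume "w \<in> frontier (cball lam 1)"
    then have w: "w \<in> sphere lam 1" by simp
    then have wl: "w \<noteq> lam" by auto
    have "Thg w s $ i = G i (w, s)"
      by (simp only: Thg_T[OF wl subsetD[OF sub s]] G_def T_def F_def Phg_def wronskian_def
          vector_add_component vector_smult_component fst_conv snd_conv)
    then show "norm (Thg w s $ i) \<le> M i" using M[of "(w, s)" i] w s by simp
  qed (use z in auto)
  show ?thesis
  proof (rule that)
    show "norm (Thg z s) \<le> M 1 + M 2" if "z \<in> cball lam 1" "s \<in> {x..y}" for z s
      using norm_vec2_le[of "Thg z s"] comp[OF that, of 1] comp[OF that, of 2] by linarith
  qed
qed

lemma Thg_sol: "dirac_solution I Qg z (Thg z)"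
proof (cases "z = lam")
  case True
  define zn where "zn n = lam + of_real (1 / real (Suc n))" for n
  have zn: "zn \<longlonglongrightarrow> lam"
  proof -
    have "(\<lambda>n. lam + complex_of_real (1 / real (Suc n))) \<longlonglongrightarrow> lam + of_real 0"
      by (intro tendsto_intros LIMSEQ_Suc lim_1_over_n)
    then show ?thesis by (simp add: zn_def[abs_def])
  qed
  have ne: "zn n \<noteq> lam" for n by (simp add: zn_def del: of_nat_Suc)
  have ball: "zn n \<in> cball lam 1" for n by (simp add: zn_def dist_norm norm_divide del: of_nat_Suc)
  have "dirac_solution I Qg lam (Thg lam)"
  proof (rule dirac_solution_limit[OF open_einterval is_interval_einterval Qg_loc Thg_sol_away[OF ne] zn])
    fix x assume x: "x \<in> I"
    have "isCont (\<lambda>z. Thg z x) lam" by (intro isCont_of_hol Thg_hol x)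
    then show "(\<lambda>n. Thg (zn n) x) \<longlonglongrightarrow> Thg lam x" by (rule isCont_tendsto_compose[OF _ zn])
  next
    fix x y assume x: "x \<in> I" "y \<in> I"
    obtain M where "\<And>z s. z \<in> cball lam 1 \<Longrightarrow> s \<in> {x..y} \<Longrightarrow> norm (Thg z s) \<le> M" by (rule Thg_bounded[OF x]) blast
    then show "\<exists>M. \<forall>n. \<forall>s\<in>{x..y}. norm (Thg (zn n) s) \<le> M" using ball by blast
  qed
  then show ?thesis using True by simp
qed (rule Thg_sol_away)

text \<open>The expansion of solutions, the Wronskians of domain solutions and the resolvent lemmas
  become available for the commuted system.\<close>

sublocale G: dirac_system a b Qg Phg Thg
proof
  show "real_entire_solution a b Qg Phg"
    using Phg_sol Phg_hol Phg_real by (auto simp: real_entire_solution_def real_valued_on_def)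
  show "real_entire_solution a b Qg Thg"
    using Thg_sol Thg_hol Thg_real by (auto simp: real_entire_solution_def real_valued_on_def)
qed (use ab Qg_sym Qg_real WTP in auto)

end

subsection \<open>Weyl solutions of the commuted operator\<close>

context double_commutation
begin

definition "bcg s = (if limit_circle s a b Qg then t else (\<lambda>x. 0))"

lemma t_nontrivial: "nontrivial_on I t"
proof -
  obtain x where x: "x \<in> I" using einterval_nonempty[OF ab] by blast
  have "t x \<noteq> 0" using th_nonzero[OF x] cc_nonzero[OF x] by (simp add: dc_u_def vec_eq_iff)
  then show ?thesis using x unfolding nontrivial_on_def by blast
qed

lemma bcg_ok: "G.bc_ok s (bcg s)"
  unfolding G.bc_ok_def bcg_def using t_sol t_nontrivial by auto

lemma wronskian_zero_left: "wronskian (\<lambda>x. 0) f = (\<lambda>x. 0)"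
  by (auto simp: wronskian_def)

lemma wronskian_self_fun: "wronskian f f = (\<lambda>x. 0)"
  by auto

lemma Phg_dom: "in_dom_near True a b (bcg True) (Phg z)"
proof (cases "z = lam")
  case True
  have "(wronskian (bcg True) t \<longlongrightarrow> 0) (end_filter True a b)"
    unfolding bcg_def by (auto simp: wronskian_zero_left wronskian_self_fun)
  then have "in_dom_near True a b (bcg True) t" using t_left by (simp add: in_dom_near_def)
  then show ?thesis by (rule in_dom_near_cong[OF ab]) (simp add: Phg_lam True)
next
  case False
  have "in_dom_near True a b (bcg True) (T z (\<Phi> z))"
    using T_left[OF U_sol Phi_left False] wronskian_t_left[OF U_sol Phi_left False]
    by (auto simp: in_dom_near_def bcg_def wronskian_zero_left)
  from in_dom_near_cmult[OF this, of "z - lam"] show ?thesis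
    by (rule in_dom_near_cong[OF ab]) (simp add: Phg_T False)
qed

lemma bcg_real: "x \<in> I \<Longrightarrow> bcg s x $ i \<in> \<real>"
  using t_real by (simp add: bcg_def)

lemma commuted_purely_discrete:
  assumes "c \<in> I"
  shows "purely_discrete_spectrum (einterval a (ereal c)) Qg (dirichlet_bc a c (bcg True))"
proof -
  interpret D: dirac_left a b Qg Phg Thg "bcg True" c
    by unfold_locales (use bcg_ok bcg_real Phg_dom assms in auto)
  show ?thesis by (rule D.dirichlet_purely_discrete)
qed

lemma T_dom_right:
  assumes bc: "bc_ok False w" and thw: "in_dom_near False a b w th"
    and u: "sol z u" "in_dom_near False a b w u" and z: "z \<noteq> lam"
  shows "in_dom_near False a b (bcg False) (T z u)"
proof -
  have W: "(wronskian th u \<longlongrightarrow> 0) (end_filter False a b)" by (rule dom_wronskian_limit[OF bc th_sol thw u])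
  have "L2_near False a b (T z u)" by (rule T_right[OF u(1) _ z W]) (use u(2) in \<open>simp add: in_dom_near_def\<close>)
  moreover have "(wronskian (bcg False) (T z u) \<longlongrightarrow> 0) (end_filter False a b)"
  proof (cases "limit_circle False a b Qg")
    case True
    then have "L2_near False a b t" using t_sol unfolding limit_circle_def by blast
    then show ?thesis using wronskian_t_right[OF W] True by (simp add: bcg_def)
  qed (rule G.bc_ok_trivial[OF bcg_ok])
  ultimately show ?thesis by (simp add: in_dom_near_def)
qed

text \<open>First the Wronskian of \<open>th\<close> with \<open>u\<close> is shown to vanish at
  \<open>b\<close>. In the limit circle case \<open>th\<close> and \<open>w\<close> give the same
  boundary condition there, so the one with \<open>w\<close> follows by nondegeneracy.\<close>

lemma T_dom_right_back:
  assumes bc: "bc_ok False w" and thw: "in_dom_near False a b w th"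
    and u: "sol z u" and Tu: "in_dom_near False a b (bcg False) (T z u)" and z: "z \<noteq> lam"
  shows "in_dom_near False a b w u"
proof -
  have L2T: "L2_near False a b (T z u)" using Tu by (simp add: in_dom_near_def)
  obtain c where c: "c \<in> I" using einterval_nonempty[OF ab] by blast
  have L2: "L2_near False a b u" by (rule T_right_back(1)[OF u z L2T c])
  have W: "(wronskian th u \<longlongrightarrow> 0) (end_filter False a b)"
  proof (rule wronskian_th_right[OF u z L2T])
    assume "L2_near False a b t"
    moreover have "(wronskian (bcg False) t \<longlongrightarrow> 0) (end_filter False a b)"
      unfolding bcg_def by (auto simp: wronskian_zero_left wronskian_self_fun)
    ultimately have "in_dom_near False a b (bcg False) t" by (simp add: in_dom_near_def)
    then show "(wronskian t (T z u) \<longlongrightarrow> 0) (end_filter False a b)"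
      by (rule G.dom_wronskian_limit[OF bcg_ok t_sol _ T_sol[OF u z] Tu])
  qed
  have "(wronskian w u \<longlongrightarrow> 0) (end_filter False a b)"
  proof (cases "limit_circle False a b Q")
    case True
    then obtain \<zeta> where w: "sol \<zeta> w" using bc by (auto simp: bc_ok_def)
    have "((\<lambda>x. - wronskian w th x) \<longlongrightarrow> - 0) (end_filter False a b)"
      using thw by (intro tendsto_intros) (simp add: in_dom_near_def)
    then have "(wronskian th w \<longlongrightarrow> 0) (end_filter False a b)"
      by (simp add: wronskian_swap[of th w, symmetric] wronskian_swap[of w th])
    then show ?thesis by (rule limit_circle_nondegenerate[OF True th_sol th_nontrivial w _ u W])
  qed (rule bc_ok_trivial[OF bc])
  then show ?thesis using L2 by (simp add: in_dom_near_def)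
qed

text \<open>\<open>T\<close> is linear in \<open>u\<close>, and for \<open>z\<close> different from
  \<open>lam\<close> the images of the basis at \<open>z\<close> span \<open>Thg z\<close> and
  \<open>Phg z\<close>.\<close>

lemma commuted_solution_is_T:
  assumes u: "dirac_solution I Qg z u" and z: "z \<noteq> lam"
  obtains u0 where "sol z u0" "\<And>x. x \<in> I \<Longrightarrow> u x = T z u0 x"
proof -
  obtain A B where AB: "\<And>x. x \<in> I \<Longrightarrow> u x = A *s Thg z x + B *s Phg z x" by (rule G.sol_expand_I[OF u]) blast
  define A' where "A' = A * (1 / (z - lam))"
  define B' where "B' = A' * (of_real g0 - Wb) * (z - lam) + B * (z - lam)"
  define u0 where "u0 x = A' *s \<Theta> z x + B' *s \<Phi> z x" for x
  have "u x = T z u0 x" if x: "x \<in> I" for x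
  proof -
    define r where "r = 1 / (z - lam)"
    have Tlin: "T z u0 x = A' *s T z (\<Theta> z) x + B' *s T z (\<Phi> z) x"
      by (simp add: T_def F_def u0_def vec_eq_iff wronskian_def diff_divide_distrib add_divide_distrib algebra_simps)
    have "u x = A' *s T z (\<Theta> z) x + (A' * (of_real g0 - Wb) * (z - lam) + B * (z - lam)) *s T z (\<Phi> z) x"
      unfolding AB[OF x] Thg_T[OF z x] Phg_T[OF z] A'_def r_def[symmetric] by (simp add: vec_eq_iff algebra_simps)
    then show ?thesis unfolding Tlin B'_def .
  qed
  moreover have "sol z u0" unfolding u0_def by (rule sol_combination)
  ultimately show ?thesis using that by blast
qed

definition "Mg M z = (M + Wb * (z - lam)) / (z - lam)\<^sup>2 - of_real g0 / (z - lam)"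

text \<open>The images of \<Theta> agree on both sides. With \<open>k = z - lam\<close> and
  \<open>e = g0 - Wb\<close>, the images of \<Phi> require \<open>M / k = e + Mg * k\<close>, which
  is the origin of the formula for \<open>Mg\<close>.\<close>

lemma Psi_decomposition:
  assumes z: "z \<noteq> lam" and x: "x \<in> I" and P: "\<And>x. x \<in> I \<Longrightarrow> P x = \<Theta> z x + M *s \<Phi> z x"
  shows "(1 / (z - lam)) *s T z P x = Thg z x + Mg M z *s Phg z x"
proof -
  define k where "k = z - lam"
  have k: "k \<noteq> 0" using z by (simp add: k_def)
  have Tlin: "T z P x $ i = T z (\<Theta> z) x $ i + M * T z (\<Phi> z) x $ i" for i
    by (simp add: T_def F_def P[OF x] wronskian_def diff_divide_distrib add_divide_distrib algebra_simps)
  have coef: "(1 / k) * (of_real g0 - Wb) * k + ((M + Wb * k) / k\<^sup>2 - of_real g0 / k) * k = M / k"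
    using k by (simp add: field_simps power2_eq_square)
  have "Thg z x $ i + Mg M z * Phg z x $ i = (1 / k) * T z (\<Theta> z) x $ i +
      ((1 / k) * (of_real g0 - Wb) * k + ((M + Wb * k) / k\<^sup>2 - of_real g0 / k) * k) * T z (\<Phi> z) x $ i" for i
    by (simp only: Thg_T[OF z x] Phg_T[OF z] Mg_def k_def[symmetric] vector_add_component vector_smult_component
        distrib_left distrib_right mult.assoc add.assoc)
  then show ?thesis unfolding coef by (simp add: vec_eq_iff Tlin k_def distrib_left)
qed

text \<open>Instead of a spectral hypothesis only a right Weyl solution and the absence of an
  eigenfunction are assumed. Thus one argument serves for \<open>z\<close> outside the spectrum of
  either operator.\<close>

lemma Psi_weyl_right:
  assumes bc: "bc_ok False w" and thw: "in_dom_near False a b w th" and z: "z \<noteq> lam"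
    and ex: "weyl_solution_right a b Q w z u0"
    and ne: "\<not> in_dom_near False a b w (\<Phi> z)"
    and P: "\<And>x. P x = \<Theta> z x + singular_weyl a b Q w \<Phi> \<Theta> z *s \<Phi> z x"
  shows "weyl_solution_right a b Qg (bcg False) z (\<lambda>x. (1 / (z - lam)) *s T z P x)"
proof -
  have W: "\<exists>x\<in>I. wronskian (\<Phi> z) u x \<noteq> 0" if "weyl_solution_right a b Q w z u" for u
  proof (rule ccontr)
    assume "\<not> ?thesis"
    then have "\<exists>x\<in>I. wronskian (\<Phi> z) u x = 0" using einterval_nonempty[OF ab] by blast
    moreover have "sol z u" "nontrivial_on I u" "in_dom_near False a b w u"
      using that by (simp_all add: weyl_solution_right_def in_dom_near_right_iff)
    ultimately obtain k where k: "\<forall>x\<in>I. \<Phi> z x = k *s u x" using proportional[OF U_sol] by blast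
    have "in_dom_near False a b w (\<Phi> z)"
      by (rule in_dom_near_cong[OF ab in_dom_near_cmult[OF \<open>in_dom_near False a b w u\<close>, of k]]) (use k in simp)
    then show False using ne by blast
  qed
  obtain u k where u: "weyl_solution_right a b Q w z u" and k: "k \<noteq> 0"
    and Pk: "\<And>x. x \<in> I \<Longrightarrow> \<Theta> z x + singular_weyl a b Q w \<Phi> \<Theta> z *s \<Phi> z x = k *s u x"
    by (rule singular_weyl_solution[OF ex W]) blast+
  have udom: "in_dom_near False a b w u" using u by (simp add: weyl_solution_right_def in_dom_near_right_iff)
  have Pd: "in_dom_near False a b w P"
    by (rule in_dom_near_cong[OF ab in_dom_near_cmult[OF udom, of k]]) (simp add: P Pk)
  have Ps: "sol z P"
  proof -
    have "sol z (\<lambda>x. 1 *s \<Theta> z x + singular_weyl a b Q w \<Phi> \<Theta> z *s \<Phi> z x)" by (rule sol_combination)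
    then show ?thesis by (simp add: P[abs_def])
  qed
  let ?f = "\<lambda>x. (1 / (z - lam)) *s T z P x"
  have "dirac_solution I Qg z ?f" by (rule dirac_solution_cmult[OF T_sol[OF Ps z]]) auto
  moreover have "in_dom_near False a b (bcg False) ?f"
    by (rule in_dom_near_cmult[OF T_dom_right[OF bc thw Ps Pd z]])
  moreover have "nontrivial_on I ?f"
  proof -
    obtain x where x: "x \<in> I" using einterval_nonempty[OF ab] by blast
    have "?f x = Thg z x + Mg (singular_weyl a b Q w \<Phi> \<Theta> z) z *s Phg z x"
      by (rule Psi_decomposition[OF z x P])
    then have "wronskian ?f (Phg z) x = wronskian (Thg z) (Phg z) x" by (simp add: wronskian_def algebra_simps)
    then have "?f x \<noteq> 0" using WTP[OF x, of z] by (auto simp: wronskian_def)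
    then show ?thesis using x unfolding nontrivial_on_def by blast
  qed
  ultimately show ?thesis by (simp add: weyl_solution_right_def in_dom_near_right_iff)
qed

text \<open>Outside the spectrum of the commuted operator, its Weyl solution is pulled back through
  \<open>T\<close> to one of the original operator.\<close>

lemma weyl_right_of_commuted:
  assumes bc: "bc_ok False w" and thw: "in_dom_near False a b w th" and z: "z \<noteq> lam"
    and sp: "z \<notin> dirac_spectrum I Qg (op_bc a b (bcg True) (bcg False))"
  obtains u0 where "weyl_solution_right a b Q w z u0"
proof -
  obtain u where u: "dirac_solution I Qg z u" "nontrivial_on I u" "in_dom_near False a b (bcg False) u"
    by (rule G.resolvent_right_solution[OF bcg_ok Phg_dom sp])
  obtain u0 where u0: "sol z u0" "\<And>x. x \<in> I \<Longrightarrow> u x = T z u0 x" by (rule commuted_solution_is_T[OF u(1) z]) blast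
  have "in_dom_near False a b (bcg False) (T z u0)" by (rule in_dom_near_cong[OF ab u(3)]) (rule u0(2))
  then have d: "in_dom_near False a b w u0" by (rule T_dom_right_back[OF bc thw u0(1) _ z])
  have "nontrivial_on I u0"
  proof -
    obtain x where x: "x \<in> I" "u x \<noteq> 0" using u(2) unfolding nontrivial_on_def by blast
    have "u0 x \<noteq> 0" using x u0(2)[OF x(1)] by (auto simp: T_def F_def wronskian_def)
    then show ?thesis using x(1) unfolding nontrivial_on_def by blast
  qed
  then show ?thesis using that u0(1) d by (simp add: weyl_solution_right_def in_dom_near_right_iff)
qed

text \<open>Two right Weyl solutions have Wronskian 0. When both have coefficient 1 at
  \<open>Thg\<close>, that Wronskian is the difference of their coefficients at
  \<open>Phg\<close>.\<close>

lemma singular_weyl_commuted: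
  assumes wy: "weyl_solution_right a b Qg (bcg False) z f" and f: "\<And>x. x \<in> I \<Longrightarrow> f x = Thg z x + m *s Phg z x"
  shows "singular_weyl a b Qg (bcg False) Phg Thg z = m"
proof -
  have fs: "dirac_solution I Qg z f" "nontrivial_on I f" "in_dom_near False a b (bcg False) f"
    using wy by (simp_all add: weyl_solution_right_def in_dom_near_right_iff)
  have "\<exists>x\<in>I. wronskian (Phg z) u x \<noteq> 0" if "weyl_solution_right a b Qg (bcg False) z u" for u
  proof -
    have us: "dirac_solution I Qg z u" "nontrivial_on I u" "in_dom_near False a b (bcg False) u"
      using that by (simp_all add: weyl_solution_right_def in_dom_near_right_iff)
    obtain x where x: "x \<in> I" "u x \<noteq> 0" using us(2) unfolding nontrivial_on_def by blast
    have "wronskian u f x = 0" by (rule G.dom_wronskian_zero[OF bcg_ok us(1,3) fs(1,3) x(1)])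
    then obtain k where k: "\<forall>x\<in>I. u x = k *s f x" using G.proportional[OF us(1) fs(1) _ fs(2)] x(1) by blast
    have "k \<noteq> 0" using k x by auto
    moreover have "wronskian (Phg z) u x = - k * wronskian (Thg z) (Phg z) x"
      using k f x(1) by (simp add: wronskian_def algebra_simps)
    ultimately show ?thesis using WTP[OF x(1), of z] by (intro bexI[OF _ x(1)]) simp
  qed
  then obtain u k where u: "weyl_solution_right a b Qg (bcg False) z u" and k: "k \<noteq> 0"
    and uk: "\<And>x. x \<in> I \<Longrightarrow> Thg z x + singular_weyl a b Qg (bcg False) Phg Thg z *s Phg z x = k *s u x"
    by (rule G.singular_weyl_solution[OF wy]) blast+
  have us: "dirac_solution I Qg z u" "in_dom_near False a b (bcg False) u"
    using u by (simp_all add: weyl_solution_right_def in_dom_near_right_iff)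
  obtain x where x: "x \<in> I" using einterval_nonempty[OF ab] by blast
  let ?s = "singular_weyl a b Qg (bcg False) Phg Thg z"
  have "wronskian f u x = 0" by (rule G.dom_wronskian_zero[OF bcg_ok fs(1,3) us x])
  then have "0 = wronskian f (\<lambda>x. k *s u x) x" by (simp add: wronskian_def algebra_simps)
  also have "\<dots> = wronskian f (\<lambda>x. Thg z x + ?s *s Phg z x) x" using uk[OF x] by (simp add: wronskian_def)
  also have "\<dots> = (?s - m) * wronskian (Thg z) (Phg z) x" using f[OF x] by (simp add: wronskian_def algebra_simps)
  also have "\<dots> = ?s - m" by (simp add: WTP[OF x])
  finally show ?thesis by simp
qed

end

section \<open>The potential of the theorem and the conclusion\<close>

lemma dirac_potential_components:
  "dirac_potential m q_el q_am q_sc x $ 1 $ 1 = of_real (q_el x) + of_real (m + q_sc x)"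
  "dirac_potential m q_el q_am q_sc x $ 1 $ 2 = of_real (q_am x)"
  "dirac_potential m q_el q_am q_sc x $ 2 $ 1 = of_real (q_am x)"
  "dirac_potential m q_el q_am q_sc x $ 2 $ 2 = of_real (q_el x) - of_real (m + q_sc x)"
  by (simp_all add: dirac_potential_def sigma1_def sigma3_def matrix_matrix_mult_def mat_def sum_2)

lemma dirac_potential_L1_loc:
  assumes "L1_loc S q_el" "L1_loc S q_am" "L1_loc S q_sc"
  shows "L1_loc S (\<lambda>x. dirac_potential m q_el q_am q_sc x $ i $ j)"
proof -
  have el: "L1_loc S (\<lambda>x. complex_of_real (q_el x))" and am: "L1_loc S (\<lambda>x. complex_of_real (q_am x))"
    using assms by (auto intro: L1_loc_linear bounded_linear_of_real)
  have "L1_loc S (\<lambda>x. m + q_sc x)" by (intro L1_loc_add assms L1_loc_continuous continuous_on_const)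
  then have sc: "L1_loc S (\<lambda>x. complex_of_real (m + q_sc x))" by (rule L1_loc_linear[OF _ bounded_linear_of_real])
  show ?thesis
    using exhaust_2[of i] exhaust_2[of j] am L1_loc_add[OF el sc] L1_loc_diff[OF el sc]
    by (auto simp: dirac_potential_components simp del: of_real_add)
qed

theorem theorem3p6:
  fixes a b \<gamma> :: ereal
    and m :: real
    and q_el q_am q_sc :: "real \<Rightarrow> real"
    and Q Q\<gamma> :: "real \<Rightarrow> complex^2^2"
    and u_minus u_plus v\<gamma> w\<gamma> \<Theta>t :: "real \<Rightarrow> complex^2"
    and \<Phi> \<Theta> \<Psi> \<Psi>\<gamma> :: "complex \<Rightarrow> real \<Rightarrow> complex^2"
    and M M\<gamma> :: "complex \<Rightarrow> complex"
    and lam Wb g :: complex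
    and I :: "real set"
  assumes ab: "a < b" and I_def: "I = einterval a b"
    and m: "0 \<le> m"
    and q_loc: "L1_loc I q_el" "L1_loc I q_am" "L1_loc I q_sc"
    and Q_def: "Q = dirac_potential m q_el q_am q_sc"
    and u_minus: "bc_spinor (limit_circle_left a b Q) a b Q u_minus"
    and u_plus: "bc_spinor (limit_circle_right a b Q) a b Q u_plus"
    and discrete: "\<exists>c\<in>I. purely_discrete_spectrum (einterval a (ereal c)) Q (dirichlet_bc a c u_minus)"
    and Phi: "real_entire_solution a b Q \<Phi>"
    and Phi_left: "\<forall>z. nontrivial_on I (\<Phi> z) \<and> in_dom_near_left a b u_minus (\<Phi> z)"
    and Theta: "real_entire_solution a b Q \<Theta>"
    and W_Theta_Phi: "\<forall>z. \<forall>x\<in>I. wronskian (\<Theta> z) (\<Phi> z) x = 1"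
    and M_def: "M = singular_weyl a b Q u_plus \<Phi> \<Theta>"
    and Psi_def: "\<Psi> = (\<lambda>z x. \<Theta> z x + M z *s \<Phi> z x)"
    and lam: "lam \<in> \<real>"
    and Theta_right: "in_dom_near_right a b u_plus (\<Theta> lam)"
    and Theta_not_L2: "\<not> square_integrable I (\<Theta> lam)"
    and gamma: "0 < \<gamma>" and g_def: "g = of_real (real_of_ereal (1 / \<gamma>))"
    and Theta_t_def: "\<Theta>t = dc_u b \<gamma> (\<Theta> lam)"
    and Qg_def: "Q\<gamma> = (\<lambda>x. Q x + dc_Q b \<gamma> (\<Theta> lam) x)"
    and vg_def: "v\<gamma> = (if limit_circle_left a b Q\<gamma> then \<Theta>t else (\<lambda>x. 0))"
    and wg_def: "w\<gamma> = (if limit_circle_right a b Q\<gamma> then \<Theta>t else (\<lambda>x. 0))"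
    and Wb_def: "Wb = Lim (right_end b) (wronskian (\<Theta> lam) (z_deriv \<Theta> lam))"
    and Psi_g_def: "\<Psi>\<gamma> = (\<lambda>z x. (1 / (z - lam)) *s
          (\<Psi> z x + (1 / (z - lam) * wronskian (\<Theta> lam) (\<Psi> z) x) *s \<Theta>t x))"
    and M_g_def: "M\<gamma> = (\<lambda>z. (M z + Wb * (z - lam)) / (z - lam)\<^sup>2 - g / (z - lam))"
  shows "\<exists>\<Phi>\<gamma> \<Theta>\<gamma>.
      real_entire_solution a b Q\<gamma> \<Phi>\<gamma> \<and> real_entire_solution a b Q\<gamma> \<Theta>\<gamma> \<and>
      (\<forall>z x. z \<noteq> lam \<and> x \<in> I \<longrightarrow>
         \<Phi>\<gamma> z x = (z - lam) *s (\<Phi> z x + (1 / (z - lam) * wronskian (\<Theta> lam) (\<Phi> z) x) *s \<Theta>t x)) \<and>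
      (\<forall>z x. z \<noteq> lam \<and> x \<in> I \<longrightarrow>
         \<Theta>\<gamma> z x = (1 / (z - lam)) *s
           (\<Theta> z x + (1 / (z - lam) * wronskian (\<Theta> lam) (\<Theta> z) x) *s \<Theta>t x + (g - Wb) *s \<Phi>\<gamma> z x)) \<and>
      (\<forall>z. \<forall>x\<in>I. wronskian (\<Theta>\<gamma> z) (\<Phi>\<gamma> z) x = 1) \<and>
      (\<forall>x\<in>I. \<Phi>\<gamma> lam x = \<Theta>t x) \<and>
      (\<forall>c\<in>I. purely_discrete_spectrum (einterval a (ereal c)) Q\<gamma> (dirichlet_bc a c v\<gamma>)) \<and>
      (\<forall>z. weyl_solution_left a b Q\<gamma> v\<gamma> z (\<Phi>\<gamma> z)) \<and>
      (\<forall>z. z \<noteq> lam \<and> z \<notin> dirac_spectrum I Q (op_bc a b u_minus u_plus) \<longrightarrow>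
         weyl_solution_right a b Q\<gamma> w\<gamma> z (\<Psi>\<gamma> z) \<and>
         (\<forall>x\<in>I. \<Psi>\<gamma> z x = \<Theta>\<gamma> z x + M\<gamma> z *s \<Phi>\<gamma> z x)) \<and>
      (\<forall>z. z \<noteq> lam \<and> z \<notin> dirac_spectrum I Q\<gamma> (op_bc a b v\<gamma> w\<gamma>) \<longrightarrow>
         weyl_solution_right a b Q\<gamma> w\<gamma> z (\<Psi>\<gamma> z) \<and>
         (\<forall>x\<in>I. \<Psi>\<gamma> z x = \<Theta>\<gamma> z x + M\<gamma> z *s \<Phi>\<gamma> z x) \<and>
         singular_weyl a b Q\<gamma> w\<gamma> \<Phi>\<gamma> \<Theta>\<gamma> z = M\<gamma> z)"
proof -
  have Qr: "Q x $ i $ j \<in> \<real>" for x i j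
    using exhaust_2[of i] exhaust_2[of j] by (auto simp: Q_def dirac_potential_components)
  interpret dirac_system a b Q \<Phi> \<Theta>
    by unfold_locales (use ab Qr Phi Theta W_Theta_Phi in \<open>auto simp: Q_def dirac_potential_components I_def\<close>)
  have bcm: "bc_ok True u_minus" and bcp: "bc_ok False u_plus"
    using u_minus u_plus unfolding bc_spinor_def bc_ok_def limit_circle_left_iff limit_circle_right_iff
    by (auto split: if_splits)
  have Phi_dom: "in_dom_near True a b u_minus (\<Phi> z)" for z
    using Phi_left by (simp add: in_dom_near_left_iff)
  have th_dom: "in_dom_near False a b u_plus (\<Theta> lam)"
    using Theta_right by (simp add: in_dom_near_right_iff)
  interpret DC: double_commutation a b Q \<Phi> \<Theta> lam \<gamma>
  proof
    show "L1_loc (einterval a b) (\<lambda>x. Q x $ i $ j)" for i j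
      unfolding Q_def by (rule dirac_potential_L1_loc) (use q_loc I_def in auto)
    show R: "L2_near False a b (\<Theta> lam)" using th_dom by (simp add: in_dom_near_def)
    \<comment> \<open>Being square integrable near \<open>b\<close> but not on the whole interval,
      \<Theta>(\<lambda>) must fail near \<open>a\<close>.\<close>
    show "\<not> L2_near True a b (\<Theta> lam)"
      using square_integrable_both_ends[OF V_sol _ R] Theta_not_L2 I_def by blast
    show "L2_near True a b (\<Phi> z)" for z using Phi_dom by (simp add: in_dom_near_def)
  qed (use lam gamma in auto)
  have Qg: "Q\<gamma> = DC.Qg" unfolding Qg_def by (auto simp: DC.Qg_def)
  have g: "g = of_real DC.g0" by (simp add: g_def DC.g0_def)
  have v: "v\<gamma> = DC.bcg True" and w: "w\<gamma> = DC.bcg False"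
    unfolding vg_def wg_def DC.bcg_def Qg Theta_t_def limit_circle_left_iff limit_circle_right_iff by simp_all
  have Wb: "Wb = DC.Wb" by (simp add: Wb_def DC.Wb_def)
  have Mg: "M\<gamma> z = DC.Mg (M z) z" for z by (simp add: M_g_def DC.Mg_def Wb g)
  have Psig: "\<Psi>\<gamma> z = (\<lambda>x. (1 / (z - lam)) *s DC.T z (\<Psi> z) x)" for z
    by (simp add: Psi_g_def DC.T_def DC.F_def Theta_t_def)
  have P: "\<Psi> z x = \<Theta> z x + singular_weyl a b Q u_plus \<Phi> \<Theta> z *s \<Phi> z x" for z x
    by (simp add: Psi_def M_def)
  have dec: "\<Psi>\<gamma> z x = DC.Thg z x + M\<gamma> z *s DC.Phg z x" if "z \<noteq> lam" "x \<in> I" for z x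
    unfolding Psig Mg by (rule DC.Psi_decomposition) (use that in \<open>auto simp: I_def Psi_def\<close>)
  have right: "weyl_solution_right a b Q\<gamma> w\<gamma> z (\<Psi>\<gamma> z)"
    if "z \<noteq> lam" "weyl_solution_right a b Q u_plus z u0" "\<not> in_dom_near False a b u_plus (\<Phi> z)" for z u0
    unfolding Psig Qg w by (rule DC.Psi_weyl_right[OF bcp th_dom that P])
  have H: "weyl_solution_right a b Q\<gamma> w\<gamma> z (\<Psi>\<gamma> z)"
    if z: "z \<noteq> lam" and sp: "z \<notin> dirac_spectrum I Q (op_bc a b u_minus u_plus)" for z
  proof -
    obtain u where "dirac_solution (einterval a b) Q z u" "nontrivial_on (einterval a b) u" "in_dom_near False a b u_plus u"
      by (rule resolvent_right_solution[OF bcm Phi_dom sp[unfolded I_def]])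
    then have "weyl_solution_right a b Q u_plus z u" by (simp add: weyl_solution_right_def in_dom_near_right_iff)
    then show ?thesis
      \<comment> \<open>\<Phi>(z) in the domain near \<open>b\<close> as well would be an
        eigenfunction of \<open>H\<close>.\<close>
      by (rule right[OF z]) (use eigenvalue_in_spectrum[OF Phi_dom] sp I_def in blast)
  qed
  have Hg: "weyl_solution_right a b Q\<gamma> w\<gamma> z (\<Psi>\<gamma> z)"
    if z: "z \<noteq> lam" and sp: "z \<notin> dirac_spectrum I Q\<gamma> (op_bc a b v\<gamma> w\<gamma>)" for z
  proof -
    have sp': "z \<notin> dirac_spectrum (einterval a b) DC.Qg (op_bc a b (DC.bcg True) (DC.bcg False))"
      using sp unfolding I_def Qg v w .
    obtain u0 where u0: "weyl_solution_right a b Q u_plus z u0"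
      by (rule DC.weyl_right_of_commuted[OF bcp th_dom z sp'])
    \<comment> \<open>Otherwise \<open>T\<close> would carry \<Phi>(z) to an eigenfunction of the
      commuted operator.\<close>
    have "\<not> in_dom_near False a b u_plus (\<Phi> z)"
    proof
      assume "in_dom_near False a b u_plus (\<Phi> z)"
      then have "in_dom_near False a b (DC.bcg False) (DC.T z (\<Phi> z))" by (rule DC.T_dom_right[OF bcp th_dom U_sol _ z])
      from in_dom_near_cmult[OF this, of "z - lam"] have "in_dom_near False a b (DC.bcg False) (DC.Phg z)"
        by (rule in_dom_near_cong[OF ab]) (simp add: DC.Phg_T[OF z])
      then show False using DC.G.eigenvalue_in_spectrum[OF DC.Phg_dom] sp' by blast
    qed
    then show ?thesis by (rule right[OF z u0])
  qed
  show ?thesis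
  proof (rule exI[of _ DC.Phg], rule exI[of _ DC.Thg], intro conjI allI impI ballI)
    show "real_entire_solution a b Q\<gamma> DC.Phg" "real_entire_solution a b Q\<gamma> DC.Thg"
      unfolding Qg by (rule DC.G.U DC.G.V)+
    show "DC.Phg z x = (z - lam) *s (\<Phi> z x + (1 / (z - lam) * wronskian (\<Theta> lam) (\<Phi> z) x) *s \<Theta>t x)"
      if "z \<noteq> lam \<and> x \<in> I" for z x
      using that by (simp add: DC.Phg_T DC.T_def DC.F_def Theta_t_def)
    show "DC.Thg z x = (1 / (z - lam)) *s
        (\<Theta> z x + (1 / (z - lam) * wronskian (\<Theta> lam) (\<Theta> z) x) *s \<Theta>t x + (g - Wb) *s DC.Phg z x)"
      if "z \<noteq> lam \<and> x \<in> I" for z x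
      using that by (simp add: DC.Thg_T I_def DC.T_def DC.F_def Theta_t_def g Wb)
    show "wronskian (DC.Thg z) (DC.Phg z) x = 1" if "x \<in> I" for z x using that DC.WTP by (simp add: I_def)
    show "DC.Phg lam x = \<Theta>t x" if "x \<in> I" for x using that DC.Phg_lam by (simp add: I_def Theta_t_def)
    show "purely_discrete_spectrum (einterval a (ereal c)) Q\<gamma> (dirichlet_bc a c v\<gamma>)" if "c \<in> I" for c
      unfolding Qg v by (rule DC.commuted_purely_discrete) (use that I_def in simp)
    show "weyl_solution_left a b Q\<gamma> v\<gamma> z (DC.Phg z)" for z
      unfolding weyl_solution_left_def in_dom_near_left_iff Qg v
      using DC.Phg_sol DC.G.U_nontrivial DC.Phg_dom by blast
    show "singular_weyl a b Q\<gamma> w\<gamma> DC.Phg DC.Thg z = M\<gamma> z"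
      if "z \<noteq> lam \<and> z \<notin> dirac_spectrum I Q\<gamma> (op_bc a b v\<gamma> w\<gamma>)" for z
      unfolding Qg w
      by (rule DC.singular_weyl_commuted[OF Hg[unfolded Qg w]]) (use that dec I_def Qg v w in auto)
  qed (use H Hg dec in blast)+
qed

end
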